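(* Let $Q$ be a finite symmetric quiver ($a_{ij}=a_{ji}$ for all $i,j\in I$). Then the following categories of locally finite graded modules are equivalent: $$\mathcal{H}\text{-}\mathrm{Mod}_{lf}\simeq\hat{\mathcal{H}}\text{-}\mathrm{Mod}_{lf}\simeq{}^{\tilde\sigma}\hat{\mathcal{H}}\text{-}\mathrm{Mod}_{lf}\simeq\mathcal{R}_{\mathbb{Q}}\text{-}\mathrm{Mod}_{lf}.$$
   Context: Notation. $Q$ has vertex set $I$ and $a_{ij}$ arrows from $i$ to $j$. For $\gamma=(\gamma^i)\in\mathbb{Z}_{\ge0}^I$ put $S_\gamma=\prod_{i}S_{\gamma^i}$, permuting for each $i$ the variables $x_{i,1},\dots,x_{i,\gamma^i}$ (resp. $z_{i,\cdot}$). All algebras are $\mathbb{Z}^I$-graded, with zero component in degrees outside $\mathbb{Z}_{\ge0}^I$. CoHA: $\mathcal{H}_\gamma=\mathbb{Q}[x_{i,\alpha}:i\in I,1\le\alpha\le\gamma^i]^{S_\gamma}$; completed CoHA: $\hat{\mathcal{H}}_\gamma=\mathbb{Q}[[x_{i,\alpha}]]^{S_\gamma}$. In both, for $f_1$ of degree $\gamma_1$ and $f_2$ of degree $\gamma_2$, $$f_1\cdot f_2=\sum_{\text{shuffles}} f_1(x')f_2(x'')\frac{\prod_{i,j\in I}\prod_{\alpha_1=1}^{\gamma_1^i}\prod_{\alpha_2=1}^{\gamma_2^j}(x''_{j,\alpha_2}-x'_{i,\alpha_1})^{a_{ij}}}{\prod_{i}\prod_{\alpha_1=1}^{\gamma_1^i}\prod_{\alpha_2=1}^{\gamma_2^i}(x''_{i,\alpha_2}-x'_{i,\alpha_1})},$$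 the sum being over all ways to split, for every $i\in I$, the variables $x_{i,1},\dots,x_{i,\gamma_1^i+\gamma_2^i}$ into $\gamma_1^i$ variables $x'_{i,\cdot}$ and $\gamma_2^i$ variables $x''_{i,\cdot}$ (each in increasing order of index). KHA: $\mathcal{R}_\gamma=\mathbb{Z}[z_{i,\alpha}^{\pm1}]^{S_\gamma}$, with product given by the same shuffle sum with each factor $x''-x'$ (numerator and denominator) replaced by $1-z'(z'')^{-1}$; $\mathcal{R}_{\mathbb{Q}}=\mathcal{R}\otimes_{\mathbb{Z}}\mathbb{Q}$. The Chern character $ch:\mathcal{R}_\gamma\hookrightarrow\hat{\mathcal{H}}_\gamma$ is $z_{i,\alpha}\mapsto e^{x_{i,\alpha}}$ (additive, not multiplicative); it extends to $\mathcal{R}_{\mathbb{Q}}$. Twist: for $\tau\in\mathbb{Z}^I$, $\gamma\in\mathbb{Z}_{\ge0}^I$ let $$\tilde b_\tau^\gamma=(-1)^{\sum_i\gamma^i\tau^i+\sum_{i,j}a_{ij}\gamma^i\tau^j}\prod_{i\in I}\exp\bigl(-(x_{i,1}+\dots+x_{i,\gamma^i})\bigr)^{\tau^i-\sum_j a_{ij}\tau^j}\in\hat{\mathcal{H}}_\gamma,$$ and $\tilde\sigma_\tau(f)=\tilde b_\tau^\gamma f$ for $f\in\hat{\mathcal{H}}_\gamma$; $\tau\mapsto\tilde\sigma_\tau$ is a homomorphism from $\mathbb{Z}^I$ to degree preserving algebra automorphisms of $\hat{\mathcal{H}}$. ${}^{\tilde\sigma}\hat{\mathcal{H}}$ is the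 left Zhang twist: the graded space $\hat{\mathcal{H}}$ with product $x\circ y=\tilde\sigma_s(x)\cdot y$ for $y$ of degree $s$. Filtrations: $\mathcal{H}_\gamma^{\ge n}$, $\hat{\mathcal{H}}_\gamma^{\ge n}$, ${}^{\tilde\sigma}\hat{\mathcal{H}}_\gamma^{\ge n}$ are the subspaces of polynomials (power series) having no monomials of degree $<n$ (each variable having degree 1); $\mathcal{R}_{\mathbb{Q},\gamma}^{\ge n}=ch^{-1}(\hat{\mathcal{H}}_\gamma^{\ge n})$. Locally finite modules: let $A$ be one of these algebras. A graded one-sided ideal $J\subset A$ is large if for every $\gamma\in\mathbb{Z}_{\ge0}^I$ there is $n_\gamma\ge0$ with $J_\gamma\supset A_\gamma^{\ge n_\gamma}$. For a graded module $M$ and $\tau\in\mathbb{Z}^I$, $M(\tau)$ is the shifted graded module $M(\tau)_\gamma=M_{\tau+\gamma}$. A $\mathbb{Z}^I$-graded left $A$-module $M$ is locally finite if there is a surjection of graded modules $\theta:\bigoplus A(\tau)\to M$ (a direct sum of shifts of $A$) such that for each summand $A(\tau)$ the kernel of $\theta|_{A(\tau)}$ is the shift of a large left ideal of $A$. $A\text{-}\mathrm{Mod}_{lf}$ is the full subcategory of locally finite modules in the category of $\mathbb{Z}^I$-graded left $A$-modules with degree preserving morphisms. *)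

theory Defs
  imports
    Complex_Main
    "HOL-Library.Poly_Mapping"
    "HOL-Library.Function_Algebras"
    "HOL-Combinatorics.Permutations"
    "HOL-Algebra.Product_Groups"
begin

section \<open>Formal power series in several variables\<close>

typedef ('v, 'k) mfps = "UNIV :: (('v \<Rightarrow>\<^sub>0 nat) \<Rightarrow> 'k) set"
  morphisms mcoeff Abs_mfps
  by simp

setup_lifting type_definition_mfps

lemma mfps_eqI: "(\<And>m. mcoeff f m = mcoeff g m) \<Longrightarrow> f = g"
  by transfer (rule ext)

definition splits :: "('v \<Rightarrow>\<^sub>0 nat) \<Rightarrow> (('v \<Rightarrow>\<^sub>0 nat) \<times> ('v \<Rightarrow>\<^sub>0 nat)) set" where
  "splits m = {(p, q). p + q = m}"

lemma finite_splits: "finite (splits m)"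
proof -
  let ?F = "{f. \<forall>v. (v \<in> Poly_Mapping.keys m \<longrightarrow> f v \<in> {.. Max (Poly_Mapping.lookup m ` Poly_Mapping.keys m)})
                 \<and> (v \<notin> Poly_Mapping.keys m \<longrightarrow> f v = 0)}"
  have F: "finite ?F"
    by (rule finite_set_of_finite_funs) auto
  have sub: "Poly_Mapping.lookup p \<in> ?F" if "p + q = m" for p q
  proof -
    have le: "Poly_Mapping.lookup p v \<le> Poly_Mapping.lookup m v" for v
      using that by (auto simp: lookup_add)
    have "Poly_Mapping.lookup p v \<le> Max (Poly_Mapping.lookup m ` Poly_Mapping.keys m)"
      if "v \<in> Poly_Mapping.keys m" for v
      using le[of v] that by (meson Max_ge finite_imageI finite_keys imageI le_trans)
    moreover have "Poly_Mapping.lookup p v = 0" if "v \<notin> Poly_Mapping.keys m" for v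
      using le[of v] that by (simp add: in_keys_iff)
    ultimately show ?thesis by auto
  qed
  have "finite (Poly_Mapping.lookup -` ?F :: ('a \<Rightarrow>\<^sub>0 nat) set)"
    by (rule finite_vimageI[OF F]) (auto intro: injI poly_mapping_eqI)
  then have fin: "finite ((Poly_Mapping.lookup -` ?F) \<times> (Poly_Mapping.lookup -` ?F) :: (('a \<Rightarrow>\<^sub>0 nat) \<times> ('a \<Rightarrow>\<^sub>0 nat)) set)"
    by blast
  have "splits m \<subseteq> (Poly_Mapping.lookup -` ?F) \<times> (Poly_Mapping.lookup -` ?F)"
  proof
    fix z assume "z \<in> splits m"
    then obtain p q where z: "z = (p, q)" and pq: "p + q = m" by (auto simp: splits_def)
    show "z \<in> (Poly_Mapping.lookup -` ?F) \<times> (Poly_Mapping.lookup -` ?F)"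
      unfolding z using sub[OF pq] sub[of q p] pq by (simp add: add.commute)
  qed
  from finite_subset[OF this fin] show ?thesis .
qed

instantiation mfps :: (type, comm_ring_1) comm_ring_1
begin

lift_definition zero_mfps :: "('a, 'b) mfps" is "\<lambda>_. 0" .
lift_definition one_mfps :: "('a, 'b) mfps" is "\<lambda>m. if m = 0 then 1 else 0" .
lift_definition plus_mfps :: "('a, 'b) mfps \<Rightarrow> ('a, 'b) mfps \<Rightarrow> ('a, 'b) mfps"
  is "\<lambda>f g m. f m + g m" .
lift_definition minus_mfps :: "('a, 'b) mfps \<Rightarrow> ('a, 'b) mfps \<Rightarrow> ('a, 'b) mfps"
  is "\<lambda>f g m. f m - g m" .
lift_definition uminus_mfps :: "('a, 'b) mfps \<Rightarrow> ('a, 'b) mfps"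
  is "\<lambda>f m. - f m" .
lift_definition times_mfps :: "('a, 'b) mfps \<Rightarrow> ('a, 'b) mfps \<Rightarrow> ('a, 'b) mfps"
  is "\<lambda>f g m. \<Sum>(p, q)\<in>splits m. f p * g q" .

instance
proof
  fix f g h :: "('a, 'b) mfps"
  show "f + g + h = f + (g + h)" "f + g = g + f" "0 + f = f" "- f + f = 0" "f - g = f + - g"
    by (transfer; simp add: fun_eq_iff algebra_simps)+
  show "(0::('a, 'b) mfps) \<noteq> 1"
    by transfer (auto simp: fun_eq_iff)
  show "f * g = g * f"
  proof (transfer, rule ext)
    fix f g :: "('a \<Rightarrow>\<^sub>0 nat) \<Rightarrow> 'b" and m
    show "(\<Sum>(p, q)\<in>splits m. f p * g q) = (\<Sum>(p, q)\<in>splits m. g p * f q)"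
      by (rule sum.reindex_bij_witness[where i = prod.swap and j = prod.swap])
         (auto simp: splits_def add.commute mult.commute)
  qed
  show "1 * f = f"
  proof (transfer, rule ext)
    fix f :: "('a \<Rightarrow>\<^sub>0 nat) \<Rightarrow> 'b" and m
    have "(\<Sum>(p, q)\<in>splits m. (if p = 0 then 1 else 0) * f q)
        = (\<Sum>(p, q)\<in>{(0 :: 'a \<Rightarrow>\<^sub>0 nat, m)}. (if p = 0 then 1 else 0) * f q)"
      by (intro sum.mono_neutral_right finite_splits) (auto simp: splits_def split: if_splits)
    then show "(\<Sum>(p, q)\<in>splits m. (if p = 0 then 1 else 0) * f q) = f m" by simp
  qed
  show "(f + g) * h = f * h + g * h"
    by transfer (simp add: fun_eq_iff algebra_simps sum.distrib[symmetric] split_def)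
  show "f * g * h = f * (g * h)"
  proof (transfer, rule ext)
    fix f g h :: "('a \<Rightarrow>\<^sub>0 nat) \<Rightarrow> 'b" and m
    have "(\<Sum>(p, q)\<in>splits m. (\<Sum>(r, s)\<in>splits p. f r * g s) * h q)
        = (\<Sum>((p, q), (r, s))\<in>Sigma (splits m) (\<lambda>(p, q). splits p). f r * g s * h q)"
      by (subst sum.Sigma[symmetric])
         (auto simp: finite_splits split_def sum_distrib_right)
    also have "\<dots> = (\<Sum>((p, q), (r, s))\<in>Sigma (splits m) (\<lambda>(p, q). splits q). f p * (g r * h s))"
      by (rule sum.reindex_bij_witness[where
            i = "\<lambda>((p, q), (r, s)). ((p + r, s), (p, r))" and
            j = "\<lambda>((p, q), (r, s)). ((r, s + q), (s, q))"])
         (auto simp: splits_def add.assoc mult.assoc)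
    also have "\<dots> = (\<Sum>(p, q)\<in>splits m. f p * (\<Sum>(r, s)\<in>splits q. g r * h s))"
      by (subst sum.Sigma[symmetric])
         (auto simp: finite_splits split_def sum_distrib_left)
    finally show "(\<Sum>(p, q)\<in>splits m. (\<Sum>(r, s)\<in>splits p. f r * g s) * h q)
        = (\<Sum>(p, q)\<in>splits m. f p * (\<Sum>(r, s)\<in>splits q. g r * h s))" .
  qed
qed

end

definition mdeg :: "('v \<Rightarrow>\<^sub>0 nat) \<Rightarrow> nat" where
  "mdeg m = (\<Sum>v\<in>Poly_Mapping.keys m. Poly_Mapping.lookup m v)"

definition mfps_const :: "'k::comm_ring_1 \<Rightarrow> ('v, 'k) mfps" where
  "mfps_const c = Abs_mfps (\<lambda>m. if m = 0 then c else 0)"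

definition mfps_var :: "'v \<Rightarrow> ('v, 'k::comm_ring_1) mfps" where
  "mfps_var v = Abs_mfps (\<lambda>m. if m = Poly_Mapping.single v 1 then 1 else 0)"

text \<open>The exponential of a series without constant term. For such \<open>f\<close> the power \<open>f ^ n\<close> has no
  monomials of degree \<open>< n\<close>, so that \<open>n \<le> mdeg m\<close> covers all terms \<open>f ^ n / n!\<close> contributing to \<open>m\<close>.\<close>

definition mfps_exp :: "('v, 'k::field_char_0) mfps \<Rightarrow> ('v, 'k) mfps" where
  "mfps_exp f = Abs_mfps (\<lambda>m. \<Sum>n\<le>mdeg m. mcoeff (f ^ n) m / fact n)"


section \<open>Symmetric polynomials, Laurent polynomials and power series\<close>

text \<open>The variable \<open>(i, \<alpha>)\<close> is \<open>x\<^bsub>i,\<alpha>+1\<^esub>\<close> (or \<open>z\<^bsub>i,\<alpha>+1\<^esub>\<close>). Polynomials have exponents in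
  \<open>nat\<close>, Laurent polynomials have exponents in \<open>int\<close>.\<close>

type_synonym 'i var = "'i \<times> nat"
type_synonym ('v, 'k) polynomial = "('v \<Rightarrow>\<^sub>0 nat) \<Rightarrow>\<^sub>0 'k"
type_synonym ('v, 'k) laurent = "('v \<Rightarrow>\<^sub>0 int) \<Rightarrow>\<^sub>0 'k"

definition pvar :: "'v \<Rightarrow> ('v \<Rightarrow>\<^sub>0 'e::{monoid_add,one}) \<Rightarrow>\<^sub>0 'k::comm_ring_1" where
  "pvar v = Poly_Mapping.single (Poly_Mapping.single v 1) 1"

definition inv_pvar :: "'v \<Rightarrow> ('v, 'k::comm_ring_1) laurent" where
  "inv_pvar v = Poly_Mapping.single (Poly_Mapping.single v (- 1)) 1"

definition rename_monom :: "('v \<Rightarrow> 'w) \<Rightarrow> ('v \<Rightarrow>\<^sub>0 'e::comm_monoid_add) \<Rightarrow> ('w \<Rightarrow>\<^sub>0 'e)" where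
  "rename_monom \<rho> m = (\<Sum>v\<in>Poly_Mapping.keys m. Poly_Mapping.single (\<rho> v) (Poly_Mapping.lookup m v))"

definition rename_poly ::
  "('v \<Rightarrow> 'w) \<Rightarrow> (('v \<Rightarrow>\<^sub>0 'e::comm_monoid_add) \<Rightarrow>\<^sub>0 'k::comm_ring_1) \<Rightarrow> (('w \<Rightarrow>\<^sub>0 'e) \<Rightarrow>\<^sub>0 'k)" where
  "rename_poly \<rho> f = (\<Sum>m\<in>Poly_Mapping.keys f.
     Poly_Mapping.single (rename_monom \<rho> m) (Poly_Mapping.lookup f m))"

text \<open>Only used for injective \<open>\<rho>\<close>; then the sum has at most one term.\<close>

definition rename_mfps :: "('v \<Rightarrow> 'w) \<Rightarrow> ('v, 'k::comm_ring_1) mfps \<Rightarrow> ('w, 'k) mfps" where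
  "rename_mfps \<rho> f = Abs_mfps (\<lambda>m. \<Sum>n | rename_monom \<rho> n = m. mcoeff f n)"

definition vars :: "('i \<Rightarrow> nat) \<Rightarrow> 'i var set" where
  "vars g = {(i, \<alpha>). \<alpha> < g i}"

definition on_vars :: "('i \<Rightarrow> nat \<Rightarrow> nat) \<Rightarrow> 'i var \<Rightarrow> 'i var" where
  "on_vars \<pi> = (\<lambda>(i, \<alpha>). (i, \<pi> i \<alpha>))"

definition var_perms :: "('i \<Rightarrow> nat) \<Rightarrow> ('i \<Rightarrow> nat \<Rightarrow> nat) set" where
  "var_perms g = {\<pi>. \<forall>i. \<pi> i permutes {..<g i}}"

definition sym_polys ::
  "('i \<Rightarrow> nat) \<Rightarrow> (('i var \<Rightarrow>\<^sub>0 'e::comm_monoid_add) \<Rightarrow>\<^sub>0 'k::comm_ring_1) set" where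
  "sym_polys g = {f. (\<forall>m\<in>Poly_Mapping.keys f. Poly_Mapping.keys m \<subseteq> vars g) \<and>
                     (\<forall>\<pi>\<in>var_perms g. rename_poly (on_vars \<pi>) f = f)}"

lemma rename_poly_map:
  fixes h :: "'k::comm_ring_1 \<Rightarrow> 'l::comm_ring_1"
  assumes add: "\<And>x y. h (x + y) = h x + h y" and h0: "\<And>x. h x = 0 \<longleftrightarrow> x = 0"
  shows "rename_poly \<rho> (Poly_Mapping.map h f) = Poly_Mapping.map h (rename_poly \<rho> f)"
proof -
  have lk: "Poly_Mapping.lookup (Poly_Mapping.map h p) m = h (Poly_Mapping.lookup p m)"
    for p :: "'z \<Rightarrow>\<^sub>0 'k" and m
    using h0[of 0] by (simp add: map.rep_eq when_def)
  have ks: "Poly_Mapping.keys (Poly_Mapping.map h p) = Poly_Mapping.keys p" for p :: "'z \<Rightarrow>\<^sub>0 'k"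
    by (simp add: set_eq_iff in_keys_iff lk h0)
  have plus: "Poly_Mapping.map h (p + q) = Poly_Mapping.map h p + Poly_Mapping.map h q"
    for p q :: "'z \<Rightarrow>\<^sub>0 'k"
    by (rule poly_mapping_eqI) (simp add: lk lookup_add add)
  have zero: "Poly_Mapping.map h (0 :: 'z \<Rightarrow>\<^sub>0 'k) = 0"
    by (rule poly_mapping_eqI) (simp add: lk h0)
  have sum: "Poly_Mapping.map h (\<Sum>m\<in>S. F m) = (\<Sum>m\<in>S. Poly_Mapping.map h (F m))"
    if "finite S" for S :: "'y set" and F :: "'y \<Rightarrow> 'z \<Rightarrow>\<^sub>0 'k"
    using that zero by (induction S rule: finite_induct) (simp_all add: plus)
  have "h 0 = 0" using h0 by blast
  then show ?thesis
    by (simp add: rename_poly_def ks lk sum)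
qed

lemma common_denominator:
  fixes S :: "rat set"
  assumes "finite S"
  shows "\<exists>n::nat. n > 0 \<and> (\<forall>q\<in>S. of_nat n * q \<in> \<int>)"
  using assms
proof (induction S rule: finite_induct)
  case (insert q S)
  then obtain n :: nat where n: "n > 0" "\<forall>q\<in>S. of_nat n * q \<in> \<int>" by blast
  obtain c d where cd: "quotient_of q = (c, d)" by (cases "quotient_of q")
  then have d: "d > 0" "q = of_int c / of_int d"
    by (simp_all add: quotient_of_denom_pos quotient_of_div)
  have "of_nat (nat d * n) * q = of_int (c * int n)"
    using d by simp
  moreover have "of_nat (nat d * n) * r = of_int d * (of_nat n * r)" if "r \<in> S" for r :: rat
    using d by simp
  ultimately have "\<forall>r\<in>insert q S. of_nat (nat d * n) * r \<in> \<int>"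
    using n by (metis Ints_mult Ints_of_int insert_iff)
  moreover have "nat d * n > 0" using n d by simp
  ultimately show ?case by blast
qed auto

lemma sym_polys_map_iff:
  fixes h :: "'k::comm_ring_1 \<Rightarrow> 'l::comm_ring_1"
  assumes add: "\<And>x y. h (x + y) = h x + h y" and h0: "\<And>x. h x = 0 \<longleftrightarrow> x = 0"
  shows "Poly_Mapping.map h f \<in> sym_polys g \<longleftrightarrow> f \<in> sym_polys g"
proof -
  have lk: "Poly_Mapping.lookup (Poly_Mapping.map h p) m = h (Poly_Mapping.lookup p m)"
    for p :: "'z \<Rightarrow>\<^sub>0 'k" and m
    using h0[of 0] by (simp add: map.rep_eq when_def)
  have ks: "Poly_Mapping.keys (Poly_Mapping.map h p) = Poly_Mapping.keys p" for p :: "'z \<Rightarrow>\<^sub>0 'k"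
    by (simp add: set_eq_iff in_keys_iff lk h0)
  have inj: "x = y" if "h x = h y" for x y
    using add[of "x - y" y] h0[of "x - y"] that by simp
  have "p = q" if "Poly_Mapping.map h p = Poly_Mapping.map h q" for p q :: "'z \<Rightarrow>\<^sub>0 'k"
  proof (rule poly_mapping_eqI)
    fix m
    have "h (Poly_Mapping.lookup p m) = h (Poly_Mapping.lookup q m)"
      using arg_cong[OF that, of "\<lambda>r. Poly_Mapping.lookup r m"] unfolding lk .
    then show "Poly_Mapping.lookup p m = Poly_Mapping.lookup q m" by (rule inj)
  qed
  then have map_eq: "Poly_Mapping.map h p = Poly_Mapping.map h q \<longleftrightarrow> p = q" for p q :: "'z \<Rightarrow>\<^sub>0 'k"
    by blast
  show ?thesis
    by (simp add: sym_polys_def ks map_eq rename_poly_map[OF add h0])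
qed

text \<open>Over the rational numbers, symmetric (Laurent) polynomials are the integral ones tensored
  with \<open>\<rat>\<close>, i.e. the localization at the positive integers.\<close>

lemma sym_polys_rat:
  fixes f :: "('i var \<Rightarrow>\<^sub>0 'e::comm_monoid_add) \<Rightarrow>\<^sub>0 rat"
  shows "f \<in> sym_polys g \<longleftrightarrow>
    (\<exists>n::nat. n > 0 \<and> (\<exists>p \<in> sym_polys g. Poly_Mapping.map (\<lambda>c. of_nat n * c) f = Poly_Mapping.map of_int (p :: _ \<Rightarrow>\<^sub>0 int)))"
    (is "?L \<longleftrightarrow> ?R")
proof
  assume f: ?L
  obtain n :: nat where n: "n > 0" "\<forall>q\<in>Poly_Mapping.lookup f ` Poly_Mapping.keys f. of_nat n * q \<in> \<int>"
    using common_denominator[of "Poly_Mapping.lookup f ` Poly_Mapping.keys f"] by auto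
  define p where "p = Poly_Mapping.map (\<lambda>c. \<lfloor>of_nat n * c\<rfloor>) f"
  have eq: "Poly_Mapping.map (\<lambda>c. of_nat n * c) f = Poly_Mapping.map of_int p"
  proof (rule poly_mapping_eqI)
    fix m
    have "of_nat n * Poly_Mapping.lookup f m \<in> \<int>"
      using n by (cases "m \<in> Poly_Mapping.keys f") (auto simp: in_keys_iff)
    then obtain k where "of_nat n * Poly_Mapping.lookup f m = of_int k"
      by (elim Ints_cases)
    then show "Poly_Mapping.lookup (Poly_Mapping.map (\<lambda>c. of_nat n * c) f) m
             = Poly_Mapping.lookup (Poly_Mapping.map of_int p) m"
      by (auto simp: p_def map.rep_eq when_def)
  qed
  have "Poly_Mapping.map (\<lambda>c. of_nat n * c) f \<in> sym_polys g"
    using f n by (subst sym_polys_map_iff) (simp_all add: algebra_simps)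
  then have "p \<in> sym_polys g"
    unfolding eq by (subst (asm) sym_polys_map_iff) simp_all
  with eq n show ?R by blast
next
  assume ?R
  then obtain n :: nat and p :: "_ \<Rightarrow>\<^sub>0 int" where n: "n > 0" and p: "p \<in> sym_polys g"
    and eq: "Poly_Mapping.map (\<lambda>c. of_nat n * c) f = Poly_Mapping.map of_int p" by blast
  have "Poly_Mapping.map of_int p \<in> (sym_polys g :: (_ \<Rightarrow>\<^sub>0 rat) set)"
    using p by (subst sym_polys_map_iff) simp_all
  then have "Poly_Mapping.map (\<lambda>c. of_nat n * c) f \<in> sym_polys g" using eq by simp
  then show ?L
    using n by (subst (asm) sym_polys_map_iff) (simp_all add: algebra_simps)
qed

definition sym_series :: "('i \<Rightarrow> nat) \<Rightarrow> ('i var, 'k::comm_ring_1) mfps set" where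
  "sym_series g = {f. (\<forall>m. mcoeff f m \<noteq> 0 \<longrightarrow> Poly_Mapping.keys m \<subseteq> vars g) \<and>
                      (\<forall>\<pi>\<in>var_perms g. rename_mfps (on_vars \<pi>) f = f)}"


section \<open>Shuffle products\<close>

text \<open>A splitting of the variables \<open>x\<^bsub>i,\<alpha>\<^esub>\<close>, \<open>\<alpha> < g1 i + g2 i\<close>, is encoded by the permutations \<open>w i\<close>
  that list first the variables \<open>x'\<close> and then the variables \<open>x''\<close>, both in increasing order:
  \<open>x'\<close> with index \<open>(i, \<alpha>)\<close> is the variable \<open>(i, w i \<alpha>)\<close>, and \<open>x''\<close> with index \<open>(i, \<alpha>)\<close> is
  \<open>(i, w i (g1 i + \<alpha>))\<close>.\<close>

definition var_shuffles :: "('i \<Rightarrow> nat) \<Rightarrow> ('i \<Rightarrow> nat) \<Rightarrow> ('i \<Rightarrow> nat \<Rightarrow> nat) set" where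
  "var_shuffles g1 g2 = {w. \<forall>i. w i permutes {..<g1 i + g2 i} \<and>
     strict_mono_on {..<g1 i} (w i) \<and> strict_mono_on {g1 i..<g1 i + g2 i} (w i)}"

definition on_vars2 :: "('i \<Rightarrow> nat) \<Rightarrow> ('i \<Rightarrow> nat \<Rightarrow> nat) \<Rightarrow> 'i var \<Rightarrow> 'i var" where
  "on_vars2 g1 w = (\<lambda>(i, \<alpha>). (i, w i (g1 i + \<alpha>)))"

text \<open>The sum of fractions \<open>\<Sum>s\<in>S. N s / D s\<close>, computed in the fraction field of a domain
  and known to lie in the domain itself.\<close>

definition fraction_sum :: "'s set \<Rightarrow> ('s \<Rightarrow> 'r::comm_ring_1) \<Rightarrow> ('s \<Rightarrow> 'r) \<Rightarrow> 'r" where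
  "fraction_sum S N D =
     (THE q. q * (\<Prod>s\<in>S. D s) = (\<Sum>s\<in>S. N s * (\<Prod>t\<in>S - {s}. D t)))"

text \<open>\<open>K x' x''\<close> is the basic factor, \<open>x'' - x'\<close> or \<open>1 - z' / z''\<close>.\<close>

definition shuffle_mult ::
  "(('i var \<Rightarrow> 'i var) \<Rightarrow> 'r \<Rightarrow> 'r) \<Rightarrow> ('i var \<Rightarrow> 'i var \<Rightarrow> 'r) \<Rightarrow> ('i \<Rightarrow> 'i \<Rightarrow> nat)
   \<Rightarrow> ('i \<Rightarrow> nat) \<Rightarrow> ('i \<Rightarrow> nat) \<Rightarrow> 'r \<Rightarrow> 'r \<Rightarrow> 'r::comm_ring_1" where
  "shuffle_mult ren K a g1 g2 f1 f2 =
     fraction_sum (var_shuffles g1 g2)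
       (\<lambda>w. ren (on_vars w) f1 * ren (on_vars2 g1 w) f2 *
          (\<Prod>i\<in>UNIV. \<Prod>j\<in>UNIV. \<Prod>\<alpha>1<g1 i. \<Prod>\<alpha>2<g2 j. K (on_vars w (i, \<alpha>1)) (on_vars2 g1 w (j, \<alpha>2)) ^ a i j))
       (\<lambda>w. \<Prod>i\<in>UNIV. \<Prod>\<alpha>1<g1 i. \<Prod>\<alpha>2<g2 i. K (on_vars w (i, \<alpha>1)) (on_vars2 g1 w (i, \<alpha>2)))"


section \<open>Graded algebras and their graded modules\<close>

text \<open>\<open>gmult A \<gamma> \<delta>\<close> is the product of elements of degrees \<open>\<gamma>\<close> and \<open>\<delta>\<close>. Abelian groups are written as
  multiplicative monoids in the style of HOL-Algebra.\<close>

type_synonym 'i degree = "'i \<Rightarrow> int"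

record ('i, 'a) graded_ring =
  gcomp :: "'i degree \<Rightarrow> 'a monoid"
  gmult :: "'i degree \<Rightarrow> 'i degree \<Rightarrow> 'a \<Rightarrow> 'a \<Rightarrow> 'a"
  gone  :: 'a

definition additive_group :: "'a::ab_group_add set \<Rightarrow> 'a monoid" where
  "additive_group S = \<lparr>carrier = S, monoid.mult = (+), one = 0\<rparr>"

definition shuffle_algebra ::
  "(('i \<Rightarrow> nat) \<Rightarrow> 'r set) \<Rightarrow> (('i var \<Rightarrow> 'i var) \<Rightarrow> 'r \<Rightarrow> 'r) \<Rightarrow> ('i var \<Rightarrow> 'i var \<Rightarrow> 'r)
   \<Rightarrow> ('i \<Rightarrow> 'i \<Rightarrow> nat) \<Rightarrow> ('i, 'r::comm_ring_1) graded_ring" where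
  "shuffle_algebra S ren K a =
     \<lparr>gcomp = (\<lambda>\<gamma>. additive_group (if \<forall>i. 0 \<le> \<gamma> i then S (\<lambda>i. nat (\<gamma> i)) else {0})),
      gmult = (\<lambda>\<gamma> \<delta>. shuffle_mult ren K a (\<lambda>i. nat (\<gamma> i)) (\<lambda>i. nat (\<delta> i))),
      gone = 1\<rparr>"

record ('i, 'a, 'm) gmodule =
  mcomp :: "'i degree \<Rightarrow> 'm monoid"
  mact  :: "'i degree \<Rightarrow> 'i degree \<Rightarrow> 'a \<Rightarrow> 'm \<Rightarrow> 'm"

text \<open>\<open>mact M \<gamma> \<delta> a\<close> maps degree \<open>\<delta>\<close> to degree \<open>\<gamma> + \<delta>\<close>, for \<open>a\<close> of degree \<open>\<gamma>\<close>.\<close>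

locale graded_left_module =
  fixes A :: "('i, 'a) graded_ring" and M :: "('i, 'a, 'm) gmodule"
  assumes comm_group_mcomp: "comm_group (mcomp M \<gamma>)"
    and mact_hom: "a \<in> carrier (gcomp A \<gamma>) \<Longrightarrow> mact M \<gamma> \<delta> a \<in> hom (mcomp M \<delta>) (mcomp M (\<gamma> + \<delta>))"
    and mact_hom_left: "x \<in> carrier (mcomp M \<delta>) \<Longrightarrow>
          (\<lambda>a. mact M \<gamma> \<delta> a x) \<in> hom (gcomp A \<gamma>) (mcomp M (\<gamma> + \<delta>))"
    and mact_mult: "a \<in> carrier (gcomp A \<gamma>) \<Longrightarrow> b \<in> carrier (gcomp A \<delta>) \<Longrightarrow> x \<in> carrier (mcomp M \<epsilon>) \<Longrightarrow>
          mact M (\<gamma> + \<delta>) \<epsilon> (gmult A \<gamma> \<delta> a b) x = mact M \<gamma> (\<delta> + \<epsilon>) a (mact M \<delta> \<epsilon> b x)"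
    and mact_one: "x \<in> carrier (mcomp M \<delta>) \<Longrightarrow> mact M 0 \<delta> (gone A) x = x"

text \<open>Morphisms are extensional, so that equality of functions is equality of morphisms.\<close>

definition graded_homs ::
  "('i, 'a) graded_ring \<Rightarrow> ('i, 'a, 'm) gmodule \<Rightarrow> ('i, 'a, 'n) gmodule \<Rightarrow> ('i degree \<Rightarrow> 'm \<Rightarrow> 'n) set" where
  "graded_homs A M N = {h.
     (\<forall>\<gamma>. h \<gamma> \<in> hom (mcomp M \<gamma>) (mcomp N \<gamma>) \<inter> extensional (carrier (mcomp M \<gamma>))) \<and>
     (\<forall>\<gamma> \<delta>. \<forall>a\<in>carrier (gcomp A \<gamma>). \<forall>x\<in>carrier (mcomp M \<delta>).
        h (\<gamma> + \<delta>) (mact M \<gamma> \<delta> a x) = mact N \<gamma> \<delta> a (h \<delta> x))}"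

definition regular_module :: "('i, 'a) graded_ring \<Rightarrow> ('i, 'a, 'a) gmodule" where
  "regular_module A = \<lparr>mcomp = gcomp A, mact = gmult A\<rparr>"

definition shift :: "'i degree \<Rightarrow> ('i, 'a, 'm) gmodule \<Rightarrow> ('i, 'a, 'm) gmodule" where
  "shift \<tau> M = \<lparr>mcomp = (\<lambda>\<gamma>. mcomp M (\<tau> + \<gamma>)), mact = (\<lambda>\<gamma> \<delta>. mact M \<gamma> (\<tau> + \<delta>))\<rparr>"

definition direct_sum :: "'k set \<Rightarrow> ('k \<Rightarrow> ('i, 'a, 'm) gmodule) \<Rightarrow> ('i, 'a, 'k \<Rightarrow> 'm) gmodule" where
  "direct_sum K N =
     \<lparr>mcomp = (\<lambda>\<gamma>. sum_group K (\<lambda>k. mcomp (N k) \<gamma>)),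
      mact = (\<lambda>\<gamma> \<delta> a x. \<lambda>k\<in>K. mact (N k) \<gamma> \<delta> a (x k))\<rparr>"

definition summand_incl ::
  "'k set \<Rightarrow> ('k \<Rightarrow> ('i, 'a, 'm) gmodule) \<Rightarrow> 'k \<Rightarrow> 'i degree \<Rightarrow> 'm \<Rightarrow> 'k \<Rightarrow> 'm" where
  "summand_incl K N k \<gamma> x = (\<lambda>l\<in>K. if l = k then x else \<one>\<^bsub>mcomp (N l) \<gamma>\<^esub>)"


section \<open>Locally finite modules\<close>

text \<open>A filtration \<open>F\<close> assigns to \<open>\<gamma>\<close> and \<open>n\<close> the subspace \<open>A\<^bsub>\<gamma>\<^esub>\<close> in filtration degree \<open>\<ge> n\<close>.\<close>

definition graded_left_ideal :: "('i, 'a) graded_ring \<Rightarrow> ('i degree \<Rightarrow> 'a set) \<Rightarrow> bool" where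
  "graded_left_ideal A J \<longleftrightarrow>
     (\<forall>\<gamma>. subgroup (J \<gamma>) (gcomp A \<gamma>)) \<and>
     (\<forall>\<gamma> \<delta>. \<forall>a\<in>carrier (gcomp A \<gamma>). \<forall>x\<in>J \<delta>. gmult A \<gamma> \<delta> a x \<in> J (\<gamma> + \<delta>))"

definition large_left_ideal ::
  "('i, 'a) graded_ring \<Rightarrow> ('i degree \<Rightarrow> nat \<Rightarrow> 'a set) \<Rightarrow> ('i degree \<Rightarrow> 'a set) \<Rightarrow> bool" where
  "large_left_ideal A F J \<longleftrightarrow>
     graded_left_ideal A J \<and> (\<forall>\<gamma>. (\<forall>i. 0 \<le> \<gamma> i) \<longrightarrow> (\<exists>n. F \<gamma> n \<subseteq> J \<gamma>))"

text \<open>The summands \<open>A(\<tau> k)\<close> are indexed by a subset of \<open>'i degree \<times> 'm\<close>. This is no restriction: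
  \<open>\<theta>\<close> on \<open>A(\<tau> k)\<close> is determined by \<open>- \<tau> k\<close> and the image in \<open>M\<close> of the unit of \<open>A\<close>, and
  summands with equal data can be dropped.\<close>

definition locally_finite ::
  "('i, 'a) graded_ring \<Rightarrow> ('i degree \<Rightarrow> nat \<Rightarrow> 'a set) \<Rightarrow> ('i, 'a, 'm) gmodule \<Rightarrow> bool" where
  "locally_finite A F M \<longleftrightarrow>
     (\<exists>(K :: ('i degree \<times> 'm) set) \<tau> \<theta>.
        let N = (\<lambda>k. shift (\<tau> k) (regular_module A)) in
        \<theta> \<in> graded_homs A (direct_sum K N) M \<and>
        (\<forall>\<gamma>. \<theta> \<gamma> ` carrier (mcomp (direct_sum K N) \<gamma>) = carrier (mcomp M \<gamma>)) \<and>
        (\<forall>k\<in>K. \<exists>J. large_left_ideal A F J \<and>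
           (\<forall>\<gamma>. kernel (mcomp (N k) \<gamma>) (mcomp M \<gamma>) (\<theta> \<gamma> \<circ> summand_incl K N k \<gamma>) = J (\<tau> k + \<gamma>))))"


section \<open>Categories and their equivalences\<close>

record ('o, 'h) cat =
  Obj  :: "'o set"
  Hom  :: "'o \<Rightarrow> 'o \<Rightarrow> 'h set"
  Ident :: "'o \<Rightarrow> 'h"
  Comp :: "'o \<Rightarrow> 'o \<Rightarrow> 'o \<Rightarrow> 'h \<Rightarrow> 'h \<Rightarrow> 'h"

text \<open>\<open>Comp C X Y Z g f\<close> is the composite of \<open>f : X \<rightarrow> Y\<close> and \<open>g : Y \<rightarrow> Z\<close>.\<close>

locale category =
  fixes C :: "('o, 'h) cat"
  assumes Ident_in: "X \<in> Obj C \<Longrightarrow> Ident C X \<in> Hom C X X"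
    and Comp_in: "\<lbrakk>X \<in> Obj C; Y \<in> Obj C; Z \<in> Obj C; f \<in> Hom C X Y; g \<in> Hom C Y Z\<rbrakk>
          \<Longrightarrow> Comp C X Y Z g f \<in> Hom C X Z"
    and Comp_Ident: "\<lbrakk>X \<in> Obj C; Y \<in> Obj C; f \<in> Hom C X Y\<rbrakk> \<Longrightarrow> Comp C X X Y f (Ident C X) = f"
    and Ident_Comp: "\<lbrakk>X \<in> Obj C; Y \<in> Obj C; f \<in> Hom C X Y\<rbrakk> \<Longrightarrow> Comp C X Y Y (Ident C Y) f = f"
    and Comp_assoc: "\<lbrakk>W \<in> Obj C; X \<in> Obj C; Y \<in> Obj C; Z \<in> Obj C;
          f \<in> Hom C W X; g \<in> Hom C X Y; h \<in> Hom C Y Z\<rbrakk>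
          \<Longrightarrow> Comp C W Y Z h (Comp C W X Y g f) = Comp C W X Z (Comp C X Y Z h g) f"

locale cat_functor = C: category C + D: category D
  for C :: "('o, 'h) cat" and D :: "('p, 'k) cat" +
  fixes Fo :: "'o \<Rightarrow> 'p" and Fh :: "'o \<Rightarrow> 'o \<Rightarrow> 'h \<Rightarrow> 'k"
  assumes Fo_in: "X \<in> Obj C \<Longrightarrow> Fo X \<in> Obj D"
    and Fh_in: "\<lbrakk>X \<in> Obj C; Y \<in> Obj C; f \<in> Hom C X Y\<rbrakk> \<Longrightarrow> Fh X Y f \<in> Hom D (Fo X) (Fo Y)"
    and Fh_Ident: "X \<in> Obj C \<Longrightarrow> Fh X X (Ident C X) = Ident D (Fo X)"
    and Fh_Comp: "\<lbrakk>X \<in> Obj C; Y \<in> Obj C; Z \<in> Obj C; f \<in> Hom C X Y; g \<in> Hom C Y Z\<rbrakk>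
          \<Longrightarrow> Fh X Z (Comp C X Y Z g f) = Comp D (Fo X) (Fo Y) (Fo Z) (Fh Y Z g) (Fh X Y f)"

definition is_iso :: "('o, 'h) cat \<Rightarrow> 'o \<Rightarrow> 'o \<Rightarrow> 'h \<Rightarrow> bool" where
  "is_iso C X Y f \<longleftrightarrow> f \<in> Hom C X Y \<and>
     (\<exists>g\<in>Hom C Y X. Comp C X Y X g f = Ident C X \<and> Comp C Y X Y f g = Ident C Y)"

definition nat_iso_to_identity ::
  "('o, 'h) cat \<Rightarrow> ('o \<Rightarrow> 'o) \<Rightarrow> ('o \<Rightarrow> 'o \<Rightarrow> 'h \<Rightarrow> 'h) \<Rightarrow> ('o \<Rightarrow> 'h) \<Rightarrow> bool" where
  "nat_iso_to_identity C Eo Eh \<eta> \<longleftrightarrow>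
     (\<forall>X\<in>Obj C. is_iso C (Eo X) X (\<eta> X)) \<and>
     (\<forall>X\<in>Obj C. \<forall>Y\<in>Obj C. \<forall>f\<in>Hom C X Y.
        Comp C (Eo X) X Y f (\<eta> X) = Comp C (Eo X) (Eo Y) Y (\<eta> Y) (Eh X Y f))"

definition equivalent_categories :: "('o, 'h) cat \<Rightarrow> ('p, 'k) cat \<Rightarrow> bool" where
  "equivalent_categories C D \<longleftrightarrow>
     (\<exists>Fo Fh Go Gh \<eta> \<epsilon>.
        cat_functor C D Fo Fh \<and> cat_functor D C Go Gh \<and>
        nat_iso_to_identity C (Go \<circ> Fo) (\<lambda>X Y. Gh (Fo X) (Fo Y) \<circ> Fh X Y) \<eta> \<and>
        nat_iso_to_identity D (Fo \<circ> Go) (\<lambda>X Y. Fh (Go X) (Go Y) \<circ> Gh X Y) \<epsilon>)"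

text \<open>The type \<open>'m\<close> plays the role of a universe: the underlying sets of the modules are subsets of \<open>'m\<close>.\<close>

definition Mod_lf ::
  "'m itself \<Rightarrow> ('i, 'a) graded_ring \<Rightarrow> ('i degree \<Rightarrow> nat \<Rightarrow> 'a set)
   \<Rightarrow> (('i, 'a, 'm) gmodule, 'i degree \<Rightarrow> 'm \<Rightarrow> 'm) cat" where
  "Mod_lf _ A F =
     \<lparr>Obj = {M. graded_left_module A M \<and> locally_finite A F M},
      Hom = graded_homs A,
      Ident = (\<lambda>M \<gamma>. \<lambda>x\<in>carrier (mcomp M \<gamma>). x),
      Comp = (\<lambda>L M N g f \<gamma>. compose (carrier (mcomp L \<gamma>)) (g \<gamma>) (f \<gamma>))\<rparr>"


section \<open>The algebras of a quiver\<close>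

text \<open>A quiver with vertex set \<open>'i\<close> is given by the numbers \<open>a i j\<close> of arrows from \<open>i\<close> to \<open>j\<close>.\<close>

definition CoHA :: "('i::finite \<Rightarrow> 'i \<Rightarrow> nat) \<Rightarrow> ('i, ('i var, rat) polynomial) graded_ring" where
  "CoHA = shuffle_algebra sym_polys rename_poly (\<lambda>u v. pvar v - pvar u)"

definition CoHA_hat :: "('i::finite \<Rightarrow> 'i \<Rightarrow> nat) \<Rightarrow> ('i, ('i var, rat) mfps) graded_ring" where
  "CoHA_hat = shuffle_algebra sym_series rename_mfps (\<lambda>u v. mfps_var v - mfps_var u)"

text \<open>The KHA with coefficients in \<open>'k\<close>: over \<open>int\<close> it is the KHA itself, and over \<open>rat\<close> it is
  the extension of scalars of the latter to the rational numbers.\<close>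

definition KHA :: "('i::finite \<Rightarrow> 'i \<Rightarrow> nat) \<Rightarrow> ('i, ('i var, 'k::comm_ring_1) laurent) graded_ring" where
  "KHA = shuffle_algebra sym_polys rename_poly (\<lambda>u v. 1 - pvar u * inv_pvar v)"

abbreviation KHA_Q :: "('i::finite \<Rightarrow> 'i \<Rightarrow> nat) \<Rightarrow> ('i, ('i var, rat) laurent) graded_ring" where
  "KHA_Q \<equiv> KHA"

definition chern :: "('v, rat) laurent \<Rightarrow> ('v, rat) mfps" where
  "chern f = (\<Sum>m\<in>Poly_Mapping.keys f. mfps_const (Poly_Mapping.lookup f m) *
     (\<Prod>v\<in>Poly_Mapping.keys m. mfps_exp (of_int (Poly_Mapping.lookup m v) * mfps_var v)))"

text \<open>Integral powers of \<open>exp f\<close> are written as \<open>exp (k f)\<close>.\<close>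

definition b_twist ::
  "('i::finite \<Rightarrow> 'i \<Rightarrow> nat) \<Rightarrow> 'i degree \<Rightarrow> ('i \<Rightarrow> nat) \<Rightarrow> ('i var, rat) mfps" where
  "b_twist a \<tau> g =
     mfps_const ((- 1) powi ((\<Sum>i\<in>UNIV. int (g i) * \<tau> i) + (\<Sum>i\<in>UNIV. \<Sum>j\<in>UNIV. int (a i j) * int (g i) * \<tau> j))) *
     (\<Prod>i\<in>UNIV. mfps_exp (of_int (\<tau> i - (\<Sum>j\<in>UNIV. int (a i j) * \<tau> j)) * - (\<Sum>\<alpha><g i. mfps_var (i, \<alpha>))))"

definition sigma_twist ::
  "('i::finite \<Rightarrow> 'i \<Rightarrow> nat) \<Rightarrow> 'i degree \<Rightarrow> 'i degree \<Rightarrow> ('i var, rat) mfps \<Rightarrow> ('i var, rat) mfps" where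
  "sigma_twist a \<tau> \<gamma> f = b_twist a \<tau> (\<lambda>i. nat (\<gamma> i)) * f"

text \<open>\<open>\<sigma> \<tau> \<gamma>\<close> is the restriction of the automorphism attached to \<open>\<tau>\<close> to the component of degree \<open>\<gamma>\<close>.\<close>

definition left_zhang_twist ::
  "('i degree \<Rightarrow> 'i degree \<Rightarrow> 'a \<Rightarrow> 'a) \<Rightarrow> ('i, 'a) graded_ring \<Rightarrow> ('i, 'a) graded_ring" where
  "left_zhang_twist \<sigma> A = A\<lparr>gmult := (\<lambda>\<gamma> \<delta> x y. gmult A \<gamma> \<delta> (\<sigma> \<delta> \<gamma> x) y)\<rparr>"

definition CoHA_hat_twist :: "('i::finite \<Rightarrow> 'i \<Rightarrow> nat) \<Rightarrow> ('i, ('i var, rat) mfps) graded_ring" where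
  "CoHA_hat_twist a = left_zhang_twist (sigma_twist a) (CoHA_hat a)"

definition CoHA_filt ::
  "('i::finite \<Rightarrow> 'i \<Rightarrow> nat) \<Rightarrow> 'i degree \<Rightarrow> nat \<Rightarrow> ('i var, rat) polynomial set" where
  "CoHA_filt a \<gamma> n = {f \<in> carrier (gcomp (CoHA a) \<gamma>). \<forall>m\<in>Poly_Mapping.keys f. n \<le> mdeg m}"

text \<open>The twisted algebra has the same components, and the same filtration.\<close>

definition CoHA_hat_filt ::
  "('i::finite \<Rightarrow> 'i \<Rightarrow> nat) \<Rightarrow> 'i degree \<Rightarrow> nat \<Rightarrow> ('i var, rat) mfps set" where
  "CoHA_hat_filt a \<gamma> n = {f \<in> carrier (gcomp (CoHA_hat a) \<gamma>). \<forall>m. mcoeff f m \<noteq> 0 \<longrightarrow> n \<le> mdeg m}"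

definition KHA_Q_filt ::
  "('i::finite \<Rightarrow> 'i \<Rightarrow> nat) \<Rightarrow> 'i degree \<Rightarrow> nat \<Rightarrow> ('i var, rat) laurent set" where
  "KHA_Q_filt a \<gamma> n = {f \<in> carrier (gcomp (KHA_Q a) \<gamma>). chern f \<in> CoHA_hat_filt a \<gamma> n}"

end

theory Submission
  imports Defs "HOL-Algebra.Free_Abelian_Groups"
begin

text \<open>
  A module over one of these algebras is locally finite exactly when each of its elements is killed,
  in each degree of the algebra, by some step of the filtration
  (\<open>locally_finite_iff_discrete\<close>): a large left ideal is the annihilator of a
  generator, and continuity of the product carries the property from the generators to all elements.
  Such actions are insensitive to two changes of the algebra, neither of which alters the graded
  group underlying a module or the maps that are morphisms.

  First, a dense filtered subalgebra suffices (\<open>Mod_lf_dense\<close>): since an element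
  \<open>x\<close> of a module is killed by a step of the filtration, \<open>b\<close> acts on
  \<open>x\<close> as any sufficiently close element of the subalgebra does, and the action extends
  by continuity. Polynomials are dense in power series, which gives the first equivalence. Second, a
  left Zhang twist only replaces the action of \<open>a\<close> on degree \<open>\<delta>\<close> by
  that of \<open>\<sigma>\<^sub>\<delta> a\<close> (\<open>Mod_lf_zhang_twist\<close>), which gives
  the second one.

  For the third one the Chern character is corrected into an algebra homomorphism from the KHA to
  the twisted completed CoHA. The two kernels are related by \<open>1 - e\<^bsup>u-v\<^esup> = (v -
  u) \<cdot> S(u,v) \<cdot> (- e\<^sup>u)\<close> with \<open>S(u,v) = (e\<^bsup>-u\<^esup> -
  e\<^bsup>-v\<^esup>) / (u - v)\<close>, which is symmetric and invertible
  (\<open>chern_kernel\<close>). As the quiver is symmetric, the product of the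
  \<open>S(x\<^bsub>i,\<alpha>\<^esub>, x\<^bsub>j,\<beta>\<^esub>)\<^bsup>a\<^bsub>ij\<^esub> -
  \<delta>\<^bsub>ij\<^esub>\<^esup>\<close> over unordered pairs of variables makes sense, and
  dividing by it absorbs the factors \<open>S\<close> that relate a variable of the left to one of
  the right factor of a product. The remaining factors \<open>- e\<^sup>u\<close> only involve the
  variables of the left factor, and together they are the series \<open>b\<close> of the twist, sign
  included (\<open>KHA_hom_mult\<close>). The image is dense because \<open>e\<^sup>x - 1\<close>
  has leading term \<open>x\<close> (\<open>chern_dense\<close>).

  All this presupposes that the shuffle sum of fractions lies in the ring of polynomials, Laurent
  polynomials or power series. The sum, multiplied by the product of the kernels over all ordered
  pairs of variables at the same vertex, is symmetric and divisible by one of the two kernels of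
  each unordered pair; being symmetric, it is then divisible by both, and distinct pairs are coprime
  (\<open>full_denom_dvd_total\<close>).
\<close>

section \<open>Locally finite modules and discrete actions\<close>

lemma additive_group_simps [simp]:
  "carrier (additive_group S) = S" "monoid.mult (additive_group S) = (+)" "one (additive_group S) = 0"
  by (simp_all add: additive_group_def)

lemma comm_group_additive_group:
  fixes S :: "'a::ab_group_add set"
  assumes "0 \<in> S" "\<And>x y. x \<in> S \<Longrightarrow> y \<in> S \<Longrightarrow> x + y \<in> S" "\<And>x. x \<in> S \<Longrightarrow> - x \<in> S"
  shows "comm_group (additive_group S)"
  by (rule comm_groupI) (use assms in \<open>auto simp: algebra_simps intro!: bexI[of _ "- _"]\<close>)

text \<open>Records give the components of a graded ring as abstract groups; here they are groups of
  elements of an additive type.\<close>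

locale biadditive_graded_ring =
  fixes A :: "('i, 'a::ab_group_add) graded_ring"
  assumes gcomp_eq: "gcomp A \<gamma> = additive_group (carrier (gcomp A \<gamma>))"
    and zero_closed: "0 \<in> carrier (gcomp A \<gamma>)"
    and add_closed: "x \<in> carrier (gcomp A \<gamma>) \<Longrightarrow> y \<in> carrier (gcomp A \<gamma>) \<Longrightarrow> x + y \<in> carrier (gcomp A \<gamma>)"
    and uminus_closed: "x \<in> carrier (gcomp A \<gamma>) \<Longrightarrow> - x \<in> carrier (gcomp A \<gamma>)"
    and carrier_negative: "\<not> (\<forall>i. 0 \<le> \<gamma> i) \<Longrightarrow> carrier (gcomp A \<gamma>) = {0}"
    and one_closed: "gone A \<in> carrier (gcomp A 0)"
    and gmult_closed: "x \<in> carrier (gcomp A \<gamma>) \<Longrightarrow> y \<in> carrier (gcomp A \<delta>) \<Longrightarrow> gmult A \<gamma> \<delta> x y \<in> carrier (gcomp A (\<gamma> + \<delta>))"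
    and gmult_add_left: "x \<in> carrier (gcomp A \<gamma>) \<Longrightarrow> x' \<in> carrier (gcomp A \<gamma>) \<Longrightarrow> y \<in> carrier (gcomp A \<delta>)
      \<Longrightarrow> gmult A \<gamma> \<delta> (x + x') y = gmult A \<gamma> \<delta> x y + gmult A \<gamma> \<delta> x' y"
    and gmult_add_right: "x \<in> carrier (gcomp A \<gamma>) \<Longrightarrow> y \<in> carrier (gcomp A \<delta>) \<Longrightarrow> y' \<in> carrier (gcomp A \<delta>)
      \<Longrightarrow> gmult A \<gamma> \<delta> x (y + y') = gmult A \<gamma> \<delta> x y + gmult A \<gamma> \<delta> x y'"
begin

abbreviation C where "C \<gamma> \<equiv> carrier (gcomp A \<gamma>)"

lemma gcomp_simps [simp]: "monoid.mult (gcomp A \<gamma>) = (+)" "one (gcomp A \<gamma>) = 0"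
  by (subst gcomp_eq; simp)+

lemma comm_group_gcomp: "comm_group (gcomp A \<gamma>)"
  by (subst gcomp_eq) (rule comm_group_additive_group; simp add: zero_closed add_closed uminus_closed)

lemma group_gcomp: "group (gcomp A \<gamma>)"
  using comm_group_gcomp by (simp add: comm_group_def)

lemma diff_closed: "x \<in> C \<gamma> \<Longrightarrow> y \<in> C \<gamma> \<Longrightarrow> x - y \<in> C \<gamma>"
  using add_closed[OF _ uminus_closed] by fastforce

lemma gmult_zero_right: "x \<in> C \<gamma> \<Longrightarrow> gmult A \<gamma> \<delta> x 0 = 0"
  using gmult_add_right[of x \<gamma> 0 \<delta> 0] by (simp add: zero_closed)

lemma gmult_zero_left: "y \<in> C \<delta> \<Longrightarrow> gmult A \<gamma> \<delta> 0 y = 0"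
  using gmult_add_left[of 0 \<gamma> 0 y \<delta>] by (simp add: zero_closed)

lemma gmult_diff_left: "x \<in> C \<gamma> \<Longrightarrow> x' \<in> C \<gamma> \<Longrightarrow> y \<in> C \<delta>
    \<Longrightarrow> gmult A \<gamma> \<delta> (x - x') y = gmult A \<gamma> \<delta> x y - gmult A \<gamma> \<delta> x' y"
  using gmult_add_left[of "x - x'" \<gamma> x' y \<delta>] diff_closed[of x \<gamma> x'] by (simp add: algebra_simps)

lemma gmult_diff_right: "x \<in> C \<gamma> \<Longrightarrow> y \<in> C \<delta> \<Longrightarrow> y' \<in> C \<delta>
    \<Longrightarrow> gmult A \<gamma> \<delta> x (y - y') = gmult A \<gamma> \<delta> x y - gmult A \<gamma> \<delta> x y'"
  using gmult_add_right[of x \<gamma> "y - y'" \<delta> y'] diff_closed[of y \<delta> y'] by (simp add: algebra_simps)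

end

locale filtered_graded_ring = biadditive_graded_ring A
  for A :: "('i, 'a::ab_group_add) graded_ring" +
  fixes F :: "'i degree \<Rightarrow> nat \<Rightarrow> 'a set"
  assumes F_carrier: "F \<gamma> n \<subseteq> carrier (gcomp A \<gamma>)"
    and F_zero: "0 \<in> F \<gamma> n"
    and F_add: "x \<in> F \<gamma> n \<Longrightarrow> y \<in> F \<gamma> n \<Longrightarrow> x + y \<in> F \<gamma> n"
    and F_uminus: "x \<in> F \<gamma> n \<Longrightarrow> - x \<in> F \<gamma> n"
    and F_mono: "m \<le> n \<Longrightarrow> F \<gamma> n \<subseteq> F \<gamma> m"
    and continuous_left: "y \<in> carrier (gcomp A \<delta>) \<Longrightarrow> \<exists>k. \<forall>x\<in>F \<gamma> k. gmult A \<gamma> \<delta> x y \<in> F (\<gamma> + \<delta>) n"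
    and continuous_right: "x \<in> carrier (gcomp A \<gamma>) \<Longrightarrow> \<exists>k. \<forall>y\<in>F \<delta> k. gmult A \<gamma> \<delta> x y \<in> F (\<gamma> + \<delta>) n"
begin

lemma F_diff: "x \<in> F \<gamma> n \<Longrightarrow> y \<in> F \<gamma> n \<Longrightarrow> x - y \<in> F \<gamma> n"
  using F_add[OF _ F_uminus] by fastforce

end

text \<open>Continuity of the action when the module is discrete and the algebra has the topology of
  the filtration.\<close>

definition discrete_action ::
  "('i degree \<Rightarrow> nat \<Rightarrow> 'a set) \<Rightarrow> ('i, 'a, 'm) gmodule \<Rightarrow> bool" where
  "discrete_action F M \<longleftrightarrow>
     (\<forall>\<gamma> \<delta>. \<forall>x\<in>carrier (mcomp M \<delta>). \<exists>n. \<forall>a\<in>F \<gamma> n. mact M \<gamma> \<delta> a x = \<one>\<^bsub>mcomp M (\<gamma> + \<delta>)\<^esub>)"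

lemma hom_restrict_carrier:
  assumes "group G" "h \<in> hom G H"
  shows "restrict h (carrier G) \<in> hom G H"
  using assms(2) monoid.m_closed[OF group.is_monoid[OF assms(1)]] by (auto simp: hom_def Pi_iff)

lemma (in comm_group) gfinprod_hom:
  assumes G': "comm_group G'" and h: "h \<in> hom G G'" and f: "f \<in> I \<rightarrow> carrier G"
    and fin: "finite {i\<in>I. f i \<noteq> \<one>}"
  shows "h (gfinprod G f I) = gfinprod G' (\<lambda>i. h (f i)) I"
proof -
  interpret G': comm_group G' by fact
  let ?S = "{i\<in>I. f i \<noteq> \<one>}"
  have h1: "h \<one> = \<one>\<^bsub>G'\<^esub>" using h by (rule hom_one) (simp_all add: is_group G'.is_group)
  have hc: "h x \<in> carrier G'" if "x \<in> carrier G" for x using h that by (auto simp: hom_def)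
  have "h (finprod G f T) = finprod G' (\<lambda>i. h (f i)) T" if "finite T" "T \<subseteq> I" for T
    using that
  proof (induction T rule: finite_induct)
    case (insert i T)
    then have "f \<in> T \<rightarrow> carrier G" "f i \<in> carrier G" using f by auto
    moreover from this have "(\<lambda>i. h (f i)) \<in> T \<rightarrow> carrier G'" "h (f i) \<in> carrier G'"
      using hc by auto
    ultimately show ?case using insert h by (simp add: hom_mult finprod_closed)
  qed (simp add: h1)
  then have "h (finprod G f ?S) = finprod G' (\<lambda>i. h (f i)) ?S" using fin by blast
  also have "\<dots> = gfinprod G' (\<lambda>i. h (f i)) ?S"
    using f hc fin by (subst G'.gfinprod_eq_finprod) auto
  also have "\<dots> = gfinprod G' (\<lambda>i. h (f i)) I"
    by (rule G'.gfinprod_mono_neutral_cong_left) (use f hc h1 in auto)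
  finally show ?thesis using fin by (simp add: gfinprod_def)
qed

context filtered_graded_ring
begin

context
  fixes M :: "('i, 'a, 'm) gmodule"
  assumes M: "graded_left_module A M"
begin

interpretation M: graded_left_module A M by (rule M)

lemma comm_group_M: "comm_group (mcomp M \<gamma>)" by (rule M.comm_group_mcomp)

lemma group_M: "group (mcomp M \<gamma>)" using comm_group_M by (simp add: comm_group_def)

lemma mact_closed: "a \<in> C \<gamma> \<Longrightarrow> x \<in> carrier (mcomp M \<delta>) \<Longrightarrow> mact M \<gamma> \<delta> a x \<in> carrier (mcomp M (\<gamma> + \<delta>))"
  using M.mact_hom[of a \<gamma> \<delta>] by (auto simp: hom_def)

lemma mact_add: "a \<in> C \<gamma> \<Longrightarrow> b \<in> C \<gamma> \<Longrightarrow> x \<in> carrier (mcomp M \<delta>) \<Longrightarrow>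
    mact M \<gamma> \<delta> (a + b) x = mact M \<gamma> \<delta> a x \<otimes>\<^bsub>mcomp M (\<gamma> + \<delta>)\<^esub> mact M \<gamma> \<delta> b x"
  using M.mact_hom_left[of x \<delta> \<gamma>] by (auto simp: hom_def)

lemma mact_zero: "x \<in> carrier (mcomp M \<delta>) \<Longrightarrow> mact M \<gamma> \<delta> 0 x = \<one>\<^bsub>mcomp M (\<gamma> + \<delta>)\<^esub>"
  using hom_one[OF M.mact_hom_left group_gcomp group_M] by simp

lemma mact_one_right: "a \<in> C \<gamma> \<Longrightarrow> mact M \<gamma> \<delta> a \<one>\<^bsub>mcomp M \<delta>\<^esub> = \<one>\<^bsub>mcomp M (\<gamma> + \<delta>)\<^esub>"
  using hom_one[OF M.mact_hom group_M group_M] .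

lemma mact_eq_if_diff_kills:
  assumes "a \<in> C \<gamma>" "b \<in> C \<gamma>" "x \<in> carrier (mcomp M \<delta>)" "mact M \<gamma> \<delta> (a - b) x = \<one>\<^bsub>mcomp M (\<gamma> + \<delta>)\<^esub>"
  shows "mact M \<gamma> \<delta> a x = mact M \<gamma> \<delta> b x"
  using mact_add[of "a - b" \<gamma> b x \<delta>] assms diff_closed[of a \<gamma> b] mact_closed[of b \<gamma> x \<delta>]
    group.is_monoid[OF group_M, of "\<gamma> + \<delta>"] by (simp add: monoid.l_one)

text \<open>These annihilators are the kernels in the presentation of a discrete module by its
  elements.\<close>

lemma annihilator_large_left_ideal:
  assumes disc: "discrete_action F M" and m: "m \<in> carrier (mcomp M \<delta>)"
  shows "large_left_ideal A F (\<lambda>\<gamma>. {a \<in> C \<gamma>. mact M \<gamma> \<delta> a m = \<one>\<^bsub>mcomp M (\<gamma> + \<delta>)\<^esub>})"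
    (is "large_left_ideal A F ?J")
  unfolding large_left_ideal_def graded_left_ideal_def
proof (intro conjI allI impI ballI)
  fix \<gamma>
  have "kernel (gcomp A \<gamma>) (mcomp M (\<gamma> + \<delta>)) (\<lambda>a. mact M \<gamma> \<delta> a m) = ?J \<gamma>"
    by (auto simp: kernel_def)
  moreover have "group_hom (gcomp A \<gamma>) (mcomp M (\<gamma> + \<delta>)) (\<lambda>a. mact M \<gamma> \<delta> a m)"
    by (intro group_hom.intro group_gcomp group_M group_hom_axioms.intro M.mact_hom_left m)
  ultimately show "subgroup (?J \<gamma>) (gcomp A \<gamma>)"
    using group_hom.subgroup_kernel by metis
next
  fix \<gamma> \<gamma>' a x assume "a \<in> C \<gamma>" "x \<in> ?J \<gamma>'"
  then show "gmult A \<gamma> \<gamma>' a x \<in> ?J (\<gamma> + \<gamma>')"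
    using m by (simp add: gmult_closed M.mact_mult mact_one_right add.assoc)
next
  fix \<gamma>
  show "\<exists>n. F \<gamma> n \<subseteq> ?J \<gamma>"
    using disc m F_carrier unfolding discrete_action_def by fast
qed

text \<open>An element is the image of a finite sum of \<open>x\<^sub>k\<close> in the summands
  \<open>A(\<tau>\<^sub>k)\<close>. By continuity, \<open>a x\<^sub>k\<close> lies in the large ideal
  of the summand as soon as \<open>a\<close> is small, so \<open>a\<close> kills the element when it
  is small enough for the finitely many \<open>k\<close>.\<close>

lemma locally_finite_imp_discrete:
  assumes "locally_finite A F M"
  shows "discrete_action F M"
  unfolding discrete_action_def
proof (intro allI ballI)
  fix \<gamma> \<delta> m assume m: "m \<in> carrier (mcomp M \<delta>)"
  from assms obtain K :: "('i degree \<times> 'm) set" and \<tau> \<theta> where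
    hom: "\<theta> \<in> graded_homs A (direct_sum K (\<lambda>k. shift (\<tau> k) (regular_module A))) M" and
    surj: "\<And>\<gamma>. \<theta> \<gamma> ` carrier (mcomp (direct_sum K (\<lambda>k. shift (\<tau> k) (regular_module A))) \<gamma>) = carrier (mcomp M \<gamma>)" and
    ker: "\<And>k. k \<in> K \<Longrightarrow> \<exists>J. large_left_ideal A F J \<and>
           (\<forall>\<gamma>. kernel (mcomp (shift (\<tau> k) (regular_module A)) \<gamma>) (mcomp M \<gamma>)
               (\<theta> \<gamma> \<circ> summand_incl K (\<lambda>k. shift (\<tau> k) (regular_module A)) k \<gamma>) = J (\<tau> k + \<gamma>))"
    unfolding locally_finite_def Let_def by (elim exE conjE) blast
  define N where "N k = shift (\<tau> k) (regular_module A)" for k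
  note hom = hom[folded N_def] and surj = surj[folded N_def] and ker = ker[folded N_def]
  have compN: "mcomp (N k) \<gamma> = gcomp A (\<tau> k + \<gamma>)" for k \<gamma>
    by (simp add: N_def shift_def regular_module_def)
  have actN: "mact (N k) \<gamma> \<delta> = gmult A \<gamma> (\<tau> k + \<delta>)" for k \<gamma> \<delta>
    by (simp add: N_def shift_def regular_module_def)
  have carr: "carrier (mcomp (direct_sum K N) \<gamma>) =
     {x \<in> \<Pi>\<^sub>E k\<in>K. C (\<tau> k + \<gamma>). finite {k\<in>K. x k \<noteq> 0}}" for \<gamma>
    by (simp add: direct_sum_def carrier_sum_group compN group_gcomp)
  have grp: "group (mcomp (direct_sum K N) \<gamma>)" for \<gamma>
    by (simp add: direct_sum_def compN group_gcomp)
  have one: "\<one>\<^bsub>mcomp (direct_sum K N) \<gamma>\<^esub> = (\<lambda>k\<in>K. 0)" for \<gamma>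
    by (simp add: direct_sum_def compN cong: restrict_cong)
  have mult: "x \<otimes>\<^bsub>mcomp (direct_sum K N) \<gamma>\<^esub> y = (\<lambda>k\<in>K. x k + y k)" for \<gamma> x y
    by (simp add: direct_sum_def compN cong: restrict_cong)
  have incl: "summand_incl K N k \<gamma> a = (\<lambda>l\<in>K. if l = k then a else 0)" for k \<gamma> a
    unfolding summand_incl_def compN gcomp_simps ..
  have th: "\<theta> \<gamma> \<in> hom (mcomp (direct_sum K N) \<gamma>) (mcomp M \<gamma>)" for \<gamma>
    using hom by (auto simp: graded_homs_def)
  obtain x where x: "x \<in> carrier (mcomp (direct_sum K N) \<delta>)" and mx: "m = \<theta> \<delta> x"
    using surj[of \<delta>] m by blast
  define S where "S = {k\<in>K. x k \<noteq> 0}"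
  have S: "finite S" "S \<subseteq> K" using x by (auto simp: carr S_def)
  have xk: "x k \<in> C (\<tau> k + \<delta>)" if "k \<in> K" for k using x that by (auto simp: carr)
  have "\<exists>n. \<forall>a\<in>F \<gamma> n. \<theta> (\<gamma> + \<delta>) (summand_incl K N k (\<gamma> + \<delta>) (gmult A \<gamma> (\<tau> k + \<delta>) a (x k))) = \<one>\<^bsub>mcomp M (\<gamma> + \<delta>)\<^esub>"
    if k: "k \<in> K" for k
  proof -
    obtain J where "large_left_ideal A F J \<and> (\<forall>\<gamma>. kernel (mcomp (N k) \<gamma>) (mcomp M \<gamma>)
        (\<theta> \<gamma> \<circ> summand_incl K N k \<gamma>) = J (\<tau> k + \<gamma>))"
      using ker[OF k] by (rule exE)
    then have J: "large_left_ideal A F J" and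
      kerJ: "kernel (mcomp (N k) (\<gamma> + \<delta>)) (mcomp M (\<gamma> + \<delta>)) (\<theta> (\<gamma> + \<delta>) \<circ> summand_incl K N k (\<gamma> + \<delta>)) = J (\<tau> k + (\<gamma> + \<delta>))"
      by simp_all
    have deg: "\<gamma> + (\<tau> k + \<delta>) = \<tau> k + (\<gamma> + \<delta>)" by (simp add: algebra_simps)
    have "\<exists>l. F (\<gamma> + (\<tau> k + \<delta>)) l \<subseteq> J (\<gamma> + (\<tau> k + \<delta>))"
    proof (cases "\<forall>i. 0 \<le> (\<gamma> + (\<tau> k + \<delta>)) i")
      case True
      then show ?thesis using J unfolding large_left_ideal_def by blast
    next
      case False
      have "0 \<in> J (\<gamma> + (\<tau> k + \<delta>))"
        using J subgroup.one_closed[of "J (\<gamma> + (\<tau> k + \<delta>))" "gcomp A (\<gamma> + (\<tau> k + \<delta>))"]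
        by (simp add: large_left_ideal_def graded_left_ideal_def)
      moreover have "F (\<gamma> + (\<tau> k + \<delta>)) 0 \<subseteq> {0}"
        using F_carrier[of "\<gamma> + (\<tau> k + \<delta>)" 0] carrier_negative[OF False] by simp
      ultimately show ?thesis by blast
    qed
    then obtain l where l: "F (\<gamma> + (\<tau> k + \<delta>)) l \<subseteq> J (\<gamma> + (\<tau> k + \<delta>))" by blast
    obtain n where n: "\<forall>a\<in>F \<gamma> n. gmult A \<gamma> (\<tau> k + \<delta>) a (x k) \<in> F (\<gamma> + (\<tau> k + \<delta>)) l"
      using continuous_left[OF xk[OF k]] by blast
    have "\<theta> (\<gamma> + \<delta>) (summand_incl K N k (\<gamma> + \<delta>) (gmult A \<gamma> (\<tau> k + \<delta>) a (x k))) = \<one>\<^bsub>mcomp M (\<gamma> + \<delta>)\<^esub>"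
      if "a \<in> F \<gamma> n" for a
      using n l that kerJ unfolding deg kernel_def by auto
    then show ?thesis by blast
  qed
  then obtain n where n: "\<And>k a. k \<in> K \<Longrightarrow> a \<in> F \<gamma> (n k) \<Longrightarrow>
      \<theta> (\<gamma> + \<delta>) (summand_incl K N k (\<gamma> + \<delta>) (gmult A \<gamma> (\<tau> k + \<delta>) a (x k))) = \<one>\<^bsub>mcomp M (\<gamma> + \<delta>)\<^esub>"
    by metis
  \<comment> \<open>a scale for all summands at which the element does not vanish\<close>
  define n0 where "n0 = Max (insert 0 (n ` S))"
  show "\<exists>n. \<forall>a\<in>F \<gamma> n. mact M \<gamma> \<delta> a m = \<one>\<^bsub>mcomp M (\<gamma> + \<delta>)\<^esub>"
  proof (intro exI ballI)
    fix a assume a: "a \<in> F \<gamma> n0"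
    then have aC: "a \<in> C \<gamma>" using F_carrier by blast
    let ?y = "\<lambda>T. \<lambda>k\<in>K. if k \<in> T then gmult A \<gamma> (\<tau> k + \<delta>) a (x k) else 0"
    have deg: "\<gamma> + (\<tau> k + \<delta>) = \<tau> k + (\<gamma> + \<delta>)" for k by (simp add: algebra_simps)
    have gm: "gmult A \<gamma> (\<tau> k + \<delta>) a (x k) \<in> C (\<tau> k + (\<gamma> + \<delta>))" if "k \<in> K" for k
      using gmult_closed[OF aC xk[OF that]] by (simp add: deg)
    have yc: "?y T \<in> carrier (mcomp (direct_sum K N) (\<gamma> + \<delta>))" if "finite T" for T
      using gm that zero_closed by (auto simp: carr PiE_iff intro: finite_subset[OF _ that])
    have "\<theta> (\<gamma> + \<delta>) (?y T) = \<one>\<^bsub>mcomp M (\<gamma> + \<delta>)\<^esub>" if "finite T" "T \<subseteq> S" for T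
      using that
    proof (induction T rule: finite_induct)
      case empty
      have "\<theta> (\<gamma> + \<delta>) \<one>\<^bsub>mcomp (direct_sum K N) (\<gamma> + \<delta>)\<^esub> = \<one>\<^bsub>mcomp M (\<gamma> + \<delta>)\<^esub>"
        by (rule hom_one[OF th grp group_M])
      then show ?case unfolding one by (simp only: empty_iff if_False)
    next
      case (insert k T)
      have kK: "k \<in> K" using insert S by blast
      have "a \<in> F \<gamma> (n k)"
        using a F_mono[of "n k" n0 \<gamma>] S insert by (auto simp: n0_def)
      note nk = n[OF kK this]
      have sc: "summand_incl K N k (\<gamma> + \<delta>) (gmult A \<gamma> (\<tau> k + \<delta>) a (x k)) \<in> carrier (mcomp (direct_sum K N) (\<gamma> + \<delta>))"
        using gm[OF kK] zero_closed by (auto simp: incl carr PiE_iff intro: finite_subset[of _ "{k}"])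
      have eq: "?y (insert k T) = summand_incl K N k (\<gamma> + \<delta>) (gmult A \<gamma> (\<tau> k + \<delta>) a (x k))
             \<otimes>\<^bsub>mcomp (direct_sum K N) (\<gamma> + \<delta>)\<^esub> ?y T"
        using insert by (auto simp: mult incl fun_eq_iff)
      show ?case
        unfolding eq hom_mult[OF th sc yc[OF insert(1)]]
        unfolding nk insert(3)[OF subset_trans[OF subset_insertI insert(4)]]
        by (rule monoid.l_one[OF group.is_monoid[OF group_M] monoid.one_closed[OF group.is_monoid[OF group_M]]])
    qed
    from this[of S] have y1: "\<theta> (\<gamma> + \<delta>) (?y S) = \<one>\<^bsub>mcomp M (\<gamma> + \<delta>)\<^esub>" using S by simp
    have "mact M \<gamma> \<delta> a m = \<theta> (\<gamma> + \<delta>) (mact (direct_sum K N) \<gamma> \<delta> a x)"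
      using hom aC x unfolding mx graded_homs_def by simp
    also have "mact (direct_sum K N) \<gamma> \<delta> a x = ?y S"
      using aC by (auto simp: direct_sum_def actN S_def gmult_zero_right intro!: restrict_ext)
    finally show "mact M \<gamma> \<delta> a m = \<one>\<^bsub>mcomp M (\<gamma> + \<delta>)\<^esub>" unfolding y1 .
  qed
qed

text \<open>Every homogeneous element \<open>m\<close> is taken as a generator: \<open>m\<close> of
  degree \<open>- d\<close> is the image of the unit of the summand \<open>A(d)\<close>, and the
  kernel on that summand is its annihilator.\<close>

lemma discrete_imp_locally_finite:
  assumes disc: "discrete_action F M"
  shows "locally_finite A F M"
proof -
  define K where "K = {(d, m). m \<in> carrier (mcomp M (- d))}"
  define N where "N = (\<lambda>k :: 'i degree \<times> 'm. shift (fst k) (regular_module A))"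
  have compN: "mcomp (N k) \<gamma> = gcomp A (fst k + \<gamma>)" for k \<gamma>
    by (simp add: N_def shift_def regular_module_def)
  have actN: "mact (N k) \<gamma> \<delta> = gmult A \<gamma> (fst k + \<delta>)" for k \<gamma> \<delta>
    by (simp add: N_def shift_def regular_module_def)
  have carr: "carrier (mcomp (direct_sum K N) \<gamma>) =
     {x \<in> \<Pi>\<^sub>E k\<in>K. C (fst k + \<gamma>). finite {k\<in>K. x k \<noteq> 0}}" for \<gamma>
    by (simp add: direct_sum_def carrier_sum_group compN group_gcomp)
  define g where "g = (\<lambda>k :: 'i degree \<times> 'm. \<lambda>\<gamma> a. mact M (fst k + \<gamma>) (- fst k) a (snd k))"
  have deg: "fst k + \<gamma> + - fst k = \<gamma>" for k :: "'i degree \<times> 'm" and \<gamma> by simp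
  have gen: "snd k \<in> carrier (mcomp M (- fst k))" if "k \<in> K" for k using that by (auto simp: K_def)
  have g_hom: "g k \<gamma> \<in> hom (gcomp A (fst k + \<gamma>)) (mcomp M \<gamma>)" if "k \<in> K" for k \<gamma>
    using M.mact_hom_left[OF gen[OF that], of "fst k + \<gamma>"] unfolding deg g_def .
  have g_closed: "g k \<gamma> a \<in> carrier (mcomp M \<gamma>)" if "k \<in> K" "a \<in> C (fst k + \<gamma>)" for k \<gamma> a
    using hom_carrier[OF g_hom[OF that(1)]] that(2) by blast
  have g_zero: "g k \<gamma> 0 = \<one>\<^bsub>mcomp M \<gamma>\<^esub>" if "k \<in> K" for k \<gamma>
    using hom_one[OF g_hom[OF that] group_gcomp group_M] by simp
  define \<theta> where "\<theta> = (\<lambda>\<gamma>. \<lambda>x \<in> carrier (mcomp (direct_sum K N) \<gamma>). gfinprod (mcomp M \<gamma>) (\<lambda>k. g k \<gamma> (x k)) K)"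
  have th_hom: "\<theta> \<gamma> \<in> hom (mcomp (direct_sum K N) \<gamma>) (mcomp M \<gamma>)" for \<gamma>
  proof -
    have "(\<lambda>x. gfinprod (mcomp M \<gamma>) (\<lambda>k. g k \<gamma> (x k)) K) \<in> hom (sum_group K (\<lambda>k. mcomp (N k) \<gamma>)) (mcomp M \<gamma>)"
      by (rule comm_group.hom_group_sum[OF comm_group_M]) (simp_all add: compN g_hom group_gcomp)
    moreover have "group (mcomp (direct_sum K N) \<gamma>)"
      by (simp add: direct_sum_def compN group_gcomp)
    ultimately show ?thesis
      unfolding \<theta>_def using hom_restrict_carrier by (simp add: direct_sum_def)
  qed
  have fin: "finite {k \<in> K. g k \<gamma> (x k) \<noteq> \<one>\<^bsub>mcomp M \<gamma>\<^esub>}" if "x \<in> carrier (mcomp (direct_sum K N) \<gamma>)" for x \<gamma>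
    using that by (auto simp: carr g_zero elim!: rev_finite_subset)
  have act_closed: "mact (direct_sum K N) \<gamma> \<delta> a x \<in> carrier (mcomp (direct_sum K N) (\<gamma> + \<delta>))"
    if a: "a \<in> C \<gamma>" and x: "x \<in> carrier (mcomp (direct_sum K N) \<delta>)" for \<gamma> \<delta> a x
  proof -
    have "gmult A \<gamma> (fst k + \<delta>) a (x k) \<in> C (fst k + (\<gamma> + \<delta>))" if "k \<in> K" for k
      using gmult_closed[OF a, of "x k" "fst k + \<delta>"] x that by (auto simp: carr algebra_simps)
    moreover have "finite {k \<in> K. gmult A \<gamma> (fst k + \<delta>) a (x k) \<noteq> 0}"
      using x a by (auto simp: carr gmult_zero_right elim!: rev_finite_subset)
    ultimately show ?thesis
      unfolding carr by (auto simp: direct_sum_def actN PiE_iff elim!: rev_finite_subset)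
  qed
  have th_act: "\<theta> (\<gamma> + \<delta>) (mact (direct_sum K N) \<gamma> \<delta> a x) = mact M \<gamma> \<delta> a (\<theta> \<delta> x)"
    if a: "a \<in> C \<gamma>" and x: "x \<in> carrier (mcomp (direct_sum K N) \<delta>)" for \<gamma> \<delta> a x
  proof -
    have xk: "x k \<in> C (fst k + \<delta>)" if "k \<in> K" for k using x that by (auto simp: carr)
    have "mact M \<gamma> \<delta> a (\<theta> \<delta> x) = gfinprod (mcomp M (\<gamma> + \<delta>)) (\<lambda>k. mact M \<gamma> \<delta> a (g k \<delta> (x k))) K"
      unfolding \<theta>_def using x
      by simp (rule comm_group.gfinprod_hom[OF comm_group_M comm_group_M M.mact_hom[OF a]];
          use xk g_closed fin in auto)
    also have "\<dots> = gfinprod (mcomp M (\<gamma> + \<delta>)) (\<lambda>k. g k (\<gamma> + \<delta>) (mact (direct_sum K N) \<gamma> \<delta> a x k)) K"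
    proof (rule comm_monoid.gfinprod_cong)
      show "comm_monoid (mcomp M (\<gamma> + \<delta>))" using comm_group_M by (simp add: comm_group_def)
      show "(\<lambda>k. mact M \<gamma> \<delta> a (g k \<delta> (x k))) \<in> K \<rightarrow> carrier (mcomp M (\<gamma> + \<delta>))"
        using xk g_closed mact_closed[OF a] by auto
      show "k \<in> K =simp=> mact M \<gamma> \<delta> a (g k \<delta> (x k)) = g k (\<gamma> + \<delta>) (mact (direct_sum K N) \<gamma> \<delta> a x k)" for k
      proof (unfold simp_implies_def)
        assume k: "k \<in> K"
        have "mact M \<gamma> \<delta> a (g k \<delta> (x k)) = g k (\<gamma> + \<delta>) (gmult A \<gamma> (fst k + \<delta>) a (x k))"
          using M.mact_mult[OF a xk[OF k] gen[OF k]] by (simp add: g_def algebra_simps)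
        then show "mact M \<gamma> \<delta> a (g k \<delta> (x k)) = g k (\<gamma> + \<delta>) (mact (direct_sum K N) \<gamma> \<delta> a x k)"
          using k by (simp add: direct_sum_def actN)
      qed
    qed simp
    also have "\<dots> = \<theta> (\<gamma> + \<delta>) (mact (direct_sum K N) \<gamma> \<delta> a x)"
      using act_closed[OF a x] by (simp add: \<theta>_def)
    finally show ?thesis by simp
  qed
  have incl: "\<theta> \<gamma> (summand_incl K N k \<gamma> a) = g k \<gamma> a" "summand_incl K N k \<gamma> a \<in> carrier (mcomp (direct_sum K N) \<gamma>)"
    if k: "k \<in> K" and a: "a \<in> C (fst k + \<gamma>)" for k \<gamma> a
  proof -
    have s: "summand_incl K N k \<gamma> a = (\<lambda>l\<in>K. if l = k then a else 0)"
      unfolding summand_incl_def compN gcomp_simps ..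
    show sc: "summand_incl K N k \<gamma> a \<in> carrier (mcomp (direct_sum K N) \<gamma>)"
      using k a zero_closed by (auto simp: s carr PiE_iff intro: finite_subset[of _ "{k}"])
    have cm: "comm_monoid (mcomp M \<gamma>)" using comm_group_M by (simp add: comm_group_def)
    have "gfinprod (mcomp M \<gamma>) (\<lambda>l. g l \<gamma> (summand_incl K N k \<gamma> a l)) {k}
        = gfinprod (mcomp M \<gamma>) (\<lambda>l. g l \<gamma> (summand_incl K N k \<gamma> a l)) K"
      by (rule comm_monoid.gfinprod_mono_neutral_cong_left[OF cm])
        (use k a g_zero g_closed in \<open>auto simp: s zero_closed\<close>)
    moreover have "gfinprod (mcomp M \<gamma>) (\<lambda>l. g l \<gamma> (summand_incl K N k \<gamma> a l)) {k} = g k \<gamma> a"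
    proof -
      have "(\<lambda>l. g l \<gamma> (summand_incl K N k \<gamma> a l)) \<in> {k} \<rightarrow> carrier (mcomp M \<gamma>)"
        using k a by (simp add: s g_closed)
      then have "gfinprod (mcomp M \<gamma>) (\<lambda>l. g l \<gamma> (summand_incl K N k \<gamma> a l)) {k}
          = finprod (mcomp M \<gamma>) (\<lambda>l. g l \<gamma> (summand_incl K N k \<gamma> a l)) {k}"
        by (intro comm_monoid.gfinprod_eq_finprod[OF cm]) simp_all
      also have "\<dots> = g k \<gamma> a"
        using k g_closed[OF k a] by (simp add: comm_monoid.finprod_insert[OF cm] comm_monoid.finprod_empty[OF cm] s
            monoid.r_one[OF comm_monoid.axioms(1)[OF cm]])
      finally show ?thesis .
    qed
    ultimately show "\<theta> \<gamma> (summand_incl K N k \<gamma> a) = g k \<gamma> a" using sc by (simp add: \<theta>_def)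
  qed
  have "\<theta> \<in> graded_homs A (direct_sum K N) M"
    unfolding graded_homs_def using th_hom th_act by (simp add: \<theta>_def)
  moreover have "\<theta> \<gamma> ` carrier (mcomp (direct_sum K N) \<gamma>) = carrier (mcomp M \<gamma>)" for \<gamma>
  proof
    show "\<theta> \<gamma> ` carrier (mcomp (direct_sum K N) \<gamma>) \<subseteq> carrier (mcomp M \<gamma>)"
      using th_hom[of \<gamma>] by (auto simp: hom_def)
    show "carrier (mcomp M \<gamma>) \<subseteq> \<theta> \<gamma> ` carrier (mcomp (direct_sum K N) \<gamma>)"
    proof
      fix m assume m: "m \<in> carrier (mcomp M \<gamma>)"
      then have k: "(- \<gamma>, m) \<in> K" by (simp add: K_def)
      have o: "gone A \<in> C (fst (- \<gamma>, m) + \<gamma>)" using one_closed by simp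
      have "m = g (- \<gamma>, m) \<gamma> (gone A)" using M.mact_one[OF m] by (simp add: g_def)
      then show "m \<in> \<theta> \<gamma> ` carrier (mcomp (direct_sum K N) \<gamma>)"
        using incl[OF k o] by (metis imageI)
    qed
  qed
  moreover have "\<exists>J. large_left_ideal A F J \<and>
     (\<forall>\<gamma>. kernel (mcomp (N k) \<gamma>) (mcomp M \<gamma>) (\<theta> \<gamma> \<circ> summand_incl K N k \<gamma>) = J (fst k + \<gamma>))" if k: "k \<in> K" for k
  proof (intro exI conjI allI)
    show "large_left_ideal A F (\<lambda>\<gamma>. {a \<in> C \<gamma>. mact M \<gamma> (- fst k) a (snd k) = \<one>\<^bsub>mcomp M (\<gamma> + - fst k)\<^esub>})"
      by (rule annihilator_large_left_ideal[OF disc gen[OF k]])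
    fix \<gamma>
    show "kernel (mcomp (N k) \<gamma>) (mcomp M \<gamma>) (\<theta> \<gamma> \<circ> summand_incl K N k \<gamma>)
      = {a \<in> C (fst k + \<gamma>). mact M (fst k + \<gamma>) (- fst k) a (snd k) = \<one>\<^bsub>mcomp M (fst k + \<gamma> + - fst k)\<^esub>}"
      unfolding kernel_def compN deg using incl(1)[OF k] by (auto simp: g_def)
  qed
  ultimately show ?thesis
    unfolding locally_finite_def Let_def N_def by blast
qed

lemma locally_finite_iff_discrete: "locally_finite A F M \<longleftrightarrow> discrete_action F M"
  using locally_finite_imp_discrete discrete_imp_locally_finite by blast

end

end

section \<open>Equivalences of categories of locally finite modules\<close>

lemma equivalent_categories_sym:
  "equivalent_categories C D \<Longrightarrow> equivalent_categories D C"
  unfolding equivalent_categories_def by blast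

lemma graded_left_module_mact_closed:
  "graded_left_module A M \<Longrightarrow> a \<in> carrier (gcomp A \<gamma>) \<Longrightarrow> x \<in> carrier (mcomp M \<delta>)
    \<Longrightarrow> mact M \<gamma> \<delta> a x \<in> carrier (mcomp M (\<gamma> + \<delta>))"
  using graded_left_module.mact_hom[of A M a \<gamma> \<delta>] by (auto simp: hom_def)

lemma graded_homs_carrier:
  "h \<in> graded_homs A M N \<Longrightarrow> x \<in> carrier (mcomp M \<gamma>) \<Longrightarrow> h \<gamma> x \<in> carrier (mcomp N \<gamma>)"
  by (auto simp: graded_homs_def hom_def)

lemma graded_homs_mact:
  "h \<in> graded_homs A M N \<Longrightarrow> a \<in> carrier (gcomp A \<gamma>) \<Longrightarrow> x \<in> carrier (mcomp M \<delta>)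
    \<Longrightarrow> h (\<gamma> + \<delta>) (mact M \<gamma> \<delta> a x) = mact N \<gamma> \<delta> a (h \<delta> x)"
  by (auto simp: graded_homs_def)

lemma identity_graded_hom:
  assumes "graded_left_module A M" "mcomp M' = mcomp M"
    and "\<And>\<gamma> \<delta> a x. a \<in> carrier (gcomp A \<gamma>) \<Longrightarrow> x \<in> carrier (mcomp M \<delta>) \<Longrightarrow> mact M' \<gamma> \<delta> a x = mact M \<gamma> \<delta> a x"
  shows "(\<lambda>\<gamma>. \<lambda>x\<in>carrier (mcomp M \<gamma>). x) \<in> graded_homs A M M'"
proof -
  have "monoid (mcomp M \<gamma>)" for \<gamma>
    using graded_left_module.comm_group_mcomp[OF assms(1)] by (simp add: comm_group_def group.is_monoid)
  then have "(\<lambda>x\<in>carrier (mcomp M \<gamma>). x) \<in> hom (mcomp M \<gamma>) (mcomp M \<gamma>)" for \<gamma>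
    by (auto simp: hom_def monoid.m_closed)
  then show ?thesis
    using assms graded_left_module_mact_closed[OF assms(1)] by (simp add: graded_homs_def)
qed

lemma compose_graded_homs:
  assumes "graded_left_module A L" "f \<in> graded_homs A L M" "g \<in> graded_homs A M N"
  shows "(\<lambda>\<gamma>. compose (carrier (mcomp L \<gamma>)) (g \<gamma>) (f \<gamma>)) \<in> graded_homs A L N"
proof -
  have mon: "monoid (mcomp L \<gamma>)" for \<gamma>
    using graded_left_module.comm_group_mcomp[OF assms(1)] by (simp add: comm_group_def group.is_monoid)
  have "compose (carrier (mcomp L \<gamma>)) (g \<gamma>) (f \<gamma>) \<in> hom (mcomp L \<gamma>) (mcomp N \<gamma>)" for \<gamma>
    using assms(2,3) mon[of \<gamma>]
    by (auto simp: graded_homs_def hom_def compose_def monoid.m_closed Pi_iff)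
  then show ?thesis
    using assms graded_left_module_mact_closed[OF assms(1)]
    by (auto simp: graded_homs_def compose_def graded_homs_carrier[OF assms(2)])
qed

lemma category_Mod_lf: "category (Mod_lf T A F)"
proof
  fix M assume "M \<in> Obj (Mod_lf T A F)"
  then show "Ident (Mod_lf T A F) M \<in> Hom (Mod_lf T A F) M M"
    using identity_graded_hom[of A M M] by (simp add: Mod_lf_def)
next
  fix L M N f g
  assume "L \<in> Obj (Mod_lf T A F)" "f \<in> Hom (Mod_lf T A F) L M" "g \<in> Hom (Mod_lf T A F) M N"
  then show "Comp (Mod_lf T A F) L M N g f \<in> Hom (Mod_lf T A F) L N"
    using compose_graded_homs[of A L f M g N] by (simp add: Mod_lf_def)
next
  fix M N f assume f: "f \<in> Hom (Mod_lf T A F) M N"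
  then have "f \<in> graded_homs A M N" by (simp add: Mod_lf_def)
  then have ext: "f \<gamma> \<in> extensional (carrier (mcomp M \<gamma>))" and
    cl: "x \<in> carrier (mcomp M \<gamma>) \<Longrightarrow> f \<gamma> x \<in> carrier (mcomp N \<gamma>)" for \<gamma> x
    by (auto simp: graded_homs_def hom_def)
  show "Comp (Mod_lf T A F) M M N f (Ident (Mod_lf T A F) M) = f"
    using extensional_arb[OF ext] by (auto simp: Mod_lf_def compose_def fun_eq_iff restrict_def)
  show "Comp (Mod_lf T A F) M N N (Ident (Mod_lf T A F) N) f = f"
    using extensional_arb[OF ext] cl by (auto simp: Mod_lf_def compose_def fun_eq_iff restrict_def)
next
  fix K L M N f g h
  assume "f \<in> Hom (Mod_lf T A F) K L" "g \<in> Hom (Mod_lf T A F) L M" "h \<in> Hom (Mod_lf T A F) M N"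
  then show "Comp (Mod_lf T A F) K M N h (Comp (Mod_lf T A F) K L M g f) =
     Comp (Mod_lf T A F) K L N (Comp (Mod_lf T A F) L M N h g) f"
    using graded_homs_carrier[of f A K L]
    by (auto simp: Mod_lf_def compose_def fun_eq_iff restrict_def)
qed

text \<open>The functors keep the underlying graded groups and the maps, so that they are the
  identity on morphisms, and the identity maps are the natural isomorphisms.\<close>

lemma equivalent_by_change_of_action:
  fixes Fo :: "('i, 'a, 'm) gmodule \<Rightarrow> ('i, 'b, 'm) gmodule" and Go :: "('i, 'b, 'm) gmodule \<Rightarrow> ('i, 'a, 'm) gmodule"
  assumes Fo_obj: "\<And>M. M \<in> Obj (Mod_lf TYPE('m) A F) \<Longrightarrow> Fo M \<in> Obj (Mod_lf TYPE('m) B G)"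
    and Go_obj: "\<And>N. N \<in> Obj (Mod_lf TYPE('m) B G) \<Longrightarrow> Go N \<in> Obj (Mod_lf TYPE('m) A F)"
    and Fo_comp: "\<And>M. mcomp (Fo M) = mcomp M" and Go_comp: "\<And>N. mcomp (Go N) = mcomp N"
    and Fo_hom: "\<And>M N h. M \<in> Obj (Mod_lf TYPE('m) A F) \<Longrightarrow> N \<in> Obj (Mod_lf TYPE('m) A F) \<Longrightarrow>
          h \<in> graded_homs A M N \<Longrightarrow> h \<in> graded_homs B (Fo M) (Fo N)"
    and Go_hom: "\<And>M N h. M \<in> Obj (Mod_lf TYPE('m) B G) \<Longrightarrow> N \<in> Obj (Mod_lf TYPE('m) B G) \<Longrightarrow>
          h \<in> graded_homs B M N \<Longrightarrow> h \<in> graded_homs A (Go M) (Go N)"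
    and Go_Fo: "\<And>M \<gamma> \<delta> a x. M \<in> Obj (Mod_lf TYPE('m) A F) \<Longrightarrow> a \<in> carrier (gcomp A \<gamma>) \<Longrightarrow>
          x \<in> carrier (mcomp M \<delta>) \<Longrightarrow> mact (Go (Fo M)) \<gamma> \<delta> a x = mact M \<gamma> \<delta> a x"
    and Fo_Go: "\<And>N \<gamma> \<delta> b x. N \<in> Obj (Mod_lf TYPE('m) B G) \<Longrightarrow> b \<in> carrier (gcomp B \<gamma>) \<Longrightarrow>
          x \<in> carrier (mcomp N \<delta>) \<Longrightarrow> mact (Fo (Go N)) \<gamma> \<delta> b x = mact N \<gamma> \<delta> b x"
  shows "equivalent_categories (Mod_lf TYPE('m) A F) (Mod_lf TYPE('m) B G)"
proof -
  let ?C = "Mod_lf TYPE('m) A F" and ?D = "Mod_lf TYPE('m) B G"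
  have func1: "cat_functor ?C ?D Fo (\<lambda>M N h. h)"
    using Fo_obj Fo_hom by (intro cat_functor.intro cat_functor_axioms.intro category_Mod_lf)
      (simp_all add: Mod_lf_def Fo_comp)
  have func2: "cat_functor ?D ?C Go (\<lambda>M N h. h)"
    using Go_obj Go_hom by (intro cat_functor.intro cat_functor_axioms.intro category_Mod_lf)
      (simp_all add: Mod_lf_def Go_comp)
  have iso: "nat_iso_to_identity (Mod_lf TYPE('m) R H) E (\<lambda>M N h. h) (Ident (Mod_lf TYPE('m) R H))"
    if obj: "\<And>M. M \<in> Obj (Mod_lf TYPE('m) R H) \<Longrightarrow> E M \<in> Obj (Mod_lf TYPE('m) R H)"
      and comp: "\<And>M. mcomp (E M) = mcomp M"
      and act: "\<And>M \<gamma> \<delta> a x. M \<in> Obj (Mod_lf TYPE('m) R H) \<Longrightarrow> a \<in> carrier (gcomp R \<gamma>) \<Longrightarrow>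
          x \<in> carrier (mcomp M \<delta>) \<Longrightarrow> mact (E M) \<gamma> \<delta> a x = mact M \<gamma> \<delta> a x"
    for R :: "('i, 'x) graded_ring" and H E
    unfolding nat_iso_to_identity_def is_iso_def
  proof (intro conjI ballI bexI[of _ "Ident (Mod_lf TYPE('m) R H) _"])
    fix M assume M: "M \<in> Obj (Mod_lf TYPE('m) R H)"
    then have gl: "graded_left_module R M" "graded_left_module R (E M)"
      using obj[OF M] by (simp_all add: Mod_lf_def)
    show "Ident (Mod_lf TYPE('m) R H) M \<in> Hom (Mod_lf TYPE('m) R H) (E M) M"
      using identity_graded_hom[OF gl(2), of M] act[OF M] comp by (simp add: Mod_lf_def)
    show "Ident (Mod_lf TYPE('m) R H) M \<in> Hom (Mod_lf TYPE('m) R H) M (E M)"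
      using identity_graded_hom[OF gl(1), of "E M"] act[OF M] comp by (simp add: Mod_lf_def)
    show "Comp (Mod_lf TYPE('m) R H) (E M) M (E M) (Ident (Mod_lf TYPE('m) R H) M) (Ident (Mod_lf TYPE('m) R H) M)
        = Ident (Mod_lf TYPE('m) R H) (E M)"
      by (auto simp: Mod_lf_def compose_def comp fun_eq_iff)
    show "Comp (Mod_lf TYPE('m) R H) M (E M) M (Ident (Mod_lf TYPE('m) R H) M) (Ident (Mod_lf TYPE('m) R H) M)
        = Ident (Mod_lf TYPE('m) R H) M"
      by (auto simp: Mod_lf_def compose_def comp fun_eq_iff)
  next
    fix M N h assume "h \<in> Hom (Mod_lf TYPE('m) R H) M N"
    then show "Comp (Mod_lf TYPE('m) R H) (E M) M N h (Ident (Mod_lf TYPE('m) R H) M)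
       = Comp (Mod_lf TYPE('m) R H) (E M) (E N) N (Ident (Mod_lf TYPE('m) R H) N) h"
      using graded_homs_carrier[of h R M N] by (auto simp: Mod_lf_def compose_def comp fun_eq_iff)
  qed
  have "nat_iso_to_identity ?C (Go \<circ> Fo) (\<lambda>M N h. h) (Ident ?C)"
    using Fo_obj Go_obj Go_Fo by (intro iso) (simp_all add: Fo_comp Go_comp)
  moreover have "nat_iso_to_identity ?D (Fo \<circ> Go) (\<lambda>M N h. h) (Ident ?D)"
    using Fo_obj Go_obj Fo_Go by (intro iso) (simp_all add: Fo_comp Go_comp)
  ultimately show ?thesis
    unfolding equivalent_categories_def
    using func1 func2
    by (intro exI[of _ Fo] exI[of _ "\<lambda>M N h. h"] exI[of _ Go] exI[of _ "Ident ?C"] exI[of _ "Ident ?D"])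
      (simp add: comp_def)
qed

subsection \<open>Zhang twists\<close>

locale zhang_twist = filtered_graded_ring A F
  for A :: "('i, 'a::ab_group_add) graded_ring" and F +
  fixes \<sigma> :: "'i degree \<Rightarrow> 'i degree \<Rightarrow> 'a \<Rightarrow> 'a"
  assumes twist_closed: "a \<in> C \<gamma> \<Longrightarrow> \<sigma> \<tau> \<gamma> a \<in> C \<gamma>"
    and twist_F: "a \<in> F \<gamma> n \<Longrightarrow> \<sigma> \<tau> \<gamma> a \<in> F \<gamma> n"
    and twist_add: "\<sigma> \<tau> \<gamma> (a + b) = \<sigma> \<tau> \<gamma> a + \<sigma> \<tau> \<gamma> b"
    and twist_comp: "\<sigma> \<tau> \<gamma> (\<sigma> \<tau>' \<gamma> a) = \<sigma> (\<tau> + \<tau>') \<gamma> a"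
    and twist_zero: "\<sigma> 0 \<gamma> a = a"
    and twist_one: "\<sigma> \<tau> 0 (gone A) = gone A"
    and twist_mult: "a \<in> C \<gamma> \<Longrightarrow> b \<in> C \<delta> \<Longrightarrow>
      \<sigma> \<tau> (\<gamma> + \<delta>) (gmult A \<gamma> \<delta> a b) = gmult A \<gamma> \<delta> (\<sigma> \<tau> \<gamma> a) (\<sigma> \<tau> \<delta> b)"

definition twist_module ::
  "('i degree \<Rightarrow> 'i degree \<Rightarrow> 'a \<Rightarrow> 'a) \<Rightarrow> ('i, 'a, 'm) gmodule \<Rightarrow> ('i, 'a, 'm) gmodule" where
  "twist_module \<sigma> M = M\<lparr>mact := (\<lambda>\<gamma> \<delta> a. mact M \<gamma> \<delta> (\<sigma> \<delta> \<gamma> a))\<rparr>"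

context zhang_twist
begin

lemma filtered_left_zhang_twist: "filtered_graded_ring (left_zhang_twist \<sigma> A) F"
proof
  fix y \<gamma> \<delta> n assume "y \<in> carrier (gcomp (left_zhang_twist \<sigma> A) \<delta>)"
  then obtain k where "\<forall>x\<in>F \<gamma> k. gmult A \<gamma> \<delta> x y \<in> F (\<gamma> + \<delta>) n"
    using continuous_left[of y \<delta> \<gamma> n] by (auto simp: left_zhang_twist_def)
  then show "\<exists>k. \<forall>x\<in>F \<gamma> k. gmult (left_zhang_twist \<sigma> A) \<gamma> \<delta> x y \<in> F (\<gamma> + \<delta>) n"
    using twist_F by (intro exI[of _ k]) (auto simp: left_zhang_twist_def)
next
  fix x \<gamma> \<delta> n assume "x \<in> carrier (gcomp (left_zhang_twist \<sigma> A) \<gamma>)"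
  then show "\<exists>k. \<forall>y\<in>F \<delta> k. gmult (left_zhang_twist \<sigma> A) \<gamma> \<delta> x y \<in> F (\<gamma> + \<delta>) n"
    using continuous_right[of "\<sigma> \<delta> \<gamma> x" \<gamma> \<delta> n] twist_closed by (simp add: left_zhang_twist_def)
qed (use gcomp_eq zero_closed add_closed uminus_closed carrier_negative one_closed gmult_closed
      gmult_add_left gmult_add_right F_carrier F_zero F_add F_uminus F_mono twist_closed twist_add
    in \<open>simp_all add: left_zhang_twist_def\<close>)

text \<open>Untwisting is itself a twist, by the inverse automorphisms; thus one direction of each
  statement on twisted modules gives the other.\<close>

lemma zhang_twist_inverse: "zhang_twist (left_zhang_twist \<sigma> A) F (\<lambda>\<tau>. \<sigma> (- \<tau>))"
proof -
  have comm: "\<sigma> \<tau> \<gamma> (\<sigma> \<tau>' \<gamma> a) = \<sigma> \<tau>' \<gamma> (\<sigma> \<tau> \<gamma> a)" for \<tau> \<tau>' \<gamma> a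
    by (simp add: twist_comp add.commute)
  show ?thesis
    by (intro zhang_twist.intro filtered_left_zhang_twist zhang_twist_axioms.intro)
      (use twist_closed twist_F twist_add twist_comp twist_zero twist_one twist_mult comm
       in \<open>simp_all add: left_zhang_twist_def\<close>)
qed

lemma twist_twist: "left_zhang_twist (\<lambda>\<tau>. \<sigma> (- \<tau>)) (left_zhang_twist \<sigma> A) = A"
  by (simp add: left_zhang_twist_def twist_comp twist_zero)

text \<open>For \<open>b\<close> of degree \<open>\<delta>\<close> and \<open>x\<close> of degree
  \<open>\<epsilon>\<close>, both ways to apply \<open>a\<close> and \<open>b\<close> to
  \<open>x\<close> amount to the action of \<open>\<sigma>\<^bsub>\<delta>+\<epsilon>\<^esub>(a)
  \<sigma>\<^sub>\<epsilon>(b)\<close>, because \<open>\<sigma>\<^sub>\<epsilon>\<close> is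
  multiplicative.\<close>

lemma graded_left_module_twist:
  assumes "graded_left_module A M"
  shows "graded_left_module (left_zhang_twist \<sigma> A) (twist_module \<sigma> M)"
proof -
  interpret M: graded_left_module A M by fact
  show ?thesis
  proof (rule graded_left_module.intro)
    fix x \<gamma> \<delta> assume "x \<in> carrier (mcomp (twist_module \<sigma> M) \<delta>)"
    then have "(\<lambda>a. mact M \<gamma> \<delta> a x) \<in> hom (gcomp A \<gamma>) (mcomp M (\<gamma> + \<delta>))"
      by (intro M.mact_hom_left) (simp add: twist_module_def)
    then show "(\<lambda>a. mact (twist_module \<sigma> M) \<gamma> \<delta> a x)
        \<in> hom (gcomp (left_zhang_twist \<sigma> A) \<gamma>) (mcomp (twist_module \<sigma> M) (\<gamma> + \<delta>))"
      using twist_closed[of _ \<gamma> \<delta>] by (auto simp: hom_def twist_module_def left_zhang_twist_def twist_add Pi_iff)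
  next
    fix a b x \<gamma> \<delta> \<epsilon>
    assume "a \<in> carrier (gcomp (left_zhang_twist \<sigma> A) \<gamma>)" "b \<in> carrier (gcomp (left_zhang_twist \<sigma> A) \<delta>)"
      "x \<in> carrier (mcomp (twist_module \<sigma> M) \<epsilon>)"
    then have *: "a \<in> C \<gamma>" "b \<in> C \<delta>" "x \<in> carrier (mcomp M \<epsilon>)"
      by (simp_all add: twist_module_def left_zhang_twist_def)
    then show "mact (twist_module \<sigma> M) (\<gamma> + \<delta>) \<epsilon> (gmult (left_zhang_twist \<sigma> A) \<gamma> \<delta> a b) x
       = mact (twist_module \<sigma> M) \<gamma> (\<delta> + \<epsilon>) a (mact (twist_module \<sigma> M) \<delta> \<epsilon> b x)"
      using M.mact_mult[of "\<sigma> \<epsilon> \<gamma> (\<sigma> \<delta> \<gamma> a)" \<gamma> "\<sigma> \<epsilon> \<delta> b" \<delta> x \<epsilon>]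
      by (simp add: twist_module_def left_zhang_twist_def twist_mult twist_closed)
        (simp add: twist_comp add.commute)
  qed (use M.comm_group_mcomp M.mact_hom M.mact_one twist_closed twist_one
        in \<open>simp_all add: twist_module_def left_zhang_twist_def\<close>)
qed

lemma discrete_action_twist: "discrete_action F M \<Longrightarrow> discrete_action F (twist_module \<sigma> M)"
  unfolding discrete_action_def twist_module_def using twist_F by simp meson

lemma twist_module_Obj:
  assumes "M \<in> Obj (Mod_lf T A F)"
  shows "twist_module \<sigma> M \<in> Obj (Mod_lf T (left_zhang_twist \<sigma> A) F)"
proof -
  interpret B: filtered_graded_ring "left_zhang_twist \<sigma> A" F by (rule filtered_left_zhang_twist)
  have "graded_left_module A M" "discrete_action F M"
    using assms locally_finite_iff_discrete by (auto simp: Mod_lf_def)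
  then show ?thesis
    using graded_left_module_twist discrete_action_twist B.locally_finite_iff_discrete
    by (auto simp: Mod_lf_def)
qed

lemma graded_homs_twist:
  "h \<in> graded_homs A M N \<Longrightarrow> h \<in> graded_homs (left_zhang_twist \<sigma> A) (twist_module \<sigma> M) (twist_module \<sigma> N)"
  using twist_closed by (simp add: graded_homs_def twist_module_def left_zhang_twist_def)

theorem Mod_lf_zhang_twist:
  "equivalent_categories (Mod_lf TYPE('m) A F) (Mod_lf TYPE('m) (left_zhang_twist \<sigma> A) F)"
proof -
  interpret B: zhang_twist "left_zhang_twist \<sigma> A" F "\<lambda>\<tau>. \<sigma> (- \<tau>)" by (rule zhang_twist_inverse)
  show ?thesis
    by (rule equivalent_by_change_of_action[where Fo = "twist_module \<sigma>" and Go = "twist_module (\<lambda>\<tau>. \<sigma> (- \<tau>))"])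
      (use twist_module_Obj B.twist_module_Obj[unfolded twist_twist] graded_homs_twist
          B.graded_homs_twist[unfolded twist_twist]
        in \<open>simp_all add: twist_module_def twist_comp twist_zero\<close>)
qed

end

subsection \<open>Dense filtered subrings\<close>

locale dense_filtered_hom = A: filtered_graded_ring A F + B: filtered_graded_ring B G
  for A :: "('i, 'a::ab_group_add) graded_ring" and F and B :: "('i, 'b::ab_group_add) graded_ring" and G +
  fixes \<phi> :: "'i degree \<Rightarrow> 'a \<Rightarrow> 'b"
  assumes hom_closed: "a \<in> A.C \<gamma> \<Longrightarrow> \<phi> \<gamma> a \<in> B.C \<gamma>"
    and hom_add: "a \<in> A.C \<gamma> \<Longrightarrow> a' \<in> A.C \<gamma> \<Longrightarrow> \<phi> \<gamma> (a + a') = \<phi> \<gamma> a + \<phi> \<gamma> a'"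
    and hom_mult: "a \<in> A.C \<gamma> \<Longrightarrow> a' \<in> A.C \<delta> \<Longrightarrow> \<phi> (\<gamma> + \<delta>) (gmult A \<gamma> \<delta> a a') = gmult B \<gamma> \<delta> (\<phi> \<gamma> a) (\<phi> \<delta> a')"
    and hom_one: "\<phi> 0 (gone A) = gone B"
    and hom_F: "a \<in> A.C \<gamma> \<Longrightarrow> \<phi> \<gamma> a \<in> G \<gamma> n \<longleftrightarrow> a \<in> F \<gamma> n"
    and dense: "b \<in> B.C \<gamma> \<Longrightarrow> \<exists>a\<in>A.C \<gamma>. b - \<phi> \<gamma> a \<in> G \<gamma> n"
begin

definition restrict_scalars :: "('i, 'b, 'm) gmodule \<Rightarrow> ('i, 'a, 'm) gmodule" where
  "restrict_scalars N = \<lparr>mcomp = mcomp N, mact = (\<lambda>\<gamma> \<delta> a. mact N \<gamma> \<delta> (\<phi> \<gamma> a))\<rparr>"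

text \<open>\<open>b\<close> acts on \<open>x\<close> as some \<open>a\<close> that is close to
  \<open>b\<close> on the scale at which elements of \<open>A\<close> kill \<open>x\<close>.\<close>

definition extend_scalars :: "('i, 'a, 'm) gmodule \<Rightarrow> ('i, 'b, 'm) gmodule" where
  "extend_scalars M = \<lparr>mcomp = mcomp M, mact = (\<lambda>\<gamma> \<delta> b x. mact M \<gamma> \<delta>
     (SOME a. a \<in> A.C \<gamma> \<and> (\<exists>n. b - \<phi> \<gamma> a \<in> G \<gamma> n \<and>
        (\<forall>a'\<in>F \<gamma> n. mact M \<gamma> \<delta> a' x = \<one>\<^bsub>mcomp M (\<gamma> + \<delta>)\<^esub>))) x)\<rparr>"

lemma hom_zero: "\<phi> \<gamma> 0 = 0"
  using hom_add[of 0 \<gamma> 0] A.zero_closed by simp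

lemma hom_diff: "a \<in> A.C \<gamma> \<Longrightarrow> b \<in> A.C \<gamma> \<Longrightarrow> \<phi> \<gamma> (a - b) = \<phi> \<gamma> a - \<phi> \<gamma> b"
  using hom_add[of "a - b" \<gamma> b] A.diff_closed[of a \<gamma> b] by (simp add: algebra_simps)

text \<open>Two approximations of \<open>b\<close> differ by an element of the coarser of the two
  filtration steps involved, and that step kills \<open>x\<close>.\<close>

lemma extend_scalars_mact:
  assumes M: "graded_left_module A M"
    and b: "b \<in> B.C \<gamma>" and x: "x \<in> carrier (mcomp M \<delta>)" and a: "a \<in> A.C \<gamma>" "b - \<phi> \<gamma> a \<in> G \<gamma> n"
    and kill: "\<And>a'. a' \<in> F \<gamma> n \<Longrightarrow> mact M \<gamma> \<delta> a' x = \<one>\<^bsub>mcomp M (\<gamma> + \<delta>)\<^esub>"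
  shows "mact (extend_scalars M) \<gamma> \<delta> b x = mact M \<gamma> \<delta> a x"
proof -
  define P where "P = (\<lambda>a n. b - \<phi> \<gamma> a \<in> G \<gamma> n \<and> (\<forall>a'\<in>F \<gamma> n. mact M \<gamma> \<delta> a' x = \<one>\<^bsub>mcomp M (\<gamma> + \<delta>)\<^esub>))"
  define s where "s = (SOME a. a \<in> A.C \<gamma> \<and> (\<exists>n. P a n))"
  have "s \<in> A.C \<gamma> \<and> (\<exists>n. P s n)"
    unfolding s_def by (rule someI[of _ a]) (use a kill in \<open>auto simp: P_def\<close>)
  then obtain l where s: "s \<in> A.C \<gamma>" "P s l" by blast
  have "\<phi> \<gamma> (s - a) \<in> G \<gamma> (min l n)"
  proof -
    have "\<phi> \<gamma> (s - a) = (b - \<phi> \<gamma> a) - (b - \<phi> \<gamma> s)" by (simp add: hom_diff a s)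
    also have "\<dots> \<in> G \<gamma> (min l n)"
      using a(2) s(2) B.F_mono[of "min l n" n \<gamma>] B.F_mono[of "min l n" l \<gamma>]
      by (intro B.F_diff[of "b - \<phi> \<gamma> a"]) (auto simp: P_def)
    finally show ?thesis .
  qed
  then have "s - a \<in> F \<gamma> (min l n)" using hom_F[OF A.diff_closed[OF s(1) a(1)]] by simp
  then have "mact M \<gamma> \<delta> (s - a) x = \<one>\<^bsub>mcomp M (\<gamma> + \<delta>)\<^esub>"
    using kill s(2) by (auto simp: P_def min_def split: if_splits)
  then have "mact M \<gamma> \<delta> s x = mact M \<gamma> \<delta> a x"
    by (rule A.mact_eq_if_diff_kills[OF M s(1) a(1) x])
  then show ?thesis by (simp add: extend_scalars_def s_def P_def)
qed

text \<open>One scale works for finitely many elements, so that they can be treated with the same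
  approximation of \<open>b\<close>.\<close>

lemma extend_scalars_eq_mact:
  assumes M: "graded_left_module A M" "discrete_action F M"
    and X: "finite X" "X \<subseteq> carrier (mcomp M \<delta>)"
  obtains n where "\<And>a b x. b \<in> B.C \<gamma> \<Longrightarrow> a \<in> A.C \<gamma> \<Longrightarrow> b - \<phi> \<gamma> a \<in> G \<gamma> n \<Longrightarrow> x \<in> X \<Longrightarrow>
    mact (extend_scalars M) \<gamma> \<delta> b x = mact M \<gamma> \<delta> a x"
proof -
  have "\<forall>x\<in>X. \<exists>n. \<forall>a\<in>F \<gamma> n. mact M \<gamma> \<delta> a x = \<one>\<^bsub>mcomp M (\<gamma> + \<delta>)\<^esub>"
    using M(2) X(2) unfolding discrete_action_def by blast
  then obtain n where n: "\<And>x a. x \<in> X \<Longrightarrow> a \<in> F \<gamma> (n x) \<Longrightarrow> mact M \<gamma> \<delta> a x = \<one>\<^bsub>mcomp M (\<gamma> + \<delta>)\<^esub>"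
    by metis
  show ?thesis
  proof (rule that[of "Max (insert 0 (n ` X))"])
    fix a b x assume *: "b \<in> B.C \<gamma>" "a \<in> A.C \<gamma>" "b - \<phi> \<gamma> a \<in> G \<gamma> (Max (insert 0 (n ` X)))" "x \<in> X"
    then have "b - \<phi> \<gamma> a \<in> G \<gamma> (n x)"
      using B.F_mono[of "n x" "Max (insert 0 (n ` X))" \<gamma>] X(1) by auto
    then show "mact (extend_scalars M) \<gamma> \<delta> b x = mact M \<gamma> \<delta> a x"
      using * X(2) n by (intro extend_scalars_mact[OF M(1)]) auto
  qed
qed

text \<open>Each axiom involves finitely many elements and reduces to the axiom for \<open>M\<close>
  by approximation; for the action of a product, continuity of multiplication ensures that a product
  of approximations approximates the product.\<close>

lemma graded_left_module_extend:
  assumes M: "graded_left_module A M" "discrete_action F M"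
  shows "graded_left_module B (extend_scalars M)"
proof -
  interpret M: graded_left_module A M by fact
  have comp: "mcomp (extend_scalars M) = mcomp M" by (simp add: extend_scalars_def)
  have act_closed: "mact (extend_scalars M) \<gamma> \<delta> b x \<in> carrier (mcomp M (\<gamma> + \<delta>))"
    if b: "b \<in> B.C \<gamma>" and x: "x \<in> carrier (mcomp M \<delta>)" for \<gamma> \<delta> b x
  proof -
    obtain n where n: "\<And>a b y. b \<in> B.C \<gamma> \<Longrightarrow> a \<in> A.C \<gamma> \<Longrightarrow> b - \<phi> \<gamma> a \<in> G \<gamma> n \<Longrightarrow> y \<in> {x} \<Longrightarrow>
        mact (extend_scalars M) \<gamma> \<delta> b y = mact M \<gamma> \<delta> a y"
      using extend_scalars_eq_mact[OF M, of "{x}" \<delta> \<gamma>] x by auto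
    obtain a where "a \<in> A.C \<gamma>" "b - \<phi> \<gamma> a \<in> G \<gamma> n" using dense[OF b] by blast
    then show ?thesis using n[OF b] x A.mact_closed[OF M(1)] by simp
  qed
  have grp: "monoid (mcomp M \<gamma>)" for \<gamma>
    using M.comm_group_mcomp[of \<gamma>] by (simp add: comm_group_def group.is_monoid)
  show ?thesis
  proof (rule graded_left_module.intro)
    show "comm_group (mcomp (extend_scalars M) \<gamma>)" for \<gamma> unfolding comp by (rule M.comm_group_mcomp)
  next
    fix b \<gamma> \<delta> assume b: "b \<in> B.C \<gamma>"
    show "mact (extend_scalars M) \<gamma> \<delta> b \<in> hom (mcomp (extend_scalars M) \<delta>) (mcomp (extend_scalars M) (\<gamma> + \<delta>))"
      unfolding comp
    proof (rule homI)
      fix x y assume xy: "x \<in> carrier (mcomp M \<delta>)" "y \<in> carrier (mcomp M \<delta>)"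
      let ?X = "{x, y, x \<otimes>\<^bsub>mcomp M \<delta>\<^esub> y}"
      have X: "finite ?X" "?X \<subseteq> carrier (mcomp M \<delta>)"
        using xy monoid.m_closed[OF grp] by auto
      obtain n where n: "\<And>a b z. b \<in> B.C \<gamma> \<Longrightarrow> a \<in> A.C \<gamma> \<Longrightarrow> b - \<phi> \<gamma> a \<in> G \<gamma> n \<Longrightarrow> z \<in> ?X \<Longrightarrow>
          mact (extend_scalars M) \<gamma> \<delta> b z = mact M \<gamma> \<delta> a z"
        using extend_scalars_eq_mact[OF M X, of \<gamma>] by blast
      obtain a where a: "a \<in> A.C \<gamma>" "b - \<phi> \<gamma> a \<in> G \<gamma> n" using dense[OF b] by blast
      show "mact (extend_scalars M) \<gamma> \<delta> b (x \<otimes>\<^bsub>mcomp M \<delta>\<^esub> y) =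
        mact (extend_scalars M) \<gamma> \<delta> b x \<otimes>\<^bsub>mcomp M (\<gamma> + \<delta>)\<^esub> mact (extend_scalars M) \<gamma> \<delta> b y"
        using n[OF b a] Group.hom_mult[OF M.mact_hom[OF a(1)] xy] by simp
    qed (use act_closed b in blast)
  next
    fix x \<gamma> \<delta> assume "x \<in> carrier (mcomp (extend_scalars M) \<delta>)"
    then have x: "x \<in> carrier (mcomp M \<delta>)" by (simp add: comp)
    obtain n where n: "\<And>a b y. b \<in> B.C \<gamma> \<Longrightarrow> a \<in> A.C \<gamma> \<Longrightarrow> b - \<phi> \<gamma> a \<in> G \<gamma> n \<Longrightarrow> y \<in> {x} \<Longrightarrow>
        mact (extend_scalars M) \<gamma> \<delta> b y = mact M \<gamma> \<delta> a y"
      using extend_scalars_eq_mact[OF M, of "{x}" \<delta> \<gamma>] x by auto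
    show "(\<lambda>b. mact (extend_scalars M) \<gamma> \<delta> b x) \<in> hom (gcomp B \<gamma>) (mcomp (extend_scalars M) (\<gamma> + \<delta>))"
      unfolding comp
    proof (rule homI)
      fix b b' assume b: "b \<in> B.C \<gamma>" and b': "b' \<in> B.C \<gamma>"
      obtain a where a: "a \<in> A.C \<gamma>" "b - \<phi> \<gamma> a \<in> G \<gamma> n" using dense[OF b] by blast
      obtain a' where a': "a' \<in> A.C \<gamma>" "b' - \<phi> \<gamma> a' \<in> G \<gamma> n" using dense[OF b'] by blast
      have "b + b' - \<phi> \<gamma> (a + a') \<in> G \<gamma> n"
        using B.F_add[OF a(2) a'(2)] by (simp add: hom_add a a' algebra_simps)
      then show "mact (extend_scalars M) \<gamma> \<delta> (b \<otimes>\<^bsub>gcomp B \<gamma>\<^esub> b') x =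
         mact (extend_scalars M) \<gamma> \<delta> b x \<otimes>\<^bsub>mcomp M (\<gamma> + \<delta>)\<^esub> mact (extend_scalars M) \<gamma> \<delta> b' x"
        using n[OF b a] n[OF b' a'] n[OF B.add_closed[OF b b'] A.add_closed[OF a(1) a'(1)]]
          A.mact_add[OF M(1) a(1) a'(1) x] by simp
    qed (use act_closed x in blast)
  next
    fix b b' x \<gamma> \<delta> \<epsilon>
    assume b: "b \<in> B.C \<gamma>" and b': "b' \<in> B.C \<delta>" and "x \<in> carrier (mcomp (extend_scalars M) \<epsilon>)"
    then have x: "x \<in> carrier (mcomp M \<epsilon>)" by (simp add: comp)
    let ?y = "mact (extend_scalars M) \<delta> \<epsilon> b' x"
    have y: "?y \<in> carrier (mcomp M (\<delta> + \<epsilon>))" using act_closed[OF b' x] .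
    obtain n0 where n0: "\<And>a b z. b \<in> B.C (\<gamma> + \<delta>) \<Longrightarrow> a \<in> A.C (\<gamma> + \<delta>) \<Longrightarrow> b - \<phi> (\<gamma> + \<delta>) a \<in> G (\<gamma> + \<delta>) n0 \<Longrightarrow> z \<in> {x} \<Longrightarrow>
        mact (extend_scalars M) (\<gamma> + \<delta>) \<epsilon> b z = mact M (\<gamma> + \<delta>) \<epsilon> a z"
      using extend_scalars_eq_mact[OF M, of "{x}" \<epsilon> "\<gamma> + \<delta>"] x by auto
    obtain n1 where n1: "\<And>a b z. b \<in> B.C \<delta> \<Longrightarrow> a \<in> A.C \<delta> \<Longrightarrow> b - \<phi> \<delta> a \<in> G \<delta> n1 \<Longrightarrow> z \<in> {x} \<Longrightarrow>
        mact (extend_scalars M) \<delta> \<epsilon> b z = mact M \<delta> \<epsilon> a z"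
      using extend_scalars_eq_mact[OF M, of "{x}" \<epsilon> \<delta>] x by auto
    obtain n2 where n2: "\<And>a b z. b \<in> B.C \<gamma> \<Longrightarrow> a \<in> A.C \<gamma> \<Longrightarrow> b - \<phi> \<gamma> a \<in> G \<gamma> n2 \<Longrightarrow> z \<in> {?y} \<Longrightarrow>
        mact (extend_scalars M) \<gamma> (\<delta> + \<epsilon>) b z = mact M \<gamma> (\<delta> + \<epsilon>) a z"
      using extend_scalars_eq_mact[OF M, of "{?y}" "\<delta> + \<epsilon>" \<gamma>] y by auto
    obtain k where k: "\<forall>z\<in>G \<gamma> k. gmult B \<gamma> \<delta> z b' \<in> G (\<gamma> + \<delta>) n0" using B.continuous_left[OF b'] by blast
    \<comment> \<open>the order of choices matters: the scale for \<open>b'\<close> depends on the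
    approximation \<open>a\<close> of \<open>b\<close>, while the scale for \<open>b\<close> only
    depends on \<open>b'\<close> and on the element \<open>b' x\<close>\<close>
    obtain a where a: "a \<in> A.C \<gamma>" "b - \<phi> \<gamma> a \<in> G \<gamma> (max n2 k)" using dense[OF b] by blast
    obtain l where l: "\<forall>z\<in>G \<delta> l. gmult B \<gamma> \<delta> (\<phi> \<gamma> a) z \<in> G (\<gamma> + \<delta>) n0"
      using B.continuous_right[OF hom_closed[OF a(1)]] by blast
    obtain a' where a': "a' \<in> A.C \<delta>" "b' - \<phi> \<delta> a' \<in> G \<delta> (max n1 l)" using dense[OF b'] by blast
    have aG: "b - \<phi> \<gamma> a \<in> G \<gamma> n2" "b - \<phi> \<gamma> a \<in> G \<gamma> k" and a'G: "b' - \<phi> \<delta> a' \<in> G \<delta> n1" "b' - \<phi> \<delta> a' \<in> G \<delta> l"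
      using subsetD[OF B.F_mono a(2)] subsetD[OF B.F_mono a'(2)] by simp_all
    have "gmult B \<gamma> \<delta> b b' - \<phi> (\<gamma> + \<delta>) (gmult A \<gamma> \<delta> a a')
        = gmult B \<gamma> \<delta> (b - \<phi> \<gamma> a) b' + gmult B \<gamma> \<delta> (\<phi> \<gamma> a) (b' - \<phi> \<delta> a')"
      by (simp add: hom_mult B.gmult_diff_left B.gmult_diff_right b b' a a' hom_closed)
    also have "\<dots> \<in> G (\<gamma> + \<delta>) n0" using k l aG a'G by (intro B.F_add) auto
    finally have "mact (extend_scalars M) (\<gamma> + \<delta>) \<epsilon> (gmult B \<gamma> \<delta> b b') x
        = mact M (\<gamma> + \<delta>) \<epsilon> (gmult A \<gamma> \<delta> a a') x"
      using B.gmult_closed[OF b b'] A.gmult_closed[OF a(1) a'(1)] by (intro n0) auto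
    also have "\<dots> = mact M \<gamma> (\<delta> + \<epsilon>) a (mact M \<delta> \<epsilon> a' x)" by (rule M.mact_mult[OF a(1) a'(1) x])
    also have "mact M \<delta> \<epsilon> a' x = ?y" using n1[OF b' a'(1) a'G(1)] by simp
    also have "mact M \<gamma> (\<delta> + \<epsilon>) a ?y = mact (extend_scalars M) \<gamma> (\<delta> + \<epsilon>) b ?y"
      using n2[OF b a(1) aG(1)] by simp
    finally show "mact (extend_scalars M) (\<gamma> + \<delta>) \<epsilon> (gmult B \<gamma> \<delta> b b') x
      = mact (extend_scalars M) \<gamma> (\<delta> + \<epsilon>) b ?y" .
  next
    fix x \<delta> assume "x \<in> carrier (mcomp (extend_scalars M) \<delta>)"
    then have x: "x \<in> carrier (mcomp M \<delta>)" by (simp add: comp)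
    obtain n where n: "\<And>a b y. b \<in> B.C 0 \<Longrightarrow> a \<in> A.C 0 \<Longrightarrow> b - \<phi> 0 a \<in> G 0 n \<Longrightarrow> y \<in> {x} \<Longrightarrow>
        mact (extend_scalars M) 0 \<delta> b y = mact M 0 \<delta> a y"
      using extend_scalars_eq_mact[OF M, of "{x}" \<delta> 0] x by auto
    show "mact (extend_scalars M) 0 \<delta> (gone B) x = x"
      using n[OF B.one_closed A.one_closed] M.mact_one[OF x] by (simp add: hom_one B.F_zero)
  qed
qed

lemma discrete_action_extend:
  assumes M: "graded_left_module A M" "discrete_action F M"
  shows "discrete_action G (extend_scalars M)"
  unfolding discrete_action_def
proof (intro allI ballI)
  fix \<gamma> \<delta> x assume "x \<in> carrier (mcomp (extend_scalars M) \<delta>)"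
  then have x: "x \<in> carrier (mcomp M \<delta>)" by (simp add: extend_scalars_def)
  obtain n where n: "\<And>a b y. b \<in> B.C \<gamma> \<Longrightarrow> a \<in> A.C \<gamma> \<Longrightarrow> b - \<phi> \<gamma> a \<in> G \<gamma> n \<Longrightarrow> y \<in> {x} \<Longrightarrow>
      mact (extend_scalars M) \<gamma> \<delta> b y = mact M \<gamma> \<delta> a y"
    using extend_scalars_eq_mact[OF M, of "{x}" \<delta> \<gamma>] x by auto
  have "mact (extend_scalars M) \<gamma> \<delta> b x = \<one>\<^bsub>mcomp (extend_scalars M) (\<gamma> + \<delta>)\<^esub>" if "b \<in> G \<gamma> n" for b
    using n[of b 0] that B.F_carrier A.zero_closed A.mact_zero[OF M(1) x]
    by (auto simp: hom_zero extend_scalars_def)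
  then show "\<exists>n. \<forall>b\<in>G \<gamma> n. mact (extend_scalars M) \<gamma> \<delta> b x = \<one>\<^bsub>mcomp (extend_scalars M) (\<gamma> + \<delta>)\<^esub>"
    by blast
qed

lemma graded_left_module_restrict:
  assumes "graded_left_module B N"
  shows "graded_left_module A (restrict_scalars N)"
proof -
  interpret N: graded_left_module B N by fact
  show ?thesis
  proof (rule graded_left_module.intro)
    fix x \<gamma> \<delta> assume "x \<in> carrier (mcomp (restrict_scalars N) \<delta>)"
    then have "(\<lambda>a. mact N \<gamma> \<delta> a x) \<in> hom (gcomp B \<gamma>) (mcomp N (\<gamma> + \<delta>))"
      by (intro N.mact_hom_left) (simp add: restrict_scalars_def)
    then show "(\<lambda>a. mact (restrict_scalars N) \<gamma> \<delta> a x) \<in> hom (gcomp A \<gamma>) (mcomp (restrict_scalars N) (\<gamma> + \<delta>))"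
      using hom_closed[of _ \<gamma>] by (auto simp: hom_def restrict_scalars_def hom_add Pi_iff)
  qed (use N.comm_group_mcomp N.mact_hom N.mact_one N.mact_mult hom_closed hom_mult hom_one
        in \<open>simp_all add: restrict_scalars_def\<close>)
qed

lemma discrete_action_restrict:
  assumes "discrete_action G N"
  shows "discrete_action F (restrict_scalars N)"
proof -
  have "\<phi> \<gamma> a \<in> G \<gamma> n" if "a \<in> F \<gamma> n" for \<gamma> a n
    using that hom_F A.F_carrier by blast
  then show ?thesis using assms unfolding discrete_action_def restrict_scalars_def by simp meson
qed

text \<open>Extension of scalars is inverse to restriction: on elements of \<open>A\<close> the
  extended action is the given one, and an action of \<open>B\<close> on a discrete module is
  determined by that of \<open>A\<close>.\<close>

theorem Mod_lf_dense:
  "equivalent_categories (Mod_lf TYPE('m) A F) (Mod_lf TYPE('m) B G)"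
proof -
  have objA: "graded_left_module A M \<and> discrete_action F M" if "M \<in> Obj (Mod_lf TYPE('m) A F)" for M
    using that A.locally_finite_iff_discrete by (auto simp: Mod_lf_def)
  have objB: "graded_left_module B N \<and> discrete_action G N" if "N \<in> Obj (Mod_lf TYPE('m) B G)" for N
    using that B.locally_finite_iff_discrete by (auto simp: Mod_lf_def)
  have res: "graded_left_module A (restrict_scalars N) \<and> discrete_action F (restrict_scalars N)"
    if "N \<in> Obj (Mod_lf TYPE('m) B G)" for N
    using objB[OF that] graded_left_module_restrict[of N] discrete_action_restrict[of N] by simp
  show ?thesis
  proof (rule equivalent_by_change_of_action[where Fo = extend_scalars and Go = restrict_scalars])
    fix M assume "M \<in> Obj (Mod_lf TYPE('m) A F)"
    then show "extend_scalars M \<in> Obj (Mod_lf TYPE('m) B G)"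
      using objA[of M] graded_left_module_extend[of M] discrete_action_extend[of M]
      by (simp add: Mod_lf_def B.locally_finite_iff_discrete)
  next
    fix N assume "N \<in> Obj (Mod_lf TYPE('m) B G)"
    then show "restrict_scalars N \<in> Obj (Mod_lf TYPE('m) A F)"
      using res[of N] by (simp add: Mod_lf_def A.locally_finite_iff_discrete)
  next
    show "mcomp (extend_scalars M) = mcomp M" for M :: "('i, 'a, 'm) gmodule" by (simp add: extend_scalars_def)
    show "mcomp (restrict_scalars N) = mcomp N" for N :: "('i, 'b, 'm) gmodule" by (simp add: restrict_scalars_def)
  next
    fix M N :: "('i, 'a, 'm) gmodule" and h
    assume "M \<in> Obj (Mod_lf TYPE('m) A F)" "N \<in> Obj (Mod_lf TYPE('m) A F)" and h: "h \<in> graded_homs A M N"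
    then have M: "graded_left_module A M" "discrete_action F M" and N: "graded_left_module A N" "discrete_action F N"
      using objA by auto
    have "h (\<gamma> + \<delta>) (mact (extend_scalars M) \<gamma> \<delta> b x) = mact (extend_scalars N) \<gamma> \<delta> b (h \<delta> x)"
      if b: "b \<in> B.C \<gamma>" and x: "x \<in> carrier (mcomp M \<delta>)" for \<gamma> \<delta> b x
    proof -
      have hx: "h \<delta> x \<in> carrier (mcomp N \<delta>)" by (rule graded_homs_carrier[OF h x])
      obtain n where n: "\<And>a b y. b \<in> B.C \<gamma> \<Longrightarrow> a \<in> A.C \<gamma> \<Longrightarrow> b - \<phi> \<gamma> a \<in> G \<gamma> n \<Longrightarrow> y \<in> {x} \<Longrightarrow>
          mact (extend_scalars M) \<gamma> \<delta> b y = mact M \<gamma> \<delta> a y"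
        using extend_scalars_eq_mact[OF M, of "{x}" \<delta> \<gamma>] x by auto
      obtain l where l: "\<And>a b y. b \<in> B.C \<gamma> \<Longrightarrow> a \<in> A.C \<gamma> \<Longrightarrow> b - \<phi> \<gamma> a \<in> G \<gamma> l \<Longrightarrow> y \<in> {h \<delta> x} \<Longrightarrow>
          mact (extend_scalars N) \<gamma> \<delta> b y = mact N \<gamma> \<delta> a y"
        using extend_scalars_eq_mact[OF N, of "{h \<delta> x}" \<delta> \<gamma>] hx by auto
      obtain a where a: "a \<in> A.C \<gamma>" "b - \<phi> \<gamma> a \<in> G \<gamma> (max n l)" using dense[OF b] by blast
      have "b - \<phi> \<gamma> a \<in> G \<gamma> n" "b - \<phi> \<gamma> a \<in> G \<gamma> l"
        using subsetD[OF B.F_mono a(2)] by simp_all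
      then show ?thesis using n[OF b a(1)] l[OF b a(1)] graded_homs_mact[OF h a(1) x] by simp
    qed
    then show "h \<in> graded_homs B (extend_scalars M) (extend_scalars N)"
      using h by (simp add: graded_homs_def extend_scalars_def)
  next
    fix M N :: "('i, 'b, 'm) gmodule" and h
    assume "h \<in> graded_homs B M N"
    then show "h \<in> graded_homs A (restrict_scalars M) (restrict_scalars N)"
      using hom_closed by (simp add: graded_homs_def restrict_scalars_def)
  next
    fix M :: "('i, 'a, 'm) gmodule" and \<gamma> \<delta> a x
    assume "M \<in> Obj (Mod_lf TYPE('m) A F)" and a: "a \<in> A.C \<gamma>" and x: "x \<in> carrier (mcomp M \<delta>)"
    then have M: "graded_left_module A M" "discrete_action F M" using objA by auto
    obtain n where n: "\<And>a b y. b \<in> B.C \<gamma> \<Longrightarrow> a \<in> A.C \<gamma> \<Longrightarrow> b - \<phi> \<gamma> a \<in> G \<gamma> n \<Longrightarrow> y \<in> {x} \<Longrightarrow>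
        mact (extend_scalars M) \<gamma> \<delta> b y = mact M \<gamma> \<delta> a y"
      using extend_scalars_eq_mact[OF M, of "{x}" \<delta> \<gamma>] x by auto
    have "mact (restrict_scalars (extend_scalars M)) \<gamma> \<delta> a x = mact (extend_scalars M) \<gamma> \<delta> (\<phi> \<gamma> a) x"
      by (simp add: restrict_scalars_def)
    also have "\<dots> = mact M \<gamma> \<delta> a x" using hom_closed[OF a] a by (intro n) (simp_all add: B.F_zero)
    finally show "mact (restrict_scalars (extend_scalars M)) \<gamma> \<delta> a x = mact M \<gamma> \<delta> a x" .
  next
    fix N :: "('i, 'b, 'm) gmodule" and \<gamma> \<delta> b x
    assume N: "N \<in> Obj (Mod_lf TYPE('m) B G)" and b: "b \<in> B.C \<gamma>" and x: "x \<in> carrier (mcomp N \<delta>)"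
    note res = res[OF N] and N = objB[OF N]
    obtain n where n: "\<forall>b\<in>G \<gamma> n. mact N \<gamma> \<delta> b x = \<one>\<^bsub>mcomp N (\<gamma> + \<delta>)\<^esub>"
      using N x unfolding discrete_action_def by blast
    obtain a where a: "a \<in> A.C \<gamma>" "b - \<phi> \<gamma> a \<in> G \<gamma> n" using dense[OF b] by blast
    have "mact (extend_scalars (restrict_scalars N)) \<gamma> \<delta> b x = mact (restrict_scalars N) \<gamma> \<delta> a x"
    proof (rule extend_scalars_mact[OF conjunct1[OF res] b _ a])
      show "x \<in> carrier (mcomp (restrict_scalars N) \<delta>)" using x by (simp add: restrict_scalars_def)
      fix a' assume a': "a' \<in> F \<gamma> n"
      then have "\<phi> \<gamma> a' \<in> G \<gamma> n" using hom_F A.F_carrier by blast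
      then show "mact (restrict_scalars N) \<gamma> \<delta> a' x = \<one>\<^bsub>mcomp (restrict_scalars N) (\<gamma> + \<delta>)\<^esub>"
        using n by (simp add: restrict_scalars_def)
    qed
    also have "\<dots> = mact N \<gamma> \<delta> (\<phi> \<gamma> a) x" by (simp add: restrict_scalars_def)
    also have "\<dots> = mact N \<gamma> \<delta> b x"
      using B.mact_eq_if_diff_kills[OF conjunct1[OF N] b hom_closed[OF a(1)] x] n a(2) by simp
    finally show "mact (extend_scalars (restrict_scalars N)) \<gamma> \<delta> b x = mact N \<gamma> \<delta> b x" .
  qed
qed

end

section \<open>Sums of fractions\<close>

definition regular :: "'r::comm_ring_1 \<Rightarrow> bool" where
  "regular x \<longleftrightarrow> (\<forall>y. x * y = 0 \<longrightarrow> y = 0)"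

lemma regular_cancel: "regular x \<Longrightarrow> x * y = x * z \<longleftrightarrow> y = z"
  unfolding regular_def by (metis eq_iff_diff_eq_0 right_diff_distrib)

lemma regular_cancel_right: "regular x \<Longrightarrow> y * x = z * x \<longleftrightarrow> y = z"
  by (metis regular_cancel mult.commute)

lemma regular_one [simp]: "regular 1"
  by (simp add: regular_def)

lemma regular_mult: "regular x \<Longrightarrow> regular y \<Longrightarrow> regular (x * y)"
  unfolding regular_def by (metis mult.assoc)

lemma regular_prod: "(\<And>s. s \<in> S \<Longrightarrow> regular (f s)) \<Longrightarrow> regular (\<Prod>s\<in>S. f s)"
  by (induction S rule: infinite_finite_induct) (auto intro: regular_mult)

lemma regular_factor: "regular (x * y) \<Longrightarrow> regular x"
  unfolding regular_def by (metis mult.assoc mult.commute mult_zero_right)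

lemma regular_unit: "x * y = 1 \<Longrightarrow> regular x"
  by (rule regular_factor[of x y]) simp

text \<open>Any common multiple of the denominators may replace their product, and it is much
  smaller in the case of shuffles.\<close>

lemma fraction_sum_common_denominator:
  assumes S: "finite S" and E: "regular E" and D: "\<And>s. s \<in> S \<Longrightarrow> D s * C s = E"
    and q: "q * E = (\<Sum>s\<in>S. N s * C s)"
  shows "fraction_sum S N D = q"
proof -
  have reg: "regular (\<Prod>s\<in>S. D s)"
    using D E by (intro regular_prod) (metis regular_factor)
  have "E * (q * (\<Prod>s\<in>S. D s)) = q * E * (\<Prod>s\<in>S. D s)" by (simp only: mult_ac)
  also have "\<dots> = (\<Sum>s\<in>S. N s * C s * (\<Prod>s\<in>S. D s))"
    by (simp only: q sum_distrib_right)
  also have "\<dots> = (\<Sum>s\<in>S. E * (N s * (\<Prod>t\<in>S - {s}. D t)))"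
    by (rule sum.cong[OF refl]) (simp add: D[symmetric] prod.remove[OF S] mult_ac)
  also have "\<dots> = E * (\<Sum>s\<in>S. N s * (\<Prod>t\<in>S - {s}. D t))"
    by (simp add: sum_distrib_left)
  finally have eq: "q * (\<Prod>s\<in>S. D s) = (\<Sum>s\<in>S. N s * (\<Prod>t\<in>S - {s}. D t))"
    using regular_cancel[OF E] by blast
  show ?thesis
    unfolding fraction_sum_def
  proof (rule the_equality)
    fix q' assume "q' * (\<Prod>s\<in>S. D s) = (\<Sum>s\<in>S. N s * (\<Prod>t\<in>S - {s}. D t))"
    then have "q' * (\<Prod>s\<in>S. D s) = q * (\<Prod>s\<in>S. D s)" unfolding eq .
    then show "q' = q" unfolding regular_cancel_right[OF reg] .
  qed (fact eq)
qed


section \<open>Permutations and shuffles of the variables\<close>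

lemma vars_Sigma: "vars g = Sigma UNIV (\<lambda>i. {..<g i})"
  by (auto simp: vars_def)

lemma finite_vars: "finite (vars (g :: 'i::finite \<Rightarrow> nat))"
  by (simp add: vars_Sigma)

lemma mem_vars [simp]: "(i, \<alpha>) \<in> vars g \<longleftrightarrow> \<alpha> < g i"
  by (simp add: vars_def)

lemma finite_var_perms: "finite (var_perms (g :: 'i::finite \<Rightarrow> nat))"
proof -
  have "var_perms g = PiE UNIV (\<lambda>i. {p. p permutes {..<g i}})"
    by (auto simp: var_perms_def PiE_def Pi_def)
  then show ?thesis by (simp add: finite_PiE finite_permutations)
qed

lemma finite_var_shuffles: "finite (var_shuffles (g1 :: 'i::finite \<Rightarrow> nat) g2)"
  by (rule finite_subset[OF _ finite_var_perms[of "\<lambda>i. g1 i + g2 i"]])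
    (auto simp: var_shuffles_def var_perms_def)

lemma shuffle_perm: "w \<in> var_shuffles g1 g2 \<Longrightarrow> w \<in> var_perms (\<lambda>i. g1 i + g2 i)"
  by (auto simp: var_shuffles_def var_perms_def)

lemma on_vars_simp [simp]: "on_vars \<pi> (i, \<alpha>) = (i, \<pi> i \<alpha>)"
  by (simp add: on_vars_def)

lemma on_vars2_simp [simp]: "on_vars2 g w (i, \<alpha>) = (i, w i (g i + \<alpha>))"
  by (simp add: on_vars2_def)

lemma var_perms_eq_iff: "w \<in> var_perms g \<Longrightarrow> w i \<alpha> = w i \<beta> \<longleftrightarrow> \<alpha> = \<beta>"
  using permutes_inj[of "w i" "{..<g i}"] by (auto simp: var_perms_def inj_eq)

lemma inj_on_vars: "w \<in> var_perms g \<Longrightarrow> inj (on_vars w)"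
  by (auto simp: inj_def var_perms_eq_iff)

lemma inj_on_vars2: "w \<in> var_perms g \<Longrightarrow> inj (on_vars2 g1 w)"
  by (auto simp: inj_def var_perms_eq_iff)

lemma on_vars_image_vars: "\<pi> \<in> var_perms g \<Longrightarrow> on_vars \<pi> ` vars g = vars g"
proof -
  assume \<pi>: "\<pi> \<in> var_perms g"
  have "(i, \<alpha>) \<in> on_vars \<pi> ` vars g" if "\<alpha> < g i" for i \<alpha>
  proof -
    have "\<alpha> \<in> \<pi> i ` {..<g i}" using \<pi> that by (auto simp: var_perms_def permutes_image)
    then obtain \<beta> where "\<beta> < g i" "\<alpha> = \<pi> i \<beta>" by auto
    then show ?thesis by (intro image_eqI[of _ _ "(i, \<beta>)"]) auto
  qed
  moreover have "\<pi> i \<alpha> < g i" if "\<alpha> < g i" for i \<alpha>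
    using \<pi> that permutes_in_image[of "\<pi> i" "{..<g i}" \<alpha>] by (auto simp: var_perms_def)
  ultimately show ?thesis by auto
qed

text \<open>Renaming the variables of a power series collects, for every monomial, the coefficients
  of the monomials mapped to it; finite fibres keep these sums finite.\<close>

definition finite_fibres :: "('a \<Rightarrow> 'b) \<Rightarrow> bool" where
  "finite_fibres \<rho> \<longleftrightarrow> (\<forall>y. finite (\<rho> -` {y}))"

lemma inj_finite_fibres: "inj \<rho> \<Longrightarrow> finite_fibres \<rho>"
  by (simp add: finite_fibres_def finite_vimageI)

lemma finite_fibres_upd: "finite_fibres (id(u := v))"
  unfolding finite_fibres_def
  by (intro allI, rule finite_subset[of _ "{u, _}"]) (auto split: if_splits)

lemma finite_fibres_comp: "finite_fibres \<rho> \<Longrightarrow> finite_fibres \<sigma> \<Longrightarrow> finite_fibres (\<rho> \<circ> \<sigma>)"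
proof -
  assume *: "finite_fibres \<rho>" "finite_fibres \<sigma>"
  have "(\<rho> \<circ> \<sigma>) -` {y} = (\<Union>z\<in>\<rho> -` {y}. \<sigma> -` {z})" for y by auto
  then show ?thesis using * by (simp add: finite_fibres_def)
qed

definition first_block :: "('i \<Rightarrow> nat) \<Rightarrow> ('i \<Rightarrow> nat \<Rightarrow> nat) \<Rightarrow> 'i var set" where
  "first_block g1 w = on_vars w ` vars g1"

definition second_block :: "('i \<Rightarrow> nat) \<Rightarrow> ('i \<Rightarrow> nat) \<Rightarrow> ('i \<Rightarrow> nat \<Rightarrow> nat) \<Rightarrow> 'i var set" where
  "second_block g1 g2 w = on_vars2 g1 w ` vars g2"

lemma mem_first_block: "(i, \<alpha>) \<in> first_block g1 w \<longleftrightarrow> \<alpha> \<in> w i ` {..<g1 i}"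
  by (auto simp: first_block_def vars_def on_vars_def image_def)

lemma mem_second_block: "(i, \<alpha>) \<in> second_block g1 g2 w \<longleftrightarrow> \<alpha> \<in> (\<lambda>\<beta>. w i (g1 i + \<beta>)) ` {..<g2 i}"
  by (auto simp: second_block_def vars_def on_vars2_def image_def)

lemma first_block_Un_second_block:
  assumes "w \<in> var_perms (\<lambda>i. g1 i + g2 i)"
  shows "first_block g1 w \<union> second_block g1 g2 w = vars (\<lambda>i. g1 i + g2 i)"
proof -
  let ?n = "\<lambda>i. g1 i + g2 i"
  have "first_block g1 w \<union> second_block g1 g2 w = on_vars w ` (vars g1 \<union> (\<lambda>(i, \<alpha>). (i, g1 i + \<alpha>)) ` vars g2)"
    by (force simp: first_block_def second_block_def image_Un image_iff)
  also have "vars g1 \<union> (\<lambda>(i, \<alpha>). (i, g1 i + \<alpha>)) ` vars g2 = vars ?n"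
  proof -
    have "(i, \<alpha>) \<in> (\<lambda>(i, \<alpha>). (i, g1 i + \<alpha>)) ` vars g2" if "\<not> \<alpha> < g1 i" "\<alpha> < g1 i + g2 i" for i \<alpha>
      using that by (intro image_eqI[of _ _ "(i, \<alpha> - g1 i)"]) auto
    then show ?thesis by (intro equalityI subsetI) fastforce+
  qed
  finally show ?thesis using on_vars_image_vars[OF assms] by simp
qed

lemma first_block_Int_second_block:
  assumes "w \<in> var_perms (\<lambda>i. g1 i + g2 i)"
  shows "first_block g1 w \<inter> second_block g1 g2 w = {}"
proof -
  show ?thesis by (auto simp: first_block_def second_block_def var_perms_eq_iff[OF assms])
qed

lemma second_block_eq:
  assumes "w \<in> var_perms (\<lambda>i. g1 i + g2 i)"
  shows "second_block g1 g2 w = vars (\<lambda>i. g1 i + g2 i) - first_block g1 w"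
  using first_block_Un_second_block[OF assms] first_block_Int_second_block[OF assms] by auto

lemma finite_blocks:
  fixes g1 g2 :: "'i::finite \<Rightarrow> nat"
  shows "finite (first_block g1 w)" "finite (second_block g1 g2 w)"
  by (simp_all add: first_block_def second_block_def finite_vars)

lemma prod_vars:
  "(\<Prod>u\<in>vars g. f u) = (\<Prod>i\<in>UNIV. \<Prod>\<alpha><g i. f (i :: 'i::finite, \<alpha>))"
  by (subst prod.Sigma) (simp_all add: vars_Sigma case_prod_eta[of f])

lemma prod_blocks:
  fixes h :: "'i::finite var \<Rightarrow> 'i var \<Rightarrow> 'r::comm_monoid_mult"
  assumes w: "w \<in> var_perms (\<lambda>i. g1 i + g2 i)"
  shows "(\<Prod>i\<in>UNIV. \<Prod>j\<in>UNIV. \<Prod>\<alpha>1<g1 i. \<Prod>\<alpha>2<g2 j. h (on_vars w (i, \<alpha>1)) (on_vars2 g1 w (j, \<alpha>2)))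
    = (\<Prod>u\<in>first_block g1 w. \<Prod>v\<in>second_block g1 g2 w. h u v)"
proof -
  have "(\<Prod>u\<in>first_block g1 w. \<Prod>v\<in>second_block g1 g2 w. h u v)
      = (\<Prod>u\<in>vars g1. \<Prod>v\<in>vars g2. h (on_vars w u) (on_vars2 g1 w v))"
    unfolding first_block_def second_block_def
    by (subst prod.reindex, rule inj_on_subset[OF inj_on_vars[OF w]], simp)
       (simp add: prod.reindex[OF inj_on_subset[OF inj_on_vars2[OF w]]])
  also have "\<dots> = (\<Prod>i\<in>UNIV. \<Prod>\<alpha>1<g1 i. \<Prod>j\<in>UNIV. \<Prod>\<alpha>2<g2 j. h (on_vars w (i, \<alpha>1)) (on_vars2 g1 w (j, \<alpha>2)))"
    by (simp only: prod_vars)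
  also have "\<dots> = (\<Prod>i\<in>UNIV. \<Prod>j\<in>UNIV. \<Prod>\<alpha>1<g1 i. \<Prod>\<alpha>2<g2 j. h (on_vars w (i, \<alpha>1)) (on_vars2 g1 w (j, \<alpha>2)))"
    by (rule prod.cong[OF refl], subst prod.swap, rule refl)
  finally show ?thesis by simp
qed

lemma sorted_enumerations_eq:
  fixes f f' :: "nat \<Rightarrow> nat"
  assumes "strict_mono_on {a..<b} f" "strict_mono_on {a..<b} f'" "f ` {a..<b} = f' ` {a..<b}" "x \<in> {a..<b}"
  shows "f x = f' x"
proof -
  have sorted: "sorted_wrt (<) (map h [a..<b])" if "strict_mono_on {a..<b} h" for h :: "nat \<Rightarrow> nat"
    unfolding sorted_wrt_map
    by (rule sorted_wrt_mono_rel[OF _ sorted_wrt_upt]) (use that in \<open>auto simp: strict_mono_on_def\<close>)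
  have "map f [a..<b] = map f' [a..<b]"
    using sorted[OF assms(1)] sorted[OF assms(2)] assms(3)
    by (intro sorted_distinct_set_unique) (auto simp: strict_sorted_iff)
  then show ?thesis using assms(4) by simp
qed

text \<open>A shuffle is determined by the set of variables in its first block, as each block is
  enumerated in increasing order.\<close>

lemma shuffle_unique:
  assumes w: "w \<in> var_shuffles g1 g2" and w': "w' \<in> var_shuffles g1 g2"
    and L: "first_block g1 w = first_block g1 w'"
  shows "w = w'"
proof (rule ext, rule ext)
  fix i \<alpha>
  note p = shuffle_perm[OF w] and p' = shuffle_perm[OF w']
  have R: "second_block g1 g2 w = second_block g1 g2 w'"
    using L by (simp add: second_block_eq p p')
  have first: "v i ` {0..<g1 i} = {\<alpha>. (i, \<alpha>) \<in> first_block g1 v}" for v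
    by (simp add: mem_first_block lessThan_atLeast0)
  have second: "v i ` {g1 i..<g1 i + g2 i} = {\<alpha>. (i, \<alpha>) \<in> second_block g1 g2 v}" for v
  proof -
    have "{g1 i..<g1 i + g2 i} = (+) (g1 i) ` {0..<g2 i}" by (simp add: add.commute)
    then show ?thesis by (simp only: image_image) (simp add: mem_second_block lessThan_atLeast0)
  qed
  consider "\<alpha> \<in> {0..<g1 i}" | "\<alpha> \<in> {g1 i..<g1 i + g2 i}" | "\<not> \<alpha> < g1 i + g2 i" by fastforce
  then show "w i \<alpha> = w' i \<alpha>"
  proof cases
    case 1
    then show ?thesis
      using w w' L by (intro sorted_enumerations_eq[of 0 "g1 i"])
        (simp_all add: var_shuffles_def first lessThan_atLeast0)
  next
    case 2
    then show ?thesis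
      using w w' R by (intro sorted_enumerations_eq[of "g1 i" "g1 i + g2 i"]) (simp_all add: var_shuffles_def second)
  next
    case 3
    then have "w i \<alpha> = \<alpha>" "w' i \<alpha> = \<alpha>"
      using p p' by (auto simp: var_perms_def permutes_def)
    then show ?thesis by simp
  qed
qed

lemma sorted_enumeration_exists:
  fixes A :: "nat set"
  assumes "A \<subseteq> {..<a + b}" "card A = a"
  shows "\<exists>w. w permutes {..<a + b} \<and> strict_mono_on {..<a} w \<and> strict_mono_on {a..<a + b} w \<and> w ` {..<a} = A"
proof -
  have fin: "finite A" using assms(1) finite_subset by blast
  define B where "B = {..<a + b} - A"
  have cB: "card B = b" using assms fin by (simp add: B_def card_Diff_subset)
  have finB: "finite B" by (simp add: B_def)
  define xs where "xs = sorted_list_of_set A @ sorted_list_of_set B"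
  have len: "length (sorted_list_of_set A) = a" "length (sorted_list_of_set B) = b"
    using assms(2) cB by simp_all
  have dist: "distinct xs" using fin finB by (auto simp: xs_def B_def)
  have set: "set xs = {..<a + b}" using fin finB assms(1) by (auto simp: xs_def B_def)
  define w where "w = (\<lambda>\<alpha>. if \<alpha> < a + b then xs ! \<alpha> else \<alpha>)"
  have "bij_betw ((!) xs) {..<a + b} {..<a + b}"
    by (rule bij_betw_nth) (use dist set len in \<open>simp_all add: xs_def\<close>)
  then have "bij_betw w {..<a + b} {..<a + b}"
    by (rule bij_betw_cong[THEN iffD1, rotated]) (simp add: w_def)
  then have "w permutes {..<a + b}" by (rule bij_imp_permutes) (simp add: w_def)
  moreover have "strict_mono_on {..<a} w"
    using strict_sorted_list_of_set[of A] len
    by (auto simp: strict_mono_on_def w_def xs_def nth_append sorted_wrt_iff_nth_less)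
  moreover have "strict_mono_on {a..<a + b} w"
    using strict_sorted_list_of_set[of B] len
    by (auto simp: strict_mono_on_def w_def xs_def nth_append sorted_wrt_iff_nth_less)
  moreover have "w ` {..<a} = A"
  proof -
    have "w ` {..<a} = (!) (sorted_list_of_set A) ` {..<a}"
      using len by (intro image_cong) (auto simp: w_def xs_def nth_append)
    also have "\<dots> = set (sorted_list_of_set A)"
      using len by (auto simp: set_conv_nth image_iff)
    finally show ?thesis using fin by simp
  qed
  ultimately show ?thesis by blast
qed

lemma shuffle_exists:
  assumes p: "p \<in> var_perms (\<lambda>i. g1 i + g2 i)"
  shows "\<exists>w\<in>var_shuffles g1 g2. first_block g1 w = first_block g1 p"
proof -
  have "\<exists>w. w permutes {..<g1 i + g2 i} \<and> strict_mono_on {..<g1 i} w \<and>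
      strict_mono_on {g1 i..<g1 i + g2 i} w \<and> w ` {..<g1 i} = p i ` {..<g1 i}" for i
  proof (rule sorted_enumeration_exists)
    have pi: "p i permutes {..<g1 i + g2 i}" using p by (simp add: var_perms_def)
    show "p i ` {..<g1 i} \<subseteq> {..<g1 i + g2 i}"
      using permutes_in_image[OF pi] by fastforce
    show "card (p i ` {..<g1 i}) = g1 i"
      using permutes_inj[OF pi] by (simp add: card_image inj_on_subset)
  qed
  then obtain w where w: "\<And>i. w i permutes {..<g1 i + g2 i}" "\<And>i. strict_mono_on {..<g1 i} (w i)"
    "\<And>i. strict_mono_on {g1 i..<g1 i + g2 i} (w i)" "\<And>i. w i ` {..<g1 i} = p i ` {..<g1 i}"
    by metis
  have block: "first_block g1 v = Sigma UNIV (\<lambda>i. v i ` {..<g1 i})" for v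
    by (auto simp: mem_first_block)
  have "w \<in> var_shuffles g1 g2" using w by (simp add: var_shuffles_def)
  moreover have "first_block g1 w = first_block g1 p" using w(4) by (simp add: block)
  ultimately show ?thesis by blast
qed

lemma var_perms_comp: "\<pi> \<in> var_perms g \<Longrightarrow> w \<in> var_perms g \<Longrightarrow> (\<lambda>i. \<pi> i \<circ> w i) \<in> var_perms g"
  by (auto simp: var_perms_def intro: permutes_compose)

lemma on_vars_comp: "on_vars (\<lambda>i. \<pi> i \<circ> w i) = on_vars \<pi> \<circ> on_vars w"
  "on_vars2 g1 (\<lambda>i. \<pi> i \<circ> w i) = on_vars \<pi> \<circ> on_vars2 g1 w"
  by (auto simp: fun_eq_iff)

lemma blocks_comp:
  "first_block g1 (\<lambda>i. \<pi> i \<circ> w i) = on_vars \<pi> ` first_block g1 w"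
  "second_block g1 g2 (\<lambda>i. \<pi> i \<circ> w i) = on_vars \<pi> ` second_block g1 g2 w"
  by (simp_all add: first_block_def second_block_def on_vars_comp image_comp)

text \<open>The full symmetric group permutes the shuffles through its action on their first blocks.\<close>

lemma sum_shuffles_comp:
  fixes h :: "('i::finite \<Rightarrow> nat \<Rightarrow> nat) \<Rightarrow> 'r::comm_monoid_add"
  assumes \<pi>: "\<pi> \<in> var_perms (\<lambda>i. g1 i + g2 i)"
    and h: "\<And>w w'. w \<in> var_perms (\<lambda>i. g1 i + g2 i) \<Longrightarrow> w' \<in> var_perms (\<lambda>i. g1 i + g2 i) \<Longrightarrow>
        first_block g1 w = first_block g1 w' \<Longrightarrow> h w = h w'"
  shows "(\<Sum>w\<in>var_shuffles g1 g2. h (\<lambda>i. \<pi> i \<circ> w i)) = (\<Sum>w\<in>var_shuffles g1 g2. h w)"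
proof -
  have "\<forall>w\<in>var_shuffles g1 g2. \<exists>w'\<in>var_shuffles g1 g2. first_block g1 w' = first_block g1 (\<lambda>i. \<pi> i \<circ> w i)"
    using shuffle_exists var_perms_comp[OF \<pi> shuffle_perm] by blast
  then obtain s where s: "\<And>w. w \<in> var_shuffles g1 g2 \<Longrightarrow> s w \<in> var_shuffles g1 g2"
    "\<And>w. w \<in> var_shuffles g1 g2 \<Longrightarrow> first_block g1 (s w) = on_vars \<pi> ` first_block g1 w"
    unfolding blocks_comp by metis
  have "inj_on s (var_shuffles g1 g2)"
  proof (rule inj_onI)
    fix w w' assume *: "w \<in> var_shuffles g1 g2" "w' \<in> var_shuffles g1 g2" "s w = s w'"
    then have "on_vars \<pi> ` first_block g1 w = on_vars \<pi> ` first_block g1 w'" using s(2) by metis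
    then have "first_block g1 w = first_block g1 w'" using inj_on_vars[OF \<pi>] by (simp add: inj_image_eq_iff)
    then show "w = w'" using shuffle_unique * by blast
  qed
  moreover have "s ` var_shuffles g1 g2 \<subseteq> var_shuffles g1 g2" using s(1) by blast
  ultimately have "s ` var_shuffles g1 g2 = var_shuffles g1 g2"
    using endo_inj_surj[OF finite_var_shuffles] by blast
  then have "(\<Sum>w\<in>var_shuffles g1 g2. h w) = (\<Sum>w\<in>var_shuffles g1 g2. h (s w))"
    using sum.reindex[OF \<open>inj_on s _\<close>, of h] by (simp add: comp_def)
  also have "\<dots> = (\<Sum>w\<in>var_shuffles g1 g2. h (\<lambda>i. \<pi> i \<circ> w i))"
    by (rule sum.cong[OF refl], rule h[OF shuffle_perm[OF s(1)] var_perms_comp[OF \<pi> shuffle_perm]])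
      (simp_all add: s(2) blocks_comp)
  finally show ?thesis by simp
qed

section \<open>Existence of shuffle products\<close>

lemma fraction_sum_cong:
  assumes "\<And>s. s \<in> S \<Longrightarrow> N s = N' s" "\<And>s. s \<in> S \<Longrightarrow> D s = D' s"
  shows "fraction_sum S N D = fraction_sum S N' D'"
proof -
  have "(\<Prod>s\<in>T. D s) = (\<Prod>s\<in>T. D' s)" if "T \<subseteq> S" for T
    using that assms(2) by (intro prod.cong) auto
  then show ?thesis using assms(1) by (simp add: fraction_sum_def)
qed

definition vpairs :: "('i::finite \<Rightarrow> nat) \<Rightarrow> ('i var \<times> 'i var) set" where
  "vpairs n = {(u, v). u \<in> vars n \<and> v \<in> vars n \<and> fst u = fst v \<and> u \<noteq> v}"

definition mixed_pairs :: "('i::finite \<Rightarrow> nat) \<Rightarrow> ('i \<Rightarrow> nat) \<Rightarrow> ('i \<Rightarrow> nat \<Rightarrow> nat) \<Rightarrow> ('i var \<times> 'i var) set" where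
  "mixed_pairs g1 g2 w = {(u, v). u \<in> first_block g1 w \<and> v \<in> second_block g1 g2 w \<and> fst u = fst v}"

text \<open>The properties shared by polynomials, Laurent polynomials and power series: \<open>V
  X\<close> are the elements that only involve the variables in \<open>X\<close>, \<open>ren\<close>
  renames variables, and \<open>K u v\<close> is the basic factor. Renaming by \<open>id(u :=
  v)\<close> is the specialization \<open>u = v\<close>; its kernel is generated by \<open>K u
  v\<close>, and \<open>K v u\<close> equals \<open>K u v\<close> up to a factor which specializes to
  \<open>- 1\<close>.\<close>

locale shuffle_ring =
  fixes V :: "'i::finite var set \<Rightarrow> 'r::comm_ring_1 set"
    and ren :: "('i var \<Rightarrow> 'i var) \<Rightarrow> 'r \<Rightarrow> 'r"
    and K :: "'i var \<Rightarrow> 'i var \<Rightarrow> 'r"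
  assumes V_zero: "0 \<in> V X" and V_one: "1 \<in> V X"
    and V_add: "f \<in> V X \<Longrightarrow> g \<in> V X \<Longrightarrow> f + g \<in> V X"
    and V_uminus: "f \<in> V X \<Longrightarrow> - f \<in> V X"
    and V_mult: "f \<in> V X \<Longrightarrow> g \<in> V X \<Longrightarrow> f * g \<in> V X"
    and V_mono: "X \<subseteq> Y \<Longrightarrow> V X \<subseteq> V Y"
    and ren_add: "finite_fibres \<rho> \<Longrightarrow> ren \<rho> (f + g) = ren \<rho> f + ren \<rho> g"
    and ren_mult: "finite_fibres \<rho> \<Longrightarrow> ren \<rho> (f * g) = ren \<rho> f * ren \<rho> g"
    and ren_one: "finite_fibres \<rho> \<Longrightarrow> ren \<rho> 1 = 1"
    and ren_comp: "finite_fibres \<rho> \<Longrightarrow> finite_fibres \<sigma> \<Longrightarrow> ren \<rho> (ren \<sigma> f) = ren (\<rho> \<circ> \<sigma>) f"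
    and ren_cong: "f \<in> V X \<Longrightarrow> finite_fibres \<rho> \<Longrightarrow> finite_fibres \<sigma> \<Longrightarrow> (\<And>v. v \<in> X \<Longrightarrow> \<rho> v = \<sigma> v) \<Longrightarrow> ren \<rho> f = ren \<sigma> f"
    and ren_V: "f \<in> V X \<Longrightarrow> finite_fibres \<rho> \<Longrightarrow> ren \<rho> f \<in> V (\<rho> ` X)"
    and K_V: "K u v \<in> V {u, v}"
    and ren_K: "finite_fibres \<rho> \<Longrightarrow> ren \<rho> (K u v) = K (\<rho> u) (\<rho> v)"
    and K_self: "K v v = 0"
    and K_regular: "u \<noteq> v \<Longrightarrow> regular (K u v)"
    and K_swap: "u \<noteq> v \<Longrightarrow> \<exists>\<eta>\<in>V {u, v}. K v u = \<eta> * K u v \<and> ren (id(u := v)) \<eta> = - 1"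
    and K_dvd: "u \<noteq> v \<Longrightarrow> u \<in> X \<Longrightarrow> v \<in> X \<Longrightarrow> f \<in> V X \<Longrightarrow> ren (id(u := v)) f = 0 \<Longrightarrow> \<exists>q\<in>V X. f = K u v * q"
    and double_eq_zero: "(x::'r) + x = 0 \<Longrightarrow> x = 0"
begin

lemma V_prod: "(\<And>s. s \<in> S \<Longrightarrow> f s \<in> V X) \<Longrightarrow> (\<Prod>s\<in>S. f s) \<in> V X"
  by (induction S rule: infinite_finite_induct) (auto intro: V_mult V_one)

lemma V_sum: "(\<And>s. s \<in> S \<Longrightarrow> f s \<in> V X) \<Longrightarrow> (\<Sum>s\<in>S. f s) \<in> V X"
  by (induction S rule: infinite_finite_induct) (auto intro: V_add V_zero)

lemma V_power: "f \<in> V X \<Longrightarrow> f ^ n \<in> V X"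
  by (induction n) (auto intro: V_mult V_one)

lemma K_V_superset: "u \<in> X \<Longrightarrow> v \<in> X \<Longrightarrow> K u v \<in> V X"
  using K_V[of u v] V_mono[of "{u, v}" X] by blast

lemma ren_zero: "finite_fibres \<rho> \<Longrightarrow> ren \<rho> 0 = 0"
  using ren_add[of \<rho> 0 0] by simp

lemma ren_uminus: "finite_fibres \<rho> \<Longrightarrow> ren \<rho> (- f) = - ren \<rho> f"
  using ren_add[of \<rho> "- f" f] ren_zero[of \<rho>] by (simp add: eq_neg_iff_add_eq_0)

lemma ren_sum: "finite_fibres \<rho> \<Longrightarrow> ren \<rho> (\<Sum>s\<in>S. f s) = (\<Sum>s\<in>S. ren \<rho> (f s))"
  by (induction S rule: infinite_finite_induct) (auto simp: ren_zero ren_add)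

lemma ren_prod: "finite_fibres \<rho> \<Longrightarrow> ren \<rho> (\<Prod>s\<in>S. f s) = (\<Prod>s\<in>S. ren \<rho> (f s))"
  by (induction S rule: infinite_finite_induct) (auto simp: ren_one ren_mult)

lemma ren_power: "finite_fibres \<rho> \<Longrightarrow> ren \<rho> (f ^ n) = ren \<rho> f ^ n"
  by (induction n) (auto simp: ren_one ren_mult)

lemma K_swap_factor:
  assumes "u \<noteq> v" "u \<in> X" "v \<in> X"
  obtains \<eta> where "\<eta> \<in> V X" "K v u = \<eta> * K u v" "ren (id(u := v)) \<eta> = - 1"
  using K_swap[OF assms(1)] V_mono[of "{u, v}" X] assms(2,3) by blast

text \<open>Write \<open>T = K u v * T1\<close>. Exchanging \<open>u\<close> and \<open>v\<close>
  turns \<open>K u v\<close> into \<open>\<eta> * K u v\<close>, so \<open>T1\<close> is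
  \<open>\<eta>\<close> times its image under the exchange. At \<open>u = v\<close> this reads
  \<open>T1 = - T1\<close>, hence \<open>T1\<close> vanishes there.\<close>

lemma symmetric_dvd_K_K:
  assumes uv: "u \<noteq> v" "u \<in> X" "v \<in> X"
    and T: "ren (transpose u v) T = T" and T1: "T1 \<in> V X" "T = K u v * T1"
  shows "\<exists>q\<in>V X. T = K u v * K v u * q"
proof -
  let ?e = "id(u := v)"
  have ffe: "finite_fibres ?e" by (rule finite_fibres_upd)
  have fft: "finite_fibres (transpose u v)" by (intro inj_finite_fibres) simp
  obtain \<eta> where \<eta>: "\<eta> \<in> V X" "K v u = \<eta> * K u v" "ren ?e \<eta> = - 1" by (rule K_swap_factor[OF uv])
  obtain \<eta>' where \<eta>': "\<eta>' \<in> V X" "K u v = \<eta>' * K v u" using K_swap_factor[of v u X] uv by blast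
  have "K u v * T1 = K v u * ren (transpose u v) T1"
    using T unfolding T1(2) by (simp add: ren_mult[OF fft] ren_K[OF fft])
  also have "\<dots> = K u v * (\<eta> * ren (transpose u v) T1)" by (simp add: \<eta> mult_ac)
  finally have "T1 = \<eta> * ren (transpose u v) T1" using regular_cancel[OF K_regular[OF uv(1)]] by blast
  then have "ren ?e T1 = ren ?e \<eta> * ren (?e \<circ> transpose u v) T1"
    using ren_mult[OF ffe, of \<eta> "ren (transpose u v) T1"] ren_comp[OF ffe fft, of T1] by simp
  also have "?e \<circ> transpose u v = ?e"
    using uv(1) by (auto simp: fun_eq_iff transpose_def)
  finally have "ren ?e T1 = - ren ?e T1" unfolding \<eta>(3) mult_minus1 .
  then have "ren ?e T1 + ren ?e T1 = 0" unfolding eq_neg_iff_add_eq_0 .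
  then have "ren ?e T1 = 0" by (rule double_eq_zero)
  then obtain q where q: "q \<in> V X" "T1 = K u v * q" using K_dvd[OF uv T1(1)] by blast
  have "T = K u v * K v u * (\<eta>' * q)"
    unfolding T1(2) q(2) by (subst (2) \<eta>'(2)) (simp add: mult_ac)
  then show ?thesis using V_mult[OF \<eta>'(1) q(1)] by blast
qed

text \<open>The factors for different unordered pairs are coprime: at \<open>u = v\<close> the
  kernels of the other pairs remain kernels of distinct variables, hence regular, and the quotient has
  to vanish there.\<close>

lemma prod_pairs_dvd:
  assumes T: "T \<in> V X"
    and P: "finite P" "\<And>u v. (u, v) \<in> P \<Longrightarrow> u \<in> X \<and> v \<in> X \<and> u \<noteq> v \<and> (v, u) \<notin> P"
    and dvd: "\<And>u v. (u, v) \<in> P \<Longrightarrow> \<exists>q\<in>V X. T = K u v * K v u * q"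
  shows "\<exists>q\<in>V X. T = (\<Prod>(u, v)\<in>P. K u v * K v u) * q"
  using P dvd
proof (induction P rule: finite_induct)
  case empty
  then show ?case using T by auto
next
  case (insert p P)
  obtain u v where p: "p = (u, v)" by (cases p)
  have uv: "u \<in> X" "v \<in> X" "u \<noteq> v" "(v, u) \<notin> P" using insert.prems(1)[of u v] p by auto
  let ?e = "id(u := v)"
  have ffe: "finite_fibres ?e" by (rule finite_fibres_upd)
  have vu: "v \<noteq> u" using uv(3) by simp
  obtain \<eta> where \<eta>: "\<eta> \<in> V X" "K u v = \<eta> * K v u" using K_swap_factor[OF vu uv(2,1)] by blast
  let ?D = "\<Prod>(a, b)\<in>P. K a b * K b a"
  obtain q where q: "q \<in> V X" "T = ?D * q"
    using insert.IH insert.prems by (metis (no_types, lifting) insert_iff)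
  obtain q0 where q0: "q0 \<in> V X" "T = K u v * K v u * q0"
    using insert.prems(2)[of u v] p by auto
  have reg: "regular (ren ?e ?D)"
    unfolding ren_prod[OF ffe]
  proof (rule regular_prod)
    fix s assume s: "s \<in> P"
    obtain a b where ab: "s = (a, b)" by (cases s)
    have "a \<noteq> b" "(b, a) \<notin> P" "s \<noteq> (u, v)" "s \<noteq> (v, u)"
      using insert.prems(1)[of a b] insert.hyps s ab p uv(4) by auto
    then have "?e a \<noteq> ?e b" using ab s insert.prems(1)[of u v] p by (auto split: if_splits)
    then show "regular (ren ?e (case s of (a, b) \<Rightarrow> K a b * K b a))"
      unfolding ab using K_regular[of "?e a" "?e b"] K_regular[of "?e b" "?e a"]
      by (simp only: prod.case ren_mult[OF ffe] ren_K[OF ffe]) (intro regular_mult; simp)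
  qed
  have eK: "ren ?e (K u v) = 0" "ren ?e (K v u) = 0"
    by (simp_all add: ren_K[OF ffe] K_self)
  have "ren ?e ?D * ren ?e q = ren ?e (K u v * K v u * q0)"
    unfolding q0(2)[symmetric] q(2) ren_mult[OF ffe] ..
  also have "\<dots> = ren ?e ?D * 0" by (simp only: ren_mult[OF ffe] eK mult_zero_left mult_zero_right)
  finally have "ren ?e q = 0" unfolding regular_cancel[OF reg] .
  then obtain q1 where q1: "q1 \<in> V X" "q = K u v * q1" using K_dvd[OF uv(3,1,2) q(1)] by blast
  have "K u v * (?D * q1) = K u v * (K v u * q0)"
    using q0(2) q(2) q1(2) by (simp add: mult_ac)
  then have D1: "?D * q1 = K v u * q0" unfolding regular_cancel[OF K_regular[OF uv(3)]] .
  have "ren ?e ?D * ren ?e q1 = ren ?e (K v u * q0)"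
    using D1 ren_mult[OF ffe] by metis
  also have "\<dots> = ren ?e ?D * 0" by (simp only: ren_mult[OF ffe] eK mult_zero_left mult_zero_right)
  finally have "ren ?e q1 = 0" unfolding regular_cancel[OF reg] .
  then obtain q2 where q2: "q2 \<in> V X" "q1 = K u v * q2" using K_dvd[OF uv(3,1,2) q1(1)] by blast
  have "T = (\<Prod>(a, b)\<in>insert p P. K a b * K b a) * (\<eta> * q2)"
  proof -
    have "T = ?D * (K u v * (K u v * q2))" using q(2) q1(2) q2(2) by simp
    also have "\<dots> = ?D * (K u v * ((\<eta> * K v u) * q2))" using \<eta>(2) by simp
    finally show ?thesis using insert.hyps by (simp add: p mult_ac)
  qed
  then show ?case using V_mult[OF \<eta>(1) q2(1)] by blast
qed

definition sym :: "('i \<Rightarrow> nat) \<Rightarrow> 'r set" where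
  "sym g = {f \<in> V (vars g). \<forall>\<pi>\<in>var_perms g. ren (on_vars \<pi>) f = f}"

lemma sym_V: "f \<in> sym g \<Longrightarrow> f \<in> V (vars g)"
  by (simp add: sym_def)

lemma sym_ren: "f \<in> sym g \<Longrightarrow> \<pi> \<in> var_perms g \<Longrightarrow> ren (on_vars \<pi>) f = f"
  by (simp add: sym_def)

lemma ff_on_vars: "\<pi> \<in> var_perms g \<Longrightarrow> finite_fibres (on_vars \<pi>)"
  by (intro inj_finite_fibres inj_on_vars)

lemma ff_on_vars2: "\<pi> \<in> var_perms g \<Longrightarrow> finite_fibres (on_vars2 g1 \<pi>)"
  by (intro inj_finite_fibres inj_on_vars2)

lemma sym_zero: "0 \<in> sym g"
  by (auto simp: sym_def V_zero ren_zero[OF ff_on_vars])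

lemma sym_one: "1 \<in> sym g"
  by (auto simp: sym_def V_one ren_one[OF ff_on_vars])

lemma sym_add: "f \<in> sym g \<Longrightarrow> f' \<in> sym g \<Longrightarrow> f + f' \<in> sym g"
  by (auto simp: sym_def V_add ren_add[OF ff_on_vars])

lemma sym_uminus: "f \<in> sym g \<Longrightarrow> - f \<in> sym g"
  by (auto simp: sym_def V_uminus ren_uminus[OF ff_on_vars])

lemma sym_mult: "f \<in> sym g \<Longrightarrow> f' \<in> sym g \<Longrightarrow> f * f' \<in> sym g"
  by (auto simp: sym_def V_mult ren_mult[OF ff_on_vars])

text \<open>The two renamings differ by a permutation of the variables in each component, under
  which \<open>f\<close> is invariant. Hence a summand of the shuffle product only depends on the set
  of variables assigned to each factor.\<close>

lemma ren_sym_eq: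
  assumes f: "f \<in> sym g"
    and ff: "finite_fibres \<rho>" "finite_fibres \<rho>'"
    and inj: "inj_on \<rho> (vars g)" "inj_on \<rho>' (vars g)"
    and fst: "\<And>v. v \<in> vars g \<Longrightarrow> fst (\<rho> v) = fst v" "\<And>v. v \<in> vars g \<Longrightarrow> fst (\<rho>' v) = fst v"
    and im: "\<rho> ` vars g = \<rho>' ` vars g"
  shows "ren \<rho> f = ren \<rho>' f"
proof -
  \<comment> \<open>the permutation with \<open>\<rho> \<circ> \<pi> = \<rho>'\<close> on the
  variables of \<open>f\<close>\<close>
  define \<pi> where "\<pi> i \<alpha> = (if \<alpha> < g i then snd (inv_into (vars g) \<rho> (\<rho>' (i, \<alpha>))) else \<alpha>)" for i \<alpha>
  have iv: "inv_into (vars g) \<rho> (\<rho>' v) \<in> vars g" "\<rho> (inv_into (vars g) \<rho> (\<rho>' v)) = \<rho>' v"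
    if "v \<in> vars g" for v
    using that im inv_into_into[of "\<rho>' v" \<rho> "vars g"] f_inv_into_f[of "\<rho>' v" \<rho> "vars g"] by auto
  have \<pi>_eq: "on_vars \<pi> v = inv_into (vars g) \<rho> (\<rho>' v)" if "v \<in> vars g" for v
  proof -
    obtain i \<alpha> where v: "v = (i, \<alpha>)" by (cases v)
    have "fst (inv_into (vars g) \<rho> (\<rho>' v)) = i"
      using iv[OF that] fst[of "inv_into (vars g) \<rho> (\<rho>' v)"] fst(2)[OF that] v by simp
    then show ?thesis using that unfolding v by (intro prod_eqI) (simp_all add: \<pi>_def)
  qed
  have "\<pi> i permutes {..<g i}" for i
  proof (rule bij_imp_permutes)
    have "\<pi> i ` {..<g i} \<subseteq> {..<g i}"
    proof
      fix \<beta> assume "\<beta> \<in> \<pi> i ` {..<g i}"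
      then obtain \<alpha> where \<alpha>: "\<alpha> < g i" "\<beta> = \<pi> i \<alpha>" by auto
      then have "on_vars \<pi> (i, \<alpha>) \<in> vars g" using \<pi>_eq[of "(i, \<alpha>)"] iv(1)[of "(i, \<alpha>)"] by simp
      then show "\<beta> \<in> {..<g i}" using \<alpha> by simp
    qed
    moreover have "inj_on (\<pi> i) {..<g i}"
    proof (rule inj_onI)
      fix \<alpha> \<beta> assume *: "\<alpha> \<in> {..<g i}" "\<beta> \<in> {..<g i}" "\<pi> i \<alpha> = \<pi> i \<beta>"
      then have "on_vars \<pi> (i, \<alpha>) = on_vars \<pi> (i, \<beta>)" by simp
      then have "\<rho>' (i, \<alpha>) = \<rho>' (i, \<beta>)"
        using iv(2)[of "(i, \<alpha>)"] iv(2)[of "(i, \<beta>)"] \<pi>_eq[of "(i, \<alpha>)"] \<pi>_eq[of "(i, \<beta>)"] * by simp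
      then show "\<alpha> = \<beta>" using inj(2) * by (auto dest: inj_onD)
    qed
    ultimately show "bij_betw (\<pi> i) {..<g i} {..<g i}"
      using endo_inj_surj[of "{..<g i}" "\<pi> i"] by (simp add: bij_betw_def)
  qed (simp add: \<pi>_def)
  then have \<pi>: "\<pi> \<in> var_perms g" by (simp add: var_perms_def)
  have "ren \<rho>' f = ren (\<rho> \<circ> on_vars \<pi>) f"
    by (rule ren_cong[OF sym_V[OF f] ff(2) finite_fibres_comp[OF ff(1) ff_on_vars[OF \<pi>]]])
      (simp add: \<pi>_eq iv)
  also have "\<dots> = ren \<rho> (ren (on_vars \<pi>) f)" by (rule ren_comp[OF ff(1) ff_on_vars[OF \<pi>], symmetric])
  finally show ?thesis using sym_ren[OF f \<pi>] by simp
qed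

subsection \<open>The common denominator\<close>

text \<open>The product is taken over ordered pairs, so that it is invariant under permutations of
  the variables, in contrast to the product over increasing pairs, which picks up signs.\<close>

definition full_denom :: "('i \<Rightarrow> nat) \<Rightarrow> 'r" where
  "full_denom n = (\<Prod>(u, v)\<in>vpairs n. K u v)"

definition denom :: "('i \<Rightarrow> nat) \<Rightarrow> ('i \<Rightarrow> nat) \<Rightarrow> ('i \<Rightarrow> nat \<Rightarrow> nat) \<Rightarrow> 'r" where
  "denom g1 g2 w = (\<Prod>(u, v)\<in>mixed_pairs g1 g2 w. K u v)"

text \<open>The cofactor of \<open>denom\<close> in \<open>full_denom\<close>.\<close>

definition codenom :: "('i \<Rightarrow> nat) \<Rightarrow> ('i \<Rightarrow> nat) \<Rightarrow> ('i \<Rightarrow> nat \<Rightarrow> nat) \<Rightarrow> 'r" where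
  "codenom g1 g2 w = (\<Prod>(u, v)\<in>vpairs (\<lambda>i. g1 i + g2 i) - mixed_pairs g1 g2 w. K u v)"

definition numer :: "('i \<Rightarrow> 'i \<Rightarrow> nat) \<Rightarrow> ('i \<Rightarrow> nat) \<Rightarrow> ('i \<Rightarrow> nat) \<Rightarrow> 'r \<Rightarrow> 'r \<Rightarrow> ('i \<Rightarrow> nat \<Rightarrow> nat) \<Rightarrow> 'r" where
  "numer a g1 g2 f1 f2 w = ren (on_vars w) f1 * ren (on_vars2 g1 w) f2 *
     (\<Prod>u\<in>first_block g1 w. \<Prod>v\<in>second_block g1 g2 w. K u v ^ a (fst u) (fst v))"

definition total :: "('i \<Rightarrow> 'i \<Rightarrow> nat) \<Rightarrow> ('i \<Rightarrow> nat) \<Rightarrow> ('i \<Rightarrow> nat) \<Rightarrow> 'r \<Rightarrow> 'r \<Rightarrow> 'r" where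
  "total a g1 g2 f1 f2 = (\<Sum>w\<in>var_shuffles g1 g2. numer a g1 g2 f1 f2 w * codenom g1 g2 w)"

lemma finite_vpairs: "finite (vpairs n)"
  by (rule finite_subset[of _ "vars n \<times> vars n"]) (auto simp: vpairs_def finite_vars)

lemma regular_full_denom: "regular (full_denom n)"
  unfolding full_denom_def by (rule regular_prod) (auto simp: vpairs_def intro: K_regular)

lemma mixed_pairs_subset:
  assumes "w \<in> var_perms (\<lambda>i. g1 i + g2 i)"
  shows "mixed_pairs g1 g2 w \<subseteq> vpairs (\<lambda>i. g1 i + g2 i)"
proof
  fix p assume "p \<in> mixed_pairs g1 g2 w"
  then obtain u v where p: "p = (u, v)" "u \<in> first_block g1 w" "v \<in> second_block g1 g2 w" "fst u = fst v"
    by (auto simp: mixed_pairs_def)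
  then have "u \<in> vars (\<lambda>i. g1 i + g2 i)" "v \<in> vars (\<lambda>i. g1 i + g2 i)" "u \<noteq> v"
    using first_block_Un_second_block[OF assms] first_block_Int_second_block[OF assms] by blast+
  then show "p \<in> vpairs (\<lambda>i. g1 i + g2 i)" using p by (simp add: vpairs_def)
qed

lemma denom_codenom:
  assumes "w \<in> var_perms (\<lambda>i. g1 i + g2 i)"
  shows "denom g1 g2 w * codenom g1 g2 w = full_denom (\<lambda>i. g1 i + g2 i)"
  unfolding denom_def codenom_def full_denom_def
  using prod.subset_diff[OF mixed_pairs_subset[OF assms] finite_vpairs, of "\<lambda>(u, v). K u v"]
  by (simp add: mult.commute)

lemma shuffle_mult_eq_fraction_sum:
  "shuffle_mult ren K a g1 g2 f1 f2 = fraction_sum (var_shuffles g1 g2) (numer a g1 g2 f1 f2) (denom g1 g2)"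
proof -
  have N: "(\<Prod>i\<in>UNIV. \<Prod>j\<in>UNIV. \<Prod>\<alpha>1<g1 i. \<Prod>\<alpha>2<g2 j. K (on_vars w (i, \<alpha>1)) (on_vars2 g1 w (j, \<alpha>2)) ^ a i j)
      = (\<Prod>u\<in>first_block g1 w. \<Prod>v\<in>second_block g1 g2 w. K u v ^ a (fst u) (fst v))"
    if "w \<in> var_shuffles g1 g2" for w
    using prod_blocks[OF shuffle_perm[OF that], of "\<lambda>u v. K u v ^ a (fst u) (fst v)"] by simp
  have D: "(\<Prod>i\<in>UNIV. \<Prod>\<alpha>1<g1 i. \<Prod>\<alpha>2<g2 i. K (on_vars w (i, \<alpha>1)) (on_vars2 g1 w (i, \<alpha>2))) = denom g1 g2 w"
    if "w \<in> var_shuffles g1 g2" for w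
  proof -
    have "denom g1 g2 w = (\<Prod>p\<in>first_block g1 w \<times> second_block g1 g2 w. if fst (fst p) = fst (snd p) then K (fst p) (snd p) else 1)"
      unfolding denom_def
      by (rule prod.mono_neutral_cong_left) (auto simp: mixed_pairs_def finite_blocks)
    also have "\<dots> = (\<Prod>u\<in>first_block g1 w. \<Prod>v\<in>second_block g1 g2 w. if fst u = fst v then K u v else 1)"
      by (simp add: prod.cartesian_product split_def)
    also have "\<dots> = (\<Prod>i\<in>UNIV. \<Prod>j\<in>UNIV. \<Prod>\<alpha>1<g1 i. \<Prod>\<alpha>2<g2 j.
          if i = j then K (on_vars w (i, \<alpha>1)) (on_vars2 g1 w (j, \<alpha>2)) else 1)"
      using prod_blocks[OF shuffle_perm[OF that], of "\<lambda>u v. if fst u = fst v then K u v else 1"] by simp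
    also have "\<dots> = (\<Prod>i\<in>UNIV. \<Prod>j\<in>UNIV. if j = i then \<Prod>\<alpha>1<g1 i. \<Prod>\<alpha>2<g2 j.
          K (on_vars w (i, \<alpha>1)) (on_vars2 g1 w (j, \<alpha>2)) else 1)"
      by (intro prod.cong[OF refl]) auto
    finally show ?thesis by simp
  qed
  show ?thesis
    unfolding shuffle_mult_def by (rule fraction_sum_cong) (simp_all only: N D numer_def)
qed

lemma shuffle_mult_eqI:
  assumes "q * full_denom (\<lambda>i. g1 i + g2 i) = total a g1 g2 f1 f2"
  shows "shuffle_mult ren K a g1 g2 f1 f2 = q"
  unfolding shuffle_mult_eq_fraction_sum
  by (rule fraction_sum_common_denominator[OF finite_var_shuffles regular_full_denom denom_codenom[OF shuffle_perm]])
    (use assms in \<open>simp_all add: total_def\<close>)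

lemma ren_mixed:
  assumes \<pi>: "\<pi> \<in> var_perms (\<lambda>i. g1 i + g2 i)" and w: "w \<in> var_perms (\<lambda>i. g1 i + g2 i)"
  shows "ren (on_vars \<pi>) (codenom g1 g2 w) = codenom g1 g2 (\<lambda>i. \<pi> i \<circ> w i)"
    and "ren (on_vars \<pi>) (numer a g1 g2 f1 f2 w) = numer a g1 g2 f1 f2 (\<lambda>i. \<pi> i \<circ> w i)"
proof -
  let ?p = "map_prod (on_vars \<pi>) (on_vars \<pi>)"
  have inj: "inj (on_vars \<pi>)" by (rule inj_on_vars[OF \<pi>])
  have injp: "inj ?p" using inj by (simp add: prod.inj_map)
  have ff: "finite_fibres (on_vars \<pi>)" by (rule ff_on_vars[OF \<pi>])
  have f: "fst (on_vars \<pi> v) = fst v" for v by (cases v) simp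
  have "?p ` vpairs (\<lambda>i. g1 i + g2 i) = vpairs (\<lambda>i. g1 i + g2 i)"
  proof -
    have iff: "?p p \<in> vpairs (\<lambda>i. g1 i + g2 i) \<longleftrightarrow> p \<in> vpairs (\<lambda>i. g1 i + g2 i)" for p
    proof -
      have "on_vars \<pi> v \<in> vars (\<lambda>i. g1 i + g2 i) \<longleftrightarrow> v \<in> vars (\<lambda>i. g1 i + g2 i)" for v
        using inj_image_mem_iff[OF inj, of v "vars (\<lambda>i. g1 i + g2 i)"] on_vars_image_vars[OF \<pi>] by simp
      moreover have "on_vars \<pi> u = on_vars \<pi> v \<longleftrightarrow> u = v" for u v by (rule inj_eq[OF inj])
      ultimately show ?thesis unfolding vpairs_def by (cases p) (simp only: map_prod_simp mem_Collect_eq prod.case f)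
    qed
    have "?p ` vpairs (\<lambda>i. g1 i + g2 i) \<subseteq> vpairs (\<lambda>i. g1 i + g2 i)"
      unfolding image_subset_iff iff by simp
    then show ?thesis by (rule endo_inj_surj[OF finite_vpairs _ inj_on_subset[OF injp subset_UNIV]])
  qed
  moreover have "mixed_pairs g1 g2 (\<lambda>i. \<pi> i \<circ> w i) = ?p ` mixed_pairs g1 g2 w"
    by (force simp: mixed_pairs_def blocks_comp f)
  ultimately have im: "vpairs (\<lambda>i. g1 i + g2 i) - mixed_pairs g1 g2 (\<lambda>i. \<pi> i \<circ> w i)
      = ?p ` (vpairs (\<lambda>i. g1 i + g2 i) - mixed_pairs g1 g2 w)"
    by (simp add: image_set_diff[OF injp])
  show "ren (on_vars \<pi>) (codenom g1 g2 w) = codenom g1 g2 (\<lambda>i. \<pi> i \<circ> w i)"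
    unfolding codenom_def im
    by (subst prod.reindex[OF inj_on_subset[OF injp subset_UNIV]])
      (auto simp: ren_prod[OF ff] ren_K[OF ff] split_def intro!: prod.cong)
  have "(\<Prod>u\<in>on_vars \<pi> ` first_block g1 w. \<Prod>v\<in>on_vars \<pi> ` second_block g1 g2 w. K u v ^ a (fst u) (fst v))
     = (\<Prod>u\<in>first_block g1 w. \<Prod>v\<in>second_block g1 g2 w. K (on_vars \<pi> u) (on_vars \<pi> v) ^ a (fst u) (fst v))"
    by (simp add: prod.reindex[OF inj_on_subset[OF inj subset_UNIV]] f)
  then show "ren (on_vars \<pi>) (numer a g1 g2 f1 f2 w) = numer a g1 g2 f1 f2 (\<lambda>i. \<pi> i \<circ> w i)"
    unfolding numer_def blocks_comp
    by (simp add: ren_mult[OF ff] ren_prod[OF ff] ren_power[OF ff] ren_K[OF ff]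
        ren_comp[OF ff ff_on_vars[OF w]] ren_comp[OF ff ff_on_vars2[OF w]] on_vars_comp)
qed

lemma ren_full_denom:
  assumes \<pi>: "\<pi> \<in> var_perms n"
  shows "ren (on_vars \<pi>) (full_denom n) = full_denom n"
proof -
  have id: "(\<lambda>i. id) \<in> var_perms n" by (simp add: var_perms_def permutes_id)
  have f1: "full_denom n = codenom n (\<lambda>i. 0) v" for v
    by (simp add: full_denom_def codenom_def mixed_pairs_def second_block_def vars_def)
  show ?thesis
    using ren_mixed(1)[of \<pi> n "\<lambda>i. 0" "\<lambda>i. id"] \<pi> id by (simp flip: f1)
qed

lemma numer_codenom_first_block:
  assumes w: "w \<in> var_perms (\<lambda>i. g1 i + g2 i)" and w': "w' \<in> var_perms (\<lambda>i. g1 i + g2 i)"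
    and L: "first_block g1 w = first_block g1 w'" and f1: "f1 \<in> sym g1" and f2: "f2 \<in> sym g2"
  shows "numer a g1 g2 f1 f2 w * codenom g1 g2 w = numer a g1 g2 f1 f2 w' * codenom g1 g2 w'"
proof -
  have R: "second_block g1 g2 w = second_block g1 g2 w'"
    using L by (simp add: second_block_eq w w')
  have f: "fst (on_vars \<pi> v) = fst v" "fst (on_vars2 g1 \<pi> v) = fst v" for \<pi> v by (cases v, simp)+
  have "ren (on_vars w) f1 = ren (on_vars w') f1"
    using L by (intro ren_sym_eq[OF f1] ff_on_vars[OF w] ff_on_vars[OF w'] inj_on_subset[OF inj_on_vars[OF w]]
        inj_on_subset[OF inj_on_vars[OF w']] f subset_UNIV) (simp add: first_block_def)
  moreover have "ren (on_vars2 g1 w) f2 = ren (on_vars2 g1 w') f2"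
    using R by (intro ren_sym_eq[OF f2] ff_on_vars2[OF w] ff_on_vars2[OF w'] inj_on_subset[OF inj_on_vars2[OF w]]
        inj_on_subset[OF inj_on_vars2[OF w']] f subset_UNIV) (simp add: second_block_def)
  ultimately show ?thesis by (simp add: numer_def codenom_def mixed_pairs_def L R)
qed

lemma ren_total:
  assumes \<pi>: "\<pi> \<in> var_perms (\<lambda>i. g1 i + g2 i)" and f1: "f1 \<in> sym g1" and f2: "f2 \<in> sym g2"
  shows "ren (on_vars \<pi>) (total a g1 g2 f1 f2) = total a g1 g2 f1 f2"
proof -
  have ff: "finite_fibres (on_vars \<pi>)" by (rule ff_on_vars[OF \<pi>])
  have "ren (on_vars \<pi>) (total a g1 g2 f1 f2) = (\<Sum>w\<in>var_shuffles g1 g2.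
      numer a g1 g2 f1 f2 (\<lambda>i. \<pi> i \<circ> w i) * codenom g1 g2 (\<lambda>i. \<pi> i \<circ> w i))"
    unfolding total_def ren_sum[OF ff] ren_mult[OF ff]
    by (rule sum.cong[OF refl]) (simp add: ren_mixed[OF \<pi> shuffle_perm])
  also have "\<dots> = total a g1 g2 f1 f2"
    unfolding total_def
    by (rule sum_shuffles_comp[OF \<pi>]) (rule numer_codenom_first_block[OF _ _ _ f1 f2])
  finally show ?thesis .
qed

lemma numer_V:
  assumes w: "w \<in> var_perms (\<lambda>i. g1 i + g2 i)" and f1: "f1 \<in> V (vars g1)" and f2: "f2 \<in> V (vars g2)"
  shows "numer a g1 g2 f1 f2 w \<in> V (vars (\<lambda>i. g1 i + g2 i))"
proof -
  have sub: "first_block g1 w \<subseteq> vars (\<lambda>i. g1 i + g2 i)" "second_block g1 g2 w \<subseteq> vars (\<lambda>i. g1 i + g2 i)"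
    using first_block_Un_second_block[OF w] by auto
  have "ren (on_vars w) f1 \<in> V (vars (\<lambda>i. g1 i + g2 i))" "ren (on_vars2 g1 w) f2 \<in> V (vars (\<lambda>i. g1 i + g2 i))"
    using ren_V[OF f1 ff_on_vars[OF w]] ren_V[OF f2 ff_on_vars2[OF w]] V_mono[OF sub(1)] V_mono[OF sub(2)]
    by (auto simp: first_block_def second_block_def)
  then show ?thesis
    unfolding numer_def using sub by (intro V_mult V_prod V_power K_V_superset) auto
qed

lemma K_dvd_total:
  assumes uv: "u \<noteq> v" "fst u = fst v" "u \<in> vars (\<lambda>i. g1 i + g2 i)" "v \<in> vars (\<lambda>i. g1 i + g2 i)"
    and f1: "f1 \<in> V (vars g1)" and f2: "f2 \<in> V (vars g2)"
  shows "\<exists>q\<in>V (vars (\<lambda>i. g1 i + g2 i)). total a g1 g2 f1 f2 = K u v * q"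
proof -
  let ?X = "vars (\<lambda>i. g1 i + g2 i)"
  have KV: "(\<Prod>(u, v)\<in>P. K u v) \<in> V ?X" if "P \<subseteq> vpairs (\<lambda>i. g1 i + g2 i)" for P
    using that by (intro V_prod) (auto simp: vpairs_def intro!: K_V_superset)
  have "\<exists>q\<in>V ?X. codenom g1 g2 w = K u v * q" if w: "w \<in> var_shuffles g1 g2" for w
  proof -
    let ?P = "vpairs (\<lambda>i. g1 i + g2 i) - mixed_pairs g1 g2 w"
    have fin: "finite ?P" using finite_vpairs by blast
    have "(u, v) \<in> ?P \<or> (v, u) \<in> ?P"
      using uv first_block_Int_second_block[OF shuffle_perm[OF w]] by (auto simp: vpairs_def mixed_pairs_def)
    then show ?thesis
    proof
      assume *: "(u, v) \<in> ?P"
      then show ?thesis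
        unfolding codenom_def using prod.remove[OF fin *, of "\<lambda>(u, v). K u v"] KV[of "?P - {(u, v)}"] by auto
    next
      assume *: "(v, u) \<in> ?P"
      obtain \<eta> where \<eta>: "\<eta> \<in> V ?X" "K v u = \<eta> * K u v" using K_swap_factor[OF uv(1,3,4)] by blast
      have "codenom g1 g2 w = K u v * (\<eta> * (\<Prod>(u, v)\<in>?P - {(v, u)}. K u v))"
        unfolding codenom_def using prod.remove[OF fin *, of "\<lambda>(u, v). K u v"] \<eta>(2) by (simp add: mult_ac)
      moreover have "(\<Prod>(u, v)\<in>?P - {(v, u)}. K u v) \<in> V ?X" by (rule KV) auto
      ultimately show ?thesis using V_mult[OF \<eta>(1)] by blast
    qed
  qed
  then obtain q where q: "\<And>w. w \<in> var_shuffles g1 g2 \<Longrightarrow> q w \<in> V ?X"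
    "\<And>w. w \<in> var_shuffles g1 g2 \<Longrightarrow> codenom g1 g2 w = K u v * q w" by metis
  have "total a g1 g2 f1 f2 = K u v * (\<Sum>w\<in>var_shuffles g1 g2. numer a g1 g2 f1 f2 w * q w)"
    unfolding total_def sum_distrib_left by (rule sum.cong[OF refl]) (simp add: q mult_ac)
  moreover have "(\<Sum>w\<in>var_shuffles g1 g2. numer a g1 g2 f1 f2 w * q w) \<in> V ?X"
    by (intro V_sum V_mult q numer_V[OF shuffle_perm f1 f2])
  ultimately show ?thesis by blast
qed

text \<open>The total numerator is symmetric, and every cofactor contains \<open>K u v\<close> or
  \<open>K v u\<close>, since only one of the two ordered pairs can run from the first to the second
  block of a shuffle.\<close>

lemma full_denom_dvd_total:
  assumes f1: "f1 \<in> sym g1" and f2: "f2 \<in> sym g2"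
  shows "\<exists>q\<in>V (vars (\<lambda>i. g1 i + g2 i)). total a g1 g2 f1 f2 = full_denom (\<lambda>i. g1 i + g2 i) * q"
proof -
  let ?n = "\<lambda>i. g1 i + g2 i"
  \<comment> \<open>one ordered pair for every unordered one\<close>
  let ?P = "{(u, v) \<in> vpairs ?n. snd u < snd v}"
  have swap: "\<exists>\<pi>\<in>var_perms ?n. on_vars \<pi> = transpose u v" if uv: "(u, v) \<in> vpairs ?n" for u v
  proof -
    obtain i \<alpha> \<beta> where u: "u = (i, \<alpha>)" and v: "v = (i, \<beta>)" using uv by (cases u; cases v) (auto simp: vpairs_def)
    let ?\<pi> = "\<lambda>j. if j = i then transpose \<alpha> \<beta> else id"
    have "?\<pi> \<in> var_perms ?n"
      using uv permutes_swap_id[of \<alpha> "{..<?n i}" \<beta>] by (auto simp: var_perms_def vpairs_def u v permutes_id)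
    moreover have "on_vars ?\<pi> = transpose u v" by (auto simp: fun_eq_iff transpose_def u v)
    ultimately show ?thesis by blast
  qed
  have "\<exists>q\<in>V (vars ?n). total a g1 g2 f1 f2 = (\<Prod>(u, v)\<in>?P. K u v * K v u) * q"
  proof (rule prod_pairs_dvd)
    show "total a g1 g2 f1 f2 \<in> V (vars ?n)"
      unfolding total_def codenom_def
      by (intro V_sum V_mult V_prod numer_V[OF shuffle_perm sym_V[OF f1] sym_V[OF f2]])
        (auto simp: vpairs_def intro!: K_V_superset)
    show "finite ?P" by (rule finite_subset[OF _ finite_vpairs[of ?n]]) auto
    fix u v assume uv: "(u, v) \<in> ?P"
    then show "u \<in> vars ?n \<and> v \<in> vars ?n \<and> u \<noteq> v \<and> (v, u) \<notin> ?P" by (auto simp: vpairs_def)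
    have uv': "u \<noteq> v" "fst u = fst v" "u \<in> vars ?n" "v \<in> vars ?n" "(u, v) \<in> vpairs ?n"
      using uv by (auto simp: vpairs_def)
    obtain \<pi> where "\<pi> \<in> var_perms ?n" "on_vars \<pi> = transpose u v" using swap[OF uv'(5)] by blast
    then have "ren (transpose u v) (total a g1 g2 f1 f2) = total a g1 g2 f1 f2"
      using ren_total[OF _ f1 f2] by metis
    moreover obtain q where "q \<in> V (vars ?n)" "total a g1 g2 f1 f2 = K u v * q"
      using K_dvd_total[OF uv'(1-4) sym_V[OF f1] sym_V[OF f2]] by blast
    ultimately show "\<exists>q\<in>V (vars ?n). total a g1 g2 f1 f2 = K u v * K v u * q"
      using symmetric_dvd_K_K[OF uv'(1,3,4)] by blast
  qed
  moreover have "full_denom ?n = (\<Prod>(u, v)\<in>?P. K u v * K v u)"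
  proof -
    let ?s = "\<lambda>(u, v). (v, u) :: 'i var \<times> 'i var"
    have finP: "finite ?P" by (rule finite_subset[OF _ finite_vpairs[of ?n]]) auto
    have "vpairs ?n = ?P \<union> ?s ` ?P"
    proof (intro equalityI subsetI)
      fix p assume p: "p \<in> vpairs ?n"
      obtain u v where uv: "p = (u, v)" by (cases p)
      then have "snd u < snd v \<or> snd v < snd u" using p by (auto simp: vpairs_def prod_eq_iff)
      then show "p \<in> ?P \<union> ?s ` ?P"
      proof
        assume "snd v < snd u"
        then have "(v, u) \<in> ?P" using p uv by (auto simp: vpairs_def)
        then show ?thesis using uv by (intro UnI2 image_eqI[of _ _ "(v, u)"]) auto
      qed (use p uv in auto)
    qed (auto simp: vpairs_def)
    moreover have "?P \<inter> ?s ` ?P = {}" by auto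
    ultimately have "full_denom ?n = (\<Prod>(u, v)\<in>?P. K u v) * (\<Prod>(u, v)\<in>?s ` ?P. K u v)"
      unfolding full_denom_def using prod.union_disjoint[OF finP finite_imageI[OF finP], of ?s "\<lambda>(u, v). K u v"] by metis
    also have "(\<Prod>(u, v)\<in>?s ` ?P. K u v) = (\<Prod>(u, v)\<in>?P. K v u)"
      by (subst prod.reindex) (auto simp: inj_on_def split_def)
    finally show ?thesis by (simp add: prod.distrib[symmetric] split_def)
  qed
  ultimately show ?thesis by simp
qed

theorem shuffle_mult:
  assumes f1: "f1 \<in> sym g1" and f2: "f2 \<in> sym g2"
  shows "shuffle_mult ren K a g1 g2 f1 f2 \<in> sym (\<lambda>i. g1 i + g2 i)"
    and "shuffle_mult ren K a g1 g2 f1 f2 * full_denom (\<lambda>i. g1 i + g2 i) = total a g1 g2 f1 f2"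
proof -
  let ?n = "\<lambda>i. g1 i + g2 i"
  obtain q where q: "q \<in> V (vars ?n)" "q * full_denom ?n = total a g1 g2 f1 f2"
    using full_denom_dvd_total[OF f1 f2, of a] by (metis mult.commute)
  have "ren (on_vars \<pi>) q = q" if \<pi>: "\<pi> \<in> var_perms ?n" for \<pi>
  proof -
    have "ren (on_vars \<pi>) q * full_denom ?n = ren (on_vars \<pi>) (q * full_denom ?n)"
      by (simp add: ren_mult[OF ff_on_vars[OF \<pi>]] ren_full_denom[OF \<pi>])
    also have "\<dots> = q * full_denom ?n" unfolding q(2) by (rule ren_total[OF \<pi> f1 f2])
    finally show ?thesis unfolding regular_cancel_right[OF regular_full_denom] .
  qed
  then have "q \<in> sym ?n" using q(1) by (simp add: sym_def)
  moreover have "shuffle_mult ren K a g1 g2 f1 f2 = q" by (rule shuffle_mult_eqI[OF q(2)])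
  ultimately show "shuffle_mult ren K a g1 g2 f1 f2 \<in> sym ?n"
    "shuffle_mult ren K a g1 g2 f1 f2 * full_denom ?n = total a g1 g2 f1 f2" using q(2) by simp_all
qed

lemma numer_add:
  assumes "w \<in> var_perms (\<lambda>i. g1 i + g2 i)"
  shows "numer a g1 g2 (f1 + f1') f2 w = numer a g1 g2 f1 f2 w + numer a g1 g2 f1' f2 w"
    and "numer a g1 g2 f1 (f2 + f2') w = numer a g1 g2 f1 f2 w + numer a g1 g2 f1 f2' w"
  by (simp_all add: numer_def ren_add[OF ff_on_vars[OF assms]] ren_add[OF ff_on_vars2[OF assms]] algebra_simps)

lemma total_add:
  "total a g1 g2 (f1 + f1') f2 = total a g1 g2 f1 f2 + total a g1 g2 f1' f2"
  "total a g1 g2 f1 (f2 + f2') = total a g1 g2 f1 f2 + total a g1 g2 f1 f2'"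
  unfolding total_def sum.distrib[symmetric]
  by (rule sum.cong[OF refl]; simp add: numer_add[OF shuffle_perm] algebra_simps)+

lemma shuffle_mult_add_left:
  assumes "f1 \<in> sym g1" "f1' \<in> sym g1" "f2 \<in> sym g2"
  shows "shuffle_mult ren K a g1 g2 (f1 + f1') f2 = shuffle_mult ren K a g1 g2 f1 f2 + shuffle_mult ren K a g1 g2 f1' f2"
  by (rule shuffle_mult_eqI) (simp add: total_add distrib_right shuffle_mult assms)

lemma shuffle_mult_add_right:
  assumes "f1 \<in> sym g1" "f2 \<in> sym g2" "f2' \<in> sym g2"
  shows "shuffle_mult ren K a g1 g2 f1 (f2 + f2') = shuffle_mult ren K a g1 g2 f1 f2 + shuffle_mult ren K a g1 g2 f1 f2'"
  by (rule shuffle_mult_eqI) (simp add: total_add distrib_right shuffle_mult assms)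

end

section \<open>Monomials and power series\<close>

abbreviation "keys \<equiv> Poly_Mapping.keys"
abbreviation "lookup \<equiv> Poly_Mapping.lookup"
abbreviation "single \<equiv> Poly_Mapping.single"

lemma lookup_sum_single:
  "finite S \<Longrightarrow> lookup (\<Sum>v\<in>S. single (\<rho> v) (h v)) w = (\<Sum>v\<in>{v\<in>S. \<rho> v = w}. h v)"
  by (simp add: lookup_sum lookup_single when_def sum.inter_filter)

lemma rename_monom_superset:
  assumes "finite S" "keys m \<subseteq> S"
  shows "rename_monom \<rho> m = (\<Sum>v\<in>S. single (\<rho> v) (lookup m v))"
  unfolding rename_monom_def
  by (rule sum.mono_neutral_left) (use assms in \<open>auto simp: in_keys_iff\<close>)

lemma rename_monom_add: "rename_monom \<rho> (m + n) = rename_monom \<rho> m + rename_monom \<rho> n"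
proof -
  let ?S = "keys m \<union> keys n"
  have "finite ?S" "keys (m + n) \<subseteq> ?S" by (simp_all add: keys_add)
  then show ?thesis
    by (simp add: rename_monom_superset[of ?S] lookup_add single_add sum.distrib)
qed

lemma rename_monom_zero [simp]: "rename_monom \<rho> 0 = 0"
  by (simp add: rename_monom_def)

lemma rename_monom_single [simp]: "rename_monom \<rho> (single v k) = single (\<rho> v) k"
  by (cases "k = 0") (simp_all add: rename_monom_def)

lemma rename_monom_sum: "rename_monom \<rho> (\<Sum>s\<in>S. f s) = (\<Sum>s\<in>S. rename_monom \<rho> (f s))"
  by (induction S rule: infinite_finite_induct) (simp_all add: rename_monom_add)

lemma rename_monom_comp: "rename_monom \<rho> (rename_monom \<sigma> m) = rename_monom (\<rho> \<circ> \<sigma>) m"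
  by (simp only: rename_monom_def[of \<sigma> m] rename_monom_sum rename_monom_single)
    (simp add: rename_monom_def[of "\<rho> \<circ> \<sigma>"])

lemma rename_monom_cong:
  "(\<And>v. v \<in> keys m \<Longrightarrow> \<rho> v = \<sigma> v) \<Longrightarrow> rename_monom \<rho> m = rename_monom \<sigma> m"
  by (simp add: rename_monom_def)

lemma lookup_rename_monom:
  "lookup (rename_monom \<rho> m) w = (\<Sum>v\<in>{v\<in>keys m. \<rho> v = w}. lookup m v)"
  unfolding rename_monom_def by (rule lookup_sum_single) simp

lemma keys_rename_monom: "keys (rename_monom \<rho> m) \<subseteq> \<rho> ` keys m"
proof
  fix w assume "w \<in> keys (rename_monom \<rho> m)"
  then have "{v\<in>keys m. \<rho> v = w} \<noteq> {}"
    unfolding in_keys_iff lookup_rename_monom by (metis sum.empty)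
  then show "w \<in> \<rho> ` keys m" by blast
qed

lemma keys_rename_monom_nat:
  "keys (rename_monom \<rho> (m :: 'v \<Rightarrow>\<^sub>0 nat)) = \<rho> ` keys m"
proof (rule antisym[OF keys_rename_monom])
  show "\<rho> ` keys m \<subseteq> keys (rename_monom \<rho> m)"
    by (auto simp: in_keys_iff[of _ "rename_monom _ _"] lookup_rename_monom sum_eq_0_iff) (auto simp: in_keys_iff)
qed

lemma mdeg_superset: "finite S \<Longrightarrow> keys m \<subseteq> S \<Longrightarrow> mdeg m = (\<Sum>v\<in>S. lookup m v)"
  unfolding mdeg_def by (rule sum.mono_neutral_left) (auto simp: in_keys_iff)

lemma mdeg_add: "mdeg (m + n) = mdeg m + mdeg n"
proof -
  let ?S = "keys m \<union> keys n"
  have "finite ?S" "keys (m + n) \<subseteq> ?S" by (simp_all add: keys_add)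
  then show ?thesis by (simp add: mdeg_superset[of ?S] lookup_add sum.distrib)
qed

lemma mdeg_zero [simp]: "mdeg 0 = 0"
  by (simp add: mdeg_def)

lemma mdeg_single [simp]: "mdeg (single v k) = k"
  by (cases "k = 0") (simp_all add: mdeg_def)

lemma mdeg_sum: "mdeg (\<Sum>s\<in>S. f s) = (\<Sum>s\<in>S. mdeg (f s))"
  by (induction S rule: infinite_finite_induct) (simp_all add: mdeg_add)

lemma mdeg_rename_monom [simp]: "mdeg (rename_monom \<rho> m) = mdeg m"
  by (simp only: rename_monom_def mdeg_sum mdeg_single) (simp add: mdeg_def)

lemma finite_bounded_monomials:
  assumes "finite X"
  shows "finite {m :: 'v \<Rightarrow>\<^sub>0 nat. keys m \<subseteq> X \<and> mdeg m \<le> d}"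
proof -
  let ?F = "{f. \<forall>v. (v \<in> X \<longrightarrow> f v \<in> {..d}) \<and> (v \<notin> X \<longrightarrow> f v = 0)}"
  have "finite (lookup -` ?F :: ('v \<Rightarrow>\<^sub>0 nat) set)"
    by (rule finite_vimageI[OF finite_set_of_finite_funs])
      (use assms in \<open>auto intro: injI poly_mapping_eqI\<close>)
  moreover have "lookup m v \<le> mdeg m" for m :: "'v \<Rightarrow>\<^sub>0 nat" and v
    by (cases "v \<in> keys m") (auto simp: mdeg_def in_keys_iff intro: member_le_sum)
  then have "{m :: 'v \<Rightarrow>\<^sub>0 nat. keys m \<subseteq> X \<and> mdeg m \<le> d} \<subseteq> lookup -` ?F"
    by (auto simp: in_keys_iff intro: le_trans)
  ultimately show ?thesis by (rule rev_finite_subset)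
qed

lemma finite_rename_monom_fibre:
  assumes "finite_fibres \<rho>"
  shows "finite {n :: 'v \<Rightarrow>\<^sub>0 nat. rename_monom \<rho> n = m}"
proof (rule finite_subset[OF _ finite_bounded_monomials[of "\<rho> -` keys m" "mdeg m"]])
  show "{n. rename_monom \<rho> n = m} \<subseteq> {n. keys n \<subseteq> \<rho> -` keys m \<and> mdeg n \<le> mdeg m}"
    using keys_rename_monom_nat[of \<rho>] by auto
  have "\<rho> -` keys m = (\<Union>w\<in>keys m. \<rho> -` {w})" by auto
  then show "finite (\<rho> -` keys m)" using assms by (simp add: finite_fibres_def)
qed

lemma mcoeff_simps [simp]:
  "mcoeff 0 m = 0" "mcoeff (f + g) m = mcoeff f m + mcoeff g m"
  "mcoeff (f - g) m = mcoeff f m - mcoeff g m" "mcoeff (- f) m = - mcoeff f m"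
  "mcoeff (Abs_mfps h) m = h m"
  by (simp_all add: zero_mfps.rep_eq plus_mfps.rep_eq minus_mfps.rep_eq uminus_mfps.rep_eq Abs_mfps_inverse)

lemma mcoeff_one: "mcoeff 1 m = (if m = 0 then 1 else 0)"
  by (simp add: one_mfps.rep_eq)

lemma mcoeff_mult: "mcoeff (f * g) m = (\<Sum>(p, q)\<in>splits m. mcoeff f p * mcoeff g q)"
  by (simp add: times_mfps.rep_eq)

lemma mcoeff_sum: "mcoeff (\<Sum>s\<in>S. f s) m = (\<Sum>s\<in>S. mcoeff (f s) m)"
  by (induction S rule: infinite_finite_induct) simp_all

definition mfps_monom :: "('v \<Rightarrow>\<^sub>0 nat) \<Rightarrow> 'k::comm_ring_1 \<Rightarrow> ('v, 'k) mfps" where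
  "mfps_monom m c = Abs_mfps (\<lambda>n. if n = m then c else 0)"

lemma mcoeff_monom: "mcoeff (mfps_monom m c) n = (if n = m then c else 0)"
  by (simp add: mfps_monom_def)

lemma mcoeff_monom_mult_add: "mcoeff (mfps_monom m c * f) (m + n) = c * mcoeff f n"
proof -
  have "mcoeff (mfps_monom m c * f) (m + n) = (\<Sum>(p, q)\<in>{(m, n)}. mcoeff (mfps_monom m c) p * mcoeff f q)"
    unfolding mcoeff_mult
    by (rule sum.mono_neutral_right[OF finite_splits]) (auto simp: splits_def mcoeff_monom split: if_splits)
  then show ?thesis by (simp add: mcoeff_monom)
qed

lemma mcoeff_monom_mult_eq_0: "(\<And>n. k \<noteq> m + n) \<Longrightarrow> mcoeff (mfps_monom m c * f) k = 0"
  unfolding mcoeff_mult by (rule sum.neutral) (auto simp: splits_def mcoeff_monom)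

lemma mfps_monom_mult: "mfps_monom m c * mfps_monom n d = mfps_monom (m + n) (c * d)"
proof (rule mfps_eqI)
  fix k
  show "mcoeff (mfps_monom m c * mfps_monom n d) k = mcoeff (mfps_monom (m + n) (c * d)) k"
  proof (cases "\<exists>l. k = m + l")
    case True
    then show ?thesis by (auto simp: mcoeff_monom_mult_add mcoeff_monom)
  next
    case False
    then show ?thesis by (subst mcoeff_monom_mult_eq_0) (auto simp: mcoeff_monom)
  qed
qed

lemma mfps_var_eq_monom: "mfps_var v = mfps_monom (single v 1) 1"
  by (simp add: mfps_var_def mfps_monom_def)

lemma mfps_const_eq_monom: "mfps_const c = mfps_monom 0 c"
  by (simp add: mfps_const_def mfps_monom_def)

lemma mfps_monom_zero_one [simp]: "mfps_monom 0 1 = 1"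
  by (rule mfps_eqI) (simp add: mcoeff_monom mcoeff_one)

lemma mfps_monom_add: "mfps_monom m (c + d) = mfps_monom m c + mfps_monom m d"
  by (rule mfps_eqI) (simp add: mcoeff_monom)

lemma mcoeff_var_mult_add: "mcoeff (mfps_var v * f) (m + single v 1) = mcoeff f m"
  using mcoeff_monom_mult_add[of "single v 1" 1 f m]
  by (simp add: mfps_var_eq_monom add.commute)

lemma mcoeff_var_mult_eq_0: "lookup m v = 0 \<Longrightarrow> mcoeff (mfps_var v * f) m = 0"
  unfolding mfps_var_eq_monom by (rule mcoeff_monom_mult_eq_0) (auto simp: lookup_add)

subsection \<open>Renaming variables\<close>

lemma mcoeff_rename: "mcoeff (rename_mfps \<rho> f) m = (\<Sum>n | rename_monom \<rho> n = m. mcoeff f n)"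
  by (simp add: rename_mfps_def)

lemma rename_mfps_add: "rename_mfps \<rho> (f + g) = rename_mfps \<rho> f + rename_mfps \<rho> g"
  by (rule mfps_eqI) (simp add: mcoeff_rename sum.distrib)

lemma rename_mfps_mult:
  assumes ff: "finite_fibres \<rho>"
  shows "rename_mfps \<rho> (f * g) = rename_mfps \<rho> f * rename_mfps \<rho> g"
proof (rule mfps_eqI)
  fix m
  note fin = finite_rename_monom_fibre[OF ff]
  have "mcoeff (rename_mfps \<rho> (f * g)) m = (\<Sum>(n, p, q)\<in>Sigma {n. rename_monom \<rho> n = m} splits. mcoeff f p * mcoeff g q)"
    unfolding mcoeff_rename mcoeff_mult by (subst sum.Sigma) (auto simp: fin finite_splits split_def)
  also have "\<dots> = (\<Sum>((P, Q), p, q)\<in>Sigma (splits m) (\<lambda>(P, Q). {n. rename_monom \<rho> n = P} \<times> {n. rename_monom \<rho> n = Q}).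
      mcoeff f p * mcoeff g q)"
    by (rule sum.reindex_bij_witness[where
          i = "\<lambda>((P, Q), p, q). (p + q, p, q)" and j = "\<lambda>(n, p, q). ((rename_monom \<rho> p, rename_monom \<rho> q), p, q)"])
      (auto simp: splits_def rename_monom_add)
  also have "\<dots> = (\<Sum>(P, Q)\<in>splits m. \<Sum>(p, q)\<in>{n. rename_monom \<rho> n = P} \<times> {n. rename_monom \<rho> n = Q}. mcoeff f p * mcoeff g q)"
    by (subst sum.Sigma[symmetric]) (auto simp: fin finite_splits split_def)
  also have "\<dots> = mcoeff (rename_mfps \<rho> f * rename_mfps \<rho> g) m"
    unfolding mcoeff_mult mcoeff_rename
    by (simp add: sum_product sum.cartesian_product)
  finally show "mcoeff (rename_mfps \<rho> (f * g)) m = mcoeff (rename_mfps \<rho> f * rename_mfps \<rho> g) m" .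
qed

lemma rename_mfps_monom: "rename_mfps \<rho> (mfps_monom m c) = mfps_monom (rename_monom \<rho> m) c"
  if ff: "finite_fibres \<rho>"
proof (rule mfps_eqI)
  fix k
  have "mcoeff (rename_mfps \<rho> (mfps_monom m c)) k = (\<Sum>n | rename_monom \<rho> n = k. if n = m then c else 0)"
    by (simp add: mcoeff_rename mcoeff_monom)
  also have "\<dots> = (if rename_monom \<rho> m = k then c else 0)"
    using finite_rename_monom_fibre[OF ff, of k] by (simp add: sum.delta)
  finally show "mcoeff (rename_mfps \<rho> (mfps_monom m c)) k = mcoeff (mfps_monom (rename_monom \<rho> m) c) k"
    by (simp add: mcoeff_monom)
qed

lemma rename_mfps_one: "finite_fibres \<rho> \<Longrightarrow> rename_mfps \<rho> 1 = 1"
  using rename_mfps_monom[of \<rho> 0 1] by simp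

lemma rename_mfps_var: "finite_fibres \<rho> \<Longrightarrow> rename_mfps \<rho> (mfps_var v) = mfps_var (\<rho> v)"
  by (simp add: mfps_var_eq_monom rename_mfps_monom)

lemma rename_mfps_const: "finite_fibres \<rho> \<Longrightarrow> rename_mfps \<rho> (mfps_const c) = mfps_const c"
  by (simp add: mfps_const_eq_monom rename_mfps_monom)

lemma rename_mfps_uminus: "rename_mfps \<rho> (- f) = - rename_mfps \<rho> f"
  by (rule mfps_eqI) (simp add: mcoeff_rename sum_negf)

lemma rename_mfps_diff: "rename_mfps \<rho> (f - g) = rename_mfps \<rho> f - rename_mfps \<rho> g"
  by (rule mfps_eqI) (simp add: mcoeff_rename sum_subtractf)

lemma rename_mfps_comp:
  assumes "finite_fibres \<rho>" "finite_fibres \<sigma>"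
  shows "rename_mfps \<rho> (rename_mfps \<sigma> f) = rename_mfps (\<rho> \<circ> \<sigma>) f"
proof (rule mfps_eqI)
  fix m
  have "mcoeff (rename_mfps \<rho> (rename_mfps \<sigma> f)) m
      = (\<Sum>k\<in>(\<Union>n\<in>{n. rename_monom \<rho> n = m}. {k. rename_monom \<sigma> k = n}). mcoeff f k)"
    unfolding mcoeff_rename by (rule sum.UNION_disjoint[symmetric]) (auto simp: finite_rename_monom_fibre assms)
  also have "(\<Union>n\<in>{n. rename_monom \<rho> n = m}. {k. rename_monom \<sigma> k = n}) = {k. rename_monom (\<rho> \<circ> \<sigma>) k = m}"
    by (auto simp: rename_monom_comp)
  finally show "mcoeff (rename_mfps \<rho> (rename_mfps \<sigma> f)) m = mcoeff (rename_mfps (\<rho> \<circ> \<sigma>) f) m"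
    by (simp add: mcoeff_rename)
qed

definition mfps_supp :: "'v set \<Rightarrow> ('v, 'k::comm_ring_1) mfps set" where
  "mfps_supp X = {f. \<forall>m. mcoeff f m \<noteq> 0 \<longrightarrow> keys m \<subseteq> X}"

lemma mfps_supp_mult: "f \<in> mfps_supp X \<Longrightarrow> g \<in> mfps_supp X \<Longrightarrow> f * g \<in> mfps_supp X"
proof -
  assume *: "f \<in> mfps_supp X" "g \<in> mfps_supp X"
  have "keys m \<subseteq> X" if nz: "mcoeff (f * g) m \<noteq> 0" for m
  proof -
    obtain z where "z \<in> splits m" "(case z of (p, q) \<Rightarrow> mcoeff f p * mcoeff g q) \<noteq> 0"
      using nz unfolding mcoeff_mult by (rule sum.not_neutral_contains_not_neutral)
    then obtain p q where pq: "p + q = m" "mcoeff f p * mcoeff g q \<noteq> 0"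
      by (auto simp: splits_def)
    then have "mcoeff f p \<noteq> 0" "mcoeff g q \<noteq> 0" by auto
    then have "keys p \<subseteq> X" "keys q \<subseteq> X" using * by (auto simp: mfps_supp_def)
    then show ?thesis using keys_add[of p q] pq(1) by blast
  qed
  then show ?thesis by (simp add: mfps_supp_def)
qed

lemma mfps_monom_supp: "keys m \<subseteq> X \<Longrightarrow> mfps_monom m c \<in> mfps_supp X"
  by (simp add: mfps_supp_def mcoeff_monom)

lemma rename_mfps_supp: "f \<in> mfps_supp X \<Longrightarrow> rename_mfps \<rho> f \<in> mfps_supp (\<rho> ` X)"
proof -
  assume f: "f \<in> mfps_supp X"
  have "keys m \<subseteq> \<rho> ` X" if nz: "mcoeff (rename_mfps \<rho> f) m \<noteq> 0" for m
  proof -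
    obtain n where "n \<in> {n. rename_monom \<rho> n = m}" "mcoeff f n \<noteq> 0"
      using nz unfolding mcoeff_rename by (rule sum.not_neutral_contains_not_neutral)
    moreover from this have "keys n \<subseteq> X" using f by (simp add: mfps_supp_def)
    ultimately show ?thesis using keys_rename_monom[of \<rho> n] by blast
  qed
  then show ?thesis by (simp add: mfps_supp_def)
qed

lemma rename_mfps_cong:
  assumes f: "f \<in> mfps_supp X" and ff: "finite_fibres \<rho>" "finite_fibres \<sigma>" and eq: "\<And>v. v \<in> X \<Longrightarrow> \<rho> v = \<sigma> v"
  shows "rename_mfps \<rho> f = rename_mfps \<sigma> f"
proof (rule mfps_eqI)
  fix m
  have same: "mcoeff f n = 0" if "rename_monom \<rho> n \<noteq> rename_monom \<sigma> n" for n
    using that f eq rename_monom_cong[of n \<rho> \<sigma>] by (auto simp: mfps_supp_def)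
  show "mcoeff (rename_mfps \<rho> f) m = mcoeff (rename_mfps \<sigma> f) m"
    unfolding mcoeff_rename
    by (rule sum.mono_neutral_cong) (use same finite_rename_monom_fibre ff in auto)
qed

subsection \<open>Division by a difference of variables\<close>

text \<open>If \<open>x\<^sub>v f = x\<^sub>u f\<close>, the coefficient of \<open>f\<close> at
  \<open>m\<close> does not change when a factor \<open>x\<^sub>u\<close> of \<open>m\<close> is
  replaced by \<open>x\<^sub>v\<close>, and it is zero once there is no such factor left.\<close>

lemma regular_var_diff:
  assumes "u \<noteq> v"
  shows "regular (mfps_var v - mfps_var u :: ('v, 'k::comm_ring_1) mfps)"
  unfolding regular_def
proof (intro allI impI)
  fix f :: "('v, 'k) mfps" assume "(mfps_var v - mfps_var u) * f = 0"
  then have eq: "mfps_var v * f = mfps_var u * f" by (simp add: algebra_simps)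
  have "mcoeff f m = 0" for m
  proof (induction "lookup m u" arbitrary: m)
    case 0
    have "mcoeff f m = mcoeff (mfps_var u * f) (m + single v 1)"
      unfolding eq[symmetric] mcoeff_var_mult_add ..
    also have "\<dots> = 0" using 0 assms by (intro mcoeff_var_mult_eq_0) (simp add: lookup_add lookup_single)
    finally show ?case .
  next
    case (Suc n)
    let ?m = "m - single u 1"
    have m: "m = ?m + single u 1"
      using Suc(2) by (intro poly_mapping_eqI) (auto simp: lookup_add lookup_minus lookup_single when_def)
    have "mcoeff f m = mcoeff (mfps_var u * f) (m + single v 1)"
      unfolding eq[symmetric] mcoeff_var_mult_add ..
    also have "m + single v 1 = (?m + single v 1) + single u 1"
      by (subst m) (simp add: add_ac)
    also have "mcoeff (mfps_var u * f) \<dots> = mcoeff f (?m + single v 1)"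
      by (rule mcoeff_var_mult_add)
    also have "\<dots> = 0" using Suc(2) assms by (intro Suc(1)) (simp add: lookup_add lookup_minus lookup_single)
    finally show ?case .
  qed
  then show "f = 0" by (intro mfps_eqI) simp
qed

text \<open>The quotient of \<open>f\<close> by \<open>x\<^sub>u - x\<^sub>v\<close>, for
  \<open>f\<close> vanishing at \<open>x\<^sub>u = x\<^sub>v\<close>. It comes from
  \<open>x\<^sub>u\<^sup>k - x\<^sub>v\<^sup>k = (x\<^sub>u - x\<^sub>v) (\<Sum>i<k. x\<^sub>u\<^sup>i
  x\<^sub>v\<^bsup>k-1-i\<^esup>)\<close> applied to the monomials of \<open>f\<close>.\<close>

definition diff_quot :: "'v \<Rightarrow> 'v \<Rightarrow> ('v, 'k::comm_ring_1) mfps \<Rightarrow> ('v, 'k) mfps" where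
  "diff_quot u v f = Abs_mfps (\<lambda>n. \<Sum>t\<le>lookup n v.
     mcoeff f (n + single u (t + 1) - single v t))"

text \<open>The difference of the two shifted sums of coefficients telescopes to the coefficient of
  \<open>f\<close>, up to the sum of the coefficients that are collected by the specialization
  \<open>x\<^sub>u = x\<^sub>v\<close>.\<close>

lemma diff_quot:
  fixes f :: "('v, 'k::comm_ring_1) mfps"
  assumes uv: "u \<noteq> v" and f: "rename_mfps (id(u := v)) f = 0"
  shows "f = (mfps_var u - mfps_var v) * diff_quot u v f"
proof (rule mfps_eqI)
  fix m
  let ?L = lookup and ?s = single
  \<comment> \<open>the coefficients along the line through \<open>m\<close> on which factors
  \<open>x\<^sub>v\<close> are traded for \<open>x\<^sub>u\<close>\<close>
  define F where "F t = mcoeff f (m + ?s u t - ?s v t)" for t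
  have xu: "mcoeff (mfps_var u * diff_quot u v f) m = (if ?L m u = 0 then 0 else \<Sum>t\<le>?L m v. F t)"
  proof (cases "?L m u = 0")
    case False
    let ?m = "m - ?s u 1"
    have m: "m = ?m + ?s u 1"
      using False by (intro poly_mapping_eqI) (auto simp: lookup_add lookup_minus lookup_single when_def)
    have "mcoeff (mfps_var u * diff_quot u v f) m = mcoeff (diff_quot u v f) ?m"
      by (subst m) (rule mcoeff_var_mult_add)
    also have "\<dots> = (\<Sum>t\<le>?L m v. mcoeff f (?m + ?s u (t + 1) - ?s v t))"
      using uv by (simp add: diff_quot_def lookup_minus lookup_single)
    also have "\<dots> = (\<Sum>t\<le>?L m v. F t)"
    proof (rule sum.cong[OF refl])
      fix t
      have "?m + ?s u (t + 1) = m + ?s u t"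
        using False by (intro poly_mapping_eqI) (auto simp: lookup_add lookup_minus lookup_single when_def)
      then show "mcoeff f (?m + ?s u (t + 1) - ?s v t) = F t" by (simp add: F_def)
    qed
    finally show ?thesis using False by simp
  qed (simp add: mcoeff_var_mult_eq_0)
  have xv: "mcoeff (mfps_var v * diff_quot u v f) m = (\<Sum>t<?L m v. F (Suc t))"
  proof (cases "?L m v = 0")
    case False
    let ?m = "m - ?s v 1"
    have m: "m = ?m + ?s v 1"
      using False by (intro poly_mapping_eqI) (auto simp: lookup_add lookup_minus lookup_single when_def)
    have "mcoeff (mfps_var v * diff_quot u v f) m = mcoeff (diff_quot u v f) ?m"
      by (subst m) (rule mcoeff_var_mult_add)
    also have "\<dots> = (\<Sum>t\<le>?L m v - 1. mcoeff f (?m + ?s u (t + 1) - ?s v t))"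
      by (simp add: diff_quot_def lookup_minus lookup_single)
    also have "{..?L m v - 1} = {..<?L m v}" using False by auto
    also have "(\<Sum>t<?L m v. mcoeff f (?m + ?s u (t + 1) - ?s v t)) = (\<Sum>t<?L m v. F (Suc t))"
    proof (rule sum.cong[OF refl])
      fix t
      have "?m + ?s u (t + 1) - ?s v t = m + ?s u (Suc t) - ?s v (Suc t)"
        using uv False by (intro poly_mapping_eqI) (auto simp: lookup_add lookup_minus lookup_single when_def)
      then show "mcoeff f (?m + ?s u (t + 1) - ?s v t) = F (Suc t)" by (simp add: F_def)
    qed
    finally show ?thesis .
  qed (simp add: mcoeff_var_mult_eq_0)
  have F0: "F 0 = mcoeff f m" by (simp add: F_def)
  have shift: "(\<Sum>t\<le>?L m v. F t) = F 0 + (\<Sum>t<?L m v. F (Suc t))"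
    by (metis lessThan_Suc_atMost sum.lessThan_Suc_shift)
  have "(\<Sum>t\<le>?L m v. F t) = 0" if mu: "?L m u = 0"
  proof -
    have lk: "?L (rename_monom (id(u := v)) n) w = (if w = u then 0 else if w = v then ?L n u + ?L n v else ?L n w)" for n :: "'v \<Rightarrow>\<^sub>0 nat" and w
    proof -
      let ?S = "insert u (insert v (insert w (keys n)))"
      have "rename_monom (id(u := v)) n = (\<Sum>x\<in>?S. ?s ((id(u := v)) x) (?L n x))"
        by (rule rename_monom_superset) auto
      then have "?L (rename_monom (id(u := v)) n) w = (\<Sum>x\<in>{x\<in>?S. (id(u := v)) x = w}. ?L n x)"
        by (simp only: lookup_sum_single finite_insert finite_keys)
      also have "{x\<in>?S. (id(u := v)) x = w} = (if w = u then {} else if w = v then {u, v} else {w})"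
        using uv by auto
      finally have "?L (rename_monom (id(u := v)) n) w
        = sum (?L n) (if w = u then {} else if w = v then {u, v} else {w})" .
      also have "\<dots> = (if w = u then 0 else if w = v then ?L n u + ?L n v else ?L n w)"
        using uv by simp
      finally show ?thesis .
    qed
    have "(\<lambda>t. m + ?s u t - ?s v t) ` {..?L m v} = {n. rename_monom (id(u := v)) n = m}"
    proof (intro equalityI subsetI)
      fix n assume "n \<in> (\<lambda>t. m + ?s u t - ?s v t) ` {..?L m v}"
      then show "n \<in> {n. rename_monom (id(u := v)) n = m}"
        using mu uv by (auto intro!: poly_mapping_eqI simp: lk lookup_add lookup_minus lookup_single when_def)
    next
      fix n assume "n \<in> {n. rename_monom (id(u := v)) n = m}"
      then have m: "m = rename_monom (id(u := v)) n" by simp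
      have "n = m + ?s u (?L n u) - ?s v (?L n u)" "?L n u \<le> ?L m v"
        using uv by (auto intro!: poly_mapping_eqI simp: m lk lookup_add lookup_minus lookup_single when_def)
      then show "n \<in> (\<lambda>t. m + ?s u t - ?s v t) ` {..?L m v}" by blast
    qed
    moreover have "inj_on (\<lambda>t. m + ?s u t - ?s v t) {..?L m v}"
    proof (rule inj_onI)
      fix t t' assume "m + ?s u t - ?s v t = m + ?s u t' - ?s v t'"
      then have "?L (m + ?s u t - ?s v t) u = ?L (m + ?s u t' - ?s v t') u" by simp
      then show "t = t'" using uv by (simp add: lookup_add lookup_minus lookup_single)
    qed
    ultimately have "(\<Sum>t\<le>?L m v. F t) = (\<Sum>n | rename_monom (id(u := v)) n = m. mcoeff f n)"
      using sum.reindex[of "\<lambda>t. m + ?s u t - ?s v t" "{..?L m v}" "mcoeff f"] by (simp add: F_def)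
    also have "\<dots> = mcoeff (rename_mfps (id(u := v)) f) m" by (simp add: mcoeff_rename)
    finally show ?thesis by (simp add: f)
  qed
  then show "mcoeff f m = mcoeff ((mfps_var u - mfps_var v) * diff_quot u v f) m"
    using shift F0 by (cases "?L m u = 0") (simp_all add: left_diff_distrib xu xv eq_neg_iff_add_eq_0)
qed

lemma diff_quot_supp:
  assumes uv: "u \<in> X" "v \<in> X" and f: "f \<in> mfps_supp X"
  shows "diff_quot u v f \<in> mfps_supp X"
proof -
  have "keys n \<subseteq> X" if nz: "mcoeff (diff_quot u v f) n \<noteq> 0" for n
  proof -
    obtain t where "mcoeff f (n + single u (t + 1) - single v t) \<noteq> 0" (is "mcoeff f ?n \<noteq> 0")
      using nz unfolding diff_quot_def mcoeff_simps by (rule sum.not_neutral_contains_not_neutral)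
    then have "keys ?n \<subseteq> X" using f by (simp add: mfps_supp_def)
    moreover have "keys n \<subseteq> insert u (insert v (keys ?n))"
      by (auto simp: in_keys_iff lookup_add lookup_minus lookup_single when_def split: if_splits)
    ultimately show ?thesis using uv by auto
  qed
  then show ?thesis by (simp add: mfps_supp_def)
qed

subsection \<open>The degree filtration\<close>

definition mfps_ge :: "nat \<Rightarrow> ('v, 'k::comm_ring_1) mfps set" where
  "mfps_ge n = {f. \<forall>m. mcoeff f m \<noteq> 0 \<longrightarrow> n \<le> mdeg m}"

lemma mfps_geD: "f \<in> mfps_ge n \<Longrightarrow> mdeg m < n \<Longrightarrow> mcoeff f m = 0"
  by (force simp: mfps_ge_def)

lemma mfps_geI: "(\<And>m. mdeg m < n \<Longrightarrow> mcoeff f m = 0) \<Longrightarrow> f \<in> mfps_ge n"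
  by (force simp: mfps_ge_def not_less[symmetric])

lemma mfps_ge_0 [simp]: "f \<in> mfps_ge 0"
  by (simp add: mfps_ge_def)

lemma mfps_ge_zero [simp]: "0 \<in> mfps_ge n"
  by (simp add: mfps_ge_def)

lemma mfps_ge_mono: "m \<le> n \<Longrightarrow> f \<in> mfps_ge n \<Longrightarrow> f \<in> mfps_ge m"
  by (auto simp: mfps_ge_def)

lemma mfps_ge_add: "f \<in> mfps_ge n \<Longrightarrow> g \<in> mfps_ge n \<Longrightarrow> f + g \<in> mfps_ge n"
  by (auto intro!: mfps_geI simp: mfps_geD)

lemma mfps_ge_uminus: "f \<in> mfps_ge n \<Longrightarrow> - f \<in> mfps_ge n"
  by (auto intro!: mfps_geI simp: mfps_geD)

lemma mfps_ge_diff: "f \<in> mfps_ge n \<Longrightarrow> g \<in> mfps_ge n \<Longrightarrow> f - g \<in> mfps_ge n"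
  by (auto intro!: mfps_geI simp: mfps_geD)

lemma mfps_ge_sum: "(\<And>s. s \<in> S \<Longrightarrow> f s \<in> mfps_ge n) \<Longrightarrow> (\<Sum>s\<in>S. f s) \<in> mfps_ge n"
  by (induction S rule: infinite_finite_induct) (auto intro: mfps_ge_add)

lemma mfps_ge_mult:
  fixes f g :: "('v, 'k::comm_ring_1) mfps"
  assumes "f \<in> mfps_ge n" "g \<in> mfps_ge k"
  shows "f * g \<in> mfps_ge (n + k)"
proof (rule mfps_geI)
  fix m :: "'v \<Rightarrow>\<^sub>0 nat" assume "mdeg m < n + k"
  note * = assms this
  show "mcoeff (f * g) m = 0"
    unfolding mcoeff_mult
  proof (rule sum.neutral, clarify)
    fix p q assume "(p, q) \<in> splits m"
    then have "mdeg p < n \<or> mdeg q < k" using *(3) by (auto simp: splits_def mdeg_add)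
    then show "mcoeff f p * mcoeff g q = 0" using * by (auto simp: mfps_geD)
  qed
qed

lemma mfps_ge_mult_left: "f \<in> mfps_ge n \<Longrightarrow> f * g \<in> mfps_ge n"
  using mfps_ge_mult[of f n g 0] by simp

lemma mfps_ge_mult_right: "f \<in> mfps_ge n \<Longrightarrow> g * f \<in> mfps_ge n"
  using mfps_ge_mult_left[of f n g] by (simp add: mult.commute)

lemma mfps_ge_power: "f \<in> mfps_ge n \<Longrightarrow> f ^ k \<in> mfps_ge (k * n)"
  by (induction k) (auto intro: mfps_ge_mult)

lemma mfps_ge_var: "mfps_var v \<in> mfps_ge 1"
  by (rule mfps_geI) (auto simp: mfps_var_eq_monom mcoeff_monom)

lemma mfps_ge_rename: "f \<in> mfps_ge n \<Longrightarrow> rename_mfps \<rho> f \<in> mfps_ge n"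
  by (rule mfps_geI) (auto simp: mcoeff_rename mfps_geD intro!: sum.neutral)

lemma mfps_eq_if_close: "(\<And>n. f - g \<in> mfps_ge n) \<Longrightarrow> f = g"
proof (rule mfps_eqI)
  fix m assume "\<And>n. f - g \<in> mfps_ge n"
  from mfps_geD[OF this, of m "Suc (mdeg m)"] show "mcoeff f m = mcoeff g m" by simp
qed

lemma diff_quot_ge:
  fixes f :: "('v, 'k::comm_ring_1) mfps"
  assumes f: "f \<in> mfps_ge (Suc n)"
  shows "diff_quot u v f \<in> mfps_ge n"
proof (rule mfps_geI)
  fix m :: "'v \<Rightarrow>\<^sub>0 nat" assume m: "mdeg m < n"
  have "mcoeff f (m + single u (t + 1) - single v t) = 0" (is "mcoeff f ?n = 0")
    if "t \<le> lookup m v" for t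
  proof -
    have "?n + single v t = m + single u (t + 1)"
      using that by (intro poly_mapping_eqI) (auto simp: lookup_add lookup_minus lookup_single when_def)
    then have "mdeg ?n + t = mdeg m + (t + 1)" by (metis mdeg_add mdeg_single)
    then show ?thesis using m by (intro mfps_geD[OF f]) simp
  qed
  then show "mcoeff (diff_quot u v f) m = 0" by (simp add: diff_quot_def)
qed

text \<open>The quotient by \<open>x\<^sub>v - x\<^sub>u\<close> is unique, hence it is given by
  \<open>diff_quot\<close>, which lowers the degree of every monomial by one.\<close>

lemma mfps_ge_var_diff_cancel:
  assumes uv: "u \<noteq> v" and f: "(mfps_var v - mfps_var u) * f \<in> mfps_ge (Suc n)"
  shows "f \<in> mfps_ge n"
proof -
  let ?e = "id(u := v)"
  have "rename_mfps ?e ((mfps_var v - mfps_var u) * f) = 0"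
    using uv by (simp only: rename_mfps_mult rename_mfps_diff rename_mfps_var finite_fibres_upd) simp
  then have "(mfps_var v - mfps_var u) * f = (mfps_var u - mfps_var v) * diff_quot u v ((mfps_var v - mfps_var u) * f)"
    by (rule diff_quot[OF uv])
  also have "\<dots> = (mfps_var v - mfps_var u) * - diff_quot u v ((mfps_var v - mfps_var u) * f)"
    by (simp add: algebra_simps)
  finally have "f = - diff_quot u v ((mfps_var v - mfps_var u) * f)"
    unfolding regular_cancel[OF regular_var_diff[OF uv]] .
  then show ?thesis using mfps_ge_uminus[OF diff_quot_ge[OF f]] by metis
qed

interpretation series: shuffle_ring "mfps_supp :: _ \<Rightarrow> ('i::finite var, rat) mfps set" rename_mfps
  "\<lambda>u v. mfps_var v - mfps_var u"
proof
  fix X Y :: "'i var set" and f g :: "('i var, rat) mfps" and u v :: "'i var" and \<rho> \<sigma> :: "'i var \<Rightarrow> 'i var"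
  show "0 \<in> (mfps_supp X :: ('i var, rat) mfps set)" by (simp add: mfps_supp_def)
  show "1 \<in> (mfps_supp X :: ('i var, rat) mfps set)" by (simp add: mfps_supp_def mcoeff_one)
  show "f \<in> mfps_supp X \<Longrightarrow> - f \<in> mfps_supp X" by (simp add: mfps_supp_def)
  show "f \<in> mfps_supp X \<Longrightarrow> g \<in> mfps_supp X \<Longrightarrow> f * g \<in> mfps_supp X" by (rule mfps_supp_mult)
  show add: "f \<in> mfps_supp X \<Longrightarrow> g \<in> mfps_supp X \<Longrightarrow> f + g \<in> mfps_supp X" for f g :: "('i var, rat) mfps" and X
    by (force simp: mfps_supp_def)
  show "X \<subseteq> Y \<Longrightarrow> mfps_supp X \<subseteq> (mfps_supp Y :: ('i var, rat) mfps set)" by (auto simp: mfps_supp_def)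
  show "finite_fibres \<rho> \<Longrightarrow> rename_mfps \<rho> (f + g) = rename_mfps \<rho> f + rename_mfps \<rho> g" by (rule rename_mfps_add)
  show "finite_fibres \<rho> \<Longrightarrow> rename_mfps \<rho> (f * g) = rename_mfps \<rho> f * rename_mfps \<rho> g" by (rule rename_mfps_mult)
  show "finite_fibres \<rho> \<Longrightarrow> rename_mfps \<rho> 1 = (1 :: ('i var, rat) mfps)" by (rule rename_mfps_one)
  show "finite_fibres \<rho> \<Longrightarrow> finite_fibres \<sigma> \<Longrightarrow> rename_mfps \<rho> (rename_mfps \<sigma> f) = rename_mfps (\<rho> \<circ> \<sigma>) f"
    by (rule rename_mfps_comp)
  show "f \<in> mfps_supp X \<Longrightarrow> finite_fibres \<rho> \<Longrightarrow> finite_fibres \<sigma> \<Longrightarrow> (\<And>v. v \<in> X \<Longrightarrow> \<rho> v = \<sigma> v) \<Longrightarrow> rename_mfps \<rho> f = rename_mfps \<sigma> f"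
    by (rule rename_mfps_cong)
  show "f \<in> mfps_supp X \<Longrightarrow> finite_fibres \<rho> \<Longrightarrow> rename_mfps \<rho> f \<in> mfps_supp (\<rho> ` X)" by (rule rename_mfps_supp)
  have "mfps_var v \<in> (mfps_supp {u, v} :: ('i var, rat) mfps set)" "- mfps_var u \<in> (mfps_supp {u, v} :: ('i var, rat) mfps set)"
    by (auto simp: mfps_supp_def mfps_var_eq_monom mcoeff_monom split: if_splits)
  from add[OF this] show "mfps_var v - mfps_var u \<in> (mfps_supp {u, v} :: ('i var, rat) mfps set)" by simp
  show "finite_fibres \<rho> \<Longrightarrow> rename_mfps \<rho> (mfps_var v - mfps_var u) = (mfps_var (\<rho> v) - mfps_var (\<rho> u) :: ('i var, rat) mfps)"
    by (simp add: rename_mfps_diff rename_mfps_var)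
  show "mfps_var v - mfps_var v = (0 :: ('i var, rat) mfps)" by simp
  show "u \<noteq> v \<Longrightarrow> regular (mfps_var v - mfps_var u :: ('i var, rat) mfps)" by (rule regular_var_diff)
  show "\<exists>\<eta>\<in>mfps_supp {u, v}. mfps_var u - mfps_var v = \<eta> * (mfps_var v - mfps_var u :: ('i var, rat) mfps) \<and>
      rename_mfps (id(u := v)) \<eta> = - 1"
    by (rule bexI[of _ "- 1"])
      (auto simp: rename_mfps_uminus rename_mfps_one finite_fibres_upd mfps_supp_def mcoeff_one)
  show "\<exists>q\<in>mfps_supp X. f = (mfps_var v - mfps_var u) * q"
    if "u \<noteq> v" "u \<in> X" "v \<in> X" "f \<in> mfps_supp X" "rename_mfps (id(u := v)) f = 0"
  proof (rule bexI[of _ "- diff_quot u v f"])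
    show "f = (mfps_var v - mfps_var u) * - diff_quot u v f"
      using diff_quot[OF that(1,5)] by (simp add: algebra_simps)
    show "- diff_quot u v f \<in> mfps_supp X"
      using diff_quot_supp[OF that(2-4)] by (simp add: mfps_supp_def)
  qed
  show "f + f = 0 \<Longrightarrow> f = 0"
  proof (rule mfps_eqI)
    fix m assume "f + f = 0"
    then have "mcoeff f m + mcoeff f m = 0" by (metis mcoeff_simps(1,2))
    then show "mcoeff f m = mcoeff 0 m" by simp
  qed
qed

lemma series_sym_eq: "series.sym g = sym_series g"
  by (simp add: series.sym_def sym_series_def mfps_supp_def)

section \<open>Polynomials and Laurent polynomials\<close>

lemma poly_mapping_sum_single: "f = (\<Sum>m\<in>keys f. single m (lookup f m))"
proof (rule poly_mapping_eqI)
  fix m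
  show "lookup f m = lookup (\<Sum>m\<in>keys f. single m (lookup f m)) m"
    by (simp add: lookup_sum lookup_single when_def sum.delta in_keys_iff)
qed

lemma poly_mapping_add_induct [case_names single add]:
  assumes "\<And>m c. P (single m c)" "\<And>f g. P f \<Longrightarrow> P g \<Longrightarrow> P (f + g)"
  shows "P (f :: 'm \<Rightarrow>\<^sub>0 'k::comm_monoid_add)"
proof -
  have "P (\<Sum>m\<in>S. single m (lookup f m))" if "finite S" for S
    using that
  proof (induction S rule: finite_induct)
    case empty
    show ?case using assms(1)[of _ 0] by simp
  qed (simp add: assms)
  then show ?thesis using poly_mapping_sum_single[of f] by (metis finite_keys)
qed

text \<open>Renaming of variables, the embedding of polynomials into power series and the Chern
  character are all of this form: they are given on monomials and extended linearly.\<close>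

locale monomial_hom =
  fixes h :: "'m::comm_monoid_add \<Rightarrow> 'k::comm_ring_1 \<Rightarrow> 'r::comm_ring_1"
  assumes monom_add: "h m (c + d) = h m c + h m d"
    and monom_mult: "h (m + n) (c * d) = h m c * h n d"
    and monom_one: "h 0 1 = 1"
begin

definition lin :: "('m \<Rightarrow>\<^sub>0 'k) \<Rightarrow> 'r" where
  "lin f = (\<Sum>m\<in>keys f. h m (lookup f m))"

lemma monom_zero: "h m 0 = 0"
  using monom_add[of m 0 0] by simp

lemma lin_superset:
  "finite S \<Longrightarrow> keys f \<subseteq> S \<Longrightarrow> lin f = (\<Sum>m\<in>S. h m (lookup f m))"
  unfolding lin_def by (rule sum.mono_neutral_left) (auto simp: in_keys_iff monom_zero)

lemma lin_add: "lin (f + g) = lin f + lin g"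
proof -
  let ?S = "keys f \<union> keys g"
  have "finite ?S" "keys (f + g) \<subseteq> ?S" by (simp_all add: keys_add)
  then show ?thesis by (simp add: lin_superset[of ?S] lookup_add monom_add sum.distrib)
qed

lemma lin_single [simp]: "lin (single m c) = h m c"
  by (cases "c = 0") (simp_all add: lin_def monom_zero)

lemma lin_one: "lin 1 = 1"
  using lin_single[of 0 1] monom_one by simp

lemma lin_zero: "lin 0 = 0"
  by (simp add: lin_def)

lemma lin_uminus: "lin (- f) = - lin f"
  using lin_add[of f "- f"] by (simp add: lin_zero eq_neg_iff_add_eq_0 add.commute)

lemma lin_diff: "lin (f - g) = lin f - lin g"
  using lin_add[of f "- g"] by (simp add: lin_uminus)

lemma lin_mult: "lin (f * g) = lin f * lin g"
proof (induction f rule: poly_mapping_add_induct)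
  case (single m c)
  show ?case
    by (induction g rule: poly_mapping_add_induct) (simp_all add: mult_single monom_mult distrib_left lin_add)
qed (simp add: distrib_right lin_add)

lemma lin_sum: "lin (\<Sum>s\<in>S. f s) = (\<Sum>s\<in>S. lin (f s))"
  by (induction S rule: infinite_finite_induct) (simp_all add: lin_add lin_zero)

lemma lin_prod: "lin (\<Prod>s\<in>S. f s) = (\<Prod>s\<in>S. lin (f s))"
  by (induction S rule: infinite_finite_induct) (simp_all add: lin_mult lin_one)

lemma lin_power: "lin (f ^ n) = lin f ^ n"
  by (induction n) (simp_all add: lin_mult lin_one)

end

interpretation rename: monomial_hom "\<lambda>m c. single (rename_monom \<rho> m) c" for \<rho>
  by unfold_locales (simp_all add: single_add mult_single rename_monom_add)

lemma rename_poly_lin: "rename_poly \<rho> f = rename.lin \<rho> f"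
  by (simp add: rename_poly_def rename.lin_def)

lemmas rename_poly_simps = rename.lin_add[folded rename_poly_lin] rename.lin_mult[folded rename_poly_lin]
  rename.lin_one[folded rename_poly_lin] rename.lin_single[folded rename_poly_lin]
  rename.lin_diff[folded rename_poly_lin] rename.lin_uminus[folded rename_poly_lin] rename.lin_sum[folded rename_poly_lin]
  rename.lin_prod[folded rename_poly_lin] rename.lin_power[folded rename_poly_lin]

lemma rename_poly_comp: "rename_poly \<rho> (rename_poly \<sigma> f) = rename_poly (\<rho> \<circ> \<sigma>) f"
  by (induction f rule: poly_mapping_add_induct) (simp_all only: rename_poly_simps rename_monom_comp)

definition poly_supp :: "'v set \<Rightarrow> (('v \<Rightarrow>\<^sub>0 'e::comm_monoid_add) \<Rightarrow>\<^sub>0 'k::comm_ring_1) set" where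
  "poly_supp X = {f. \<forall>m\<in>keys f. keys m \<subseteq> X}"

lemma poly_supp_zero: "0 \<in> poly_supp X" and poly_supp_one: "1 \<in> poly_supp X"
  by (simp_all add: poly_supp_def)

lemma poly_supp_add: "f \<in> poly_supp X \<Longrightarrow> g \<in> poly_supp X \<Longrightarrow> f + g \<in> poly_supp X"
  using keys_add[of f g] by (auto simp: poly_supp_def)

lemma poly_supp_uminus: "f \<in> poly_supp X \<Longrightarrow> - f \<in> poly_supp X"
  by (simp add: poly_supp_def in_keys_iff)

lemma poly_supp_mult:
  assumes "f \<in> poly_supp X" "g \<in> poly_supp X"
  shows "f * g \<in> poly_supp X"
proof -
  have "keys m \<subseteq> X" if m: "m \<in> keys (f * g)" for m
  proof -
    obtain p q where "m = p + q" "p \<in> keys f" "q \<in> keys g"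
      using m keys_mult[of f g] by blast
    then have "keys p \<subseteq> X" "keys q \<subseteq> X" using assms by (auto simp: poly_supp_def)
    then show ?thesis using \<open>m = p + q\<close> keys_add[of p q] by blast
  qed
  then show ?thesis by (simp add: poly_supp_def)
qed

lemma poly_supp_single: "keys m \<subseteq> X \<Longrightarrow> single m c \<in> poly_supp X"
  by (auto simp: poly_supp_def split: if_splits)

lemma poly_supp_sum: "(\<And>s. s \<in> S \<Longrightarrow> f s \<in> poly_supp X) \<Longrightarrow> (\<Sum>s\<in>S. f s) \<in> poly_supp X"
  by (induction S rule: infinite_finite_induct) (auto intro: poly_supp_add poly_supp_zero)

lemma poly_supp_power: "f \<in> poly_supp X \<Longrightarrow> f ^ n \<in> poly_supp X"
  by (induction n) (auto intro: poly_supp_mult poly_supp_one)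

lemma poly_supp_rename: "f \<in> poly_supp X \<Longrightarrow> rename_poly \<rho> f \<in> poly_supp (\<rho> ` X)"
proof -
  assume f: "f \<in> poly_supp X"
  have "keys (rename_monom \<rho> m) \<subseteq> \<rho> ` X" if "m \<in> keys f" for m
    using f that keys_rename_monom[of \<rho> m] by (fastforce simp: poly_supp_def)
  then show ?thesis unfolding rename_poly_def by (intro poly_supp_sum poly_supp_single)
qed

lemma rename_poly_cong:
  assumes "f \<in> poly_supp X" "\<And>v. v \<in> X \<Longrightarrow> \<rho> v = \<sigma> v"
  shows "rename_poly \<rho> f = rename_poly \<sigma> f"
proof -
  have "rename_monom \<rho> m = rename_monom \<sigma> m" if "m \<in> keys f" for m
    using that assms by (intro rename_monom_cong) (auto simp: poly_supp_def)
  then show ?thesis by (simp add: rename_poly_def)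
qed

lemma single_eq_prod_vars:
  "single m c = single 0 c *
     (\<Prod>w\<in>keys m. single (single w (lookup m w)) (1 :: 'k::comm_ring_1))"
proof -
  have "(\<Prod>w\<in>S. single (f w) (1 :: 'k)) = single (\<Sum>w\<in>S. f w) 1" if "finite S"
    for S and f :: "'w \<Rightarrow> ('v \<Rightarrow>\<^sub>0 'e::comm_monoid_add)"
    using that by (induction S rule: finite_induct) (simp_all add: mult_single)
  note * = this[OF finite_keys]
  show ?thesis by (simp only: * mult_single add_0 mult_1_right flip: poly_mapping_sum_single)
qed

text \<open>The \<open>f\<close> with \<open>f - rename_poly \<rho> f\<close> divisible by
  \<open>d\<close> form a subring, so that only powers of single variables have to be checked.\<close>

lemma rename_poly_diff_dvd:
  fixes f :: "('v \<Rightarrow>\<^sub>0 'e::comm_monoid_add) \<Rightarrow>\<^sub>0 'k::comm_ring_1"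
  assumes \<rho>: "\<rho> ` X \<subseteq> X"
    and vars: "\<And>w k. w \<in> X \<Longrightarrow> \<exists>q\<in>poly_supp X. single (single w k) 1
        - rename_poly \<rho> (single (single w k) 1) = d * q"
    and f: "f \<in> poly_supp X"
  shows "\<exists>q\<in>poly_supp X. f - rename_poly \<rho> f = d * q"
proof -
  define P where "P f \<longleftrightarrow> f \<in> poly_supp X \<and> (\<exists>q\<in>poly_supp X. f - rename_poly \<rho> f = d * q)"
    for f :: "('v \<Rightarrow>\<^sub>0 'e) \<Rightarrow>\<^sub>0 'k"
  have P_add: "P (f + g)" if fg: "P f" "P g" for f g
  proof -
    obtain q r where qr: "q \<in> poly_supp X" "f - rename_poly \<rho> f = d * q"
      "r \<in> poly_supp X" "g - rename_poly \<rho> g = d * r" using fg unfolding P_def by blast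
    have "f + g - rename_poly \<rho> (f + g) = (f - rename_poly \<rho> f) + (g - rename_poly \<rho> g)"
      by (simp add: rename_poly_simps)
    also have "\<dots> = d * (q + r)" by (simp only: qr distrib_left)
    finally show ?thesis using fg poly_supp_add[of f X g] poly_supp_add[OF qr(1,3)] by (auto simp: P_def)
  qed
  have P_mult: "P (f * g)" if fg: "P f" "P g" for f g
  proof -
    obtain q r where qr: "q \<in> poly_supp X" "f - rename_poly \<rho> f = d * q"
      "r \<in> poly_supp X" "g - rename_poly \<rho> g = d * r" using fg unfolding P_def by blast
    have rf: "rename_poly \<rho> f \<in> poly_supp X"
      using fg poly_supp_rename[of f X \<rho>] \<rho> by (auto simp: P_def poly_supp_def)
    have "f * g - rename_poly \<rho> (f * g) = (f - rename_poly \<rho> f) * g + rename_poly \<rho> f * (g - rename_poly \<rho> g)"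
      by (simp add: rename_poly_simps algebra_simps)
    also have "\<dots> = d * (q * g + rename_poly \<rho> f * r)" by (simp add: qr(2,4) algebra_simps)
    finally have "f * g - rename_poly \<rho> (f * g) = d * (q * g + rename_poly \<rho> f * r)" .
    moreover have "q * g + rename_poly \<rho> f * r \<in> poly_supp X" "f * g \<in> poly_supp X"
      using fg qr rf by (auto simp: P_def intro!: poly_supp_add poly_supp_mult)
    ultimately show ?thesis by (auto simp: P_def)
  qed
  have P_const: "P (single 0 c)" for c
    by (auto simp: P_def rename_poly_simps poly_supp_single intro!: bexI[of _ 0] poly_supp_zero)
  have P_prod: "P (\<Prod>w\<in>S. F w)" if "\<And>w. w \<in> S \<Longrightarrow> P (F w)" for S :: "'v set" and F
    using that P_const[of 1] by (induction S rule: infinite_finite_induct) (auto intro: P_mult)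
  have P_sum: "P (\<Sum>m\<in>S. F m)" if "\<And>m. m \<in> S \<Longrightarrow> P (F m)" for S :: "('v \<Rightarrow>\<^sub>0 'e) set" and F
    using that P_const[of 0] by (induction S rule: infinite_finite_induct) (auto intro: P_add)
  have "P (single m c)" if "m \<in> keys f" for m c
  proof -
    have "keys m \<subseteq> X" using f that by (auto simp: poly_supp_def)
    then have "P (single (single w (lookup m w)) 1)" if "w \<in> keys m" for w
      using that vars[of w] by (auto simp: P_def intro!: poly_supp_single split: if_splits)
    then show ?thesis
      unfolding single_eq_prod_vars[of m c] by (intro P_mult P_const P_prod)
  qed
  then have "P f" by (subst poly_mapping_sum_single) (rule P_sum)
  then show ?thesis by (simp add: P_def)
qed

definition poly_series :: "('v, 'k::comm_ring_1) polynomial \<Rightarrow> ('v, 'k) mfps" where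
  "poly_series f = Abs_mfps (lookup f)"

interpretation series_of: monomial_hom mfps_monom
  by unfold_locales (simp_all add: mfps_monom_add mfps_monom_mult)

lemma poly_series_lin: "poly_series f = series_of.lin f"
proof (rule mfps_eqI)
  fix m
  have "mcoeff (series_of.lin f) m = (\<Sum>n\<in>keys f. if m = n then lookup f n else 0)"
    by (simp add: series_of.lin_def mcoeff_sum mcoeff_monom)
  also have "\<dots> = lookup f m" by (simp add: in_keys_iff)
  finally show "mcoeff (poly_series f) m = mcoeff (series_of.lin f) m" by (simp add: poly_series_def)
qed

lemma mcoeff_poly_series [simp]: "mcoeff (poly_series f) m = lookup f m"
  by (simp add: poly_series_def)

lemmas poly_series_simps = series_of.lin_add[folded poly_series_lin] series_of.lin_mult[folded poly_series_lin]
  series_of.lin_one[folded poly_series_lin] series_of.lin_single[folded poly_series_lin]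
  series_of.lin_diff[folded poly_series_lin]

lemma poly_series_pvar: "poly_series (pvar v) = mfps_var v"
  by (simp add: pvar_def poly_series_simps mfps_var_eq_monom)

lemma poly_series_eq_0: "poly_series f = 0 \<Longrightarrow> f = 0"
  by (rule poly_mapping_eqI) (metis mcoeff_poly_series mcoeff_simps(1) lookup_zero)

lemma poly_series_rename: "finite_fibres \<rho> \<Longrightarrow> poly_series (rename_poly \<rho> f) = rename_mfps \<rho> (poly_series f)"
  by (induction f rule: poly_mapping_add_induct)
    (simp_all add: rename_poly_simps poly_series_simps rename_mfps_monom rename_mfps_add)

lemma rename_poly_pvar: "rename_poly \<rho> (pvar v) = pvar (\<rho> v)"
  by (simp add: pvar_def rename_poly_simps)

lemma rename_poly_inv_pvar: "rename_poly \<rho> (inv_pvar v) = inv_pvar (\<rho> v)"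
  by (simp add: inv_pvar_def rename_poly_simps)

lemma pvar_inv_pvar: "pvar v * inv_pvar v = (1 :: ('v, 'k::comm_ring_1) laurent)"
  by (simp add: pvar_def inv_pvar_def mult_single flip: single_add)

lemma pvar_supp: "v \<in> X \<Longrightarrow> pvar v \<in> poly_supp X"
  unfolding pvar_def by (rule poly_supp_single) auto

lemma inv_pvar_supp: "v \<in> X \<Longrightarrow> inv_pvar v \<in> poly_supp X"
  unfolding inv_pvar_def by (rule poly_supp_single) auto

lemma poly_supp_diff: "f \<in> poly_supp X \<Longrightarrow> g \<in> poly_supp X \<Longrightarrow> f - g \<in> poly_supp X"
  using poly_supp_add[OF _ poly_supp_uminus] by fastforce

lemma single_var_add:
  "single (single w (k + l)) (1 :: 'k::comm_ring_1)
    = single (single w k) 1 * single (single w l) 1"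
  by (simp add: mult_single single_add)

lemma single_var_power: "single (single w k) 1 = (pvar w :: ('v, 'k::comm_ring_1) polynomial) ^ k"
proof (induction k)
  case (Suc k)
  then show ?case using single_var_add[of w 1 k, where ?'k = 'k] by (simp add: pvar_def)
qed simp

lemma single_var_int_power:
  "single (single w k) 1 =
     (if 0 \<le> k then pvar w ^ nat k else (inv_pvar w :: ('v, 'k::comm_ring_1) laurent) ^ nat (- k))"
proof -
  have pos: "single (single w (int n)) 1 = (pvar w :: ('v, 'k) laurent) ^ n" for n
  proof (induction n)
    case (Suc n)
    then show ?case using single_var_add[of w 1 "int n", where ?'k = 'k] by (simp add: pvar_def)
  qed simp
  have neg: "single (single w (- int n)) 1 = (inv_pvar w :: ('v, 'k) laurent) ^ n" for n
  proof (induction n)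
    case (Suc n)
    then show ?case using single_var_add[of w "- 1" "- int n", where ?'k = 'k] by (simp add: inv_pvar_def)
  qed simp
  show ?thesis using pos[of "nat k"] neg[of "nat (- k)"] by auto
qed

lemma power_diff_dvd:
  assumes "x \<in> poly_supp X" "y \<in> poly_supp X"
  shows "\<exists>q\<in>poly_supp X. x ^ n - y ^ n = (x - y) * q"
proof (induction n)
  case 0
  show ?case by (auto intro!: bexI[of _ 0] poly_supp_zero)
next
  case (Suc n)
  then obtain q where q: "q \<in> poly_supp X" "x ^ n - y ^ n = (x - y) * q" by blast
  have "x ^ Suc n - y ^ Suc n = x * (x ^ n - y ^ n) + (x - y) * y ^ n" by (simp add: algebra_simps)
  also have "\<dots> = (x - y) * (x * q + y ^ n)" unfolding q(2) by (simp add: algebra_simps)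
  finally show ?case using q(1) assms by (meson poly_supp_add poly_supp_mult poly_supp_power)
qed

lemma poly_mapping_double_eq_0:
  fixes f :: "'m \<Rightarrow>\<^sub>0 rat"
  assumes "f + f = 0"
  shows "f = 0"
proof (rule poly_mapping_eqI)
  fix m
  have "lookup f m + lookup f m = 0"
    using assms by (metis lookup_add lookup_zero)
  then show "lookup f m = lookup 0 m" by simp
qed

interpretation poly: shuffle_ring "poly_supp :: _ \<Rightarrow> ('i::finite var, rat) polynomial set" rename_poly
  "\<lambda>u v. pvar v - pvar u"
proof
  fix X Y :: "'i var set" and f g :: "('i var, rat) polynomial" and u v :: "'i var" and \<rho> \<sigma> :: "'i var \<Rightarrow> 'i var"
  show "X \<subseteq> Y \<Longrightarrow> poly_supp X \<subseteq> (poly_supp Y :: ('i var, rat) polynomial set)" by (auto simp: poly_supp_def)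
  show "f \<in> poly_supp X \<Longrightarrow> finite_fibres \<rho> \<Longrightarrow> finite_fibres \<sigma> \<Longrightarrow> (\<And>v. v \<in> X \<Longrightarrow> \<rho> v = \<sigma> v) \<Longrightarrow>
      rename_poly \<rho> f = rename_poly \<sigma> f"
    by (rule rename_poly_cong)
  show "pvar v - pvar u \<in> (poly_supp {u, v} :: ('i var, rat) polynomial set)"
    by (intro poly_supp_diff pvar_supp) auto
  show "u \<noteq> v \<Longrightarrow> regular (pvar v - pvar u :: ('i var, rat) polynomial)"
    unfolding regular_def
  proof (intro allI impI)
    fix h :: "('i var, rat) polynomial" assume "u \<noteq> v" "(pvar v - pvar u) * h = 0"
    then have "(mfps_var v - mfps_var u) * poly_series h = poly_series 0"
      by (metis poly_series_simps(2,5) poly_series_pvar)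
    then have "(mfps_var v - mfps_var u) * poly_series h = 0" by (simp add: poly_series_lin series_of.lin_zero)
    then have "poly_series h = 0" using regular_var_diff[OF \<open>u \<noteq> v\<close>] unfolding regular_def by blast
    then show "h = 0" by (rule poly_series_eq_0)
  qed
  show "\<exists>\<eta>\<in>poly_supp {u, v}. pvar u - pvar v = \<eta> * (pvar v - pvar u :: ('i var, rat) polynomial) \<and>
      rename_poly (id(u := v)) \<eta> = - 1"
    by (rule bexI[of _ "- 1"]) (simp_all add: rename_poly_lin rename.lin_uminus rename.lin_one poly_supp_uminus poly_supp_one)
  show "\<exists>q\<in>poly_supp X. f = (pvar v - pvar u) * q"
    if uv: "u \<noteq> v" "u \<in> X" "v \<in> X" and f: "f \<in> poly_supp X" "rename_poly (id(u := v)) f = 0"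
  proof -
    have "\<exists>q\<in>poly_supp X. f - rename_poly (id(u := v)) f = (pvar v - pvar u) * q"
    proof (rule rename_poly_diff_dvd[OF _ _ f(1)])
      show "(id(u := v)) ` X \<subseteq> X" using uv by auto
      fix w k assume "w \<in> X"
      show "\<exists>q\<in>poly_supp X. single (single w k) 1 -
            rename_poly (id(u := v)) (single (single w k) 1) = (pvar v - pvar u) * (q :: ('i var, rat) polynomial)"
      proof (cases "w = u")
        case True
        obtain q :: "('i var, rat) polynomial" where q: "q \<in> poly_supp X" "pvar u ^ k - pvar v ^ k = (pvar u - pvar v) * q"
          using power_diff_dvd[OF pvar_supp[OF uv(2)] pvar_supp[OF uv(3)]] by blast
        have "pvar u ^ k - pvar v ^ k = (pvar v - pvar u) * - q" unfolding q(2) by (simp add: algebra_simps)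
        then show ?thesis
          using True poly_supp_uminus[OF q(1)]
          by (intro bexI[of _ "- q"]) (simp_all add: single_var_power rename_poly_simps rename_poly_pvar)
      qed (auto simp: rename_poly_simps intro!: bexI[of _ 0] poly_supp_zero)
    qed
    then show ?thesis using f(2) by simp
  qed
  show "f + f = 0 \<Longrightarrow> f = 0" by (rule poly_mapping_double_eq_0)
qed (simp_all add: poly_supp_zero poly_supp_one poly_supp_add poly_supp_uminus poly_supp_mult rename_poly_simps
    rename_poly_comp poly_supp_rename rename_poly_pvar)

lemma lookup_single_mult:
  fixes f :: "('v \<Rightarrow>\<^sub>0 int) \<Rightarrow>\<^sub>0 'k::comm_ring_1"
  shows "lookup (single d 1 * f) (d + m) = lookup f m"
  by (induction f rule: poly_mapping_add_induct)
    (simp_all add: mult_single lookup_single distrib_left lookup_add when_def)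

text \<open>A solution of \<open>z\<^sub>u z\<^sub>v\<^sup>-\<^sup>1 f = f\<close> has the same
  coefficients along the infinite sequences of monomials \<open>m (z\<^sub>u
  z\<^sub>v\<^sup>-\<^sup>1)\<^sup>k\<close>.\<close>

lemma regular_laurent_factor:
  assumes uv: "u \<noteq> v"
  shows "regular (1 - pvar u * inv_pvar v :: ('v, 'k::comm_ring_1) laurent)"
  unfolding regular_def
proof (intro allI impI)
  fix f :: "('v, 'k) laurent" assume f: "(1 - pvar u * inv_pvar v) * f = 0"
  let ?d = "single u 1 + single v (- 1) :: 'v \<Rightarrow>\<^sub>0 int"
  have "f = single ?d 1 * f"
    using f by (simp add: pvar_def inv_pvar_def mult_single algebra_simps)
  then have step: "lookup f (?d + m) = lookup f m" for m
    using lookup_single_mult[of ?d f m] by simp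
  show "f = 0"
  proof (rule ccontr)
    assume "f \<noteq> 0"
    then obtain m where m: "lookup f m \<noteq> 0" by (metis poly_mapping_eqI lookup_zero)
    \<comment> \<open>an infinite sequence of monomials with the same nonzero coefficient\<close>
    define M where "M = rec_nat m (\<lambda>_ n. ?d + n)"
    have M: "M 0 = m" "M (Suc k) = ?d + M k" for k by (simp_all add: M_def)
    have "lookup f (M k) = lookup f m" for k
      by (induction k) (simp_all only: M step)
    then have "range M \<subseteq> keys f" using m by (auto simp: in_keys_iff)
    moreover have "lookup (M k) u = lookup m u + int k" for k
      using uv by (induction k) (simp_all add: M lookup_add lookup_single)
    then have "inj M" by (metis injI add_left_cancel of_nat_eq_iff)
    ultimately show False by (meson finite_keys finite_subset range_inj_infinite)
  qed
qed

interpretation laurent: shuffle_ring "poly_supp :: _ \<Rightarrow> ('i::finite var, rat) laurent set" rename_poly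
  "\<lambda>u v. 1 - pvar u * inv_pvar v"
proof
  fix X Y :: "'i var set" and f g :: "('i var, rat) laurent" and u v :: "'i var" and \<rho> \<sigma> :: "'i var \<Rightarrow> 'i var"
  show "X \<subseteq> Y \<Longrightarrow> poly_supp X \<subseteq> (poly_supp Y :: ('i var, rat) laurent set)" by (auto simp: poly_supp_def)
  show "f \<in> poly_supp X \<Longrightarrow> finite_fibres \<rho> \<Longrightarrow> finite_fibres \<sigma> \<Longrightarrow> (\<And>v. v \<in> X \<Longrightarrow> \<rho> v = \<sigma> v) \<Longrightarrow>
      rename_poly \<rho> f = rename_poly \<sigma> f"
    by (rule rename_poly_cong)
  show "1 - pvar u * inv_pvar v \<in> (poly_supp {u, v} :: ('i var, rat) laurent set)"
    by (intro poly_supp_diff poly_supp_one poly_supp_mult pvar_supp inv_pvar_supp) auto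
  show "u \<noteq> v \<Longrightarrow> regular (1 - pvar u * inv_pvar v :: ('i var, rat) laurent)" by (rule regular_laurent_factor)
  show "1 - pvar v * inv_pvar v = (0 :: ('i var, rat) laurent)" by (simp add: pvar_inv_pvar)
  show "\<exists>\<eta>\<in>poly_supp {u, v}. 1 - pvar v * inv_pvar u = \<eta> * (1 - pvar u * inv_pvar v :: ('i var, rat) laurent) \<and>
      rename_poly (id(u := v)) \<eta> = - 1" if "u \<noteq> v"
  proof (intro bexI[of _ "- (pvar v * inv_pvar u)"] conjI)
    have "pvar v * inv_pvar u * (pvar u * inv_pvar v) = (pvar v * inv_pvar v) * (pvar u * inv_pvar u :: ('i var, rat) laurent)"
      by (simp only: mult_ac)
    then have "pvar v * inv_pvar u * (pvar u * inv_pvar v) = (1 :: ('i var, rat) laurent)"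
      by (simp only: pvar_inv_pvar mult_1_left)
    then show "1 - pvar v * inv_pvar u = - (pvar v * inv_pvar u) * (1 - pvar u * inv_pvar v :: ('i var, rat) laurent)"
      by (simp only: right_diff_distrib mult_1_right minus_mult_left[symmetric] minus_diff_minus) simp
    show "rename_poly (id(u := v)) (- (pvar v * inv_pvar u)) = (- 1 :: ('i var, rat) laurent)"
      using that by (simp add: rename_poly_simps rename_poly_pvar rename_poly_inv_pvar pvar_inv_pvar)
    show "- (pvar v * inv_pvar u) \<in> (poly_supp {u, v} :: ('i var, rat) laurent set)"
      by (intro poly_supp_uminus poly_supp_mult pvar_supp inv_pvar_supp) auto
  qed
  show "\<exists>q\<in>poly_supp X. f = (1 - pvar u * inv_pvar v) * q"
    if uv: "u \<noteq> v" "u \<in> X" "v \<in> X" and f: "f \<in> poly_supp X" "rename_poly (id(u := v)) f = 0"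
  proof -
    have "\<exists>q\<in>poly_supp X. f - rename_poly (id(u := v)) f = (1 - pvar u * inv_pvar v) * q"
    proof (rule rename_poly_diff_dvd[OF _ _ f(1)])
      show "(id(u := v)) ` X \<subseteq> X" using uv by auto
      fix w k assume "w \<in> X"
      show "\<exists>q\<in>poly_supp X. single (single w k) 1 -
            rename_poly (id(u := v)) (single (single w k) 1) = (1 - pvar u * inv_pvar v) * (q :: ('i var, rat) laurent)"
      proof (cases "w = u")
        case True
        have pos: "pvar u - pvar v = (1 - pvar u * inv_pvar v) * (- pvar v :: ('i var, rat) laurent)"
        proof -
          have "pvar u * inv_pvar v * pvar v = pvar u * (pvar v * inv_pvar v :: ('i var, rat) laurent)" by (simp only: mult_ac)
          then show ?thesis by (simp add: pvar_inv_pvar left_diff_distrib)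
        qed
        have neg: "inv_pvar u - inv_pvar v = (1 - pvar u * inv_pvar v) * (inv_pvar u :: ('i var, rat) laurent)"
        proof -
          have "pvar u * inv_pvar v * inv_pvar u = inv_pvar v * (pvar u * inv_pvar u :: ('i var, rat) laurent)" by (simp only: mult_ac)
          then show ?thesis by (simp add: pvar_inv_pvar left_diff_distrib)
        qed
        show ?thesis
        proof (cases "0 \<le> k")
          case nonneg: True
          obtain q :: "('i var, rat) laurent" where q: "q \<in> poly_supp X" "pvar u ^ nat k - pvar v ^ nat k = (pvar u - pvar v) * q"
            using power_diff_dvd[OF pvar_supp[OF uv(2)] pvar_supp[OF uv(3)]] by blast
          have "pvar u ^ nat k - pvar v ^ nat k = (1 - pvar u * inv_pvar v) * (- pvar v * q)"
            unfolding q(2) pos by (simp only: mult.assoc)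
          moreover have "- pvar v * q \<in> poly_supp X" by (intro poly_supp_mult poly_supp_uminus pvar_supp q uv)
          ultimately show ?thesis using True nonneg
            by (intro bexI[of _ "- pvar v * q"]) (simp_all only: single_var_int_power if_True rename_poly_simps rename_poly_pvar fun_upd_same)
        next
          case False
          obtain q :: "('i var, rat) laurent" where q: "q \<in> poly_supp X" "inv_pvar u ^ nat (- k) - inv_pvar v ^ nat (- k) = (inv_pvar u - inv_pvar v) * q"
            using power_diff_dvd[OF inv_pvar_supp[OF uv(2)] inv_pvar_supp[OF uv(3)]] by blast
          have "inv_pvar u ^ nat (- k) - inv_pvar v ^ nat (- k) = (1 - pvar u * inv_pvar v) * (inv_pvar u * q)"
            unfolding q(2) neg by (simp only: mult.assoc)
          moreover have "inv_pvar u * q \<in> poly_supp X" by (intro poly_supp_mult inv_pvar_supp q uv)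
          ultimately show ?thesis using True False
            by (intro bexI[of _ "inv_pvar u * q"]) (simp_all only: single_var_int_power if_False rename_poly_simps rename_poly_inv_pvar fun_upd_same)
        qed
      qed (auto simp: rename_poly_simps intro!: bexI[of _ 0] poly_supp_zero)
    qed
    then show ?thesis using f(2) by simp
  qed
  show "f + f = 0 \<Longrightarrow> f = 0" by (rule poly_mapping_double_eq_0)
qed (simp_all add: poly_supp_zero poly_supp_one poly_supp_add poly_supp_uminus poly_supp_mult rename_poly_simps
    rename_poly_comp poly_supp_rename rename_poly_pvar rename_poly_inv_pvar)

lemma poly_sym_eq: "poly.sym g = sym_polys g" and laurent_sym_eq: "laurent.sym g = sym_polys g"
  by (simp_all add: poly.sym_def laurent.sym_def sym_polys_def poly_supp_def)

section \<open>Homomorphisms between shuffle algebras\<close>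

text \<open>The factors \<open>G\<close> are there because the Chern character only matches the two
  kernels up to invertible series.\<close>

locale shuffle_hom = R: shuffle_ring V ren K + R': shuffle_ring V' ren' K'
  for V :: "'i::finite var set \<Rightarrow> 'r::comm_ring_1 set" and ren K
    and V' :: "'i::finite var set \<Rightarrow> 's::comm_ring_1 set" and ren' K' +
  fixes h :: "'r \<Rightarrow> 's" and G :: "'i var \<Rightarrow> 'i var \<Rightarrow> 's"
  assumes h_add: "h (f + g) = h f + h g" and h_mult: "h (f * g) = h f * h g" and h_one: "h 1 = 1"
    and h_K: "u \<noteq> v \<Longrightarrow> h (K u v) = K' u v * G u v"
    and G_regular: "u \<noteq> v \<Longrightarrow> regular (G u v)"
begin

lemma h_zero: "h 0 = 0"
  using h_add[of 0 0] by simp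

lemma h_sum: "h (\<Sum>s\<in>S. f s) = (\<Sum>s\<in>S. h (f s))"
  by (induction S rule: infinite_finite_induct) (simp_all add: h_zero h_add)

lemma h_prod: "h (\<Prod>s\<in>S. f s) = (\<Prod>s\<in>S. h (f s))"
  by (induction S rule: infinite_finite_induct) (simp_all add: h_one h_mult)

lemma h_power: "h (f ^ n) = h f ^ n"
  by (induction n) (simp_all add: h_one h_mult)

lemma h_prod_K:
  assumes "\<And>u v. (u, v) \<in> P \<Longrightarrow> u \<noteq> v"
  shows "h (\<Prod>(u, v)\<in>P. K u v) = (\<Prod>(u, v)\<in>P. K' u v) * (\<Prod>(u, v)\<in>P. G u v)"
  unfolding h_prod prod.distrib[symmetric] 
proof (rule prod.cong[OF refl])
  fix p assume "p \<in> P"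
  moreover obtain u v where p: "p = (u, v)" by (cases p)
  ultimately show "h (case p of (u, v) \<Rightarrow> K u v) = (case p of (u, v) \<Rightarrow> K' u v) * (case p of (u, v) \<Rightarrow> G u v)"
    using assms[of u v] by (simp add: h_K)
qed

text \<open>The factors \<open>G\<close> that come from the denominators are cancelled by those
  assumed in the numerators.\<close>

theorem h_shuffle_mult:
  assumes f: "f1 \<in> R.sym g1" "f2 \<in> R.sym g2" and f': "f1' \<in> R'.sym g1" "f2' \<in> R'.sym g2"
    and numer: "\<And>w. w \<in> var_perms (\<lambda>i. g1 i + g2 i) \<Longrightarrow> h (R.numer a g1 g2 f1 f2 w) =
        c * R'.numer a g1 g2 f1' f2' w * (\<Prod>(u, v)\<in>mixed_pairs g1 g2 w. G u v)"
  shows "h (shuffle_mult ren K a g1 g2 f1 f2) = c * shuffle_mult ren' K' a g1 g2 f1' f2'"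
proof -
  let ?n = "\<lambda>i. g1 i + g2 i"
  let ?q = "shuffle_mult ren K a g1 g2 f1 f2" and ?q' = "shuffle_mult ren' K' a g1 g2 f1' f2'"
  \<comment> \<open>the factor by which the homomorphism changes the common denominator\<close>
  define GE where "GE = (\<Prod>(u, v)\<in>vpairs ?n. G u v)"
  have ne: "u \<noteq> v" if "(u, v) \<in> vpairs ?n" for u v using that by (simp add: vpairs_def)
  have reg: "regular (R'.full_denom ?n * GE)"
    unfolding GE_def using ne by (intro regular_mult R'.regular_full_denom regular_prod) (auto simp: G_regular)
  have "h (R.numer a g1 g2 f1 f2 w * R.codenom g1 g2 w)
      = c * GE * (R'.numer a g1 g2 f1' f2' w * R'.codenom g1 g2 w)" if w: "w \<in> var_shuffles g1 g2" for w
  proof -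
    note w = shuffle_perm[OF w]
    have "h (R.codenom g1 g2 w) = R'.codenom g1 g2 w * (\<Prod>(u, v)\<in>vpairs ?n - mixed_pairs g1 g2 w. G u v)"
      unfolding R.codenom_def R'.codenom_def by (rule h_prod_K) (auto dest: ne)
    moreover have "GE = (\<Prod>(u, v)\<in>vpairs ?n - mixed_pairs g1 g2 w. G u v) * (\<Prod>(u, v)\<in>mixed_pairs g1 g2 w. G u v)"
      unfolding GE_def by (rule prod.subset_diff[OF R.mixed_pairs_subset[OF w] R.finite_vpairs])
    ultimately show ?thesis by (simp add: h_mult numer[OF w] mult_ac)
  qed
  then have total: "h (R.total a g1 g2 f1 f2) = c * GE * R'.total a g1 g2 f1' f2'"
    unfolding R.total_def R'.total_def h_sum sum_distrib_left by (intro sum.cong refl)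
  have "h (R.full_denom ?n) = R'.full_denom ?n * GE"
    unfolding R.full_denom_def R'.full_denom_def GE_def by (rule h_prod_K) (rule ne)
  then have "h ?q * (R'.full_denom ?n * GE) = h (?q * R.full_denom ?n)" by (simp add: h_mult)
  also have "\<dots> = c * GE * (?q' * R'.full_denom ?n)"
    unfolding R.shuffle_mult(2)[OF f] R'.shuffle_mult(2)[OF f'] by (rule total)
  also have "\<dots> = (c * ?q') * (R'.full_denom ?n * GE)" by (simp only: mult_ac)
  finally show ?thesis unfolding regular_cancel_right[OF reg] .
qed

end

lemma poly_series_sym: "poly_series f \<in> sym_series g \<longleftrightarrow> f \<in> sym_polys g"
proof -
  have "poly_series f = poly_series f' \<longleftrightarrow> f = f'" for f f' :: "('a var, 'b) polynomial"
    by (metis mcoeff_poly_series poly_mapping_eqI)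
  then have "rename_mfps (on_vars \<pi>) (poly_series f) = poly_series f \<longleftrightarrow> rename_poly (on_vars \<pi>) f = f"
    if "\<pi> \<in> var_perms g" for \<pi>
    using poly_series_rename[OF inj_finite_fibres[OF inj_on_vars[OF that]], of f] by metis
  then show ?thesis by (auto simp: sym_series_def sym_polys_def in_keys_iff)
qed

lemma poly_series_shuffle_mult:
  fixes f1 f2 :: "('i::finite var, rat) polynomial"
  assumes "f1 \<in> sym_polys g1" "f2 \<in> sym_polys g2"
  shows "poly_series (shuffle_mult rename_poly (\<lambda>u v. pvar v - pvar u) a g1 g2 f1 f2)
    = shuffle_mult rename_mfps (\<lambda>u v. mfps_var v - mfps_var u) a g1 g2 (poly_series f1) (poly_series f2)"
proof -
  interpret shuffle_hom poly_supp rename_poly "\<lambda>u v. pvar v - pvar u" mfps_supp rename_mfps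
    "\<lambda>u v. mfps_var v - mfps_var u" "poly_series :: ('i var, rat) polynomial \<Rightarrow> _" "\<lambda>_ _. 1"
    by unfold_locales (simp_all add: poly_series_simps poly_series_rename poly_series_pvar)
  have "poly_series (poly.numer a g1 g2 f1 f2 w) = 1 * series.numer a g1 g2 (poly_series f1) (poly_series f2) w
      * (\<Prod>(u, v)\<in>mixed_pairs g1 g2 w. 1)" if w: "w \<in> var_perms (\<lambda>i. g1 i + g2 i)" for w
    by (simp add: poly.numer_def series.numer_def h_mult h_prod h_power poly_series_simps poly_series_pvar
        poly_series_rename[OF poly.ff_on_vars[OF w]] poly_series_rename[OF poly.ff_on_vars2[OF w]] split_def)
  from h_shuffle_mult[OF _ _ _ _ this] show ?thesis
    using assms by (simp add: poly_sym_eq series_sym_eq poly_series_sym)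
qed

section \<open>Exponentials of power series\<close>

lemma mcoeff_const_mult: "mcoeff (mfps_const c * f) m = c * mcoeff f m"
  using mcoeff_monom_mult_add[of 0 c f m] by (simp add: mfps_const_eq_monom)

lemma mfps_const_add: "mfps_const (c + d) = mfps_const c + mfps_const d"
  by (simp add: mfps_const_eq_monom mfps_monom_add)

lemma mfps_const_mult: "mfps_const (c * d) = mfps_const c * mfps_const d"
  by (simp add: mfps_const_eq_monom mfps_monom_mult)

lemma mfps_const_one [simp]: "mfps_const 1 = 1"
  by (simp add: mfps_const_eq_monom)

lemma mfps_const_of_nat: "mfps_const (of_nat n) = of_nat n"
proof (induction n)
  case 0
  show ?case by (rule mfps_eqI) (simp add: mfps_const_eq_monom mcoeff_monom)
qed (simp add: mfps_const_add)

lemma mfps_const_supp [simp]: "mfps_const c \<in> mfps_supp X"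
  by (simp add: mfps_const_eq_monom mfps_monom_supp)

lemma mfps_supp_add: "f \<in> mfps_supp X \<Longrightarrow> g \<in> mfps_supp X \<Longrightarrow> f + g \<in> mfps_supp X"
  by (force simp: mfps_supp_def)

lemma mfps_supp_uminus: "f \<in> mfps_supp X \<Longrightarrow> - f \<in> mfps_supp X"
  by (simp add: mfps_supp_def)

lemma mfps_supp_power: "f \<in> mfps_supp X \<Longrightarrow> f ^ n \<in> mfps_supp X"
  by (induction n) (auto intro: mfps_supp_mult simp flip: mfps_const_one)

lemma mfps_supp_prod: "(\<And>s. s \<in> S \<Longrightarrow> f s \<in> mfps_supp X) \<Longrightarrow> (\<Prod>s\<in>S. f s) \<in> mfps_supp X"
  by (induction S rule: infinite_finite_induct) (auto intro: mfps_supp_mult simp flip: mfps_const_one)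

lemma mfps_supp_sum: "(\<And>s. s \<in> S \<Longrightarrow> f s \<in> mfps_supp X) \<Longrightarrow> (\<Sum>s\<in>S. f s) \<in> mfps_supp X"
proof (induction S rule: infinite_finite_induct)
  case (insert s S)
  then show ?case by (auto intro: mfps_supp_add)
qed (simp_all add: mfps_supp_def)

lemma mfps_var_supp: "v \<in> X \<Longrightarrow> mfps_var v \<in> mfps_supp X"
  unfolding mfps_var_eq_monom by (rule mfps_monom_supp) auto

lemma rename_mfps_power: "finite_fibres \<rho> \<Longrightarrow> rename_mfps \<rho> (f ^ n) = rename_mfps \<rho> f ^ n"
  by (induction n) (simp_all add: rename_mfps_one rename_mfps_mult)

lemma rename_mfps_zero: "rename_mfps \<rho> 0 = 0"
  by (rule mfps_eqI) (simp add: mcoeff_rename)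

lemma rename_mfps_sum: "rename_mfps \<rho> (\<Sum>s\<in>S. f s) = (\<Sum>s\<in>S. rename_mfps \<rho> (f s))"
  by (induction S rule: infinite_finite_induct) (simp_all add: rename_mfps_zero rename_mfps_add)

lemma rename_mfps_prod: "finite_fibres \<rho> \<Longrightarrow> rename_mfps \<rho> (\<Prod>s\<in>S. f s) = (\<Prod>s\<in>S. rename_mfps \<rho> (f s))"
  by (induction S rule: infinite_finite_induct) (simp_all add: rename_mfps_one rename_mfps_mult)

lemma mcoeff_mfps_exp: "mcoeff (mfps_exp f) m = (\<Sum>n\<le>mdeg m. mcoeff (f ^ n) m / fact n)"
  by (simp add: mfps_exp_def)

definition exp_poly :: "nat \<Rightarrow> ('v, 'k::field_char_0) mfps \<Rightarrow> ('v, 'k) mfps" where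
  "exp_poly N f = (\<Sum>n\<le>N. mfps_const (inverse (fact n)) * f ^ n)"

lemma mfps_exp_close:
  fixes f :: "('v, 'k::field_char_0) mfps"
  assumes f: "f \<in> mfps_ge 1"
  shows "mfps_exp f - exp_poly N f \<in> mfps_ge (Suc N)"
proof (rule mfps_geI)
  fix m :: "'v \<Rightarrow>\<^sub>0 nat" assume "mdeg m < Suc N"
  then have "(\<Sum>n\<le>mdeg m. mcoeff (f ^ n) m / fact n) = (\<Sum>n\<le>N. mcoeff (f ^ n) m / fact n)"
    using mfps_geD[OF mfps_ge_power[OF f]] by (intro sum.mono_neutral_left) auto
  then show "mcoeff (mfps_exp f - exp_poly N f) m = 0"
    by (simp add: mcoeff_mfps_exp exp_poly_def mcoeff_sum mcoeff_const_mult divide_inverse mult.commute[of _ "inverse _"])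
qed

lemma mfps_exp_minus_1_minus: "f \<in> mfps_ge 1 \<Longrightarrow> mfps_exp f - 1 - f \<in> mfps_ge 2"
  using mfps_exp_close[of f 1] by (simp add: exp_poly_def diff_diff_eq numeral_2_eq_2)

lemma mfps_exp_zero [simp]: "mfps_exp 0 = 1"
proof (rule mfps_eqI)
  fix m
  have "mcoeff (mfps_exp 0) m = (\<Sum>n\<le>mdeg m. if n = 0 then mcoeff 1 m else 0)"
    unfolding mcoeff_mfps_exp by (intro sum.cong refl) (auto simp: power_0_left)
  then show "mcoeff (mfps_exp 0) m = mcoeff 1 m" by simp
qed

text \<open>Modulo terms of degree above \<open>N\<close> the exponentials are their truncations.
  The product of the truncations contains the terms \<open>f\<^sup>i g\<^sup>j / (i! j!)\<close> with
  \<open>i, j \<le> N\<close>, the truncation for \<open>f + g\<close> those with \<open>i + j \<le>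
  N\<close>, and the others have degree above \<open>N\<close>.\<close>

lemma mfps_exp_add:
  fixes f g :: "('v, 'k::field_char_0) mfps"
  assumes f: "f \<in> mfps_ge 1" and g: "g \<in> mfps_ge 1"
  shows "mfps_exp (f + g) = mfps_exp f * mfps_exp g"
proof (rule mfps_eq_if_close)
  fix n
  show "mfps_exp (f + g) - mfps_exp f * mfps_exp g \<in> mfps_ge n"
  proof (cases n)
    case (Suc N)
    define t where "t i j = mfps_const (inverse (fact i)) * mfps_const (inverse (fact j)) * (f ^ i * g ^ j)" for i j
    have "exp_poly N (f + g) = (\<Sum>n\<le>N. \<Sum>i\<le>n. t i (n - i))"
    proof -
      have "mfps_const (inverse (fact n)) * (f + g) ^ n = (\<Sum>i\<le>n. t i (n - i))" for n
      proof -
        have "mfps_const (inverse (fact n)) * (of_nat (n choose i) * f ^ i * g ^ (n - i)) = t i (n - i)" if "i \<le> n" for i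
        proof -
          have "inverse (fact n) * of_nat (n choose i) = (inverse (fact i) * inverse (fact (n - i)) :: 'k)"
            using binomial_fact[OF that, where ?'a = 'k] by (simp add: field_simps)
          then have "mfps_const (inverse (fact n)) * of_nat (n choose i)
              = (mfps_const (inverse (fact i)) * mfps_const (inverse (fact (n - i))) :: ('v, 'k) mfps)"
            by (metis mfps_const_mult mfps_const_of_nat)
          then show ?thesis unfolding t_def by (metis mult.assoc)
        qed
        then show ?thesis by (simp add: binomial_ring sum_distrib_left)
      qed
      then show ?thesis by (simp add: exp_poly_def)
    qed
    also have "\<dots> = (\<Sum>(i, j)\<in>{(i, j). i + j \<le> N}. t i j)" by (rule sum.triangle_reindex_eq[symmetric])
    finally have lhs: "exp_poly N (f + g) = (\<Sum>(i, j)\<in>{(i, j). i + j \<le> N}. t i j)" .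
    have "exp_poly N f * exp_poly N g = (\<Sum>(i, j)\<in>{..N} \<times> {..N}. t i j)"
      unfolding exp_poly_def sum_product sum.cartesian_product[symmetric]
      by (intro sum.cong refl) (simp add: t_def mult_ac)
    also have "\<dots> = (\<Sum>(i, j)\<in>{..N} \<times> {..N} - {(i, j). i + j \<le> N}. t i j) + (\<Sum>(i, j)\<in>{(i, j). i + j \<le> N}. t i j)"
      by (rule sum.subset_diff) auto
    finally have "exp_poly N f * exp_poly N g - exp_poly N (f + g)
        = (\<Sum>(i, j)\<in>{..N} \<times> {..N} - {(i, j). i + j \<le> N}. t i j)" by (simp add: lhs)
    also have "\<dots> \<in> mfps_ge (Suc N)"
    proof (rule mfps_ge_sum)
      fix p assume "p \<in> {..N} \<times> {..N} - {(i, j). i + j \<le> N}"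
      then obtain i j where p: "p = (i, j)" and "\<not> i + j \<le> N" by auto
      then have "f ^ i * g ^ j \<in> mfps_ge (Suc N)"
        using mfps_ge_mono[OF _ mfps_ge_mult[OF mfps_ge_power[OF f, of i] mfps_ge_power[OF g, of j]]] by simp
      then show "(case p of (i, j) \<Rightarrow> t i j) \<in> mfps_ge (Suc N)"
        unfolding t_def p prod.case by (rule mfps_ge_mult_right)
    qed
    finally have 1: "exp_poly N f * exp_poly N g - exp_poly N (f + g) \<in> mfps_ge (Suc N)" .
    have 2: "mfps_exp (f + g) - exp_poly N (f + g) \<in> mfps_ge (Suc N)" by (rule mfps_exp_close[OF mfps_ge_add[OF f g]])
    have "mfps_exp f * mfps_exp g - exp_poly N f * exp_poly N g
        = (mfps_exp f - exp_poly N f) * mfps_exp g + exp_poly N f * (mfps_exp g - exp_poly N g)"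
      by (simp add: algebra_simps)
    also have "\<dots> \<in> mfps_ge (Suc N)"
      by (intro mfps_ge_add mfps_ge_mult_left mfps_ge_mult_right mfps_exp_close f g)
    finally have 3: "mfps_exp f * mfps_exp g - exp_poly N f * exp_poly N g \<in> mfps_ge (Suc N)" .
    have "mfps_exp (f + g) - mfps_exp f * mfps_exp g = (mfps_exp (f + g) - exp_poly N (f + g))
       - (exp_poly N f * exp_poly N g - exp_poly N (f + g)) - (mfps_exp f * mfps_exp g - exp_poly N f * exp_poly N g)"
      by (simp add: algebra_simps)
    also have "\<dots> \<in> mfps_ge (Suc N)" by (intro mfps_ge_diff 1 2 3)
    finally show ?thesis using Suc by simp
  qed simp
qed

lemma mfps_exp_sum:
  fixes f :: "'s \<Rightarrow> ('v, 'k::field_char_0) mfps"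
  shows "(\<And>s. s \<in> S \<Longrightarrow> f s \<in> mfps_ge 1) \<Longrightarrow> mfps_exp (\<Sum>s\<in>S. f s) = (\<Prod>s\<in>S. mfps_exp (f s))"
proof (induction S rule: infinite_finite_induct)
  case (insert s S)
  then show ?case by (simp add: mfps_exp_add mfps_ge_sum)
qed simp_all

lemma mfps_exp_uminus: "f \<in> mfps_ge 1 \<Longrightarrow> mfps_exp f * mfps_exp (- f) = 1"
  using mfps_exp_add[of f "- f"] by (simp add: mfps_ge_uminus)

lemma rename_mfps_exp:
  assumes ff: "finite_fibres \<rho>"
  shows "rename_mfps \<rho> (mfps_exp f) = mfps_exp (rename_mfps \<rho> f)"
proof (rule mfps_eqI)
  fix m
  have "mcoeff (rename_mfps \<rho> (mfps_exp f)) m = (\<Sum>n | rename_monom \<rho> n = m. \<Sum>k\<le>mdeg m. mcoeff (f ^ k) n / fact k)"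
    unfolding mcoeff_rename mcoeff_mfps_exp by (rule sum.cong) auto
  also have "\<dots> = (\<Sum>k\<le>mdeg m. (\<Sum>n | rename_monom \<rho> n = m. mcoeff (f ^ k) n) / fact k)"
    by (subst sum.swap) (simp add: sum_divide_distrib)
  also have "\<dots> = mcoeff (mfps_exp (rename_mfps \<rho> f)) m"
    unfolding mcoeff_mfps_exp rename_mfps_power[OF ff, symmetric] mcoeff_rename ..
  finally show "mcoeff (rename_mfps \<rho> (mfps_exp f)) m = mcoeff (mfps_exp (rename_mfps \<rho> f)) m" .
qed

lemma mfps_exp_supp:
  assumes "f \<in> mfps_supp X"
  shows "mfps_exp f \<in> mfps_supp X"
proof -
  have "keys m \<subseteq> X" if nz: "mcoeff (mfps_exp f) m \<noteq> 0" for m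
  proof -
    obtain n where "mcoeff (f ^ n) m / fact n \<noteq> 0"
      using nz unfolding mcoeff_mfps_exp by (rule sum.not_neutral_contains_not_neutral)
    then show ?thesis using mfps_supp_power[OF assms, of n] by (auto simp: mfps_supp_def)
  qed
  then show ?thesis by (simp add: mfps_supp_def)
qed

section \<open>The Chern character\<close>

lemma mfps_ge_of_int_mult_var: "of_int k * mfps_var v \<in> mfps_ge 1"
  by (intro mfps_ge_mult_right mfps_ge_var)

text \<open>The exponent of the Chern character of the Laurent monomial with exponents
  \<open>m\<close>.\<close>

definition linear_form :: "('v \<Rightarrow>\<^sub>0 int) \<Rightarrow> ('v, rat) mfps" where
  "linear_form m = (\<Sum>v\<in>keys m. of_int (lookup m v) * mfps_var v)"

lemma linear_form_ge: "linear_form m \<in> mfps_ge 1"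
  unfolding linear_form_def by (intro mfps_ge_sum mfps_ge_of_int_mult_var)

lemma linear_form_add: "linear_form (m + n) = linear_form m + linear_form n"
proof -
  have super: "linear_form m = (\<Sum>v\<in>S. of_int (lookup m v) * mfps_var v)"
    if "finite S" "keys m \<subseteq> S" for S m
    unfolding linear_form_def by (rule sum.mono_neutral_left) (use that in \<open>auto simp: in_keys_iff\<close>)
  let ?S = "keys m \<union> keys n"
  have "finite ?S" "keys (m + n) \<subseteq> ?S" by (simp_all add: keys_add)
  then show ?thesis by (simp add: super[of ?S] lookup_add distrib_right sum.distrib)
qed

lemma linear_form_single [simp]: "linear_form (single v k) = of_int k * mfps_var v"
  by (cases "k = 0") (simp_all add: linear_form_def)

lemma linear_form_zero [simp]: "linear_form 0 = 0"
  by (simp add: linear_form_def)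

lemma linear_form_sum: "linear_form (\<Sum>s\<in>S. f s) = (\<Sum>s\<in>S. linear_form (f s))"
  by (induction S rule: infinite_finite_induct) (simp_all add: linear_form_add)

lemma rename_of_int: "finite_fibres \<rho> \<Longrightarrow> rename_mfps \<rho> (of_int k) = of_int k"
proof -
  assume ff: "finite_fibres \<rho>"
  have "rename_mfps \<rho> (of_nat n) = of_nat n" for n
    by (induction n) (simp_all add: rename_mfps_zero rename_mfps_add rename_mfps_one[OF ff])
  then show ?thesis by (cases k rule: int_cases2) (simp_all add: rename_mfps_uminus)
qed

lemma rename_linear_form:
  assumes ff: "finite_fibres \<rho>"
  shows "rename_mfps \<rho> (linear_form m) = linear_form (rename_monom \<rho> m)"
  unfolding rename_monom_def linear_form_sum linear_form_single
  by (simp add: linear_form_def rename_mfps_sum rename_mfps_mult[OF ff] rename_of_int[OF ff] rename_mfps_var[OF ff])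

interpretation chern: monomial_hom "\<lambda>m c. mfps_const c * mfps_exp (linear_form m)"
  by unfold_locales (simp_all add: mfps_const_add mfps_const_mult linear_form_add
      mfps_exp_add[OF linear_form_ge linear_form_ge] algebra_simps)

lemma chern_lin: "chern f = chern.lin f"
proof -
  have "(\<Prod>v\<in>keys m. mfps_exp (of_int (lookup m v) * mfps_var v)) = mfps_exp (linear_form m)"
    for m :: "'a \<Rightarrow>\<^sub>0 int"
    unfolding linear_form_def by (rule mfps_exp_sum[symmetric]) (rule mfps_ge_of_int_mult_var)
  then show ?thesis by (simp add: chern_def chern.lin_def)
qed

lemmas chern_simps = chern.lin_add[folded chern_lin] chern.lin_mult[folded chern_lin]
  chern.lin_one[folded chern_lin] chern.lin_single[folded chern_lin] chern.lin_diff[folded chern_lin]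
  chern.lin_sum[folded chern_lin] chern.lin_prod[folded chern_lin] chern.lin_power[folded chern_lin]

lemma chern_pvar: "chern (pvar v) = mfps_exp (mfps_var v)"
  by (simp add: pvar_def chern_simps)

lemma chern_inv_pvar: "chern (inv_pvar v) = mfps_exp (- mfps_var v)"
  by (simp add: inv_pvar_def chern_simps)

lemma chern_rename: "finite_fibres \<rho> \<Longrightarrow> chern (rename_poly \<rho> f) = rename_mfps \<rho> (chern f)"
  by (induction f rule: poly_mapping_add_induct)
    (simp_all add: rename_poly_simps chern_simps rename_mfps_add rename_mfps_mult rename_mfps_const
      rename_mfps_exp rename_linear_form)

lemma chern_supp:
  assumes "f \<in> poly_supp X"
  shows "chern f \<in> mfps_supp X"
proof -
  have "linear_form m \<in> mfps_supp X" if "m \<in> keys f" for m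
  proof -
    have "of_int k * mfps_var v \<in> (mfps_supp X :: ('a, rat) mfps set)" if "v \<in> X" for k and v :: 'a
    proof -
      have "of_int k = (mfps_const (of_int k) :: ('a, rat) mfps)"
      proof (cases k rule: int_cases2)
        case (nonpos n)
        have "mfps_const (- of_nat n) = - (mfps_const (of_nat n) :: ('a, rat) mfps)"
          by (rule mfps_eqI) (simp add: mfps_const_eq_monom mcoeff_monom)
        then show ?thesis using nonpos by (simp add: mfps_const_of_nat)
      qed (simp add: mfps_const_of_nat)
      then show ?thesis using that by (simp add: mfps_supp_mult mfps_var_supp)
    qed
    then show ?thesis
      using assms that unfolding linear_form_def by (intro mfps_supp_sum) (auto simp: poly_supp_def)
  qed
  then show ?thesis
    unfolding chern_lin chern.lin_def by (intro mfps_supp_sum mfps_supp_mult mfps_const_supp mfps_exp_supp)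
qed

lemma chern_sym: "f \<in> sym_polys g \<Longrightarrow> chern f \<in> sym_series g"
proof -
  assume f: "f \<in> sym_polys g"
  then have "chern f \<in> mfps_supp (vars g)" by (intro chern_supp) (simp add: sym_polys_def poly_supp_def)
  moreover have "rename_mfps (on_vars \<pi>) (chern f) = chern f" if "\<pi> \<in> var_perms g" for \<pi>
    using f that chern_rename[OF inj_finite_fibres[OF inj_on_vars[OF that]], of f] by (simp add: sym_polys_def)
  ultimately show ?thesis by (simp add: sym_series_def mfps_supp_def)
qed

section \<open>Comparison of the two kernels\<close>

text \<open>The series \<open>1 / (1 - h)\<close>, for \<open>h\<close> without constant
  term.\<close>

definition mfps_geometric :: "('v, 'k::comm_ring_1) mfps \<Rightarrow> ('v, 'k) mfps" where
  "mfps_geometric h = Abs_mfps (\<lambda>m. \<Sum>n\<le>mdeg m. mcoeff (h ^ n) m)"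

lemma mfps_geometric:
  fixes h :: "('v, 'k::comm_ring_1) mfps"
  assumes h: "h \<in> mfps_ge 1"
  shows "(1 - h) * mfps_geometric h = 1"
proof (rule mfps_eq_if_close)
  fix n
  show "(1 - h) * mfps_geometric h - 1 \<in> mfps_ge n"
  proof (cases n)
    case (Suc N)
    have "mfps_geometric h - (\<Sum>n\<le>N. h ^ n) \<in> mfps_ge (Suc N)"
    proof (rule mfps_geI)
      fix m :: "'v \<Rightarrow>\<^sub>0 nat" assume "mdeg m < Suc N"
      then have "(\<Sum>n\<le>mdeg m. mcoeff (h ^ n) m) = (\<Sum>n\<le>N. mcoeff (h ^ n) m)"
        using mfps_geD[OF mfps_ge_power[OF h]] by (intro sum.mono_neutral_left) auto
      then show "mcoeff (mfps_geometric h - (\<Sum>n\<le>N. h ^ n)) m = 0"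
        by (simp add: mfps_geometric_def mcoeff_sum)
    qed
    then have "(1 - h) * (mfps_geometric h - (\<Sum>n\<le>N. h ^ n)) - h ^ Suc N \<in> mfps_ge (Suc N)"
      using mfps_ge_power[OF h, of "Suc N"] mfps_ge_diff[OF mfps_ge_mult_right] by simp
    also have "(1 - h) * (mfps_geometric h - (\<Sum>n\<le>N. h ^ n)) - h ^ Suc N = (1 - h) * mfps_geometric h - 1"
      using sum_gp_basic[of h N] by (simp add: algebra_simps)
    finally show ?thesis using Suc by simp
  qed simp
qed

lemma mfps_geometric_supp:
  assumes "h \<in> mfps_supp X"
  shows "mfps_geometric h \<in> mfps_supp X"
proof -
  have "keys m \<subseteq> X" if nz: "mcoeff (mfps_geometric h) m \<noteq> 0" for m
  proof -
    obtain n where "mcoeff (h ^ n) m \<noteq> 0"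
      using nz unfolding mfps_geometric_def mcoeff_simps by (rule sum.not_neutral_contains_not_neutral)
    then show ?thesis using mfps_supp_power[OF assms, of n] by (auto simp: mfps_supp_def)
  qed
  then show ?thesis by (simp add: mfps_supp_def)
qed

text \<open>The symmetric series \<open>(e\<^bsup>-u\<^esup> - e\<^bsup>-v\<^esup>) / (u -
  v)\<close>, which has constant term \<open>- 1\<close>.\<close>

definition exp_quot :: "'v \<Rightarrow> 'v \<Rightarrow> ('v, rat) mfps" where
  "exp_quot u v = diff_quot u v (mfps_exp (- mfps_var u) - mfps_exp (- mfps_var v))"

definition exp_quot_inv :: "'v \<Rightarrow> 'v \<Rightarrow> ('v, rat) mfps" where
  "exp_quot_inv u v = - mfps_geometric (1 + exp_quot u v)"

lemma exp_quot: "u \<noteq> v \<Longrightarrow> (mfps_var u - mfps_var v) * exp_quot u v = mfps_exp (- mfps_var u) - mfps_exp (- mfps_var v)"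
  unfolding exp_quot_def
  by (rule diff_quot[symmetric])
    (simp_all add: rename_mfps_diff rename_mfps_exp rename_mfps_uminus rename_mfps_var finite_fibres_upd del: fun_upd_apply, simp)

lemma exp_quot_commute:
  assumes "u \<noteq> v"
  shows "exp_quot v u = exp_quot u v"
proof -
  have "(mfps_var u - mfps_var v) * exp_quot v u = (mfps_var u - mfps_var v) * exp_quot u v"
  proof -
    have "(mfps_var u - mfps_var v) * exp_quot v u = - ((mfps_var v - mfps_var u) * exp_quot v u)"
      by (simp only: minus_mult_left minus_diff_eq)
    also have "\<dots> = (mfps_var u - mfps_var v) * exp_quot u v"
      unfolding exp_quot[OF assms] exp_quot[OF assms[symmetric]] by (rule minus_diff_eq)
    finally show ?thesis .
  qed
  then show ?thesis unfolding regular_cancel[OF regular_var_diff[OF assms[symmetric]]] .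
qed

lemma rename_exp_quot:
  assumes ff: "finite_fibres \<rho>" and uv: "u \<noteq> v" "\<rho> u \<noteq> \<rho> v"
  shows "rename_mfps \<rho> (exp_quot u v) = exp_quot (\<rho> u) (\<rho> v)"
proof -
  have "(mfps_var (\<rho> u) - mfps_var (\<rho> v)) * rename_mfps \<rho> (exp_quot u v)
      = rename_mfps \<rho> ((mfps_var u - mfps_var v) * exp_quot u v)"
    by (simp add: rename_mfps_mult[OF ff] rename_mfps_diff rename_mfps_var[OF ff])
  also have "\<dots> = (mfps_var (\<rho> u) - mfps_var (\<rho> v)) * exp_quot (\<rho> u) (\<rho> v)"
    by (simp add: exp_quot uv rename_mfps_diff rename_mfps_exp[OF ff] rename_mfps_uminus rename_mfps_var[OF ff])
  finally show ?thesis unfolding regular_cancel[OF regular_var_diff[OF uv(2)[symmetric]]] .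
qed

lemma exp_quot_plus_1:
  assumes "u \<noteq> v"
  shows "1 + exp_quot u v \<in> mfps_ge 1"
proof (rule mfps_ge_var_diff_cancel[of v u])
  show "v \<noteq> u" using assms by simp
  have "(mfps_var u - mfps_var v) * (1 + exp_quot u v) =
      (mfps_exp (- mfps_var u) - 1 - (- mfps_var u)) - (mfps_exp (- mfps_var v) - 1 - (- mfps_var v))"
    unfolding distrib_left exp_quot[OF assms] by simp
  also have "\<dots> \<in> mfps_ge 2" by (intro mfps_ge_diff mfps_exp_minus_1_minus mfps_ge_uminus mfps_ge_var)
  finally show "(mfps_var u - mfps_var v) * (1 + exp_quot u v) \<in> mfps_ge (Suc 1)"
    by (simp add: numeral_2_eq_2)
qed

lemma exp_quot_inv: "u \<noteq> v \<Longrightarrow> exp_quot u v * exp_quot_inv u v = 1"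
  using mfps_geometric[OF exp_quot_plus_1[of u v]] by (simp add: exp_quot_inv_def)

lemma exp_quot_inv_unique: "u \<noteq> v \<Longrightarrow> exp_quot u v * r = 1 \<Longrightarrow> r = exp_quot_inv u v"
  using exp_quot_inv[of u v] by (metis mult.left_commute mult.right_neutral)

lemma exp_quot_inv_commute: "u \<noteq> v \<Longrightarrow> exp_quot_inv v u = exp_quot_inv u v"
  using exp_quot_inv_unique[of u v "exp_quot_inv v u"] exp_quot_inv[of v u] exp_quot_commute[of u v] by simp

lemma rename_exp_quot_inv:
  assumes ff: "finite_fibres \<rho>" and uv: "u \<noteq> v" "\<rho> u \<noteq> \<rho> v"
  shows "rename_mfps \<rho> (exp_quot_inv u v) = exp_quot_inv (\<rho> u) (\<rho> v)"
  using exp_quot_inv_unique[OF uv(2)] arg_cong[OF exp_quot_inv[OF uv(1)], of "rename_mfps \<rho>"]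
  by (simp add: rename_mfps_mult[OF ff] rename_mfps_one[OF ff] rename_exp_quot[OF ff uv])

lemma exp_quot_supp:
  assumes "u \<in> X" "v \<in> X"
  shows "exp_quot u v \<in> mfps_supp X"
proof -
  have "mfps_exp (- mfps_var u) \<in> mfps_supp X" "- mfps_exp (- mfps_var v) \<in> (mfps_supp X :: ('a, rat) mfps set)"
    using assms by (auto intro!: mfps_supp_uminus mfps_exp_supp mfps_var_supp)
  from mfps_supp_add[OF this] show ?thesis
    unfolding exp_quot_def using assms by (intro diff_quot_supp) simp_all
qed

lemma exp_quot_inv_supp: "u \<in> X \<Longrightarrow> v \<in> X \<Longrightarrow> exp_quot_inv u v \<in> mfps_supp X"
  unfolding exp_quot_inv_def
  using mfps_const_supp[of 1 X] by (intro mfps_supp_uminus mfps_geometric_supp mfps_supp_add exp_quot_supp) simp_all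

text \<open>This follows on multiplying \<open>e\<^bsup>-u\<^esup> - e\<^bsup>-v\<^esup>\<close> by
  \<open>e\<^sup>u\<close>.\<close>

lemma chern_kernel:
  assumes "u \<noteq> v"
  shows "chern (1 - pvar u * inv_pvar v) = (mfps_var v - mfps_var u) * (- exp_quot u v * mfps_exp (mfps_var u))"
proof -
  have "(mfps_var v - mfps_var u) * (- exp_quot u v * mfps_exp (mfps_var u))
      = ((mfps_var u - mfps_var v) * exp_quot u v) * mfps_exp (mfps_var u)" by (simp add: algebra_simps)
  also have "\<dots> = 1 - mfps_exp (mfps_var u) * mfps_exp (- mfps_var v)"
    unfolding exp_quot[OF assms] using mfps_exp_uminus[OF mfps_ge_var[of u]] by (simp add: algebra_simps)
  finally show ?thesis by (simp add: chern_simps chern_pvar chern_inv_pvar)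
qed

section \<open>Products over unordered pairs\<close>

text \<open>The common value \<open>\<phi> u v = \<phi> v u\<close> on an unordered pair.\<close>

definition on_pair :: "('v \<Rightarrow> 'v \<Rightarrow> 'r) \<Rightarrow> 'v set \<Rightarrow> 'r" where
  "on_pair \<phi> B = (THE r. \<exists>u v. B = {u, v} \<and> u \<noteq> v \<and> r = \<phi> u v)"

definition pair_prod :: "('v \<Rightarrow> 'v \<Rightarrow> 'r::comm_ring_1) \<Rightarrow> 'v set \<Rightarrow> 'r" where
  "pair_prod \<phi> X = (\<Prod>B | B \<subseteq> X \<and> card B = 2. on_pair \<phi> B)"

lemma on_pair:
  assumes "\<And>u v. u \<noteq> v \<Longrightarrow> \<phi> v u = \<phi> u v" "u \<noteq> v"
  shows "on_pair \<phi> {u, v} = \<phi> u v"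
  unfolding on_pair_def using assms by (intro the_equality) (auto simp: doubleton_eq_iff)

lemma pair_prod_mult_eq_1:
  assumes "\<And>u v. u \<noteq> v \<Longrightarrow> \<phi> v u = \<phi> u v" "\<And>u v. u \<noteq> v \<Longrightarrow> \<psi> v u = \<psi> u v"
    and "\<And>u v. u \<noteq> v \<Longrightarrow> \<phi> u v * \<psi> u v = 1"
  shows "pair_prod \<phi> X * pair_prod \<psi> X = 1"
  unfolding pair_prod_def prod.distrib[symmetric]
  by (rule prod.neutral) (auto simp: card_2_iff on_pair assms)

lemma pair_prod_image:
  assumes sym: "\<And>u v. u \<noteq> v \<Longrightarrow> \<phi> v u = \<phi> u v" and inj: "inj \<rho>"
  shows "pair_prod \<phi> (\<rho> ` X) = pair_prod (\<lambda>u v. \<phi> (\<rho> u) (\<rho> v)) X"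
proof -
  have im: "{B. B \<subseteq> \<rho> ` X \<and> card B = 2} = image \<rho> ` {B. B \<subseteq> X \<and> card B = 2}"
  proof (intro equalityI subsetI)
    fix B assume B: "B \<in> {B. B \<subseteq> \<rho> ` X \<and> card B = 2}"
    then obtain A where "A \<subseteq> X" "B = \<rho> ` A" by (auto elim: subset_imageE)
    then show "B \<in> image \<rho> ` {B. B \<subseteq> X \<and> card B = 2}"
      using B card_image[OF inj_on_subset[OF inj subset_UNIV], of A] by auto
  qed (auto simp: card_image[OF inj_on_subset[OF inj subset_UNIV]])
  have val: "on_pair \<phi> (\<rho> ` B) = on_pair (\<lambda>u v. \<phi> (\<rho> u) (\<rho> v)) B" if B: "card B = 2" for B
  proof -
    obtain u v where uv: "B = {u, v}" "u \<noteq> v" using B by (auto simp: card_2_iff)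
    then have ne: "\<rho> u \<noteq> \<rho> v" using inj by (simp add: inj_eq)
    have "on_pair \<phi> {\<rho> u, \<rho> v} = \<phi> (\<rho> u) (\<rho> v)" by (rule on_pair[OF sym ne])
    moreover have "on_pair (\<lambda>u v. \<phi> (\<rho> u) (\<rho> v)) {u, v} = \<phi> (\<rho> u) (\<rho> v)"
      by (rule on_pair[OF sym uv(2)]) (simp add: inj_eq[OF inj])
    ultimately show ?thesis by (simp add: uv(1))
  qed
  have "inj_on (image \<rho>) {B. B \<subseteq> X \<and> card B = 2}"
    using inj by (auto simp: inj_on_def inj_image_eq_iff)
  then show ?thesis unfolding pair_prod_def im by (subst prod.reindex) (auto simp: val intro!: prod.cong)
qed

text \<open>An unordered pair in the union lies in one of the parts or has exactly one element in
  each.\<close>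

lemma pair_prod_Un:
  assumes sym: "\<And>u v. u \<noteq> v \<Longrightarrow> \<phi> v u = \<phi> u v"
    and fin: "finite Y" "finite Z" and disj: "Y \<inter> Z = {}"
  shows "pair_prod \<phi> (Y \<union> Z) = pair_prod \<phi> Y * pair_prod \<phi> Z * (\<Prod>u\<in>Y. \<Prod>v\<in>Z. \<phi> u v)"
proof -
  let ?P = "\<lambda>X. {B. B \<subseteq> X \<and> card B = 2}" and ?M = "(\<lambda>(u, v). {u, v}) ` (Y \<times> Z)"
  have finP: "finite (?P Y)" "finite (?P Z)" using fin by simp_all
  have finM: "finite ?M" using fin by simp
  have eq: "?P (Y \<union> Z) = (?P Y \<union> ?P Z) \<union> ?M"
  proof (intro equalityI subsetI)
    fix B assume "B \<in> ?P (Y \<union> Z)"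
    then obtain u v where "B = {u, v}" "u \<noteq> v" "u \<in> Y \<union> Z" "v \<in> Y \<union> Z" by (auto simp: card_2_iff)
    then show "B \<in> (?P Y \<union> ?P Z) \<union> ?M" by (auto simp: doubleton_eq_iff image_iff)
  next
    fix B assume "B \<in> (?P Y \<union> ?P Z) \<union> ?M"
    then consider "B \<in> ?P Y \<union> ?P Z" | u v where "B = {u, v}" "u \<in> Y" "v \<in> Z" by auto
    then show "B \<in> ?P (Y \<union> Z)"
    proof cases
      case 2
      then have "u \<noteq> v" using disj by auto
      then show ?thesis using 2 by simp
    qed auto
  qed
  have d1: "?P Y \<inter> ?P Z = {}"
  proof -
    have "card B \<noteq> 2" if "B \<subseteq> Y" "B \<subseteq> Z" for B
    proof -
      have "B = {}" using that disj by blast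
      then show ?thesis by simp
    qed
    then show ?thesis by blast
  qed
  have d2: "(?P Y \<union> ?P Z) \<inter> ?M = {}" using disj by auto
  have injM: "inj_on (\<lambda>(u, v). {u, v}) (Y \<times> Z)" using disj by (auto simp: inj_on_def doubleton_eq_iff)
  have "(\<Prod>B\<in>?M. on_pair \<phi> B) = (\<Prod>(u, v)\<in>Y \<times> Z. \<phi> u v)"
    unfolding prod.reindex[OF injM]
  proof (rule prod.cong[OF refl])
    fix p assume "p \<in> Y \<times> Z"
    then obtain u v where "p = (u, v)" "u \<in> Y" "v \<in> Z" by auto
    moreover from this have "u \<noteq> v" using disj by auto
    ultimately have p: "p = (u, v)" "u \<noteq> v" by simp_all
    then show "(on_pair \<phi> \<circ> (\<lambda>(u, v). {u, v})) p = (case p of (u, v) \<Rightarrow> \<phi> u v)"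
      using on_pair[of \<phi>, OF sym p(2)] by simp
  qed
  then show ?thesis
    unfolding pair_prod_def eq prod.union_disjoint[OF finite_UnI[OF finP] finM d2] prod.union_disjoint[OF finP d1]
    by (simp add: prod.cartesian_product)
qed

lemma pair_prod_rename:
  assumes sym: "\<And>u v. u \<noteq> v \<Longrightarrow> \<phi> v u = \<phi> u v" and inj: "inj \<rho>"
    and ren: "\<And>u v. u \<noteq> v \<Longrightarrow> rename_mfps \<rho> (\<phi> u v) = \<phi> (\<rho> u) (\<rho> v)"
  shows "rename_mfps \<rho> (pair_prod \<phi> X) = pair_prod \<phi> (\<rho> ` X)"
proof -
  have "rename_mfps \<rho> (on_pair \<phi> B) = on_pair (\<lambda>u v. \<phi> (\<rho> u) (\<rho> v)) B" if B: "card B = 2" for B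
  proof -
    obtain u v where uv: "B = {u, v}" "u \<noteq> v" using B by (auto simp: card_2_iff)
    have "on_pair \<phi> {u, v} = \<phi> u v" by (rule on_pair[OF sym uv(2)])
    moreover have "on_pair (\<lambda>u v. \<phi> (\<rho> u) (\<rho> v)) {u, v} = \<phi> (\<rho> u) (\<rho> v)"
      by (rule on_pair[OF sym uv(2)]) (simp add: inj_eq[OF inj])
    ultimately show ?thesis using ren[OF uv(2)] by (simp add: uv(1))
  qed
  then have "rename_mfps \<rho> (pair_prod \<phi> X) = pair_prod (\<lambda>u v. \<phi> (\<rho> u) (\<rho> v)) X"
    unfolding pair_prod_def rename_mfps_prod[OF inj_finite_fibres[OF inj]] by (intro prod.cong) auto
  then show ?thesis using pair_prod_image[of \<phi> \<rho> X, OF sym inj] by simp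
qed

lemma pair_prod_supp:
  assumes "\<And>u v. u \<noteq> v \<Longrightarrow> \<phi> v u = \<phi> u v" "\<And>u v. u \<in> X \<Longrightarrow> v \<in> X \<Longrightarrow> \<phi> u v \<in> mfps_supp X"
  shows "pair_prod \<phi> X \<in> mfps_supp X"
  unfolding pair_prod_def by (rule mfps_supp_prod) (auto simp: card_2_iff on_pair[of \<phi>, OF assms(1)] assms(2))

section \<open>The twist\<close>

text \<open>The power \<open>(- e\<^sup>x)\<^sup>k\<close> for the variable \<open>x\<close>: the
  signs of the twist are distributed over the variables, so that they follow the same rules as the
  exponentials.\<close>

definition signed_exp :: "'v \<Rightarrow> int \<Rightarrow> ('v, rat) mfps" where
  "signed_exp u k = mfps_const ((- 1) powi k) * mfps_exp (of_int k * mfps_var u)"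

lemma signed_exp_add: "signed_exp u (k + l) = signed_exp u k * signed_exp u l"
proof -
  have "mfps_exp (of_int (k + l) * mfps_var u) = mfps_exp (of_int k * mfps_var u) * (mfps_exp (of_int l * mfps_var u) :: ('a, rat) mfps)"
    unfolding of_int_add distrib_right by (rule mfps_exp_add[OF mfps_ge_of_int_mult_var mfps_ge_of_int_mult_var])
  moreover have "(- 1 :: rat) powi (k + l) = (- 1) powi k * (- 1) powi l" by (rule power_int_add) simp
  ultimately show ?thesis by (simp add: signed_exp_def mfps_const_mult mult_ac)
qed

lemma signed_exp_zero [simp]: "signed_exp u 0 = 1"
  by (simp add: signed_exp_def)

lemma signed_exp_sum: "signed_exp u (\<Sum>s\<in>S. k s) = (\<Prod>s\<in>S. signed_exp u (k s))"
  by (induction S rule: infinite_finite_induct) (simp_all add: signed_exp_add)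

lemma signed_exp_of_nat_mult: "signed_exp u (int n * k) = signed_exp u k ^ n"
  by (induction n) (simp_all add: distrib_right signed_exp_add)

lemma signed_exp_mult_inverse: "signed_exp u k * signed_exp u (- k) = 1"
  using signed_exp_add[of u k "- k"] by simp

lemma rename_signed_exp: "finite_fibres \<rho> \<Longrightarrow> rename_mfps \<rho> (signed_exp u k) = signed_exp (\<rho> u) k"
  by (simp add: signed_exp_def rename_mfps_mult rename_mfps_const rename_mfps_exp rename_of_int rename_mfps_var)

lemma mfps_of_int_supp: "(of_int k :: ('v, rat) mfps) \<in> mfps_supp X"
proof -
  have "(of_nat n :: ('v, rat) mfps) \<in> mfps_supp X" for n
    by (metis mfps_const_of_nat mfps_const_supp)
  then show ?thesis by (cases k rule: int_cases2) (auto intro: mfps_supp_uminus)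
qed

lemma signed_exp_supp: "u \<in> X \<Longrightarrow> signed_exp u k \<in> mfps_supp X"
  unfolding signed_exp_def
  by (intro mfps_supp_mult mfps_const_supp mfps_exp_supp mfps_of_int_supp mfps_var_supp)

lemma minus_one_powi_uminus: "(- 1 :: rat) powi (- k) = (- 1) powi k"
  by (simp add: power_int_minus flip: power_int_inverse)

lemma minus_one_powi_diff: "(- 1 :: rat) powi (y + - x) = (- 1) powi (x + y)"
proof -
  have "(- 1 :: rat) powi (k + l) = (- 1) powi k * (- 1) powi l" for k l by (rule power_int_add) simp
  then show ?thesis by (simp only: minus_one_powi_uminus mult.commute)
qed

text \<open>The negative of the exponent in the twist, so that it is an exponent of
  \<open>e\<^sup>x\<close> and not of \<open>e\<^bsup>-x\<^esup>\<close>.\<close>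

definition twist_exponent :: "('i::finite \<Rightarrow> 'i \<Rightarrow> nat) \<Rightarrow> 'i degree \<Rightarrow> 'i \<Rightarrow> int" where
  "twist_exponent a \<tau> i = (\<Sum>j\<in>UNIV. int (a i j) * \<tau> j) - \<tau> i"

text \<open>The exponents of \<open>- 1\<close> on both sides have the same parity: they are
  \<open>x + y\<close> and \<open>y - x\<close>, for \<open>x = \<Sum>i. \<gamma>\<^sup>i
  \<tau>\<^sup>i\<close> and \<open>y = \<Sum>i j. a\<^bsub>ij\<^esub> \<gamma>\<^sup>i
  \<tau>\<^sup>j\<close>.\<close>

lemma b_twist_eq: "b_twist a \<tau> g = (\<Prod>u\<in>vars g. signed_exp u (twist_exponent a \<tau> (fst u)))"
proof -
  let ?t = "twist_exponent a \<tau>"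
  have exps: "mfps_exp (of_int (\<tau> i - (\<Sum>j\<in>UNIV. int (a i j) * \<tau> j)) * - (\<Sum>\<alpha><g i. mfps_var (i, \<alpha>)))
      = (\<Prod>\<alpha><g i. mfps_exp (of_int (?t i) * (mfps_var (i, \<alpha>) :: ('a var, rat) mfps)))" for i
  proof -
    have "of_int (\<tau> i - (\<Sum>j\<in>UNIV. int (a i j) * \<tau> j)) * - (\<Sum>\<alpha><g i. mfps_var (i, \<alpha>))
        = (\<Sum>\<alpha><g i. of_int (?t i) * (mfps_var (i, \<alpha>) :: ('a var, rat) mfps))"
    proof -
      have "\<tau> i - (\<Sum>j\<in>UNIV. int (a i j) * \<tau> j) = - ?t i" by (simp add: twist_exponent_def)
      then show ?thesis by (simp only: of_int_minus minus_mult_minus sum_distrib_left)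
    qed
    then show ?thesis by (simp add: mfps_exp_sum[OF mfps_ge_of_int_mult_var])
  qed
  have sum_vars: "(\<Sum>u\<in>vars g. f (fst u)) = (\<Sum>i\<in>UNIV. int (g i) * f i)" for f :: "'a \<Rightarrow> int"
    unfolding vars_Sigma by (subst sum.Sigma[symmetric, of UNIV _ "\<lambda>i \<alpha>. f i", unfolded split_def, simplified]) simp_all
  have const_prod: "(\<Prod>u\<in>S. mfps_const ((- 1) powi k u)) = (mfps_const ((- 1) powi (\<Sum>u\<in>S. k u)) :: ('a var, rat) mfps)"
    for S :: "'a var set" and k
    by (induction S rule: infinite_finite_induct) (simp_all add: power_int_add mfps_const_mult)
  have sign: "(- 1 :: rat) powi ((\<Sum>i\<in>UNIV. int (g i) * \<tau> i) + (\<Sum>i\<in>UNIV. \<Sum>j\<in>UNIV. int (a i j) * int (g i) * \<tau> j))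
      = (- 1) powi (\<Sum>u\<in>vars g. ?t (fst u))"
  proof -
    have "(\<Sum>u\<in>vars g. ?t (fst u)) = (\<Sum>i\<in>UNIV. \<Sum>j\<in>UNIV. int (a i j) * int (g i) * \<tau> j) + - (\<Sum>i\<in>UNIV. int (g i) * \<tau> i)"
      unfolding sum_vars unfolding twist_exponent_def by (simp add: right_diff_distrib sum_subtractf sum_distrib_left mult_ac)
    then show ?thesis by (simp only: minus_one_powi_diff)
  qed
  have "(\<Prod>u\<in>vars g. signed_exp u (?t (fst u))) =
      mfps_const ((- 1) powi (\<Sum>u\<in>vars g. ?t (fst u))) * (\<Prod>u\<in>vars g. mfps_exp (of_int (?t (fst u)) * mfps_var u))"
    unfolding signed_exp_def prod.distrib const_prod ..
  also have "(\<Prod>u\<in>vars g. mfps_exp (of_int (?t (fst u)) * (mfps_var u :: ('a var, rat) mfps)))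
      = (\<Prod>i\<in>UNIV. \<Prod>\<alpha><g i. mfps_exp (of_int (?t i) * mfps_var (i, \<alpha>)))"
    by (simp add: prod_vars)
  finally show ?thesis unfolding b_twist_def exps sign ..
qed

lemma fst_on_vars [simp]: "fst (on_vars w u) = fst u" "fst (on_vars2 g w u) = fst u"
  by (cases u; simp)+

lemma b_twist_supp: "b_twist a \<tau> g \<in> mfps_supp (vars g)"
  unfolding b_twist_eq by (intro mfps_supp_prod signed_exp_supp)

lemma rename_b_twist:
  assumes w: "w \<in> var_perms n"
  shows "rename_mfps (on_vars w) (b_twist a \<tau> g) = (\<Prod>u\<in>on_vars w ` vars g. signed_exp u (twist_exponent a \<tau> (fst u)))"
    and "rename_mfps (on_vars2 g' w) (b_twist a \<tau> g) = (\<Prod>u\<in>on_vars2 g' w ` vars g. signed_exp u (twist_exponent a \<tau> (fst u)))"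
  unfolding b_twist_eq
  by (simp_all add: prod.reindex[OF inj_on_subset[OF inj_on_vars[OF w]]] prod.reindex[OF inj_on_subset[OF inj_on_vars2[OF w]]]
      rename_mfps_prod[OF series.ff_on_vars[OF w]] rename_mfps_prod[OF series.ff_on_vars2[OF w]]
      rename_signed_exp[OF series.ff_on_vars[OF w]] rename_signed_exp[OF series.ff_on_vars2[OF w]])

lemma b_twist_sym: "b_twist a \<tau> g \<in> series.sym g"
proof -
  have "rename_mfps (on_vars \<pi>) (b_twist a \<tau> g) = b_twist a \<tau> g" if "\<pi> \<in> var_perms g" for \<pi>
    unfolding rename_b_twist(1)[OF that] on_vars_image_vars[OF that] by (rule b_twist_eq[symmetric])
  then show ?thesis by (simp add: series.sym_def b_twist_supp)
qed

lemma b_twist_add: "b_twist a (\<tau> + \<tau>') g = b_twist a \<tau> g * b_twist a \<tau>' g"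
proof -
  have "twist_exponent a (\<tau> + \<tau>') i = twist_exponent a \<tau> i + twist_exponent a \<tau>' i" for i
    by (simp add: twist_exponent_def distrib_left sum.distrib)
  then show ?thesis by (simp add: b_twist_eq signed_exp_add prod.distrib)
qed

lemma b_twist_zero: "b_twist a 0 g = 1"
  by (simp add: b_twist_eq twist_exponent_def)

lemma b_twist_no_vars: "b_twist a \<tau> (\<lambda>i. 0) = 1"
  by (simp add: b_twist_eq vars_def)

lemma b_twist_shuffle:
  assumes w: "w \<in> var_perms (\<lambda>i. g1 i + g2 i)"
  shows "rename_mfps (on_vars w) (b_twist a \<tau> g1) * rename_mfps (on_vars2 g1 w) (b_twist a \<tau> g2) = b_twist a \<tau> (\<lambda>i. g1 i + g2 i)"
proof -
  have "b_twist a \<tau> (\<lambda>i. g1 i + g2 i) = (\<Prod>u\<in>first_block g1 w \<union> second_block g1 g2 w. signed_exp u (twist_exponent a \<tau> (fst u)))"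
    unfolding first_block_Un_second_block[OF w] by (rule b_twist_eq)
  also have "\<dots> = (\<Prod>u\<in>first_block g1 w. signed_exp u (twist_exponent a \<tau> (fst u)))
      * (\<Prod>u\<in>second_block g1 g2 w. signed_exp u (twist_exponent a \<tau> (fst u)))"
    by (rule prod.union_disjoint[OF finite_blocks first_block_Int_second_block[OF w]])
  finally show ?thesis unfolding rename_b_twist[OF w] first_block_def second_block_def by simp
qed

abbreviation series_mult where
  "series_mult \<equiv> shuffle_mult rename_mfps (\<lambda>u v. mfps_var v - (mfps_var u :: ('i::finite var, rat) mfps))"

abbreviation laurent_mult where
  "laurent_mult \<equiv> shuffle_mult rename_poly (\<lambda>u v. 1 - pvar u * (inv_pvar v :: ('i::finite var, rat) laurent))"

text \<open>Every summand of the shuffle product is multiplied by the same series, as the product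
  over all variables splits into those over the two blocks.\<close>

lemma series_mult_twist:
  assumes "f1 \<in> series.sym g1" "f2 \<in> series.sym g2"
  shows "series_mult a g1 g2 (b_twist a \<tau> g1 * f1) (b_twist a \<tau> g2 * f2)
    = b_twist a \<tau> (\<lambda>i. g1 i + g2 i) * series_mult a g1 g2 f1 f2"
proof -
  interpret shuffle_hom mfps_supp rename_mfps "\<lambda>u v. mfps_var v - (mfps_var u :: ('a var, rat) mfps)" mfps_supp rename_mfps
    "\<lambda>u v. mfps_var v - mfps_var u" "\<lambda>f. f" "\<lambda>_ _. 1"
    by unfold_locales simp_all
  have "series.numer a g1 g2 (b_twist a \<tau> g1 * f1) (b_twist a \<tau> g2 * f2) w
     = b_twist a \<tau> (\<lambda>i. g1 i + g2 i) * series.numer a g1 g2 f1 f2 w * (\<Prod>(u, v)\<in>mixed_pairs g1 g2 w. 1)"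
    if w: "w \<in> var_perms (\<lambda>i. g1 i + g2 i)" for w
    unfolding b_twist_shuffle[OF w, symmetric]
    by (simp add: series.numer_def rename_mfps_mult[OF series.ff_on_vars[OF w]] rename_mfps_mult[OF series.ff_on_vars2[OF w]]
        split_def mult_ac)
  from h_shuffle_mult[OF _ _ assms this] show ?thesis
    using assms by (simp add: series.sym_mult b_twist_sym)
qed

section \<open>The Chern character as an algebra homomorphism\<close>

text \<open>\<open>S(u,v)\<^bsup>a\<^bsub>ij\<^esub> - \<delta>\<^bsub>ij\<^esub>\<^esup>\<close>
  for \<open>u\<close> and \<open>v\<close> at the vertices \<open>i\<close> and \<open>j\<close>,
  where \<open>S\<close> is \<open>exp_quot\<close>.\<close>

definition pair_factor :: "('i \<Rightarrow> 'i \<Rightarrow> nat) \<Rightarrow> 'i var \<Rightarrow> 'i var \<Rightarrow> ('i var, rat) mfps" where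
  "pair_factor a u v = exp_quot u v ^ a (fst u) (fst v) * (if fst u = fst v then exp_quot_inv u v else 1)"

definition pair_factor_inv :: "('i \<Rightarrow> 'i \<Rightarrow> nat) \<Rightarrow> 'i var \<Rightarrow> 'i var \<Rightarrow> ('i var, rat) mfps" where
  "pair_factor_inv a u v = exp_quot_inv u v ^ a (fst u) (fst v) * (if fst u = fst v then exp_quot u v else 1)"

definition KHA_hom :: "('i::finite \<Rightarrow> 'i \<Rightarrow> nat) \<Rightarrow> ('i \<Rightarrow> nat) \<Rightarrow> ('i var, rat) laurent \<Rightarrow> ('i var, rat) mfps" where
  "KHA_hom a g f = chern f * pair_prod (pair_factor_inv a) (vars g)"

context
  fixes a :: "'i::finite \<Rightarrow> 'i \<Rightarrow> nat"
  assumes symmetric: "\<And>i j. a i j = a j i"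
begin

lemma pair_factor_commute:
  "u \<noteq> v \<Longrightarrow> pair_factor a v u = pair_factor a u v" "u \<noteq> v \<Longrightarrow> pair_factor_inv a v u = pair_factor_inv a u v"
  using symmetric[of "fst u" "fst v"]
  by (auto simp: pair_factor_def pair_factor_inv_def exp_quot_commute[of u v] exp_quot_inv_commute[of u v])

lemma pair_factor_mult_inv: "u \<noteq> v \<Longrightarrow> pair_factor a u v * pair_factor_inv a u v = 1"
proof -
  assume uv: "u \<noteq> v"
  have "(exp_quot u v * exp_quot_inv u v) ^ a (fst u) (fst v) * (if fst u = fst v then exp_quot u v * exp_quot_inv u v else 1) = 1"
    by (simp add: exp_quot_inv[OF uv])
  then show ?thesis
    unfolding pair_factor_def pair_factor_inv_def by (simp add: power_mult_distrib mult_ac split: if_splits)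
qed

lemma pair_prod_factor_mult_inv: "pair_prod (pair_factor a) X * pair_prod (pair_factor_inv a) X = 1"
  by (rule pair_prod_mult_eq_1) (simp_all add: pair_factor_commute pair_factor_mult_inv)

lemma rename_pair_factor:
  assumes inj: "inj \<rho>" and fst: "\<And>u. fst (\<rho> u) = fst u" and uv: "u \<noteq> v"
  shows "rename_mfps \<rho> (pair_factor a u v) = pair_factor a (\<rho> u) (\<rho> v)"
    and "rename_mfps \<rho> (pair_factor_inv a u v) = pair_factor_inv a (\<rho> u) (\<rho> v)"
proof -
  have ne: "\<rho> u \<noteq> \<rho> v" using inj uv by (simp add: inj_eq)
  note ff = inj_finite_fibres[OF inj]
  show "rename_mfps \<rho> (pair_factor a u v) = pair_factor a (\<rho> u) (\<rho> v)"
    "rename_mfps \<rho> (pair_factor_inv a u v) = pair_factor_inv a (\<rho> u) (\<rho> v)"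
    by (simp_all add: pair_factor_def pair_factor_inv_def rename_mfps_mult[OF ff] rename_mfps_power[OF ff] rename_mfps_one[OF ff]
        rename_exp_quot[OF ff uv ne] rename_exp_quot_inv[OF ff uv ne] fst)
qed

lemma rename_pair_prod_factor:
  assumes "inj \<rho>" "\<And>u. fst (\<rho> u) = fst u"
  shows "rename_mfps \<rho> (pair_prod (pair_factor a) X) = pair_prod (pair_factor a) (\<rho> ` X)"
    and "rename_mfps \<rho> (pair_prod (pair_factor_inv a) X) = pair_prod (pair_factor_inv a) (\<rho> ` X)"
  by (intro pair_prod_rename assms pair_factor_commute rename_pair_factor; assumption)+

lemma pair_prod_factor_sym:
  "pair_prod (pair_factor a) (vars g) \<in> series.sym g" "pair_prod (pair_factor_inv a) (vars g) \<in> series.sym g"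
proof -
  have "pair_prod (pair_factor a) (vars g) \<in> mfps_supp (vars g)" "pair_prod (pair_factor_inv a) (vars g) \<in> mfps_supp (vars g)"
    using mfps_const_supp[of 1]
    by (intro pair_prod_supp pair_factor_commute;
        auto simp: pair_factor_def pair_factor_inv_def intro!: mfps_supp_mult mfps_supp_power exp_quot_supp exp_quot_inv_supp)+
  moreover have "rename_mfps (on_vars \<pi>) (pair_prod (pair_factor a) (vars g)) = pair_prod (pair_factor a) (vars g)"
    "rename_mfps (on_vars \<pi>) (pair_prod (pair_factor_inv a) (vars g)) = pair_prod (pair_factor_inv a) (vars g)"
    if "\<pi> \<in> var_perms g" for \<pi>
    using rename_pair_prod_factor[OF inj_on_vars[OF that], of "vars g"] on_vars_image_vars[OF that] by simp_all
  ultimately show "pair_prod (pair_factor a) (vars g) \<in> series.sym g" "pair_prod (pair_factor_inv a) (vars g) \<in> series.sym g"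
    by (simp_all add: series.sym_def)
qed

lemma KHA_hom_sym: "f \<in> sym_polys g \<Longrightarrow> KHA_hom a g f \<in> series.sym g"
  unfolding KHA_hom_def using chern_sym[of f g] by (intro series.sym_mult pair_prod_factor_sym) (simp add: series_sym_eq)

text \<open>For \<open>u\<close> at the vertex \<open>i\<close>, the variables \<open>v\<close> of
  the second block at the vertex \<open>j\<close> contribute \<open>\<gamma>\<^sub>2\<^sup>j
  (a\<^bsub>ij\<^esub> - \<delta>\<^bsub>ij\<^esub>)\<close> to the exponent of \<open>-
  e\<^sup>u\<close>.\<close>

lemma b_twist_eq_mixed_prod:
  assumes w: "w \<in> var_perms (\<lambda>i. g1 i + g2 i)"
  shows "rename_mfps (on_vars w) (b_twist a (\<lambda>i. int (g2 i)) g1) =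
    (\<Prod>u\<in>first_block g1 w. \<Prod>v\<in>second_block g1 g2 w.
       signed_exp u 1 ^ a (fst u) (fst v) * (if fst u = fst v then signed_exp u (- 1) else 1))"
proof -
  have "(\<Prod>v\<in>second_block g1 g2 w. signed_exp u 1 ^ a (fst u) (fst v) * (if fst u = fst v then signed_exp u (- 1) else 1))
      = signed_exp u (twist_exponent a (\<lambda>i. int (g2 i)) (fst u))" for u :: "'i var"
  proof -
    let ?F = "\<lambda>j. signed_exp u (int (a (fst u) j) - (if fst u = j then 1 else 0))"
    have "(\<Prod>v\<in>second_block g1 g2 w. signed_exp u 1 ^ a (fst u) (fst v) * (if fst u = fst v then signed_exp u (- 1) else 1))
        = (\<Prod>v\<in>second_block g1 g2 w. ?F (fst v))"
      by (rule prod.cong[OF refl])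
        (simp add: signed_exp_of_nat_mult[of u _ 1, simplified] signed_exp_add[of u "int _" "- 1", simplified])
    also have "\<dots> = (\<Prod>v\<in>vars g2. ?F (fst v))"
      unfolding second_block_def by (simp add: prod.reindex[OF inj_on_subset[OF inj_on_vars2[OF w]]])
    also have "\<dots> = (\<Prod>j\<in>UNIV. signed_exp u (int (g2 j) * (int (a (fst u) j) - (if fst u = j then 1 else 0))))"
      by (simp add: prod_vars signed_exp_of_nat_mult)
    also have "\<dots> = signed_exp u (\<Sum>j\<in>UNIV. int (g2 j) * (int (a (fst u) j) - (if fst u = j then 1 else 0)))"
      by (rule signed_exp_sum[symmetric])
    also have "(\<Sum>j\<in>UNIV. int (g2 j) * (int (a (fst u) j) - (if fst u = j then 1 else 0)))
        = twist_exponent a (\<lambda>i. int (g2 i)) (fst u)"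
    proof -
      have "(\<Sum>j\<in>UNIV. int (g2 j) * (if fst u = j then 1 else 0)) = int (g2 (fst u))"
        by (simp add: if_distrib[of "(*) _"] cong: if_cong)
      then show ?thesis by (simp add: twist_exponent_def right_diff_distrib sum_subtractf mult.commute)
    qed
    finally show ?thesis .
  qed
  then show ?thesis unfolding rename_b_twist(1)[OF w] first_block_def by simp
qed

text \<open>The kernels of the KHA contribute, for every \<open>u\<close> in the first and
  \<open>v\<close> in the second block, \<open>S(u,v)\<^bsup>a\<^bsub>ij\<^esub> -
  \<delta>\<^bsub>ij\<^esub>\<^esup>\<close> and the same power of \<open>- e\<^sup>u\<close>. The
  former is the part of the product over all unordered pairs which is not accounted for by the pairs
  within one block, and the latter is the twist.\<close>

theorem KHA_hom_mult:
  assumes f1: "f1 \<in> sym_polys g1" and f2: "f2 \<in> sym_polys g2"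
  shows "KHA_hom a (\<lambda>i. g1 i + g2 i) (laurent_mult a g1 g2 f1 f2)
    = series_mult a g1 g2 (b_twist a (\<lambda>i. int (g2 i)) g1 * KHA_hom a g1 f1) (KHA_hom a g2 f2)"
proof -
  let ?n = "\<lambda>i. g1 i + g2 i"
  define G where "G u v = - exp_quot u v * mfps_exp (mfps_var u)" for u v :: "'i var"
  define P where "P = pair_prod (pair_factor a)"
  define Q where "Q = pair_prod (pair_factor_inv a)"
  have PQ: "P X * Q X = 1" for X by (simp add: P_def Q_def pair_prod_factor_mult_inv)
  have signed: "signed_exp u 1 = - mfps_exp (mfps_var u)" "signed_exp u (- 1) * mfps_exp (mfps_var u) = - 1" for u :: "'i var"
  proof -
    have m1: "mfps_const (- 1) = (- 1 :: ('i var, rat) mfps)"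
      by (rule mfps_eqI) (simp add: mfps_const_eq_monom mcoeff_monom mcoeff_one)
    show 1: "signed_exp u 1 = - mfps_exp (mfps_var u)" by (simp add: signed_exp_def m1)
    show "signed_exp u (- 1) * mfps_exp (mfps_var u) = - 1"
      using signed_exp_mult_inverse[of u 1] unfolding 1 by (simp add: mult.commute eq_neg_iff_add_eq_0 minus_equation_iff)
  qed
  have G_regular: "regular (G u v)" if "u \<noteq> v" for u v
  proof (rule regular_unit)
    have "G u v * - (exp_quot_inv u v * mfps_exp (- mfps_var u))
       = (exp_quot u v * exp_quot_inv u v) * (mfps_exp (mfps_var u) * mfps_exp (- mfps_var u))"
      by (simp add: G_def mult_ac)
    then show "G u v * - (exp_quot_inv u v * mfps_exp (- mfps_var u)) = 1"
      by (simp add: exp_quot_inv[OF that] mfps_exp_uminus[OF mfps_ge_var])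
  qed
  interpret shuffle_hom poly_supp rename_poly "\<lambda>u v. 1 - pvar u * (inv_pvar v :: ('i var, rat) laurent)" mfps_supp rename_mfps
    "\<lambda>u v. mfps_var v - mfps_var u" chern G
    by unfold_locales (simp_all only: chern_simps(1,2,3) chern_rename chern_kernel G_regular simp_thms, simp only: G_def)
  have "chern (laurent_mult a g1 g2 f1 f2)
    = P (vars ?n) * series_mult a g1 g2 (b_twist a (\<lambda>i. int (g2 i)) g1 * KHA_hom a g1 f1) (KHA_hom a g2 f2)"
  proof (rule h_shuffle_mult)
    show "f1 \<in> laurent.sym g1" "f2 \<in> laurent.sym g2" using f1 f2 by (simp_all add: laurent_sym_eq)
    show "b_twist a (\<lambda>i. int (g2 i)) g1 * KHA_hom a g1 f1 \<in> series.sym g1" "KHA_hom a g2 f2 \<in> series.sym g2"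
      using f1 f2 by (simp_all add: series.sym_mult b_twist_sym KHA_hom_sym)
  next
    fix w assume w: "w \<in> var_perms ?n"
    let ?L = "first_block g1 w" and ?R = "second_block g1 g2 w"
    let ?K = "\<lambda>u v :: 'i var. mfps_var v - mfps_var u :: ('i var, rat) mfps"
    let ?r1 = "rename_mfps (on_vars w)" and ?r2 = "rename_mfps (on_vars2 g1 w)"
    have ne: "u \<noteq> v" if "u \<in> ?L" "v \<in> ?R" for u v
      using that first_block_Int_second_block[OF w] by blast
    have mixed: "(\<Prod>(u, v)\<in>mixed_pairs g1 g2 w. G u v) = (\<Prod>u\<in>?L. \<Prod>v\<in>?R. if fst u = fst v then G u v else 1)"
    proof -
      have "(\<Prod>(u, v)\<in>mixed_pairs g1 g2 w. G u v) = (\<Prod>p\<in>?L \<times> ?R. if fst (fst p) = fst (snd p) then G (fst p) (snd p) else 1)"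
        by (rule prod.mono_neutral_cong_left) (auto simp: mixed_pairs_def finite_blocks)
      then show ?thesis by (simp add: prod.cartesian_product split_def)
    qed
    have P_shuffle: "P (vars ?n) = ?r1 (P (vars g1)) * ?r2 (P (vars g2)) * (\<Prod>u\<in>?L. \<Prod>v\<in>?R. pair_factor a u v)"
    proof -
      have "P (vars ?n) = P ?L * P ?R * (\<Prod>u\<in>?L. \<Prod>v\<in>?R. pair_factor a u v)"
        unfolding P_def first_block_Un_second_block[OF w, symmetric]
        by (rule pair_prod_Un[OF pair_factor_commute(1) finite_blocks first_block_Int_second_block[OF w]])
      then show ?thesis
        using rename_pair_prod_factor(1)[OF inj_on_vars[OF w], of "vars g1"]
          rename_pair_prod_factor(1)[OF inj_on_vars2[OF w], of g1 "vars g2"]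
        by (simp add: P_def first_block_def second_block_def)
    qed
    have r1: "?r1 (f * g) = ?r1 f * ?r1 g" and r2: "?r2 (f * g) = ?r2 f * ?r2 g" for f g
      by (rule rename_mfps_mult[OF series.ff_on_vars[OF w]] rename_mfps_mult[OF series.ff_on_vars2[OF w]])+
    have r1PQ: "?r1 (P X) * ?r1 (Q X) = 1" and r2PQ: "?r2 (P X) * ?r2 (Q X) = 1" for X
      unfolding r1[symmetric] r2[symmetric] PQ
      by (rule rename_mfps_one[OF series.ff_on_vars[OF w]] rename_mfps_one[OF series.ff_on_vars2[OF w]])+
    \<comment> \<open>\<open>G = S * (- e\<^sup>u)\<close>, and one factor \<open>G\<close> is split
    off from the power when both variables are at the same vertex\<close>
    have pointwise: "G u v ^ a (fst u) (fst v) = (signed_exp u 1 ^ a (fst u) (fst v) * (if fst u = fst v then signed_exp u (- 1) else 1))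
         * (pair_factor a u v * (if fst u = fst v then G u v else 1))" if "u \<in> ?L" "v \<in> ?R" for u v
    proof -
      have G: "G u v = exp_quot u v * signed_exp u 1" by (simp add: G_def signed(1))
      have "signed_exp u (- 1) * (exp_quot_inv u v * G u v) = 1"
        using exp_quot_inv[OF ne[OF that]] signed_exp_mult_inverse[of u 1] unfolding G
        by (metis (no_types, lifting) mult.assoc mult.commute mult_1)
      then show ?thesis
        by (simp add: pair_factor_def G power_mult_distrib mult_ac)
    qed
    have "chern (laurent.numer a g1 g2 f1 f2 w)
        = ?r1 (chern f1) * ?r2 (chern f2) * (\<Prod>u\<in>?L. \<Prod>v\<in>?R. (?K u v * G u v) ^ a (fst u) (fst v))"
      unfolding laurent.numer_def
      by (simp add: h_mult h_prod h_power chern_rename[OF series.ff_on_vars[OF w]] chern_rename[OF series.ff_on_vars2[OF w]])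
        (intro arg_cong2[of _ _ _ _ "(*)"] refl prod.cong; simp add: h_K ne)
    also have "(\<Prod>u\<in>?L. \<Prod>v\<in>?R. (?K u v * G u v) ^ a (fst u) (fst v))
        = (\<Prod>u\<in>?L. \<Prod>v\<in>?R. ?K u v ^ a (fst u) (fst v)) * (\<Prod>u\<in>?L. \<Prod>v\<in>?R. G u v ^ a (fst u) (fst v))"
      by (simp add: power_mult_distrib prod.distrib)
    also have "(\<Prod>u\<in>?L. \<Prod>v\<in>?R. G u v ^ a (fst u) (fst v)) = ?r1 (b_twist a (\<lambda>i. int (g2 i)) g1)
         * ((\<Prod>u\<in>?L. \<Prod>v\<in>?R. pair_factor a u v) * (\<Prod>(u, v)\<in>mixed_pairs g1 g2 w. G u v))"
      unfolding b_twist_eq_mixed_prod[OF w] mixed prod.distrib[symmetric]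
      by (intro prod.cong refl) (simp add: pointwise)
    also have "?r1 (chern f1) * ?r2 (chern f2) * ((\<Prod>u\<in>?L. \<Prod>v\<in>?R. ?K u v ^ a (fst u) (fst v)) *
          (?r1 (b_twist a (\<lambda>i. int (g2 i)) g1) * ((\<Prod>u\<in>?L. \<Prod>v\<in>?R. pair_factor a u v) * (\<Prod>(u, v)\<in>mixed_pairs g1 g2 w. G u v))))
        = P (vars ?n) * series.numer a g1 g2 (b_twist a (\<lambda>i. int (g2 i)) g1 * KHA_hom a g1 f1) (KHA_hom a g2 f2) w
        * (\<Prod>(u, v)\<in>mixed_pairs g1 g2 w. G u v)" (is "?lhs = ?rhs")
    proof -
      have "?rhs = (?r1 (P (vars g1)) * ?r1 (Q (vars g1))) * (?r2 (P (vars g2)) * ?r2 (Q (vars g2))) * ?lhs"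
        unfolding P_shuffle series.numer_def KHA_hom_def r1 r2 Q_def[symmetric] by (simp only: mult_ac)
      then show ?thesis unfolding r1PQ r2PQ mult_1_left by (rule sym)
    qed
    finally show "chern (laurent.numer a g1 g2 f1 f2 w)
        = P (vars ?n) * series.numer a g1 g2 (b_twist a (\<lambda>i. int (g2 i)) g1 * KHA_hom a g1 f1) (KHA_hom a g2 f2) w
        * (\<Prod>(u, v)\<in>mixed_pairs g1 g2 w. G u v)" .
  qed
  then show ?thesis
    unfolding KHA_hom_def[of a ?n] Q_def[symmetric] using PQ[of "vars ?n"] by (simp add: mult_ac flip: mult.assoc)
qed

end

section \<open>The filtered algebras\<close>

text \<open>Continuity of the product is inherited by subalgebras with the induced
  filtration.\<close>

lemma (in biadditive_graded_ring) filtered_pullback: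
  assumes B: "filtered_graded_ring B G"
    and closed: "\<And>\<gamma> x. x \<in> C \<gamma> \<Longrightarrow> \<phi> \<gamma> x \<in> carrier (gcomp B \<gamma>)"
    and add: "\<And>\<gamma> x y. x \<in> C \<gamma> \<Longrightarrow> y \<in> C \<gamma> \<Longrightarrow> \<phi> \<gamma> (x + y) = \<phi> \<gamma> x + \<phi> \<gamma> y"
    and mult: "\<And>\<gamma> \<delta> x y. x \<in> C \<gamma> \<Longrightarrow> y \<in> C \<delta> \<Longrightarrow>
        \<phi> (\<gamma> + \<delta>) (gmult A \<gamma> \<delta> x y) = gmult B \<gamma> \<delta> (\<phi> \<gamma> x) (\<phi> \<delta> y)"
    and F: "\<And>\<gamma> n. F \<gamma> n = {x \<in> C \<gamma>. \<phi> \<gamma> x \<in> G \<gamma> n}"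
  shows "filtered_graded_ring A F"
proof -
  interpret B: filtered_graded_ring B G by (rule B)
  have zero: "\<phi> \<gamma> 0 = 0" for \<gamma> using add[of 0 \<gamma> 0] zero_closed by simp
  have uminus: "\<phi> \<gamma> (- x) = - \<phi> \<gamma> x" if "x \<in> C \<gamma>" for \<gamma> x
    using add[OF that uminus_closed[OF that]] zero by (simp add: eq_neg_iff_add_eq_0 add.commute)
  show ?thesis
  proof
    fix y \<gamma> \<delta> n assume y: "y \<in> C \<delta>"
    obtain k where k: "\<forall>x\<in>G \<gamma> k. gmult B \<gamma> \<delta> x (\<phi> \<delta> y) \<in> G (\<gamma> + \<delta>) n"
      using B.continuous_left[OF closed[OF y]] by blast
    then show "\<exists>k. \<forall>x\<in>F \<gamma> k. gmult A \<gamma> \<delta> x y \<in> F (\<gamma> + \<delta>) n"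
      by (intro exI[of _ k]) (simp add: F mult y gmult_closed)
  next
    fix x \<gamma> \<delta> n assume x: "x \<in> C \<gamma>"
    obtain k where k: "\<forall>y\<in>G \<delta> k. gmult B \<gamma> \<delta> (\<phi> \<gamma> x) y \<in> G (\<gamma> + \<delta>) n"
      using B.continuous_right[OF closed[OF x]] by blast
    then show "\<exists>k. \<forall>y\<in>F \<delta> k. gmult A \<gamma> \<delta> x y \<in> F (\<gamma> + \<delta>) n"
      by (intro exI[of _ k]) (simp add: F mult x gmult_closed)
  next
    fix m n :: nat and \<gamma> assume "m \<le> n"
    then show "F \<gamma> n \<subseteq> F \<gamma> m" using B.F_mono[of m n \<gamma>] by (auto simp: F)
  qed (simp_all add: F add zero uminus B.F_zero B.F_add B.F_uminus zero_closed add_closed uminus_closed)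
qed

lemma nat_degree_add:
  "(\<forall>i. 0 \<le> \<gamma> i) \<Longrightarrow> (\<forall>i. 0 \<le> \<delta> i) \<Longrightarrow> (\<lambda>i. nat ((\<gamma> + \<delta>) i)) = (\<lambda>i. nat (\<gamma> i) + nat (\<delta> i))"
  by (simp add: fun_eq_iff nat_add_distrib)

context shuffle_ring
begin

abbreviation algebra where "algebra \<equiv> shuffle_algebra sym ren K"

lemma algebra_carrier:
  "carrier (gcomp (algebra a) \<gamma>) = (if \<forall>i. 0 \<le> \<gamma> i then sym (\<lambda>i. nat (\<gamma> i)) else {0})"
  by (simp add: shuffle_algebra_def)

lemma algebra_carrier_sym: "x \<in> carrier (gcomp (algebra a) \<gamma>) \<Longrightarrow> x \<in> sym (\<lambda>i. nat (\<gamma> i))"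
  by (auto simp: algebra_carrier sym_zero split: if_splits)

lemma algebra_gmult: "gmult (algebra a) \<gamma> \<delta> = shuffle_mult ren K a (\<lambda>i. nat (\<gamma> i)) (\<lambda>i. nat (\<delta> i))"
  by (simp add: shuffle_algebra_def)

lemma shuffle_mult_zero:
  "f1 \<in> sym g1 \<Longrightarrow> shuffle_mult ren K a g1 g2 f1 0 = 0" "f2 \<in> sym g2 \<Longrightarrow> shuffle_mult ren K a g1 g2 0 f2 = 0"
  using shuffle_mult_add_right[of f1 g1 0 g2 0 a] shuffle_mult_add_left[of 0 g1 0 f2 g2 a] by (simp_all add: sym_zero)

lemma biadditive_algebra: "biadditive_graded_ring (algebra a)"
proof
  fix x y \<gamma> \<delta> assume x: "x \<in> carrier (gcomp (algebra a) \<gamma>)" and y: "y \<in> carrier (gcomp (algebra a) \<delta>)"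
  note xy = algebra_carrier_sym[OF x] algebra_carrier_sym[OF y]
  show "gmult (algebra a) \<gamma> \<delta> x y \<in> carrier (gcomp (algebra a) (\<gamma> + \<delta>))"
  proof (cases "(\<forall>i. 0 \<le> \<gamma> i) \<and> (\<forall>i. 0 \<le> \<delta> i)")
    case True
    then have "\<forall>i. 0 \<le> (\<gamma> + \<delta>) i" by simp
    then show ?thesis
      using True shuffle_mult(1)[OF xy, of a] nat_degree_add[of \<gamma> \<delta>]
      by (simp add: algebra_carrier algebra_gmult del: plus_fun_apply)
  next
    case False
    then have "x = 0 \<or> y = 0" using x y by (auto simp: algebra_carrier split: if_splits)
    then have "gmult (algebra a) \<gamma> \<delta> x y = 0" using xy by (auto simp: algebra_gmult shuffle_mult_zero)
    then show ?thesis by (simp add: algebra_carrier sym_zero)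
  qed
next
  fix \<gamma> show "gcomp (algebra a) \<gamma> = additive_group (carrier (gcomp (algebra a) \<gamma>))"
    by (simp add: shuffle_algebra_def)
next
  fix x x' y \<gamma> \<delta>
  assume "x \<in> carrier (gcomp (algebra a) \<gamma>)" "x' \<in> carrier (gcomp (algebra a) \<gamma>)" "y \<in> carrier (gcomp (algebra a) \<delta>)"
  then show "gmult (algebra a) \<gamma> \<delta> (x + x') y = gmult (algebra a) \<gamma> \<delta> x y + gmult (algebra a) \<gamma> \<delta> x' y"
    unfolding algebra_gmult by (intro shuffle_mult_add_left algebra_carrier_sym)
next
  fix x y y' \<gamma> \<delta>
  assume "x \<in> carrier (gcomp (algebra a) \<gamma>)" "y \<in> carrier (gcomp (algebra a) \<delta>)" "y' \<in> carrier (gcomp (algebra a) \<delta>)"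
  then show "gmult (algebra a) \<gamma> \<delta> x (y + y') = gmult (algebra a) \<gamma> \<delta> x y + gmult (algebra a) \<gamma> \<delta> x y'"
    unfolding algebra_gmult by (intro shuffle_mult_add_right algebra_carrier_sym)
qed (auto simp: algebra_carrier sym_zero sym_add sym_uminus sym_one shuffle_algebra_def split: if_splits)

end

lemma CoHA_eq: "CoHA a = poly.algebra a"
  by (simp add: CoHA_def ext[OF poly_sym_eq])

lemma CoHA_hat_eq: "CoHA_hat a = series.algebra a"
  by (simp add: CoHA_hat_def ext[OF series_sym_eq])

lemma KHA_eq: "KHA a = laurent.algebra a"
  by (simp add: KHA_def ext[OF laurent_sym_eq])

lemma CoHA_hat_filt_eq: "CoHA_hat_filt a \<gamma> n = {f \<in> carrier (gcomp (CoHA_hat a) \<gamma>). f \<in> mfps_ge n}"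
  by (simp add: CoHA_hat_filt_def mfps_ge_def)

text \<open>The denominator is a product of differences of variables, each of which raises the order
  of vanishing by exactly one.\<close>

lemma mfps_ge_full_denom_cancel:
  assumes "f * series.full_denom n \<in> mfps_ge (k + card (vpairs n))"
  shows "f \<in> mfps_ge k"
proof -
  have "f \<in> mfps_ge k" if "finite P" "\<And>u v. (u, v) \<in> P \<Longrightarrow> u \<noteq> v"
    "f * (\<Prod>(u, v)\<in>P. mfps_var v - mfps_var u) \<in> mfps_ge (k + card P)" for P :: "('a var \<times> 'a var) set"
    using that
  proof (induction P arbitrary: f rule: finite_induct)
    case (insert p P)
    obtain u v where p: "p = (u, v)" by (cases p)
    have uv: "u \<noteq> v" using insert.prems(1)[of u v] p by simp
    have "(mfps_var v - mfps_var u) * (f * (\<Prod>(u, v)\<in>P. mfps_var v - mfps_var u)) \<in> mfps_ge (Suc (k + card P))"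
      using insert.prems(2) insert.hyps by (simp add: p mult_ac)
    then have "f * (\<Prod>(u, v)\<in>P. mfps_var v - mfps_var u) \<in> mfps_ge (k + card P)"
      by (rule mfps_ge_var_diff_cancel[OF uv])
    then show ?case using insert.IH insert.prems(1) by simp
  qed simp
  from this[OF series.finite_vpairs] show ?thesis
    using assms unfolding series.full_denom_def by (auto simp: vpairs_def)
qed

text \<open>The shuffle product lowers the filtration degree at most by the degree of the common
  denominator.\<close>

lemma series_mult_ge:
  assumes f: "f1 \<in> series.sym g1" "f2 \<in> series.sym g2"
    and k: "f1 \<in> mfps_ge (k + card (vpairs (\<lambda>i. g1 i + g2 i))) \<or> f2 \<in> mfps_ge (k + card (vpairs (\<lambda>i. g1 i + g2 i)))"
  shows "series_mult a g1 g2 f1 f2 \<in> mfps_ge k"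
proof (rule mfps_ge_full_denom_cancel[of _ "\<lambda>i. g1 i + g2 i"])
  have "series.total a g1 g2 f1 f2 \<in> mfps_ge (k + card (vpairs (\<lambda>i. g1 i + g2 i)))"
    unfolding series.total_def series.numer_def
    using k
  proof (elim disjE, goal_cases)
    case 1
    show ?case by (intro mfps_ge_sum mfps_ge_mult_left mfps_ge_rename 1)
  next
    case 2
    show ?case
      by (intro mfps_ge_sum mfps_ge_mult_left[OF mfps_ge_mult_left[OF mfps_ge_mult_right[OF mfps_ge_rename[OF 2]]]])
  qed
  then show "series_mult a g1 g2 f1 f2 * series.full_denom (\<lambda>i. g1 i + g2 i) \<in> mfps_ge (k + card (vpairs (\<lambda>i. g1 i + g2 i)))"
    unfolding series.shuffle_mult(2)[OF f] .
qed

lemma filtered_CoHA_hat: "filtered_graded_ring (CoHA_hat a) (CoHA_hat_filt a)"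
proof -
  interpret biadditive_graded_ring "CoHA_hat a" unfolding CoHA_hat_eq by (rule series.biadditive_algebra)
  show ?thesis
  proof
    fix y \<gamma> \<delta> n assume y: "y \<in> C \<delta>"
    let ?k = "n + card (vpairs (\<lambda>i. nat (\<gamma> i) + nat (\<delta> i)))"
    have "gmult (CoHA_hat a) \<gamma> \<delta> x y \<in> CoHA_hat_filt a (\<gamma> + \<delta>) n" if "x \<in> CoHA_hat_filt a \<gamma> ?k" for x
      using that y gmult_closed[of x \<gamma> y \<delta>]
        series_mult_ge[of x "\<lambda>i. nat (\<gamma> i)" y "\<lambda>i. nat (\<delta> i)" n a, OF series.algebra_carrier_sym series.algebra_carrier_sym]
      by (auto simp: CoHA_hat_filt_eq CoHA_hat_eq series.algebra_gmult)
    then show "\<exists>k. \<forall>x\<in>CoHA_hat_filt a \<gamma> k. gmult (CoHA_hat a) \<gamma> \<delta> x y \<in> CoHA_hat_filt a (\<gamma> + \<delta>) n" by blast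
  next
    fix x \<gamma> \<delta> n assume x: "x \<in> C \<gamma>"
    let ?k = "n + card (vpairs (\<lambda>i. nat (\<gamma> i) + nat (\<delta> i)))"
    have "gmult (CoHA_hat a) \<gamma> \<delta> x y \<in> CoHA_hat_filt a (\<gamma> + \<delta>) n" if "y \<in> CoHA_hat_filt a \<delta> ?k" for y
      using that x gmult_closed[of x \<gamma> y \<delta>]
        series_mult_ge[of x "\<lambda>i. nat (\<gamma> i)" y "\<lambda>i. nat (\<delta> i)" n a, OF series.algebra_carrier_sym series.algebra_carrier_sym]
      by (auto simp: CoHA_hat_filt_eq CoHA_hat_eq series.algebra_gmult)
    then show "\<exists>k. \<forall>y\<in>CoHA_hat_filt a \<delta> k. gmult (CoHA_hat a) \<gamma> \<delta> x y \<in> CoHA_hat_filt a (\<gamma> + \<delta>) n" by blast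
  qed (auto simp: CoHA_hat_filt_eq zero_closed add_closed uminus_closed mfps_ge_add mfps_ge_uminus intro: mfps_ge_mono)
qed

lemma zhang_twist_CoHA_hat: "zhang_twist (CoHA_hat a) (CoHA_hat_filt a) (sigma_twist a)"
proof -
  interpret filtered_graded_ring "CoHA_hat a" "CoHA_hat_filt a" by (rule filtered_CoHA_hat)
  have closed: "sigma_twist a \<tau> \<gamma> f \<in> C \<gamma>" if "f \<in> C \<gamma>" for \<tau> \<gamma> f
    using that by (auto simp: sigma_twist_def CoHA_hat_eq series.algebra_carrier series.sym_mult b_twist_sym split: if_splits)
  show ?thesis
  proof
    show "f \<in> C \<gamma> \<Longrightarrow> sigma_twist a \<tau> \<gamma> f \<in> C \<gamma>" for \<tau> \<gamma> f by (rule closed)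
    show "f \<in> CoHA_hat_filt a \<gamma> n \<Longrightarrow> sigma_twist a \<tau> \<gamma> f \<in> CoHA_hat_filt a \<gamma> n" for \<tau> \<gamma> f n
      using closed[of f \<gamma> \<tau>] by (auto simp: CoHA_hat_filt_eq sigma_twist_def intro: mfps_ge_mult_right)
    show "sigma_twist a \<tau> \<gamma> (f + g) = sigma_twist a \<tau> \<gamma> f + sigma_twist a \<tau> \<gamma> g" for \<tau> \<gamma> f g
      by (simp add: sigma_twist_def distrib_left)
    show "sigma_twist a \<tau> \<gamma> (sigma_twist a \<tau>' \<gamma> f) = sigma_twist a (\<tau> + \<tau>') \<gamma> f" for \<tau> \<tau>' \<gamma> f
      by (simp add: sigma_twist_def b_twist_add mult.assoc)
    show "sigma_twist a 0 \<gamma> f = f" for \<gamma> f by (simp add: sigma_twist_def b_twist_zero)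
    show "sigma_twist a \<tau> 0 (gone (CoHA_hat a)) = gone (CoHA_hat a)" for \<tau>
      by (simp add: sigma_twist_def b_twist_no_vars)
    fix \<tau> \<gamma> \<delta> f g assume f: "f \<in> C \<gamma>" and g: "g \<in> C \<delta>"
    show "sigma_twist a \<tau> (\<gamma> + \<delta>) (gmult (CoHA_hat a) \<gamma> \<delta> f g)
       = gmult (CoHA_hat a) \<gamma> \<delta> (sigma_twist a \<tau> \<gamma> f) (sigma_twist a \<tau> \<delta> g)"
    proof (cases "(\<forall>i. 0 \<le> \<gamma> i) \<and> (\<forall>i. 0 \<le> \<delta> i)")
      case True
      then show ?thesis
        using f g nat_degree_add[of \<gamma> \<delta>] series_mult_twist[of f "\<lambda>i. nat (\<gamma> i)" g "\<lambda>i. nat (\<delta> i)" a \<tau>]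
        by (simp add: sigma_twist_def CoHA_hat_eq series.algebra_gmult series.algebra_carrier_sym del: plus_fun_apply)
    next
      case False
      then have "f = 0 \<or> g = 0" using f g carrier_negative by blast
      then have "gmult (CoHA_hat a) \<gamma> \<delta> f g = 0 \<and> gmult (CoHA_hat a) \<gamma> \<delta> (sigma_twist a \<tau> \<gamma> f) (sigma_twist a \<tau> \<delta> g) = 0"
        using f g closed[of f \<gamma> \<tau>] closed[of g \<delta> \<tau>] gmult_zero_left gmult_zero_right by (auto simp: sigma_twist_def)
      then show ?thesis by (simp add: sigma_twist_def)
    qed
  qed
qed

section \<open>Density\<close>

text \<open>Truncation commutes with permutations of the variables, as these preserve
  degrees.\<close>

lemma poly_series_dense:
  fixes f :: "('i::finite var, rat) mfps"
  assumes f: "f \<in> sym_series g"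
  shows "\<exists>p\<in>sym_polys g. f - poly_series p \<in> mfps_ge n"
proof -
  define h where "h m = (if mdeg m < n then mcoeff f m else 0)" for m
  have "{m. h m \<noteq> 0} \<subseteq> {m. keys m \<subseteq> vars g \<and> mdeg m \<le> n}"
    using f by (auto simp: h_def sym_series_def split: if_splits)
  then have fin: "finite {m. h m \<noteq> 0}" by (rule finite_subset) (rule finite_bounded_monomials[OF finite_vars])
  define p where "p = Abs_poly_mapping h"
  have p: "mcoeff (poly_series p) m = h m" for m using fin by (simp add: p_def)
  have "rename_mfps (on_vars \<pi>) (poly_series p) = poly_series p" if "\<pi> \<in> var_perms g" for \<pi>
  proof (rule mfps_eqI)
    fix m
    have "mcoeff (rename_mfps (on_vars \<pi>) (poly_series p)) m = (\<Sum>k | rename_monom (on_vars \<pi>) k = m. h k)"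
      by (simp add: mcoeff_rename p del: mcoeff_poly_series)
    also have "\<dots> = (if mdeg m < n then mcoeff (rename_mfps (on_vars \<pi>) f) m else 0)"
      by (auto simp: mcoeff_rename h_def intro!: sum.cong sum.neutral)
    also have "\<dots> = mcoeff (poly_series p) m"
      unfolding p using f that by (simp add: sym_series_def h_def)
    finally show "mcoeff (rename_mfps (on_vars \<pi>) (poly_series p)) m = mcoeff (poly_series p) m" .
  qed
  then have "poly_series p \<in> sym_series g"
    using f by (auto simp: sym_series_def p h_def simp del: mcoeff_poly_series split: if_splits)
  then have "p \<in> sym_polys g" by (simp only: poly_series_sym)
  moreover have "f - poly_series p \<in> mfps_ge n"
    by (rule mfps_geI) (simp add: p h_def del: mcoeff_poly_series)
  ultimately show ?thesis by blast
qed

text \<open>The monomial \<open>m\<close> evaluated at \<open>z - 1\<close>; its Chern character has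
  leading term \<open>x\<^sup>m\<close>.\<close>

definition unipotent_monom :: "('v \<Rightarrow>\<^sub>0 nat) \<Rightarrow> ('v, rat) laurent" where
  "unipotent_monom m = (\<Prod>v\<in>keys m. (pvar v - 1) ^ lookup m v)"

lemma unipotent_monom_add: "unipotent_monom (m + n) = unipotent_monom m * unipotent_monom n"
proof -
  have super: "unipotent_monom m = (\<Prod>v\<in>S. (pvar v - 1) ^ lookup m v)"
    if "finite S" "keys m \<subseteq> S" for S m
    unfolding unipotent_monom_def by (rule prod.mono_neutral_left) (use that in \<open>auto simp: in_keys_iff\<close>)
  let ?S = "keys m \<union> keys n"
  have "finite ?S" "keys (m + n) \<subseteq> ?S" by (simp_all add: keys_add)
  then show ?thesis by (simp add: super[of ?S] lookup_add power_add prod.distrib)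
qed

lemma unipotent_monom_single [simp]: "unipotent_monom (single v k) = (pvar v - 1) ^ k"
  by (cases "k = 0") (simp_all add: unipotent_monom_def)

lemma unipotent_monom_sum: "unipotent_monom (\<Sum>s\<in>S. f s) = (\<Prod>s\<in>S. unipotent_monom (f s))"
  by (induction S rule: infinite_finite_induct) (simp_all add: unipotent_monom_add unipotent_monom_def[of 0])

lemma rename_unipotent_monom: "rename_poly \<rho> (unipotent_monom m) = unipotent_monom (rename_monom \<rho> m)"
  unfolding rename_monom_def unipotent_monom_sum unipotent_monom_single
  by (simp add: unipotent_monom_def rename_poly_simps rename_poly_pvar)

lemma mfps_ge_monom: "mfps_monom m c \<in> mfps_ge (mdeg m)"
  by (rule mfps_geI) (auto simp: mcoeff_monom)

lemma chern_unipotent_monom: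
  fixes m :: "'v \<Rightarrow>\<^sub>0 nat"
  shows "chern (unipotent_monom m) - mfps_monom m 1 \<in> mfps_ge (Suc (mdeg m))"
proof -
  have mult: "chern (unipotent_monom (m + n)) - mfps_monom (m + n) 1 \<in> mfps_ge (Suc (mdeg (m + n)))"
    if m: "chern (unipotent_monom m) - mfps_monom m 1 \<in> mfps_ge (Suc (mdeg m))"
      and n: "chern (unipotent_monom n) - mfps_monom n 1 \<in> mfps_ge (Suc (mdeg n))" for m n :: "'v \<Rightarrow>\<^sub>0 nat"
  proof -
    have "chern (unipotent_monom m) = (chern (unipotent_monom m) - mfps_monom m 1) + mfps_monom m 1" by simp
    also have "\<dots> \<in> mfps_ge (mdeg m)"
      by (intro mfps_ge_add mfps_ge_monom) (rule mfps_ge_mono[OF _ m], simp)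
    finally have cm: "chern (unipotent_monom m) \<in> mfps_ge (mdeg m)" .
    have "mfps_monom (m + n) 1 = mfps_monom m 1 * (mfps_monom n 1 :: ('v, rat) mfps)" by (simp add: mfps_monom_mult)
    then have "chern (unipotent_monom (m + n)) - mfps_monom (m + n) 1
        = chern (unipotent_monom m) * (chern (unipotent_monom n) - mfps_monom n 1)
          + (chern (unipotent_monom m) - mfps_monom m 1) * mfps_monom n 1"
      by (simp add: unipotent_monom_add chern_simps algebra_simps)
    also have "\<dots> \<in> mfps_ge (Suc (mdeg (m + n)))"
      using mfps_ge_mult[OF cm n] mfps_ge_mult[OF m mfps_ge_monom] by (intro mfps_ge_add) (simp_all add: mdeg_add)
    finally show ?thesis .
  qed
  have zero: "chern (unipotent_monom 0) - mfps_monom 0 1 \<in> mfps_ge (Suc (mdeg (0 :: 'v \<Rightarrow>\<^sub>0 nat)))"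
    by (simp add: unipotent_monom_def chern_simps)
  have one: "chern (unipotent_monom (single v 1)) - mfps_monom (single v 1) 1
      \<in> mfps_ge (Suc (mdeg (single v 1)))" for v :: 'v
    using mfps_exp_minus_1_minus[OF mfps_ge_var[of v]]
    by (simp add: chern_simps chern_pvar numeral_2_eq_2 flip: mfps_var_eq_monom[unfolded One_nat_def])
  show ?thesis
  proof (induction m rule: poly_mapping_add_induct)
    case (single v k)
    show ?case
    proof (induction k)
      case (Suc k)
      have eq: "single v (Suc k) = single v 1 + single v k"
        by (simp flip: single_add)
      show ?case unfolding eq by (rule mult[OF one Suc])
    qed (use zero in simp)
  qed (rule mult)
qed

lemma rename_monom_inj:
  fixes m n :: "'v \<Rightarrow>\<^sub>0 'e::comm_monoid_add"
  assumes "inj \<rho>" "rename_monom \<rho> m = rename_monom \<rho> n"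
  shows "m = n"
proof -
  have "rename_monom (inv_into UNIV \<rho>) (rename_monom \<rho> k) = k" for k :: "'v \<Rightarrow>\<^sub>0 'e"
    by (simp add: rename_monom_comp inv_o_cancel[OF assms(1)]) (simp add: rename_monom_def flip: poly_mapping_sum_single)
  then show ?thesis using assms(2) by metis
qed

text \<open>The leading form of \<open>f\<close>, evaluated at \<open>z - 1\<close>, is a symmetric
  Laurent polynomial whose Chern character has the same leading form.\<close>

lemma chern_dense_step:
  fixes f :: "('i::finite var, rat) mfps"
  assumes f: "f \<in> sym_series g" "f \<in> mfps_ge n"
  shows "\<exists>r\<in>sym_polys g. f - chern r \<in> mfps_ge (Suc n)"
proof -
  let ?M = "{m. keys m \<subseteq> vars g \<and> mdeg m = n}"
  have finM: "finite ?M" by (rule finite_subset[OF _ finite_bounded_monomials[OF finite_vars, of g n]]) auto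
  define r where "r = (\<Sum>m\<in>?M. single 0 (mcoeff f m) * unipotent_monom m)"
  have "r \<in> poly_supp (vars g)"
    unfolding r_def unipotent_monom_def
    by (intro poly_supp_sum poly_supp_mult poly_supp_single laurent.V_prod poly_supp_power poly_supp_diff pvar_supp poly_supp_one) auto
  moreover have "rename_poly (on_vars \<pi>) r = r" if \<pi>: "\<pi> \<in> var_perms g" for \<pi>
  proof -
    note inj = inj_on_vars[OF \<pi>]
    have coeff: "mcoeff f (rename_monom (on_vars \<pi>) m) = mcoeff f m" for m
    proof -
      have "mcoeff f (rename_monom (on_vars \<pi>) m) = mcoeff (rename_mfps (on_vars \<pi>) f) (rename_monom (on_vars \<pi>) m)"
        using f(1) \<pi> by (simp add: sym_series_def)
      also have "{k. rename_monom (on_vars \<pi>) k = rename_monom (on_vars \<pi>) m} = {m}"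
        using rename_monom_inj[OF inj] by blast
      then have "mcoeff (rename_mfps (on_vars \<pi>) f) (rename_monom (on_vars \<pi>) m) = mcoeff f m"
        by (simp add: mcoeff_rename)
      finally show ?thesis .
    qed
    have "inj_on (rename_monom (on_vars \<pi>)) ?M" using rename_monom_inj[OF inj] by (auto simp: inj_on_def)
    moreover have "rename_monom (on_vars \<pi>) ` ?M \<subseteq> ?M"
      using keys_rename_monom[of "on_vars \<pi>"] on_vars_image_vars[OF \<pi>] by fastforce
    ultimately have im: "rename_monom (on_vars \<pi>) ` ?M = ?M" using endo_inj_surj[OF finM] by blast
    have "rename_poly (on_vars \<pi>) r = (\<Sum>m\<in>?M. single 0 (mcoeff f m) * unipotent_monom (rename_monom (on_vars \<pi>) m))"
      by (simp add: r_def rename_poly_simps rename_unipotent_monom)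
    also have "\<dots> = (\<Sum>m\<in>rename_monom (on_vars \<pi>) ` ?M. single 0 (mcoeff f m) * unipotent_monom m)"
      using \<open>inj_on _ ?M\<close> by (simp add: sum.reindex coeff)
    finally show ?thesis unfolding im r_def .
  qed
  ultimately have "r \<in> sym_polys g" by (simp add: sym_polys_def poly_supp_def)
  moreover have "f - chern r \<in> mfps_ge (Suc n)"
  proof -
    define l where "l = (\<Sum>m\<in>?M. mfps_monom m (mcoeff f m))"
    have "mcoeff l m = mcoeff f m" if "mdeg m < Suc n" for m
    proof -
      have "mcoeff l m = (\<Sum>k\<in>?M. if m = k then mcoeff f k else 0)"
        by (simp add: l_def mcoeff_sum mcoeff_monom)
      also have "\<dots> = (if m \<in> ?M then mcoeff f m else 0)" using finM by (simp add: sum.delta)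
      also have "\<dots> = mcoeff f m"
        using f that mfps_geD[OF f(2), of m] by (auto simp: sym_series_def less_Suc_eq)
      finally show ?thesis .
    qed
    then have 1: "f - l \<in> mfps_ge (Suc n)" by (intro mfps_geI) simp
    have "chern r - l = (\<Sum>m\<in>?M. mfps_const (mcoeff f m) * (chern (unipotent_monom m) - mfps_monom m 1))"
      by (simp add: r_def l_def chern_simps sum_subtractf right_diff_distrib mfps_const_eq_monom mfps_monom_mult)
    also have "\<dots> \<in> mfps_ge (Suc n)"
      using chern_unipotent_monom by (intro mfps_ge_sum mfps_ge_mult_right) auto
    finally have 2: "chern r - l \<in> mfps_ge (Suc n)" .
    have "f - chern r = (f - l) - (chern r - l)" by simp
    then show ?thesis using mfps_ge_diff[OF 1 2] by simp
  qed
  ultimately show ?thesis by blast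
qed

lemma chern_dense:
  fixes f :: "('i::finite var, rat) mfps"
  assumes f: "f \<in> sym_series g"
  shows "\<exists>r\<in>sym_polys g. f - chern r \<in> mfps_ge n"
proof (induction n)
  case 0
  show ?case using laurent.sym_zero by (auto simp: laurent_sym_eq)
next
  case (Suc n)
  then obtain r where r: "r \<in> sym_polys g" "f - chern r \<in> mfps_ge n" by blast
  have "f - chern r \<in> sym_series g"
    using series.sym_add[of f g "- chern r"] series.sym_uminus[of "chern r" g] f chern_sym[OF r(1)]
    by (simp add: series_sym_eq)
  from chern_dense_step[OF this r(2)] obtain s where s: "s \<in> sym_polys g" "f - chern r - chern s \<in> mfps_ge (Suc n)" by blast
  have "r + s \<in> sym_polys g" using laurent.sym_add[of r g s] r s by (simp add: laurent_sym_eq)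
  moreover have "f - chern (r + s) \<in> mfps_ge (Suc n)" using s(2) by (simp add: chern_simps diff_diff_eq)
  ultimately show ?case by blast
qed

section \<open>The equivalences\<close>

lemma dense_CoHA: "dense_filtered_hom (CoHA a) (CoHA_filt a) (CoHA_hat a) (CoHA_hat_filt a) (\<lambda>_. poly_series)"
proof -
  interpret A: biadditive_graded_ring "CoHA a" unfolding CoHA_eq by (rule poly.biadditive_algebra)
  interpret B: filtered_graded_ring "CoHA_hat a" "CoHA_hat_filt a" by (rule filtered_CoHA_hat)
  have zero: "poly_series 0 = (0 :: ('a var, rat) mfps)" by (rule mfps_eqI) simp
  have closed: "poly_series f \<in> B.C \<gamma> \<longleftrightarrow> f \<in> A.C \<gamma>" for \<gamma> f
    using poly_series_eq_0[of f] zero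
    by (auto simp: CoHA_eq CoHA_hat_eq poly.algebra_carrier series.algebra_carrier poly_sym_eq series_sym_eq poly_series_sym)
  have mult: "poly_series (gmult (CoHA a) \<gamma> \<delta> f g) = gmult (CoHA_hat a) \<gamma> \<delta> (poly_series f) (poly_series g)"
    if "f \<in> A.C \<gamma>" "g \<in> A.C \<delta>" for \<gamma> \<delta> f g
    using poly.algebra_carrier_sym[OF that(1)[unfolded CoHA_eq]] poly.algebra_carrier_sym[OF that(2)[unfolded CoHA_eq]]
    by (simp add: CoHA_eq CoHA_hat_eq poly.algebra_gmult series.algebra_gmult poly_series_shuffle_mult poly_sym_eq)
  have F: "CoHA_filt a \<gamma> n = {f \<in> A.C \<gamma>. poly_series f \<in> CoHA_hat_filt a \<gamma> n}" for \<gamma> n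
    using closed by (auto simp: CoHA_filt_def CoHA_hat_filt_def in_keys_iff)
  have "filtered_graded_ring (CoHA a) (CoHA_filt a)"
    by (rule A.filtered_pullback[OF filtered_CoHA_hat[of a], of "\<lambda>_. poly_series"]) (simp_all add: closed mult F poly_series_simps)
  then show ?thesis
  proof (intro dense_filtered_hom.intro dense_filtered_hom_axioms.intro filtered_CoHA_hat)
    fix f \<gamma> n assume f: "f \<in> B.C \<gamma>"
    show "\<exists>p\<in>A.C \<gamma>. f - poly_series p \<in> CoHA_hat_filt a \<gamma> n"
    proof (cases "\<forall>i. 0 \<le> \<gamma> i")
      case True
      then have "f \<in> sym_series (\<lambda>i. nat (\<gamma> i))" using f by (simp add: CoHA_hat_eq series.algebra_carrier series_sym_eq)
      from poly_series_dense[OF this, of n] obtain p where p: "p \<in> sym_polys (\<lambda>i. nat (\<gamma> i))" "f - poly_series p \<in> mfps_ge n"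
        by blast
      then have "p \<in> A.C \<gamma>" using True by (simp add: CoHA_eq poly.algebra_carrier poly_sym_eq)
      then show ?thesis using p(2) f B.diff_closed[of f \<gamma> "poly_series p"] closed by (auto simp: CoHA_hat_filt_eq)
    next
      case False
      then have "f = 0" using f B.carrier_negative by blast
      then show ?thesis using A.zero_closed B.F_zero zero by (intro bexI[of _ 0]) simp_all
    qed
  next
    show "poly_series (gone (CoHA a)) = gone (CoHA_hat a)"
      by (simp add: CoHA_def CoHA_hat_def shuffle_algebra_def poly_series_simps)
  qed (simp_all add: closed mult F poly_series_simps)
qed

text \<open>For density, \<open>f\<close> is first multiplied by the product of the
  \<open>pair_factor\<close>s, then approximated by Chern characters, and the product is divided out
  again; none of this affects the filtration.\<close>

lemma dense_KHA:
  fixes a :: "'i::finite \<Rightarrow> 'i \<Rightarrow> nat"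
  assumes symmetric: "\<And>i j. a i j = a j i"
  shows "dense_filtered_hom (KHA_Q a) (KHA_Q_filt a) (CoHA_hat_twist a) (CoHA_hat_filt a) (\<lambda>\<gamma>. KHA_hom a (\<lambda>i. nat (\<gamma> i)))"
proof -
  let ?\<phi> = "\<lambda>\<gamma>. KHA_hom a (\<lambda>i. nat (\<gamma> i))"
  interpret A: biadditive_graded_ring "KHA_Q a" unfolding KHA_eq by (rule laurent.biadditive_algebra)
  interpret H: zhang_twist "CoHA_hat a" "CoHA_hat_filt a" "sigma_twist a" by (rule zhang_twist_CoHA_hat)
  have filtB: "filtered_graded_ring (CoHA_hat_twist a) (CoHA_hat_filt a)"
    unfolding CoHA_hat_twist_def by (rule H.filtered_left_zhang_twist)
  interpret B: filtered_graded_ring "CoHA_hat_twist a" "CoHA_hat_filt a" by (rule filtB)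
  have CB: "B.C \<gamma> = H.C \<gamma>" for \<gamma> by (simp add: CoHA_hat_twist_def left_zhang_twist_def)
  have zero: "KHA_hom a g 0 = 0" for g by (simp add: KHA_hom_def chern_lin chern.lin_zero)
  have add: "KHA_hom a g (f + f') = KHA_hom a g f + KHA_hom a g f'" for g f f'
    by (simp add: KHA_hom_def chern_simps distrib_right)
  have closed: "?\<phi> \<gamma> f \<in> B.C \<gamma>" if "f \<in> A.C \<gamma>" for \<gamma> f
    using that KHA_hom_sym[of a, OF symmetric, of f "\<lambda>i. nat (\<gamma> i)"] zero
    by (auto simp: CB KHA_eq CoHA_hat_eq laurent.algebra_carrier series.algebra_carrier laurent_sym_eq split: if_splits)
  have mult: "?\<phi> (\<gamma> + \<delta>) (gmult (KHA_Q a) \<gamma> \<delta> f g) = gmult (CoHA_hat_twist a) \<gamma> \<delta> (?\<phi> \<gamma> f) (?\<phi> \<delta> g)"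
    if f: "f \<in> A.C \<gamma>" and g: "g \<in> A.C \<delta>" for \<gamma> \<delta> f g
  proof (cases "(\<forall>i. 0 \<le> \<gamma> i) \<and> (\<forall>i. 0 \<le> \<delta> i)")
    case True
    then have "(\<lambda>i. int (nat (\<delta> i))) = \<delta>" by (simp add: fun_eq_iff)
    then show ?thesis
      using True KHA_hom_mult[of a, OF symmetric, of f "\<lambda>i. nat (\<gamma> i)" g "\<lambda>i. nat (\<delta> i)"] nat_degree_add[of \<gamma> \<delta>]
        laurent.algebra_carrier_sym[OF f[unfolded KHA_eq]] laurent.algebra_carrier_sym[OF g[unfolded KHA_eq]]
      by (simp add: KHA_eq CoHA_hat_twist_def left_zhang_twist_def CoHA_hat_eq laurent.algebra_gmult series.algebra_gmult
          laurent_sym_eq sigma_twist_def del: plus_fun_apply)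
  next
    case False
    then have "f = 0 \<or> g = 0" using f g A.carrier_negative by blast
    then show ?thesis
      using A.gmult_zero_left[OF g] A.gmult_zero_right[OF f] B.gmult_zero_left[OF closed[OF g]] B.gmult_zero_right[OF closed[OF f]] zero
      by auto
  qed
  have ge: "KHA_hom a g f \<in> mfps_ge n \<longleftrightarrow> chern f \<in> mfps_ge n" for g f n
  proof
    assume "KHA_hom a g f \<in> mfps_ge n"
    then have "KHA_hom a g f * pair_prod (pair_factor a) (vars g) \<in> mfps_ge n" by (rule mfps_ge_mult_left)
    also have "KHA_hom a g f * pair_prod (pair_factor a) (vars g)
        = chern f * (pair_prod (pair_factor a) (vars g) * pair_prod (pair_factor_inv a) (vars g))"
      by (simp only: KHA_hom_def mult_ac)
    finally show "chern f \<in> mfps_ge n" by (simp add: pair_prod_factor_mult_inv[of a, OF symmetric])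
  qed (simp add: KHA_hom_def mfps_ge_mult_left)
  have chern_closed: "chern f \<in> H.C \<gamma>" if "f \<in> A.C \<gamma>" for \<gamma> f
    using that chern_sym[of f "\<lambda>i. nat (\<gamma> i)"]
    by (auto simp: KHA_eq CoHA_hat_eq laurent.algebra_carrier series.algebra_carrier laurent_sym_eq series_sym_eq
        chern_lin chern.lin_zero split: if_splits)
  have F: "KHA_Q_filt a \<gamma> n = {f \<in> A.C \<gamma>. ?\<phi> \<gamma> f \<in> CoHA_hat_filt a \<gamma> n}" for \<gamma> n
    using chern_closed closed by (auto simp: KHA_Q_filt_def CoHA_hat_filt_eq ge CB)
  have "filtered_graded_ring (KHA_Q a) (KHA_Q_filt a)"
    by (rule A.filtered_pullback[OF filtB, of ?\<phi>]) (simp_all add: closed mult F add del: plus_fun_apply)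
  then show ?thesis
  proof (intro dense_filtered_hom.intro dense_filtered_hom_axioms.intro filtB)
    show "?\<phi> 0 (gone (KHA_Q a)) = gone (CoHA_hat_twist a)"
    proof -
      have "{B :: 'i var set. B \<subseteq> vars (\<lambda>i. 0) \<and> card B = 2} = {}" by (auto simp: vars_def)
      then have "pair_prod (pair_factor_inv a) (vars (\<lambda>i. 0)) = 1"
        unfolding pair_prod_def by (simp only: prod.empty)
      then show ?thesis
        by (simp add: KHA_hom_def KHA_def CoHA_hat_twist_def left_zhang_twist_def CoHA_hat_def shuffle_algebra_def chern_simps)
    qed
    fix f \<gamma> n assume f: "f \<in> B.C \<gamma>"
    show "\<exists>r\<in>A.C \<gamma>. f - ?\<phi> \<gamma> r \<in> CoHA_hat_filt a \<gamma> n"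
    proof (cases "\<forall>i. 0 \<le> \<gamma> i")
      case True
      let ?g = "\<lambda>i. nat (\<gamma> i)"
      let ?P = "pair_prod (pair_factor a) (vars ?g)" and ?Q = "pair_prod (pair_factor_inv a) (vars ?g)"
      have "f * ?P \<in> sym_series ?g"
        using f True series.sym_mult[OF _ pair_prod_factor_sym(1)[of a, OF symmetric], of f ?g]
        by (simp add: CB CoHA_hat_eq series.algebra_carrier series_sym_eq)
      from chern_dense[OF this, of n] obtain r where r: "r \<in> sym_polys ?g" "f * ?P - chern r \<in> mfps_ge n" by blast
      have "(f * ?P - chern r) * ?Q = f * (?P * ?Q) - KHA_hom a ?g r" by (simp add: KHA_hom_def algebra_simps)
      then have "f - KHA_hom a ?g r \<in> mfps_ge n"
        using mfps_ge_mult_left[OF r(2), of ?Q] by (simp add: pair_prod_factor_mult_inv[of a, OF symmetric])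
      moreover have "r \<in> A.C \<gamma>" using True r(1) by (simp add: KHA_eq laurent.algebra_carrier laurent_sym_eq)
      ultimately show ?thesis using f B.diff_closed[OF f closed] by (auto simp: CoHA_hat_filt_eq CB)
    next
      case False
      then have "f = 0" using f B.carrier_negative by blast
      then show ?thesis using A.zero_closed B.F_zero zero by (intro bexI[of _ 0]) simp_all
    qed
  qed (simp_all add: closed mult F add del: plus_fun_apply)
qed

theorem proposition3:
  fixes a :: "'i::finite \<Rightarrow> 'i \<Rightarrow> nat"
  assumes symmetric: "\<And>i j. a i j = a j i"
  shows "equivalent_categories
           (Mod_lf TYPE('m) (CoHA a) (CoHA_filt a))
           (Mod_lf TYPE('m) (CoHA_hat a) (CoHA_hat_filt a)) \<and>
         equivalent_categories
           (Mod_lf TYPE('m) (CoHA_hat a) (CoHA_hat_filt a))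
           (Mod_lf TYPE('m) (CoHA_hat_twist a) (CoHA_hat_filt a)) \<and>
         equivalent_categories
           (Mod_lf TYPE('m) (CoHA_hat_twist a) (CoHA_hat_filt a))
           (Mod_lf TYPE('m) (KHA_Q a) (KHA_Q_filt a))"
proof (intro conjI)
  show "equivalent_categories (Mod_lf TYPE('m) (CoHA a) (CoHA_filt a)) (Mod_lf TYPE('m) (CoHA_hat a) (CoHA_hat_filt a))"
    by (rule dense_filtered_hom.Mod_lf_dense[OF dense_CoHA])
  show "equivalent_categories (Mod_lf TYPE('m) (CoHA_hat a) (CoHA_hat_filt a))
      (Mod_lf TYPE('m) (CoHA_hat_twist a) (CoHA_hat_filt a))"
    unfolding CoHA_hat_twist_def by (rule zhang_twist.Mod_lf_zhang_twist[OF zhang_twist_CoHA_hat])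
  show "equivalent_categories (Mod_lf TYPE('m) (CoHA_hat_twist a) (CoHA_hat_filt a))
      (Mod_lf TYPE('m) (KHA_Q a) (KHA_Q_filt a))"
    by (rule equivalent_categories_sym[OF dense_filtered_hom.Mod_lf_dense[OF dense_KHA[of a, OF symmetric]]])
qed

end
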